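(* Suppose the standing assumptions on $c$, $a^*$, $U$ listed in the context hold, with growth exponent $q\ge2$ for $U$. Let all $n$ principals offer independent copies $(\xi^i,\theta^i)_{i\le n}$ of a mean field contract, let $(Y^{n,i},Z^{n,i})_{i\le n}$ solve the agent's BSDE system $$Y^{n,i}_t=\xi^i+\int_t^T\Big(\frac1{n-1}\sum_{j\ne i}c^*(Y^{n,j}_u-Y^{n,i}_u)+\theta^i_u\Big)du-\int_t^TZ^{n,i}_u\cdot dW_u,\quad i=1,\dots,n,$$ let $p^n=\frac1n\sum_{j=1}^n\delta_{Y^{n,j}}$ be the empirical measure on $C([0,T];\mathbb{R})$ and $p^*$ the law on $C([0,T];\mathbb{R})$ of the mean field process $\overline Y$. Then $$\lim_{n\to\infty}\mathbb{E}\big[d_0^2(p^n,p^* )\big]=0.$$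
   Context: Assumptions: (i) $c$ is a nonnegative convex cost function equal to $+\infty$ outside a compact set, for every $y\in\mathbb{R}$ there is a unique maximizer $a^*(y)=\arg\max_{a\ge0}\{ay-c(a)\}$ in that compact set, and $c^*(y)=\sup_{a\ge0}\{ay-c(a)\}$ is Lipschitz continuous; (ii) $a^*$ is Lipschitz continuous, $U:\mathbb{R}\to\mathbb{R}$ is convex, and $C(|\theta|^q-1)\le U(\theta)\le C'(|\theta|^q+1)$ for constants $0<C<C'$, $q>1$. Distance: for probability measures $\mu,\nu$ on $\mathcal{C}:=C([0,T];\mathbb{R})$ with finite second moment, $d_t^2(\mu,\nu):=\inf_{\pi}\int_{\mathcal{C}\times\mathcal{C}}\sup_{t\le u\le T}|x_u-y_u|^2\pi(dx,dy)$, the infimum over couplings $\pi$ of $\mu$ and $\nu$. Mean field game. Fix $T>0$, a real $R$, compact sets $K_0\subset[R,\infty)$ and $\Sigma\subset\mathbb{R}$. On $\overline\Omega=C([0,T],\mathbb{R}^2)$ with canonical process $(\overline W,\overline Y)$ and canonical filtration $\overline{\mathbb{F}}$, for $p\in\mathcal{P}(\overline\Omega)$ let $p_t=p\circ\overline Y_t^{-1}$, and let $\mathcal{W}(p)$ be the set of laws $\mathbb{P}$ under which $\overline W$ is a Brownian motion and $d\overline Y_t=-(\int c^*(y-\overline Y_t)p_t(dy)+\theta_t)dt+\eta_td\overline W_t$, $\mathcal{L}(\overline Y_0)=\lambda$, for some $\lambda$ supported in $K_0$, $\overline{\mathbb{F}}$-adapted $\Sigma$-valued $\eta$, and adapted $\theta$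 with $\mathbb{E}^{\mathbb{P}}\int_0^T|\theta_u|^2du<\infty$. With $\alpha^*_t=\int a^*(y-\overline Y_t)p_t(dy)$, $\beta^*_t=e^{-\int_0^t\alpha^*_sds}$ let $J(\mathbb{P},\theta;p)=\mathbb{E}^{\mathbb{P}}[\int_0^T\beta^*_u(\alpha^*_u\overline W_u-U(\theta_u)+1)du+\beta^*_T(\overline W_T-U(\overline Y_T))]$. A mean field game is a law $p$ with controls $(\lambda,\eta,\theta)$ such that $p\in\mathcal{W}(p)$ with these controls and $(p,\theta)$ maximizes $J(\cdot,\cdot;p)$ over $\mathbb{P}\in\mathcal{W}(p)$ and the associated $\theta$. Mean field contract. Fix a mean field game with controls $(\lambda,\eta,\theta)$ satisfying $\mathbb{E}\int_0^T|\theta_u|^qdu<\infty$, let $p^*$ be the law of the path $\overline Y$ and $p^*_u$ the law of $\overline Y_u$ under it, and set $\xi=\overline Y_T$. It is assumed that $\xi$ is measurable with respect to $\mathcal{F}_T^{\overline W,\overline Y_0}$ and $\theta$ is adapted to $(\mathcal{F}_t^{\overline W,\overline Y_0})_t$ (the filtration generated by $\overline W$ and $\overline Y_0$). Let $W=(W^1,\dots,W^n)$ be an $n$-dimensional Brownian motion and $(Y^{*,i},\xi^i,\theta^i,\eta^i)_{i\le n}$ be $n$ independent copies of $(\overline Y,\xi,\theta,\eta)$, the $i$-th driven by $W^i$, so that $Y^{*,i}_t=\xi^i+\int_t^T(\int_{\mathbb{R}}c^*(y-Y^{*,i}_u)p^*_u(dy)+\theta^i_u)du-\int_t^T\eta^i_udW^i_u$.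 The BSDE system for $(Y^{n,i},Z^{n,i})$ is solved (square-integrably) in the filtration generated by $W$ and the initial values $Y^{*,1}_0,\dots,Y^{*,n}_0$. $\mathbb{E}$ denotes expectation under the corresponding law. *)

theory Defs
  imports "HOL-Probability.Probability"
begin

section \<open>Cost, conjugate, utility\<close>

text \<open>
  The cost is extended-valued and only its values on \<open>[0,\<infinity>)\<close> matter.  Under
  \<^term>\<open>standing_assumptions\<close> below the conjugate is finite, since the supremum is attained at a
  point where the cost is finite; hence the projection \<^const>\<open>real_of_ereal\<close> loses nothing.
\<close>

definition is_maximizer :: "(real \<Rightarrow> ereal) \<Rightarrow> real \<Rightarrow> real \<Rightarrow> bool" where
  "is_maximizer c y a \<longleftrightarrow>
     0 \<le> a \<and> (\<forall>b\<ge>0. ereal (b * y) - c b \<le> ereal (a * y) - c a)"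

definition astar :: "(real \<Rightarrow> ereal) \<Rightarrow> real \<Rightarrow> real" where
  "astar c y = (THE a. is_maximizer c y a)"

definition cstar :: "(real \<Rightarrow> ereal) \<Rightarrow> real \<Rightarrow> real" where
  "cstar c y = real_of_ereal (SUP a\<in>{0..}. ereal (a * y) - c a)"

definition standing_assumptions ::
    "(real \<Rightarrow> ereal) \<Rightarrow> (real \<Rightarrow> real) \<Rightarrow> real \<Rightarrow> bool" where
  "standing_assumptions c U q \<longleftrightarrow>
     (\<forall>a\<ge>0. 0 \<le> c a) \<and>
     (\<forall>a\<ge>0. \<forall>b\<ge>0. \<forall>u\<in>{0..1}.
        c ((1 - u) * a + u * b) \<le> ereal (1 - u) * c a + ereal u * c b) \<and>
     (\<exists>K. compact K \<and> K \<subseteq> {0..} \<and> (\<forall>a\<ge>0. a \<notin> K \<longrightarrow> c a = \<infinity>) \<and>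
          (\<forall>y. (\<exists>!a. is_maximizer c y a) \<and> astar c y \<in> K)) \<and>
     (\<exists>L. L-lipschitz_on UNIV (cstar c)) \<and>
     (\<exists>L. L-lipschitz_on UNIV (astar c)) \<and>
     convex_on UNIV U \<and>
     q > 1 \<and>
     (\<exists>C C'. 0 < C \<and> C < C' \<and>
        (\<forall>x. C * (\<bar>x\<bar> powr q - 1) \<le> U x \<and> U x \<le> C' * (\<bar>x\<bar> powr q + 1)))"


section \<open>Path space and the distance on laws\<close>

text \<open>
  \<open>C([0,T];E)\<close>: continuous functions on \<open>[0,T]\<close>, represented as functions that are
  \<^term>\<open>undefined\<close> off \<open>[0,T]\<close>, with the sigma-algebra generated by the evaluations. For
  \<open>E = \<real>, \<real>\<^sup>2\<close> this is the Borel sigma-algebra of the uniform norm.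
\<close>

definition path_space :: "real \<Rightarrow> (real \<Rightarrow> 'a::topological_space) measure" where
  "path_space T = restrict_space (\<Pi>\<^sub>M t\<in>{0..T}. borel) {x. continuous_on {0..T} x}"

definition couplings :: "'a measure \<Rightarrow> 'a measure \<Rightarrow> ('a \<times> 'a) measure set" where
  "couplings \<mu> \<nu> =
     {\<pi>. sets \<pi> = sets (\<mu> \<Otimes>\<^sub>M \<nu>) \<and> distr \<pi> \<mu> fst = \<mu> \<and> distr \<pi> \<nu> snd = \<nu>}"

text \<open>The squared distance \<open>d\<^sub>t\<^sup>2\<close>, with values in \<open>[0,\<infinity>]\<close>.\<close>

definition dist_sq ::
    "real \<Rightarrow> real \<Rightarrow> (real \<Rightarrow> real) measure \<Rightarrow> (real \<Rightarrow> real) measure \<Rightarrow> ennreal" where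
  "dist_sq T t \<mu> \<nu> =
     (INF \<pi>\<in>couplings \<mu> \<nu>.
        \<integral>\<^sup>+z. (SUP u\<in>{t..T}. ennreal (\<bar>fst z u - snd z u\<bar>\<^sup>2)) \<partial>\<pi>)"

definition empirical_measure ::
    "real \<Rightarrow> nat \<Rightarrow> (nat \<Rightarrow> real \<Rightarrow> real) \<Rightarrow> (real \<Rightarrow> real) measure" where
  "empirical_measure T n x =
     measure_of (space (path_space T)) (sets (path_space T))
       (\<lambda>A. (\<Sum>j<n. emeasure (return (path_space T) (x j)) A) / of_nat n)"

lemma emeasure_empirical_measure:
  assumes "A \<in> sets (path_space T)"
  shows "emeasure (empirical_measure T n x) A =
           (\<Sum>j<n. emeasure (return (path_space T) (x j)) A) / of_nat n"
proof (rule emeasure_measure_of[OF empirical_measure_def])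
  show "sets (path_space T) \<subseteq> Pow (space (path_space T))"
    by (rule sets.space_closed)
  show "A \<in> sets (empirical_measure T n x)"
    using assms by (simp add: empirical_measure_def)
  show "positive (sets (empirical_measure T n x))
          (\<lambda>A. (\<Sum>j<n. emeasure (return (path_space T) (x j)) A) / of_nat n)"
    by (auto simp: positive_def)
  show "countably_additive (sets (empirical_measure T n x))
          (\<lambda>A. (\<Sum>j<n. emeasure (return (path_space T) (x j)) A) / of_nat n)"
  proof (rule countably_additiveI)
    fix B :: "nat \<Rightarrow> (real \<Rightarrow> real) set"
    assume B: "range B \<subseteq> sets (empirical_measure T n x)" "disjoint_family B"
    have "(\<Sum>i. (\<Sum>j<n. emeasure (return (path_space T) (x j)) (B i)) / of_nat n) =
          (\<Sum>j<n. \<Sum>i. emeasure (return (path_space T) (x j)) (B i)) / of_nat n"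
      by (simp add: divide_ennreal_def ennreal_suminf_multc suminf_sum)
    also have "(\<Sum>j<n. \<Sum>i. emeasure (return (path_space T) (x j)) (B i)) =
               (\<Sum>j<n. emeasure (return (path_space T) (x j)) (\<Union>i. B i))"
      using B by (intro sum.cong refl suminf_emeasure) (auto simp: empirical_measure_def)
    finally show "(\<Sum>i. (\<Sum>j<n. emeasure (return (path_space T) (x j)) (B i)) / of_nat n) =
        (\<Sum>j<n. emeasure (return (path_space T) (x j)) (\<Union>i. B i)) / of_nat n" .
  qed
qed


section \<open>Filtrations, Brownian motion, stochastic integral\<close>

text \<open>
  Filtrations are augmented by the null events of the ambient law. For the filtration generated by
  \<open>W\<close> and \<open>Y\<^sub>0\<close> on the canonical space this is indispensable: without it \<open>Y\<^sub>T\<close> is never measurable.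
\<close>

definition aug_sigma :: "'a measure \<Rightarrow> ('a \<Rightarrow> real) set \<Rightarrow> 'a measure" where
  "aug_sigma M S =
     sigma (space M) ({f -` A \<inter> space M | f A. f \<in> S \<and> A \<in> sets borel} \<union> null_sets M)"

definition adapted :: "(real \<Rightarrow> 'a measure) \<Rightarrow> real \<Rightarrow> (real \<Rightarrow> 'a \<Rightarrow> real) \<Rightarrow> bool" where
  "adapted F T H \<longleftrightarrow> (\<forall>t\<in>{0..T}. H t \<in> borel_measurable (F t))"

definition measurable_process :: "'a measure \<Rightarrow> real \<Rightarrow> (real \<Rightarrow> 'a \<Rightarrow> real) \<Rightarrow> bool" where
  "measurable_process M T H \<longleftrightarrow>
     (\<lambda>(t, \<omega>). H t \<omega>) \<in> borel_measurable (restrict_space borel {0..T} \<Otimes>\<^sub>M M)"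

definition brownian_motion ::
    "'a measure \<Rightarrow> (real \<Rightarrow> 'a measure) \<Rightarrow> real \<Rightarrow> (real \<Rightarrow> 'a \<Rightarrow> real) \<Rightarrow> bool" where
  "brownian_motion M F T W \<longleftrightarrow>
     prob_space M \<and> adapted F T W \<and>
     (\<forall>\<omega>\<in>space M. continuous_on {0..T} (\<lambda>t. W t \<omega>)) \<and>
     (AE \<omega> in M. W 0 \<omega> = 0) \<and>
     (\<forall>s t. 0 \<le> s \<and> s < t \<and> t \<le> T \<longrightarrow>
        distributed M lborel (\<lambda>\<omega>. W t \<omega> - W s \<omega>) (normal_density 0 (sqrt (t - s))) \<and>
        prob_space.indep_set M (sets (F s))
          (sets (vimage_algebra (space M) (\<lambda>\<omega>. W t \<omega> - W s \<omega>) borel)))"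

text \<open>
  A triple \<open>(m, \<tau>, \<zeta>)\<close> encodes the simple integrand
  \<open>\<Sum>j<m. \<zeta> j \<cdot> 1\<^bsub>(\<tau> j, \<tau> (j+1)]\<^esub>\<close>.
\<close>

definition simple_integrand ::
    "'a measure \<Rightarrow> (real \<Rightarrow> 'a measure) \<Rightarrow> real \<Rightarrow> nat \<Rightarrow> (nat \<Rightarrow> real) \<Rightarrow> (nat \<Rightarrow> 'a \<Rightarrow> real) \<Rightarrow> bool"
  where
  "simple_integrand M F T m \<tau> \<zeta> \<longleftrightarrow>
     (\<forall>j<m. 0 \<le> \<tau> j \<and> \<tau> j \<le> \<tau> (Suc j) \<and> \<tau> (Suc j) \<le> T \<and>
        \<zeta> j \<in> borel_measurable (F (\<tau> j)) \<and> (\<exists>B. \<forall>\<omega>\<in>space M. \<bar>\<zeta> j \<omega>\<bar> \<le> B))"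

definition simple_value ::
    "nat \<Rightarrow> (nat \<Rightarrow> real) \<Rightarrow> (nat \<Rightarrow> 'a \<Rightarrow> real) \<Rightarrow> real \<Rightarrow> 'a \<Rightarrow> real" where
  "simple_value m \<tau> \<zeta> t \<omega> = (\<Sum>j<m. \<zeta> j \<omega> * indicator {\<tau> j<..\<tau> (Suc j)} t)"

definition simple_integral ::
    "(real \<Rightarrow> 'a \<Rightarrow> real) \<Rightarrow> nat \<Rightarrow> (nat \<Rightarrow> real) \<Rightarrow> (nat \<Rightarrow> 'a \<Rightarrow> real) \<Rightarrow> real \<Rightarrow> 'a \<Rightarrow> real" where
  "simple_integral W m \<tau> \<zeta> t \<omega> =
     (\<Sum>j<m. \<zeta> j \<omega> * (W (min t (\<tau> (Suc j))) \<omega> - W (min t (\<tau> j)) \<omega>))"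

definition square_integrable_process ::
    "'a measure \<Rightarrow> real \<Rightarrow> (real \<Rightarrow> 'a \<Rightarrow> real) \<Rightarrow> bool" where
  "square_integrable_process M T H \<longleftrightarrow>
     (\<integral>\<^sup>+\<omega>. (\<integral>\<^sup>+t\<in>{0..T}. ennreal (\<bar>H t \<omega>\<bar>\<^sup>2) \<partial>lborel) \<partial>M) < \<infinity>"

text \<open>
  \<open>I\<close> is (a continuous version of) the process \<open>\<integral>\<^sub>0\<^sup>t H dW\<close>: the \<open>L\<^sup>2\<close>-limit of the integrals of
  simple integrands converging to \<open>H\<close> in \<open>L\<^sup>2(dt \<otimes> dM)\<close>.
\<close>

definition ito_integral ::
    "'a measure \<Rightarrow> (real \<Rightarrow> 'a measure) \<Rightarrow> real \<Rightarrow> (real \<Rightarrow> 'a \<Rightarrow> real) \<Rightarrow>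
     (real \<Rightarrow> 'a \<Rightarrow> real) \<Rightarrow> (real \<Rightarrow> 'a \<Rightarrow> real) \<Rightarrow> bool" where
  "ito_integral M F T W H I \<longleftrightarrow>
     measurable_process M T H \<and> adapted F T H \<and> square_integrable_process M T H \<and>
     adapted F T I \<and> (AE \<omega> in M. continuous_on {0..T} (\<lambda>t. I t \<omega>)) \<and>
     (\<exists>m \<tau> \<zeta>.
        (\<forall>k. simple_integrand M F T (m k) (\<tau> k) (\<zeta> k)) \<and>
        (\<lambda>k. \<integral>\<^sup>+\<omega>. (\<integral>\<^sup>+t\<in>{0..T}.
            ennreal (\<bar>simple_value (m k) (\<tau> k) (\<zeta> k) t \<omega> - H t \<omega>\<bar>\<^sup>2) \<partial>lborel) \<partial>M)
          \<longlonglongrightarrow> 0 \<and>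
        (\<forall>t\<in>{0..T}.
          (\<lambda>k. \<integral>\<^sup>+\<omega>. ennreal (\<bar>simple_integral W (m k) (\<tau> k) (\<zeta> k) t \<omega> - I t \<omega>\<bar>\<^sup>2) \<partial>M)
            \<longlonglongrightarrow> 0))"


section \<open>The mean field game\<close>

text \<open>Canonical process on \<open>C([0,T];\<real>\<^sup>2)\<close>.\<close>

type_synonym path2 = "real \<Rightarrow> real \<times> real"

definition Wbar :: "real \<Rightarrow> path2 \<Rightarrow> real" where
  "Wbar t \<omega> = fst (\<omega> t)"

definition Ybar :: "real \<Rightarrow> path2 \<Rightarrow> real" where
  "Ybar t \<omega> = snd (\<omega> t)"

definition canonical_filtration :: "path2 measure \<Rightarrow> real \<Rightarrow> path2 measure" where
  "canonical_filtration P t = aug_sigma P (Wbar ` {0..t} \<union> Ybar ` {0..t})"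

definition WY0_filtration :: "path2 measure \<Rightarrow> real \<Rightarrow> path2 measure" where
  "WY0_filtration P t = aug_sigma P (Wbar ` {0..t} \<union> {Ybar 0})"

definition Ylaw_at :: "path2 measure \<Rightarrow> real \<Rightarrow> real measure" where
  "Ylaw_at p t = distr p borel (Ybar t)"

definition Ylaw :: "real \<Rightarrow> path2 measure \<Rightarrow> (real \<Rightarrow> real) measure" where
  "Ylaw T p = distr p (path_space T) (\<lambda>\<omega>. \<lambda>t\<in>{0..T}. Ybar t \<omega>)"

text \<open>\<open>admissible c T K0 S p P lam \<eta> \<theta>\<close>: \<open>P \<in> W(p)\<close> with associated controls \<open>(lam, \<eta>, \<theta>)\<close>.\<close>

definition admissible ::
    "(real \<Rightarrow> ereal) \<Rightarrow> real \<Rightarrow> real set \<Rightarrow> real set \<Rightarrow> path2 measure \<Rightarrow> path2 measure \<Rightarrow>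
     real measure \<Rightarrow> (real \<Rightarrow> path2 \<Rightarrow> real) \<Rightarrow> (real \<Rightarrow> path2 \<Rightarrow> real) \<Rightarrow> bool" where
  "admissible c T K0 S p P lam \<eta> \<theta> \<longleftrightarrow>
     prob_space P \<and> sets P = sets (path_space T) \<and>
     brownian_motion P (canonical_filtration P) T Wbar \<and>
     distr P borel (Ybar 0) = lam \<and> (AE y in lam. y \<in> K0) \<and>
     measurable_process P T \<eta> \<and> adapted (canonical_filtration P) T \<eta> \<and>
     (\<forall>t\<in>{0..T}. \<forall>\<omega>\<in>space P. \<eta> t \<omega> \<in> S) \<and>
     measurable_process P T \<theta> \<and> adapted (canonical_filtration P) T \<theta> \<and>
     square_integrable_process P T \<theta> \<and>
     (\<forall>t\<in>{0..T}. \<forall>x. integrable (Ylaw_at p t) (\<lambda>y. cstar c (y - x))) \<and>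
     (AE \<omega> in P. set_integrable lborel {0..T}
        (\<lambda>u. (\<integral>y. cstar c (y - Ybar u \<omega>) \<partial>Ylaw_at p u) + \<theta> u \<omega>)) \<and>
     (\<exists>I. ito_integral P (canonical_filtration P) T Wbar \<eta> I \<and>
        (AE \<omega> in P. \<forall>t\<in>{0..T}.
           Ybar t \<omega> = Ybar 0 \<omega>
             - (LINT u:{0..t}|lborel. (\<integral>y. cstar c (y - Ybar u \<omega>) \<partial>Ylaw_at p u) + \<theta> u \<omega>)
             + I t \<omega>))"

definition alpha_star :: "(real \<Rightarrow> ereal) \<Rightarrow> path2 measure \<Rightarrow> real \<Rightarrow> path2 \<Rightarrow> real" where
  "alpha_star c p t \<omega> = (\<integral>y. astar c (y - Ybar t \<omega>) \<partial>Ylaw_at p t)"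

definition beta_star :: "(real \<Rightarrow> ereal) \<Rightarrow> path2 measure \<Rightarrow> real \<Rightarrow> path2 \<Rightarrow> real" where
  "beta_star c p t \<omega> = exp (- (LINT s:{0..t}|lborel. alpha_star c p s \<omega>))"

text \<open>
  For \<open>\<theta>\<close> merely in \<open>L\<^sup>2\<close> the term \<open>U(\<theta>)\<close> need not be integrable, and then \<open>J = -\<infinity>\<close>. The Bochner
  integral would return \<open>0\<close> instead, so \<open>J\<close> uses the extended integral. The positive
  parts are integrable, because \<open>U\<close> is bounded below and \<open>\<alpha>\<^sup>*\<close>, \<open>\<beta>\<^sup>*\<close> are bounded, so
  \<open>\<infinity> - \<infinity>\<close> does not occur.
\<close>

definition ext_integral :: "'a measure \<Rightarrow> ('a \<Rightarrow> ereal) \<Rightarrow> ereal" where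
  "ext_integral M f =
     enn2ereal (\<integral>\<^sup>+x. e2ennreal (f x) \<partial>M) - enn2ereal (\<integral>\<^sup>+x. e2ennreal (- f x) \<partial>M)"

definition objective ::
    "(real \<Rightarrow> ereal) \<Rightarrow> (real \<Rightarrow> real) \<Rightarrow> real \<Rightarrow> path2 measure \<Rightarrow> (real \<Rightarrow> path2 \<Rightarrow> real) \<Rightarrow>
     path2 measure \<Rightarrow> ereal" where
  "objective c U T P \<theta> p =
     ext_integral P (\<lambda>\<omega>.
       ext_integral (restrict_space lborel {0..T})
         (\<lambda>u. ereal (beta_star c p u \<omega> * (alpha_star c p u \<omega> * Wbar u \<omega> - U (\<theta> u \<omega>) + 1)))
       + ereal (beta_star c p T \<omega> * (Wbar T \<omega> - U (Ybar T \<omega>))))"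

definition mean_field_game ::
    "(real \<Rightarrow> ereal) \<Rightarrow> (real \<Rightarrow> real) \<Rightarrow> real \<Rightarrow> real set \<Rightarrow> real set \<Rightarrow> path2 measure \<Rightarrow>
     real measure \<Rightarrow> (real \<Rightarrow> path2 \<Rightarrow> real) \<Rightarrow> (real \<Rightarrow> path2 \<Rightarrow> real) \<Rightarrow> bool" where
  "mean_field_game c U T K0 S p lam \<eta> \<theta> \<longleftrightarrow>
     admissible c T K0 S p p lam \<eta> \<theta> \<and>
     (\<forall>P lam' \<eta>' \<theta>'. admissible c T K0 S p P lam' \<eta>' \<theta>' \<longrightarrow>
        objective c U T P \<theta>' p \<le> objective c U T p \<theta> p)"

definition mean_field_contract ::
    "(real \<Rightarrow> ereal) \<Rightarrow> (real \<Rightarrow> real) \<Rightarrow> real \<Rightarrow> real \<Rightarrow> real set \<Rightarrow> real set \<Rightarrow> path2 measure \<Rightarrow>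
     real measure \<Rightarrow> (real \<Rightarrow> path2 \<Rightarrow> real) \<Rightarrow> (real \<Rightarrow> path2 \<Rightarrow> real) \<Rightarrow> bool" where
  "mean_field_contract c U q T K0 S p lam \<eta> \<theta> \<longleftrightarrow>
     mean_field_game c U T K0 S p lam \<eta> \<theta> \<and>
     (\<integral>\<^sup>+\<omega>. (\<integral>\<^sup>+u\<in>{0..T}. ennreal (\<bar>\<theta> u \<omega>\<bar> powr q) \<partial>lborel) \<partial>p) < \<infinity> \<and>
     Ybar T \<in> borel_measurable (WY0_filtration p T) \<and>
     adapted (WY0_filtration p) T \<theta>"


section \<open>Independent copies and the agent's BSDE system\<close>

text \<open>
  \<open>X i\<close> is the pair of paths \<open>(W\<^sup>i, Y\<^sup>*\<^sup>,\<^sup>i)\<close>. Since \<open>\<xi>, \<theta>, \<eta>\<close> are functionals of the canonical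
  path, their copies are \<open>\<xi>\<^sup>i = Ybar T (X i)\<close> and \<open>\<theta>\<^sup>i\<^sub>t = \<theta> t (X i)\<close>, \<open>\<eta>\<^sup>i\<^sub>t = \<eta> t (X i)\<close>.
  Indices are \<open>0, \<dots>, n - 1\<close>.
\<close>

definition independent_copies ::
    "real \<Rightarrow> path2 measure \<Rightarrow> 'a measure \<Rightarrow> nat \<Rightarrow> (nat \<Rightarrow> 'a \<Rightarrow> path2) \<Rightarrow> bool" where
  "independent_copies T p M n X \<longleftrightarrow>
     prob_space M \<and>
     prob_space.indep_vars M (\<lambda>_. path_space T) X {..<n} \<and>
     (\<forall>i<n. distr M (path_space T) (X i) = p)"

definition copies_filtration ::
    "'a measure \<Rightarrow> nat \<Rightarrow> (nat \<Rightarrow> 'a \<Rightarrow> path2) \<Rightarrow> real \<Rightarrow> 'a measure" where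
  "copies_filtration M n X t =
     aug_sigma M ({\<lambda>\<omega>. Wbar s (X i \<omega>) | i s. i < n \<and> s \<in> {0..t}} \<union>
                  {\<lambda>\<omega>. Ybar 0 (X i \<omega>) | i. i < n})"

text \<open>\<open>Z i k\<close> is the \<open>k\<close>-th component of the \<open>\<real>\<^sup>n\<close>-valued process \<open>Z\<^sup>n\<^sup>,\<^sup>i\<close>.\<close>

definition solves_bsde_system ::
    "(real \<Rightarrow> ereal) \<Rightarrow> real \<Rightarrow> 'a measure \<Rightarrow> (real \<Rightarrow> 'a measure) \<Rightarrow> nat \<Rightarrow>
     (nat \<Rightarrow> real \<Rightarrow> 'a \<Rightarrow> real) \<Rightarrow> (nat \<Rightarrow> 'a \<Rightarrow> real) \<Rightarrow> (nat \<Rightarrow> real \<Rightarrow> 'a \<Rightarrow> real) \<Rightarrow>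
     (nat \<Rightarrow> 'a \<Rightarrow> real \<Rightarrow> real) \<Rightarrow> (nat \<Rightarrow> nat \<Rightarrow> real \<Rightarrow> 'a \<Rightarrow> real) \<Rightarrow> bool" where
  "solves_bsde_system c T M F n W \<xi> \<theta> Y Z \<longleftrightarrow>
     (\<forall>i<n.
        Y i \<in> M \<rightarrow>\<^sub>M path_space T \<and> adapted F T (\<lambda>t \<omega>. Y i \<omega> t) \<and>
        square_integrable_process M T (\<lambda>t \<omega>. Y i \<omega> t) \<and>
        (\<exists>I. (\<forall>k<n. ito_integral M F T (W k) (Z i k) (I k)) \<and>
           (AE \<omega> in M. \<forall>t\<in>{0..T}.
              Y i \<omega> t = \<xi> i \<omega>
                + (LINT u:{t..T}|lborel.
                     1 / (real n - 1) * (\<Sum>j\<in>{..<n} - {i}. cstar c (Y j \<omega> u - Y i \<omega> u))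
                     + \<theta> i u \<omega>)
                - (\<Sum>k<n. I k T \<omega> - I k t \<omega>))))"

end

theory Submission
  imports Defs
begin

text \<open>
  Let \<open>\<F>\<close> be the joint filtration of all \<open>n\<close> copies \<open>(W\<^sup>i, Y\<^sup>*\<^sup>,\<^sup>i)\<close>. With respect to \<open>\<F>\<close> both
  \<open>Y\<^sup>n\<^sup>,\<^sup>i\<close> and \<open>Y\<^sup>*\<^sup>,\<^sup>i\<close> solve backward equations with the same \<open>\<theta>\<^sup>i\<close>, the same terminal value and
  martingale parts whose increments are orthogonal to the past. Their difference therefore is
  \<open>\<integral>\<^sub>t\<^sup>T D\<^sup>i du\<close> minus an orthogonal martingale increment, which gives an energy estimate; Gronwall's
  inequality for the mean over \<open>i\<close> and Doob's maximal inequality then bound the uniform distance of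
  \<open>Y\<^sup>n\<^sup>,\<^sup>i\<close> and \<open>Y\<^sup>*\<^sup>,\<^sup>i\<close>. The inhomogeneity in this estimate consists of terms of order \<open>1 / n\<close> and of the
  deviation of the mean of \<open>c\<^sup>*(Y\<^sup>*\<^sup>,\<^sup>j - x)\<close> from its expectation, and since \<open>c\<^sup>*\<close> is Lipschitz the latter
  is at most the transport cost between the empirical measure of the independent \<open>Y\<^sup>*\<^sup>,\<^sup>j\<close> and their law.
  That cost tends to \<open>0\<close> in mean: one partitions the path space into countably many small cells and
  transports within the cells whatever mass the two measures share there, and all remaining mass
  independently.
\<close>

section \<open>Path space and uniform norms\<close>

text \<open>Two obstacles shape the proof. The drift of the mean field equation is evaluated at the
  random point \<open>Ys i \<omega> u\<close>, so a law of large numbers for one function at a time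
  does not suffice; the transport cost controls all functions \<open>cstar c (y - x)\<close> at
  once, uniformly in \<open>x\<close> and in time. Moreover, neither an optimal coupling nor the
  optimal cost comes with measurability in the sample point. So the couplings are given by explicit
  weights for each sample point, and what is integrated is a measurable majorant \<open>Q\<close> of
  their cost. As the weights refer to indices and not to atoms, the same weights couple both
  \<open>Ys\<close> and \<open>Y\<close> with the limit law, and the triangle inequality is applied
  path by path. Stochastic integrals enter through the orthogonality of their increments to the
  past. This property carries over to the joint filtration as soon as each Brownian motion remains
  one there, so the martingale parts of the two equations, which live in different filtrations, can
  be subtracted.\<close>

lemma space_path_space:
  "space (path_space T) = {x \<in> {0..T} \<rightarrow>\<^sub>E UNIV. continuous_on {0..T} x}"
  by (auto simp: path_space_def space_restrict_space space_PiM)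

lemma measurable_eval:
  fixes t T :: real
  assumes "t \<in> {0..T}"
  shows "(\<lambda>x. x t) \<in> borel_measurable (path_space T)"
  unfolding path_space_def
  by (intro measurable_restrict_space1 measurable_component_singleton assms)

lemma measurable_path_spaceI:
  assumes "\<And>\<omega>. \<omega> \<in> space N \<Longrightarrow> f \<omega> \<in> space (path_space T)"
    and "\<And>t. t \<in> {0..T} \<Longrightarrow> (\<lambda>\<omega>. f \<omega> t) \<in> borel_measurable N"
  shows "f \<in> N \<rightarrow>\<^sub>M path_space T"
  unfolding path_space_def
proof (rule measurable_restrict_space2)
  show "f \<in> space N \<rightarrow> {x. continuous_on {0..T} x}"
    using assms(1) by (auto simp: space_path_space)
  show "f \<in> N \<rightarrow>\<^sub>M (\<Pi>\<^sub>M t\<in>{0..T}. borel)"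
    by (rule measurable_PiM_single') (use assms in \<open>auto simp: space_path_space\<close>)
qed

section \<open>Regular grids and suprema of continuous paths\<close>

definition gridpt :: "real \<Rightarrow> nat \<Rightarrow> nat \<Rightarrow> real" where
  "gridpt T k j = T * real j / real (Suc k)"

definition gridix :: "real \<Rightarrow> nat \<Rightarrow> real \<Rightarrow> nat" where
  "gridix T k u = nat \<lfloor>u * real (Suc k) / T\<rfloor>"

lemma gridpt_mem: "0 < T \<Longrightarrow> j \<le> Suc k \<Longrightarrow> gridpt T k j \<in> {0..T}"
proof -
  assume T: "0 < T" "j \<le> Suc k"
  have "T * real j \<le> T * real (Suc k)" using T by (intro mult_left_mono) auto
  then show ?thesis using T by (auto simp: gridpt_def divide_le_eq zero_le_divide_iff)
qed

lemma gridpt_mono: "0 < T \<Longrightarrow> i \<le> j \<Longrightarrow> gridpt T k i \<le> gridpt T k j"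
  by (simp add: gridpt_def divide_right_mono)

lemma gridix_le: assumes "0 < T" "u \<in> {0..T}" shows "gridix T k u \<le> Suc k"
proof -
  have "u * real (Suc k) / T \<le> real (Suc k)"
    using assms mult_right_mono[of u T "real (Suc k)"] by (simp add: divide_le_eq mult.commute)
  then have "\<lfloor>u * real (Suc k) / T\<rfloor> \<le> int (Suc k)"
    by linarith
  then show ?thesis by (simp add: gridix_def)
qed

lemma gridpt_gridix_close:
  assumes "0 < T" "u \<in> {0..T}"
  shows "\<bar>gridpt T k (gridix T k u) - u\<bar> \<le> T * inverse (real (Suc k))"
proof -
  define z where "z = u * real (Suc k) / T"
  have z: "0 \<le> z" using assms by (simp add: z_def)
  have g: "real (gridix T k u) = real_of_int \<lfloor>z\<rfloor>" using z by (simp add: gridix_def z_def)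
  have "gridpt T k (gridix T k u) - u = T * inverse (real (Suc k)) * (real_of_int \<lfloor>z\<rfloor> - z)"
  proof -
    have "u = T * inverse (real (Suc k)) * z" using assms by (simp add: z_def)
    moreover have "gridpt T k (gridix T k u) = T * inverse (real (Suc k)) * real_of_int \<lfloor>z\<rfloor>"
      by (simp add: gridpt_def g divide_inverse mult_ac)
    ultimately have "gridpt T k (gridix T k u) - u
        = T * inverse (real (Suc k)) * real_of_int \<lfloor>z\<rfloor> - T * inverse (real (Suc k)) * z"
      by linarith
    then show ?thesis unfolding right_diff_distrib .
  qed
  then have "\<bar>gridpt T k (gridix T k u) - u\<bar> = T * inverse (real (Suc k)) * \<bar>real_of_int \<lfloor>z\<rfloor> - z\<bar>"
    using assms by (simp add: abs_mult)
  also have "\<dots> \<le> T * inverse (real (Suc k)) * 1"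
    using assms(1) by (intro mult_left_mono) (linarith, simp)
  finally show ?thesis by simp
qed

lemma gridpt_gridix_tendsto:
  assumes "0 < T" "u \<in> {0..T}"
  shows "(\<lambda>k. gridpt T k (gridix T k u)) \<longlonglongrightarrow> u"
proof -
  have "(\<lambda>k. T * inverse (real (Suc k))) \<longlonglongrightarrow> T * 0"
    by (rule tendsto_mult[OF tendsto_const LIMSEQ_inverse_real_of_nat])
  then have "(\<lambda>k. T * inverse (real (Suc k))) \<longlonglongrightarrow> 0"
    by (simp only: mult_zero_right)
  then have "(\<lambda>k. gridpt T k (gridix T k u) - u) \<longlonglongrightarrow> 0"
    by (rule Lim_null_comparison[OF always_eventually, rotated]) (use gridpt_gridix_close[OF assms] in \<open>simp only: real_norm_def simp_thms\<close>)
  then show ?thesis by (simp add: LIM_zero_iff)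
qed

lemma continuous_gridpt_tendsto:
  fixes f :: "real \<Rightarrow> 'b::topological_space"
  assumes "0 < T" "u \<in> {0..T}" "continuous_on {0..T} f"
  shows "(\<lambda>k. f (gridpt T k (gridix T k u))) \<longlonglongrightarrow> f u"
proof (rule continuous_on_tendsto_compose[OF assms(3) gridpt_gridix_tendsto assms(2)])
  show "\<forall>\<^sub>F k in sequentially. gridpt T k (gridix T k u) \<in> {0..T}"
    using assms by (intro always_eventually allI gridpt_mem gridix_le)
qed (use assms in auto)

abbreviation sup_sq :: "real \<Rightarrow> (real \<Rightarrow> real) \<Rightarrow> ennreal" where
  "sup_sq T f \<equiv> (SUP u\<in>{0..T}. ennreal ((f u)\<^sup>2))"

definition grid_sup_sq :: "real \<Rightarrow> nat \<Rightarrow> (real \<Rightarrow> real) \<Rightarrow> ennreal" where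
  "grid_sup_sq T k f = (SUP j\<in>{..Suc k}. ennreal ((f (gridpt T k j))\<^sup>2))"

text \<open>The grids are not nested, so the maxima over them need not increase with
  \<open>k\<close>. The lower limit avoids this question, and it is the form to which measurability
  of limits and Fatou's lemma apply.\<close>

lemma sup_sq_eq_liminf_grid:
  assumes "0 < T" "continuous_on {0..T} f"
  shows "sup_sq T f = liminf (\<lambda>k. grid_sup_sq T k f)"
proof (rule antisym)
  show "sup_sq T f \<le> liminf (\<lambda>k. grid_sup_sq T k f)"
  proof (rule SUP_least)
    fix u assume u: "u \<in> {0..T}"
    have "(\<lambda>k. ennreal ((f (gridpt T k (gridix T k u)))\<^sup>2)) \<longlonglongrightarrow> ennreal ((f u)\<^sup>2)"
      by (intro tendsto_ennrealI tendsto_power continuous_gridpt_tendsto assms u)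
    then have "ennreal ((f u)\<^sup>2) = liminf (\<lambda>k. ennreal ((f (gridpt T k (gridix T k u)))\<^sup>2))"
      by (metis lim_imp_Liminf trivial_limit_sequentially)
    also have "\<dots> \<le> liminf (\<lambda>k. grid_sup_sq T k f)"
      unfolding grid_sup_sq_def
      by (intro Liminf_mono always_eventually allI SUP_upper2[OF _ order_refl])
        (use gridix_le[OF assms(1) u] in auto)
    finally show "ennreal ((f u)\<^sup>2) \<le> liminf (\<lambda>k. grid_sup_sq T k f)" .
  qed
  have "grid_sup_sq T k f \<le> sup_sq T f" for k
    unfolding grid_sup_sq_def using gridpt_mem[OF assms(1)]
    by (intro SUP_least SUP_upper2[OF _ order_refl]) auto
  then have "liminf (\<lambda>k. grid_sup_sq T k f) \<le> liminf (\<lambda>k::nat. sup_sq T f)"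
    by (intro Liminf_mono always_eventually allI)
  then show "liminf (\<lambda>k. grid_sup_sq T k f) \<le> sup_sq T f"
    by (simp add: Liminf_const)
qed

lemma borel_measurable_sup_sq:
  assumes T: "0 < T"
    and cont: "\<And>\<omega>. \<omega> \<in> space M \<Longrightarrow> continuous_on {0..T} (f \<omega>)"
    and meas: "\<And>t. t \<in> {0..T} \<Longrightarrow> (\<lambda>\<omega>. f \<omega> t) \<in> borel_measurable M"
  shows "(\<lambda>\<omega>. sup_sq T (f \<omega>)) \<in> borel_measurable M"
proof -
  have "(\<lambda>\<omega>. liminf (\<lambda>k. grid_sup_sq T k (f \<omega>))) \<in> borel_measurable M"
    unfolding grid_sup_sq_def
    by (intro borel_measurable_liminf borel_measurable_SUP measurable_compose[OF _ measurable_ennreal]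
        borel_measurable_power meas gridpt_mem T) auto
  then show ?thesis
    by (rule measurable_cong[THEN iffD1, rotated]) (use sup_sq_eq_liminf_grid[OF T cont] in auto)
qed

lemma borel_measurable_sup_sq_path [measurable]:
  assumes T: "0 < T" and [measurable]: "f \<in> M \<rightarrow>\<^sub>M path_space T" "g \<in> M \<rightarrow>\<^sub>M path_space T"
  shows "(\<lambda>\<omega>. sup_sq T (\<lambda>u. f \<omega> u - g \<omega> u)) \<in> borel_measurable M"
proof (rule borel_measurable_sup_sq[OF T])
  fix \<omega> assume "\<omega> \<in> space M"
  then have "f \<omega> \<in> space (path_space T)" "g \<omega> \<in> space (path_space T)"
    using measurable_space[OF assms(2)] measurable_space[OF assms(3)] by auto
  then show "continuous_on {0..T} (\<lambda>u. f \<omega> u - g \<omega> u)"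
    by (intro continuous_intros) (auto simp: space_path_space)
next
  fix t assume t: "t \<in> {0..T}"
  show "(\<lambda>\<omega>. f \<omega> t - g \<omega> t) \<in> borel_measurable M"
    using measurable_compose[OF assms(2) measurable_eval[OF t]]
      measurable_compose[OF assms(3) measurable_eval[OF t]] by simp
qed

lemma borel_measurable_sup_sq_path1 [measurable]:
  assumes T: "0 < T" and f: "f \<in> M \<rightarrow>\<^sub>M path_space T"
  shows "(\<lambda>\<omega>. sup_sq T (f \<omega>)) \<in> borel_measurable M"
proof (rule borel_measurable_sup_sq[OF T])
  fix \<omega> assume "\<omega> \<in> space M"
  then have "f \<omega> \<in> space (path_space T)"
    using f by (auto dest: measurable_space)
  then show "continuous_on {0..T} (f \<omega>)"
    by (auto simp: space_path_space)
qed (rule measurable_compose[OF f measurable_eval])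

text \<open>A continuous path is the pointwise limit of its values at the left neighbouring grid
  points. Each approximation is jointly measurable because \<open>gridix\<close> takes finitely many
  values, and for a fixed value only the sample point varies.\<close>

lemma measurable_eval_pair:
  fixes f :: "'a \<Rightarrow> real \<Rightarrow> real"
  assumes T: "0 < T" and f: "f \<in> M \<rightarrow>\<^sub>M path_space T"
  shows "(\<lambda>(t, \<omega>). f \<omega> t) \<in> borel_measurable (restrict_space borel {0..T} \<Otimes>\<^sub>M M)"
proof (rule borel_measurable_LIMSEQ_metric)
  fix z assume z: "z \<in> space (restrict_space borel {0..T} \<Otimes>\<^sub>M M)"
  obtain t \<omega> where zz: "z = (t, \<omega>)" by force
  have t: "t \<in> {0..T}" and w: "\<omega> \<in> space M"
    using z by (auto simp: zz space_pair_measure space_restrict_space)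
  have "f \<omega> \<in> space (path_space T)" using f w by (auto dest: measurable_space)
  then have "(\<lambda>k. f \<omega> (gridpt T k (gridix T k t))) \<longlonglongrightarrow> f \<omega> t"
    by (intro continuous_gridpt_tendsto T t) (simp add: space_path_space)
  then show "(\<lambda>k. (case z of (t, \<omega>) \<Rightarrow> f \<omega> (gridpt T k (gridix T k t)))) \<longlonglongrightarrow> (case z of (t, \<omega>) \<Rightarrow> f \<omega> t)"
    by (simp add: zz)
next
  fix k
  let ?N = "restrict_space borel {0..T} \<Otimes>\<^sub>M M"
  have "(\<lambda>z. gridix T k (fst z)) \<in> ?N \<rightarrow>\<^sub>M count_space {..Suc k}"
  proof (rule measurable_count_space_eq2[THEN iffD2], simp, intro conjI ballI)
    show "(\<lambda>z. gridix T k (fst z)) \<in> space ?N \<rightarrow> {..Suc k}"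
      using gridix_le[OF T] by (auto simp: space_pair_measure space_restrict_space)
    fix a
    have [measurable]: "fst \<in> ?N \<rightarrow>\<^sub>M borel"
      by (rule measurable_compose[OF measurable_fst measurable_restrict_space1]) simp
    show "(\<lambda>z. gridix T k (fst z)) -` {a} \<inter> space ?N \<in> sets ?N"
      unfolding gridix_def by measurable
  qed
  then have "(\<lambda>z. (\<lambda>j z. f (snd z) (gridpt T k j)) (gridix T k (fst z)) z) \<in> borel_measurable ?N"
    by (rule measurable_compose_countable'[rotated])
      (auto intro!: measurable_compose[OF measurable_compose[OF measurable_snd f] measurable_eval] gridpt_mem T)
  then show "(\<lambda>(t, \<omega>). f \<omega> (gridpt T k (gridix T k t))) \<in> borel_measurable ?N"
    by (simp add: case_prod_beta')
qed

section \<open>Couplings with the empirical measure\<close>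

lemma nn_integral_uniform_count_measure:
  assumes "finite A"
  shows "(\<integral>\<^sup>+x. f x \<partial>uniform_count_measure A) = (\<Sum>a\<in>A. f a) / of_nat (card A)"
proof (cases "A = {}")
  case True
  then show ?thesis by (simp add: uniform_count_measure_def point_measure_def nn_integral_empty)
next
  case False
  then have c: "0 < card A" using assms by (simp add: card_gt_0_iff)
  have "(\<integral>\<^sup>+x. f x \<partial>uniform_count_measure A) = (\<Sum>a\<in>A. ennreal (1 / real (card A)) * f a)"
    using assms by (simp add: uniform_count_measure_def point_measure_def nn_integral_density
        nn_integral_count_space_finite)
  also have "\<dots> = ennreal (1 / real (card A)) * (\<Sum>a\<in>A. f a)"
    by (simp only: sum_distrib_left)
  also have "ennreal (1 / real (card A)) = inverse (of_nat (card A))"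
    using c by (simp add: inverse_ennreal ennreal_of_nat_eq_real_of_nat inverse_eq_divide)
  also have "\<dots> * (\<Sum>a\<in>A. f a) = (\<Sum>a\<in>A. f a) / of_nat (card A)"
    by (simp add: divide_ennreal_def mult.commute)
  finally show ?thesis .
qed

text \<open>As the law of \<open>x\<close> at a uniformly chosen index, the empirical measure turns
  integrals into finite averages through the rules for \<open>distr\<close>.\<close>

lemma empirical_measure_eq_distr:
  assumes "0 < n" and x: "\<And>j. j < n \<Longrightarrow> x j \<in> space (path_space T)"
  shows "empirical_measure T n x = distr (uniform_count_measure {..<n}) (path_space T) x"
    (is "?L = ?R")
proof (rule measure_eqI)
  show sets_eq: "sets ?L = sets ?R" by (simp add: empirical_measure_def)
  fix A assume "A \<in> sets ?L"
  then have A: "A \<in> sets (path_space T)" by (simp add: empirical_measure_def)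
  have m: "x \<in> uniform_count_measure {..<n} \<rightarrow>\<^sub>M path_space T"
    using x by (auto simp: space_uniform_count_measure measurable_def sets_uniform_count_measure)
  have "emeasure ?R A = (\<integral>\<^sup>+z. indicator A z \<partial>?R)"
    using A by simp
  also have "\<dots> = (\<integral>\<^sup>+j. indicator A (x j) \<partial>uniform_count_measure {..<n})"
    by (rule nn_integral_distr[OF m]) (use A in simp)
  also have "\<dots> = (\<Sum>j<n. indicator A (x j)) / of_nat n"
    by (simp add: nn_integral_uniform_count_measure)
  also have "\<dots> = emeasure ?L A"
    using A by (simp add: emeasure_empirical_measure)
  finally show "emeasure ?L A = emeasure ?R A" by simp
qed

lemma sets_empirical_measure [measurable_cong]:
  "sets (empirical_measure T n x) = sets (path_space T)"
  by (simp add: empirical_measure_def)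

text \<open>The coupling is the image under \<open>(j, y) \<mapsto> (x j, y)\<close> of the measure
  with density \<open>g j y\<close> relative to the product of the uniform law on the indices and
  \<open>\<mu>\<close>. Total mass 1 for each index yields the first marginal, total weight
  \<open>n\<close> over each point \<open>y\<close> the second. Working with indices also covers
  samples with repeated atoms.\<close>

lemma coupling_of_weights:
  fixes g :: "nat \<Rightarrow> (real \<Rightarrow> real) \<Rightarrow> real"
  assumes n: "0 < n" and x: "\<And>j. j < n \<Longrightarrow> x j \<in> space (path_space T)"
    and \<mu>: "prob_space \<mu>" and s[measurable_cong]: "sets \<mu> = sets (path_space T)"
    and g: "\<And>j. j < n \<Longrightarrow> g j \<in> borel_measurable \<mu>"
    and g1: "\<And>j. j < n \<Longrightarrow> (\<integral>\<^sup>+y. ennreal (g j y) \<partial>\<mu>) = 1"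
    and g2: "AE y in \<mu>. (\<Sum>j<n. ennreal (g j y)) = of_nat n"
  obtains \<pi> where "\<pi> \<in> couplings (empirical_measure T n x) \<mu>"
    and "\<And>F. F \<in> borel_measurable (path_space T \<Otimes>\<^sub>M path_space T) \<Longrightarrow>
      (\<integral>\<^sup>+z. F z \<partial>\<pi>) = (\<Sum>j<n. \<integral>\<^sup>+y. ennreal (g j y) * F (x j, y) \<partial>\<mu>) / of_nat n"
proof -
  interpret \<mu>: prob_space \<mu> by (rule \<mu>)
  let ?C = "uniform_count_measure {..<n}" and ?P = "path_space T"
  define \<pi> where "\<pi> = distr (density (?C \<Otimes>\<^sub>M \<mu>) (\<lambda>(j, y). ennreal (g j y)))
     (?P \<Otimes>\<^sub>M ?P) (\<lambda>(j, y). (x j, y))"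
  have Cs[measurable_cong]: "sets (?C \<Otimes>\<^sub>M \<mu>) = sets (count_space {..<n} \<Otimes>\<^sub>M \<mu>)"
    by (intro sets_pair_measure_cong) (auto simp: sets_uniform_count_measure_count_space)
  have mg: "(\<lambda>(j, y). ennreal (g j y)) \<in> borel_measurable (?C \<Otimes>\<^sub>M \<mu>)"
    unfolding measurable_cong_sets[OF Cs refl]
    by (rule measurable_pair_measure_countable1) (use g in auto)
  have mx: "(\<lambda>(j, y). (x j, y)) \<in> ?C \<Otimes>\<^sub>M \<mu> \<rightarrow>\<^sub>M ?P \<Otimes>\<^sub>M ?P"
    unfolding measurable_cong_sets[OF Cs refl]
  proof (rule measurable_pair_measure_countable1)
    fix j assume "j \<in> {..<n}"
    then have "x j \<in> space ?P" using x by auto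
    then show "(\<lambda>y. case (j, y) of (j, y) \<Rightarrow> (x j, y)) \<in> \<mu> \<rightarrow>\<^sub>M ?P \<Otimes>\<^sub>M ?P"
      by (auto intro!: measurable_Pair simp: measurable_ident_sets[OF s])
  qed simp
  have F: "(\<integral>\<^sup>+z. F z \<partial>\<pi>) = (\<Sum>j<n. \<integral>\<^sup>+y. ennreal (g j y) * F (x j, y) \<partial>\<mu>) / of_nat n"
    if Fm: "F \<in> borel_measurable (?P \<Otimes>\<^sub>M ?P)" for F
  proof -
    have mFx: "(\<lambda>z. F (case z of (j, y) \<Rightarrow> (x j, y))) \<in> borel_measurable (?C \<Otimes>\<^sub>M \<mu>)"
      by (rule measurable_compose[OF mx Fm])
    have "(\<integral>\<^sup>+z. F z \<partial>\<pi>) = (\<integral>\<^sup>+z. F (case z of (j, y) \<Rightarrow> (x j, y))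
        \<partial>density (?C \<Otimes>\<^sub>M \<mu>) (\<lambda>(j, y). ennreal (g j y)))"
      unfolding \<pi>_def by (rule nn_integral_distr) (use mx Fm in simp_all)
    also have "\<dots> = (\<integral>\<^sup>+z. (case z of (j, y) \<Rightarrow> ennreal (g j y)) * F (case z of (j, y) \<Rightarrow> (x j, y))
        \<partial>(?C \<Otimes>\<^sub>M \<mu>))"
      by (rule nn_integral_density[OF mg mFx])
    also have "\<dots> = (\<integral>\<^sup>+j. \<integral>\<^sup>+y. ennreal (g j y) * F (x j, y) \<partial>\<mu> \<partial>?C)"
      by (subst \<mu>.nn_integral_fst[symmetric]) (use mg mFx in \<open>auto intro!: borel_measurable_times_ennreal\<close>)
    finally show ?thesis by (simp add: nn_integral_uniform_count_measure)
  qed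
  have "\<pi> \<in> couplings (empirical_measure T n x) \<mu>"
    unfolding couplings_def
  proof (intro CollectI conjI)
    have s1: "sets \<pi> = sets (?P \<Otimes>\<^sub>M ?P)" by (simp add: \<pi>_def)
    show "sets \<pi> = sets (empirical_measure T n x \<Otimes>\<^sub>M \<mu>)"
      unfolding s1 by (intro sets_pair_measure_cong) (simp_all add: s sets_empirical_measure)
    have [measurable]: "fst \<in> \<pi> \<rightarrow>\<^sub>M ?P" "snd \<in> \<pi> \<rightarrow>\<^sub>M ?P"
      unfolding measurable_cong_sets[OF s1 refl] by simp_all
    have sp: "space \<pi> = space (?P \<Otimes>\<^sub>M ?P)" using s1 by (rule sets_eq_imp_space_eq)
    show "distr \<pi> (empirical_measure T n x) fst = empirical_measure T n x" (is "?D = _")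
    proof (rule measure_eqI)
      fix A assume "A \<in> sets ?D"
      then have A[measurable]: "A \<in> sets ?P" by (simp add: sets_empirical_measure)
      have "emeasure ?D A = emeasure \<pi> (fst -` A \<inter> space \<pi>)"
        by (rule emeasure_distr) (simp_all add: measurable_cong_sets[OF refl sets_empirical_measure] sets_empirical_measure)
      also have "\<dots> = (\<integral>\<^sup>+z. indicator (fst -` A \<inter> space \<pi>) z \<partial>\<pi>)"
        by (rule nn_integral_indicator[symmetric], rule measurable_sets[OF _ A]) simp
      also have "\<dots> = (\<integral>\<^sup>+z. indicator A (fst z) \<partial>\<pi>)"
        by (rule nn_integral_cong) (auto split: split_indicator)
      also have "\<dots> = (\<Sum>j<n. \<integral>\<^sup>+y. ennreal (g j y) * indicator A (x j) \<partial>\<mu>) / of_nat n"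
        by (subst F) auto
      also have "(\<Sum>j<n. \<integral>\<^sup>+y. ennreal (g j y) * indicator A (x j) \<partial>\<mu>) = (\<Sum>j<n. indicator A (x j))"
      proof (intro sum.cong refl)
        fix j assume "j \<in> {..<n}"
        then have j: "j < n" by simp
        show "(\<integral>\<^sup>+y. ennreal (g j y) * indicator A (x j) \<partial>\<mu>) = indicator A (x j)"
          by (subst nn_integral_multc) (use g[OF j] g1[OF j] in simp_all)
      qed
      also have "\<dots> / of_nat n = emeasure (empirical_measure T n x) A"
        by (simp add: emeasure_empirical_measure)
      finally show "emeasure ?D A = emeasure (empirical_measure T n x) A" .
    qed simp
    show "distr \<pi> \<mu> snd = \<mu>" (is "?D = _")
    proof (rule measure_eqI)
      fix A assume "A \<in> sets ?D"
      then have A: "A \<in> sets \<mu>" by simp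
      then have A': "A \<in> sets ?P" using s by simp
      have ms: "snd \<in> \<pi> \<rightarrow>\<^sub>M \<mu>" by (simp add: measurable_cong_sets[OF refl s])
      have "emeasure ?D A = emeasure \<pi> (snd -` A \<inter> space \<pi>)"
        by (rule emeasure_distr[OF ms A])
      also have "\<dots> = (\<integral>\<^sup>+z. indicator (snd -` A \<inter> space \<pi>) z \<partial>\<pi>)"
        by (rule nn_integral_indicator[symmetric], rule measurable_sets[OF _ A']) simp
      also have "\<dots> = (\<integral>\<^sup>+z. indicator A (snd z) \<partial>\<pi>)"
        by (rule nn_integral_cong) (auto split: split_indicator)
      also have "\<dots> = (\<Sum>j<n. \<integral>\<^sup>+y. ennreal (g j y) * indicator A y \<partial>\<mu>) / of_nat n"
        by (subst F) (use A' in auto)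
      also have "(\<Sum>j<n. \<integral>\<^sup>+y. ennreal (g j y) * indicator A y \<partial>\<mu>)
          = (\<integral>\<^sup>+y. (\<Sum>j<n. ennreal (g j y) * indicator A y) \<partial>\<mu>)"
        by (rule nn_integral_sum[symmetric]) (use g A in auto)
      also have "\<dots> = (\<integral>\<^sup>+y. of_nat n * indicator A y \<partial>\<mu>)"
        by (rule nn_integral_cong_AE) (use g2 in \<open>auto simp: sum_distrib_right[symmetric]\<close>)
      also have "\<dots> = of_nat n * emeasure \<mu> A"
        using A by (simp add: nn_integral_cmult)
      also have "\<dots> / of_nat n = emeasure \<mu> A"
        using n by (simp add: ennreal_divide_times mult.commute[of "of_nat n"] mult_divide_eq_ennreal)
      finally show "emeasure ?D A = emeasure \<mu> A" .
    qed simp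
  qed
  then show thesis using F that by blast
qed

lemma sup_sq_measurable_pair [measurable]:
  "0 < T \<Longrightarrow> (\<lambda>z. sup_sq T (\<lambda>u. fst z u - snd z u)) \<in> borel_measurable (path_space T \<Otimes>\<^sub>M path_space T)"
  by (rule borel_measurable_sup_sq_path) auto

lemma dist_sq_le:
  assumes "\<pi> \<in> couplings \<mu> \<nu>"
  shows "dist_sq T 0 \<mu> \<nu> \<le> (\<integral>\<^sup>+z. sup_sq T (\<lambda>u. fst z u - snd z u) \<partial>\<pi>)"
  unfolding dist_sq_def by (rule INF_lower2[OF assms]) simp

text \<open>Jensen's inequality for the square. For a function that is not integrable the left side
  is 0, the default value of the Bochner integral.\<close>

lemma (in prob_space) square_integral_le:
  fixes f :: "'a \<Rightarrow> real"
  assumes [measurable]: "f \<in> borel_measurable M"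
  shows "ennreal ((\<integral>x. f x \<partial>M)\<^sup>2) \<le> (\<integral>\<^sup>+x. ennreal ((f x)\<^sup>2) \<partial>M)"
proof (cases "integrable M f")
  case True
  have "ennreal ((\<integral>x. f x \<partial>M)\<^sup>2) = (ennreal (norm (\<integral>x. f x \<partial>M)))\<^sup>2"
    by (simp add: ennreal_power)
  also have "\<dots> \<le> (\<integral>\<^sup>+x. ennreal (norm (f x)) * 1 \<partial>M)\<^sup>2"
    using integral_norm_bound_ennreal[OF True] by (intro power_mono) auto
  also have "\<dots> \<le> (\<integral>\<^sup>+x. (ennreal (norm (f x)))\<^sup>2 \<partial>M) * (\<integral>\<^sup>+x. 1\<^sup>2 \<partial>M)"
    by (rule Cauchy_Schwarz_nn_integral) auto
  also have "\<dots> = (\<integral>\<^sup>+x. ennreal ((f x)\<^sup>2) \<partial>M)"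
    by (simp add: ennreal_power emeasure_space_1)
  finally show ?thesis .
next
  case False
  then show ?thesis by (simp add: not_integrable_integral_eq)
qed

text \<open>Both averages are integrals of the same function against the two marginals of
  \<open>\<pi>\<close>, so their difference is the integral of
  \<open>\<phi> (fst z u) - \<phi> (snd z u)\<close>. One coupling thus serves all Lipschitz
  \<open>\<phi>\<close> and all times, in particular the functions \<open>cstar c (y - x)\<close>
  with a centre \<open>x\<close> that depends on the sample.\<close>

lemma coupling_lipschitz:
  assumes T: "0 < T" and n: "0 < n" and x: "\<And>j. j < n \<Longrightarrow> x j \<in> space (path_space T)"
    and \<mu>: "prob_space \<mu>" and s: "sets \<mu> = sets (path_space T)"
    and \<pi>: "\<pi> \<in> couplings (empirical_measure T n x) \<mu>"
    and u: "u \<in> {0..T}" and L: "L-lipschitz_on UNIV \<phi>"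
    and int: "integrable \<mu> (\<lambda>y. \<phi> (y u))"
  shows "ennreal (((\<Sum>j<n. \<phi> (x j u)) / n - (\<integral>y. \<phi> (y u) \<partial>\<mu>))\<^sup>2)
     \<le> ennreal (L\<^sup>2) * (\<integral>\<^sup>+z. sup_sq T (\<lambda>u. fst z u - snd z u) \<partial>\<pi>)"
proof -
  let ?P = "path_space T" and ?e = "empirical_measure T n x"
  have sp: "sets \<pi> = sets (?P \<Otimes>\<^sub>M ?P)"
    using \<pi> sets_pair_measure_cong[OF sets_empirical_measure s] by (auto simp: couplings_def)
  have d1: "distr \<pi> ?e fst = ?e" and d2: "distr \<pi> \<mu> snd = \<mu>" using \<pi> by (auto simp: couplings_def)
  have m1: "fst \<in> \<pi> \<rightarrow>\<^sub>M ?e" and m2: "snd \<in> \<pi> \<rightarrow>\<^sub>M \<mu>"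
    by (simp_all add: measurable_cong_sets[OF sp sets_empirical_measure] measurable_cong_sets[OF sp s])
  interpret \<mu>: prob_space \<mu> by (rule \<mu>)
  interpret \<pi>: prob_space \<pi>
  proof
    have "emeasure \<mu> (space \<mu>) = emeasure (distr \<pi> \<mu> snd) (space \<mu>)" by (simp add: d2)
    also have "\<dots> = emeasure \<pi> (space \<pi>)"
      using m2 by (subst emeasure_distr) (auto intro!: arg_cong[where f="emeasure \<pi>"] dest: measurable_space)
    finally show "emeasure \<pi> (space \<pi>) = 1" by (simp add: \<mu>.emeasure_space_1)
  qed
  have \<phi>[measurable]: "\<phi> \<in> borel_measurable borel"
    by (intro borel_measurable_continuous_onI lipschitz_on_continuous_on[OF L])
  have e: "?e = distr (uniform_count_measure {..<n}) ?P x"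
    by (rule empirical_measure_eq_distr[OF n x])
  have xm: "x \<in> uniform_count_measure {..<n} \<rightarrow>\<^sub>M ?P"
    using x by (auto simp: space_uniform_count_measure measurable_def sets_uniform_count_measure)
  have \<phi>u: "(\<lambda>y. \<phi> (y u)) \<in> borel_measurable ?P"
    by (rule measurable_compose[OF measurable_eval[OF u] \<phi>])
  have fin: "finite_measure (uniform_count_measure {..<n})"
    using n by (intro prob_space.finite_measure prob_space_uniform_count_measure) auto
  have "integrable (uniform_count_measure {..<n}) (\<lambda>j. \<phi> (x j u))"
    unfolding uniform_count_measure_def by (rule integrable_point_measure_finite) auto
  then have i1: "integrable ?e (\<lambda>y. \<phi> (y u))"
    unfolding e by (subst integrable_distr_eq[OF xm \<phi>u])
  have "(\<integral>y. \<phi> (y u) \<partial>?e) = (\<integral>j. \<phi> (x j u) \<partial>uniform_count_measure {..<n})"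
    unfolding e by (rule integral_distr[OF xm \<phi>u])
  also have "\<dots> = (\<Sum>j<n. \<phi> (x j u)) / n"
    by (simp add: integral_uniform_count_measure)
  finally have e1: "(\<integral>y. \<phi> (y u) \<partial>?e) = (\<Sum>j<n. \<phi> (x j u)) / n" .
  have \<phi>e: "(\<lambda>y. \<phi> (y u)) \<in> borel_measurable ?e" and \<phi>\<mu>: "(\<lambda>y. \<phi> (y u)) \<in> borel_measurable \<mu>"
    using i1 int by auto
  have j1: "integrable \<pi> (\<lambda>z. \<phi> (fst z u))"
    using i1 by (subst (asm) d1[symmetric]) (simp add: integrable_distr_eq[OF m1 \<phi>e])
  have j2: "integrable \<pi> (\<lambda>z. \<phi> (snd z u))"
    using int by (subst (asm) d2[symmetric]) (simp add: integrable_distr_eq[OF m2 \<phi>\<mu>])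
  have k1: "(\<integral>y. \<phi> (y u) \<partial>?e) = (\<integral>z. \<phi> (fst z u) \<partial>\<pi>)"
    by (subst (1) d1[symmetric]) (simp add: integral_distr[OF m1 \<phi>e])
  have k2: "(\<integral>y. \<phi> (y u) \<partial>\<mu>) = (\<integral>z. \<phi> (snd z u) \<partial>\<pi>)"
    by (subst (1) d2[symmetric]) (simp add: integral_distr[OF m2 \<phi>\<mu>])
  have "(\<Sum>j<n. \<phi> (x j u)) / n - (\<integral>y. \<phi> (y u) \<partial>\<mu>) = (\<integral>z. \<phi> (fst z u) - \<phi> (snd z u) \<partial>\<pi>)"
    using e1 k1 k2 j1 j2 by simp
  then have "ennreal (((\<Sum>j<n. \<phi> (x j u)) / n - (\<integral>y. \<phi> (y u) \<partial>\<mu>))\<^sup>2)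
      \<le> (\<integral>\<^sup>+z. ennreal ((\<phi> (fst z u) - \<phi> (snd z u))\<^sup>2) \<partial>\<pi>)"
    using \<pi>.square_integral_le[of "\<lambda>z. \<phi> (fst z u) - \<phi> (snd z u)"] j1 j2 by simp
  also have "\<dots> \<le> (\<integral>\<^sup>+z. ennreal (L\<^sup>2) * sup_sq T (\<lambda>u. fst z u - snd z u) \<partial>\<pi>)"
  proof (rule nn_integral_mono)
    fix z :: "(real \<Rightarrow> real) \<times> (real \<Rightarrow> real)"
    have "\<bar>\<phi> (fst z u) - \<phi> (snd z u)\<bar> \<le> L * \<bar>fst z u - snd z u\<bar>"
      using lipschitz_onD[OF L, of "fst z u" "snd z u"] by (simp add: dist_real_def)
    then have "(\<phi> (fst z u) - \<phi> (snd z u))\<^sup>2 \<le> (L * \<bar>fst z u - snd z u\<bar>)\<^sup>2"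
      by (metis abs_ge_zero power2_abs power_mono)
    then have "ennreal ((\<phi> (fst z u) - \<phi> (snd z u))\<^sup>2) \<le> ennreal (L\<^sup>2) * ennreal ((fst z u - snd z u)\<^sup>2)"
      by (simp add: power_mult_distrib ennreal_mult[symmetric] ennreal_leI)
    also have "\<dots> \<le> ennreal (L\<^sup>2) * sup_sq T (\<lambda>u. fst z u - snd z u)"
      by (intro mult_left_mono SUP_upper u) auto
    finally show "ennreal ((\<phi> (fst z u) - \<phi> (snd z u))\<^sup>2) \<le> ennreal (L\<^sup>2) * sup_sq T (\<lambda>u. fst z u - snd z u)" .
  qed
  also have "\<dots> = ennreal (L\<^sup>2) * (\<integral>\<^sup>+z. sup_sq T (\<lambda>u. fst z u - snd z u) \<partial>\<pi>)"
    by (rule nn_integral_cmult) (use sup_sq_measurable_pair[OF T] in \<open>simp add: measurable_cong_sets[OF sp refl]\<close>)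
  finally show ?thesis .
qed

section \<open>Mean deviation of empirical frequencies\<close>

lemma (in prob_space) indep_vars_sum_square_le:
  fixes f :: "'i \<Rightarrow> 'a \<Rightarrow> real"
  assumes "finite I" "indep_vars (\<lambda>_. borel) f I"
    and "\<And>i \<omega>. i \<in> I \<Longrightarrow> \<bar>f i \<omega>\<bar> \<le> 1" and "\<And>i. i \<in> I \<Longrightarrow> expectation (f i) = 0"
  shows "expectation (\<lambda>\<omega>. (\<Sum>i\<in>I. f i \<omega>)\<^sup>2) \<le> card I"
  using assms
proof (induction I)
  case empty
  then show ?case by simp
next
  case (insert i I)
  have m: "f j \<in> borel_measurable M" if "j \<in> insert i I" for j
    using insert.prems(1) that by (auto simp: indep_vars_def)
  have ij: "indep_var borel (f i) borel (\<lambda>\<omega>. \<Sum>i\<in>I. f i \<omega>)"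
    by (rule indep_vars_sum) (use insert in auto)
  define S where "S \<omega> = (\<Sum>i\<in>I. f i \<omega>)" for \<omega>
  have mS: "S \<in> borel_measurable M"
    unfolding S_def by (intro borel_measurable_sum m) auto
  have bS: "\<bar>S \<omega>\<bar> \<le> card I" for \<omega>
  proof -
    have "\<bar>S \<omega>\<bar> \<le> (\<Sum>i\<in>I. 1)"
      unfolding S_def by (rule order_trans[OF sum_abs sum_mono]) (use insert.prems(2) in auto)
    then show ?thesis by simp
  qed
  have iS: "integrable M S" by (rule integrable_const_bound[of _ "card I"]) (use bS mS in auto)
  have iS2: "integrable M (\<lambda>\<omega>. (S \<omega>)\<^sup>2)"
    by (rule integrable_const_bound[of _ "(card I)\<^sup>2"])
      (use mS in \<open>auto simp: abs_le_square_iff[symmetric] bS\<close>)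
  have if1: "integrable M (f i)"
    by (rule integrable_const_bound[of _ 1]) (use insert.prems(2) m in auto)
  have fb: "(f i \<omega>)\<^sup>2 \<le> 1" for \<omega>
    using insert.prems(2)[of i \<omega>] by (simp add: abs_square_le_1)
  have if2: "integrable M (\<lambda>\<omega>. (f i \<omega>)\<^sup>2)"
    by (rule integrable_const_bound[of _ 1]) (use fb m in auto)
  \<comment> \<open>The cross term vanishes: the new summand is centred and independent of the
    partial sum.\<close>
  have ifS: "integrable M (\<lambda>\<omega>. f i \<omega> * S \<omega>)" and efS: "expectation (\<lambda>\<omega>. f i \<omega> * S \<omega>) = 0"
    using indep_var_integrable[OF ij[folded S_def] if1 iS]
      indep_var_lebesgue_integral[OF ij[folded S_def] if1 iS] insert.prems(3)[of i]
    by simp_all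
  have "expectation (\<lambda>\<omega>. (\<Sum>i\<in>insert i I. f i \<omega>)\<^sup>2)
      = expectation (\<lambda>\<omega>. (f i \<omega>)\<^sup>2 + 2 * (f i \<omega> * S \<omega>) + (S \<omega>)\<^sup>2)"
    using insert by (simp add: S_def power2_sum algebra_simps)
  also have "\<dots> = expectation (\<lambda>\<omega>. (f i \<omega>)\<^sup>2) + expectation (\<lambda>\<omega>. (S \<omega>)\<^sup>2)"
    using if2 ifS iS2 efS by simp
  also have "\<dots> \<le> 1 + real (card I)"
  proof (rule add_mono)
    have "expectation (\<lambda>\<omega>. (f i \<omega>)\<^sup>2) \<le> expectation (\<lambda>\<omega>. 1)"
      by (rule integral_mono[OF if2]) (use fb in auto)
    then show "expectation (\<lambda>\<omega>. (f i \<omega>)\<^sup>2) \<le> 1" by (simp add: prob_space)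
    show "expectation (\<lambda>\<omega>. (S \<omega>)\<^sup>2) \<le> card I"
      unfolding S_def using insert by (intro insert.IH indep_vars_subset[OF insert.prems(1)]) auto
  qed
  finally show ?case using insert by simp
qed

text \<open>A variance of at most \<open>1 / n\<close>, turned into a bound in L1 by Jensen's
  inequality. The first power is what the transport cost contains: the mass that has to leave or
  enter a cell is an absolute difference of two masses.\<close>

lemma (in prob_space) frequency_deviation_le:
  fixes n :: nat
  assumes n: "0 < n" and V: "indep_vars (\<lambda>_. N) V {..<n}" and A: "A \<in> sets N"
    and q: "\<And>j. j < n \<Longrightarrow> prob (V j -` A \<inter> space M) = q"
  shows "(\<integral>\<^sup>+\<omega>. ennreal \<bar>(\<Sum>j<n. indicator A (V j \<omega>)) / n - q\<bar> \<partial>M) \<le> ennreal (1 / sqrt n)"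
proof -
  define f where "f j \<omega> = (indicator A (V j \<omega>) - q :: real)" for j \<omega>
  have q01: "0 \<le> q" "q \<le> 1" using q[OF n] prob_le_1 measure_nonneg by metis+
  have Vm: "V j \<in> M \<rightarrow>\<^sub>M N" if "j < n" for j using V that by (auto simp: indep_vars_def)
  have fm: "f j \<in> borel_measurable M" if "j < n" for j
    unfolding f_def[abs_def] using Vm[OF that] A by measurable
  have fi: "indep_vars (\<lambda>_. borel) f {..<n}"
    unfolding f_def[abs_def]
    by (rule indep_vars_compose2[OF V, where Y="\<lambda>j y. indicator A y - q"]) (use A in measurable)
  have fb: "\<bar>f j \<omega>\<bar> \<le> 1" for j \<omega>
    using q01 by (auto simp: f_def split: split_indicator)
  have f0: "expectation (f j) = 0" if "j < n" for j
  proof -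
    have s: "V j -` A \<inter> space M \<in> events" using Vm[OF that] A by (rule measurable_sets)
    have "expectation (f j) = expectation (\<lambda>\<omega>. indicator (V j -` A \<inter> space M) \<omega> - q)"
      by (rule Bochner_Integration.integral_cong) (auto simp: f_def split: split_indicator)
    also have "\<dots> = prob (V j -` A \<inter> space M) - q"
      using s by (subst Bochner_Integration.integral_diff)
        (auto simp: prob_space emeasure_eq_measure intro!: integrable_real_indicator)
    finally show ?thesis using q[OF that] by simp
  qed
  define S where "S \<omega> = (\<Sum>j<n. f j \<omega>) / n" for \<omega>
  have mS: "S \<in> borel_measurable M" unfolding S_def[abs_def] using fm by auto
  have S_eq: "(\<Sum>j<n. indicator A (V j \<omega>)) / n - q = S \<omega>" for \<omega>
    using n by (simp add: S_def f_def sum_subtractf field_simps)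
  have Sb: "\<bar>S \<omega>\<bar> \<le> 1" for \<omega>
  proof -
    have "\<bar>\<Sum>j<n. f j \<omega>\<bar> \<le> (\<Sum>j<n. 1)"
      by (rule order_trans[OF sum_abs sum_mono]) (use fb in auto)
    then show ?thesis using n by (simp add: S_def)
  qed
  have iS: "integrable M (\<lambda>\<omega>. \<bar>S \<omega>\<bar>)"
    by (rule integrable_const_bound[of _ 1]) (use Sb mS in auto)
  have iS2: "integrable M (\<lambda>\<omega>. (S \<omega>)\<^sup>2)"
    by (rule integrable_const_bound[of _ 1]) (use Sb mS in \<open>auto simp: abs_square_le_1\<close>)
  have "expectation (\<lambda>\<omega>. (S \<omega>)\<^sup>2) = expectation (\<lambda>\<omega>. (\<Sum>j<n. f j \<omega>)\<^sup>2) / n\<^sup>2"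
    by (simp add: S_def power_divide)
  also have "\<dots> \<le> real n / n\<^sup>2"
    using indep_vars_sum_square_le[OF _ fi fb f0] by (intro divide_right_mono) auto
  also have "\<dots> = 1 / n" using n by (simp add: power2_eq_square)
  finally have ES2: "expectation (\<lambda>\<omega>. (S \<omega>)\<^sup>2) \<le> 1 / n" .
  have "(expectation (\<lambda>\<omega>. \<bar>S \<omega>\<bar>))\<^sup>2 \<le> expectation (\<lambda>\<omega>. \<bar>S \<omega>\<bar>\<^sup>2)"
    using variance_positive[of "\<lambda>\<omega>. \<bar>S \<omega>\<bar>"] variance_eq[OF iS] iS2 by simp
  also have "\<dots> \<le> 1 / n" using ES2 by simp
  finally have "expectation (\<lambda>\<omega>. \<bar>S \<omega>\<bar>) \<le> sqrt (1 / n)"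
    by (rule real_le_rsqrt)
  then have "expectation (\<lambda>\<omega>. \<bar>S \<omega>\<bar>) \<le> 1 / sqrt n" by (simp add: real_sqrt_divide)
  moreover have "(\<integral>\<^sup>+\<omega>. ennreal \<bar>S \<omega>\<bar> \<partial>M) = ennreal (expectation (\<lambda>\<omega>. \<bar>S \<omega>\<bar>))"
    by (rule nn_integral_eq_integral[OF iS]) auto
  ultimately show ?thesis unfolding S_eq by (simp add: ennreal_leI)
qed

section \<open>Couplings along a finite partition\<close>

lemma sup_sq_diff_le: "sup_sq T (\<lambda>u. x u - y u) \<le> 2 * sup_sq T x + 2 * sup_sq T y"
proof (rule SUP_least)
  fix u assume u: "u \<in> {0..T}"
  have "0 \<le> (x u + y u)\<^sup>2" by simp
  then have "(x u - y u)\<^sup>2 \<le> 2 * (x u)\<^sup>2 + 2 * (y u)\<^sup>2"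
    by (simp add: power2_sum power2_diff)
  then have "ennreal ((x u - y u)\<^sup>2) \<le> 2 * ennreal ((x u)\<^sup>2) + 2 * ennreal ((y u)\<^sup>2)"
    by (simp add: ennreal_leI ennreal_plus[symmetric] ennreal_mult[symmetric] ennreal_numeral[symmetric]
        del: ennreal_numeral ennreal_plus)
  also have "\<dots> \<le> 2 * sup_sq T x + 2 * sup_sq T y"
    by (intro add_mono mult_left_mono SUP_upper u) auto
  finally show "ennreal ((x u - y u)\<^sup>2) \<le> 2 * sup_sq T x + 2 * sup_sq T y" .
qed

lemma nn_integral_finite_range:
  fixes m :: nat
  assumes \<kappa>: "\<kappa> \<in> \<mu> \<rightarrow>\<^sub>M count_space UNIV" and r: "\<And>y. y \<in> space \<mu> \<Longrightarrow> \<kappa> y \<le> m"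
  shows "(\<integral>\<^sup>+y. F (\<kappa> y) \<partial>\<mu>) = (\<Sum>l\<le>m. F l * emeasure \<mu> {y\<in>space \<mu>. \<kappa> y = l})"
proof -
  have [measurable]: "{y\<in>space \<mu>. \<kappa> y = l} \<in> sets \<mu>" for l using \<kappa> by measurable
  have "(\<integral>\<^sup>+y. F (\<kappa> y) \<partial>\<mu>) = (\<integral>\<^sup>+y. (\<Sum>l\<le>m. F l * indicator {y\<in>space \<mu>. \<kappa> y = l} y) \<partial>\<mu>)"
  proof (rule nn_integral_cong)
    fix y assume y: "y \<in> space \<mu>"
    have "(\<Sum>l\<le>m. F l * indicator {y\<in>space \<mu>. \<kappa> y = l} y) = (\<Sum>l\<le>m. if l = \<kappa> y then F l else 0)"
      by (rule sum.cong) (use y in \<open>auto split: split_indicator\<close>)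
    also have "\<dots> = F (\<kappa> y)"
      using r[OF y] by (subst sum.delta) auto
    finally show "F (\<kappa> y) = (\<Sum>l\<le>m. F l * indicator {y\<in>space \<mu>. \<kappa> y = l} y)" ..
  qed
  also have "\<dots> = (\<Sum>l\<le>m. F l * emeasure \<mu> {y\<in>space \<mu>. \<kappa> y = l})"
    by (subst nn_integral_sum) (auto simp: nn_integral_cmult_indicator)
  finally show ?thesis .
qed

text \<open>The mass \<open>t k\<close> shared by two distributions \<open>\<alpha>\<close>, \<open>q\<close> on \<open>{..m}\<close> stays in its cell, the rest is
  matched independently. Where \<open>\<alpha> k = 0\<close> or \<open>q k = 0\<close>, also \<open>t k = 0\<close>, and the junk value \<open>0 / 0 = 0\<close>
  is the right one; the same holds for \<open>shared_defect = 0\<close>.\<close>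

definition shared_defect :: "nat \<Rightarrow> (nat \<Rightarrow> real) \<Rightarrow> real" where
  "shared_defect m t = 1 - (\<Sum>k\<le>m. t k)"

definition cell_weight ::
    "nat \<Rightarrow> (nat \<Rightarrow> real) \<Rightarrow> (nat \<Rightarrow> real) \<Rightarrow> (nat \<Rightarrow> real) \<Rightarrow> nat \<Rightarrow> nat \<Rightarrow> real" where
  "cell_weight m \<alpha> q t k l =
     (if k = l then t k / (\<alpha> k * q k) else 0) + (1 - t k / \<alpha> k) * (1 - t l / q l) / shared_defect m t"

context
  fixes m :: nat and \<alpha> q t :: "nat \<Rightarrow> real"
  assumes t0: "\<And>k. k \<le> m \<Longrightarrow> 0 \<le> t k" and t\<alpha>: "\<And>k. k \<le> m \<Longrightarrow> t k \<le> \<alpha> k" and tq: "\<And>k. k \<le> m \<Longrightarrow> t k \<le> q k"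
    and \<alpha>1: "(\<Sum>k\<le>m. \<alpha> k) = 1" and q1: "(\<Sum>k\<le>m. q k) = 1"
begin

lemma shared_defect_nonneg: "0 \<le> shared_defect m t"
  using sum_mono[of "{..m}" t \<alpha>] t\<alpha> \<alpha>1 by (simp add: shared_defect_def)

lemma rest_nonneg:
  assumes "k \<le> m" shows "0 \<le> 1 - t k / \<alpha> k" "0 \<le> 1 - t k / q k" "1 - t k / \<alpha> k \<le> 1" "1 - t k / q k \<le> 1"
  using t0[OF assms] t\<alpha>[OF assms] tq[OF assms] by (auto simp: divide_le_eq_1)

lemma rest_mult:
  assumes "k \<le> m" shows "(1 - t k / \<alpha> k) * \<alpha> k = \<alpha> k - t k" "(1 - t k / q k) * q k = q k - t k"
  using t0[OF assms] t\<alpha>[OF assms] tq[OF assms] by (auto simp: left_diff_distrib)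

lemma sum_rest:
  "(\<Sum>k\<le>m. (1 - t k / \<alpha> k) * \<alpha> k) = shared_defect m t" "(\<Sum>k\<le>m. (1 - t k / q k) * q k) = shared_defect m t"
  using \<alpha>1 q1 by (simp_all add: rest_mult sum_subtractf shared_defect_def)

lemma shared_defect_0:
  assumes "shared_defect m t = 0" "k \<le> m" shows "t k = \<alpha> k" "t k = q k"
proof -
  have "(\<Sum>k\<le>m. \<alpha> k - t k) = 0" "(\<Sum>k\<le>m. q k - t k) = 0"
    using assms \<alpha>1 q1 by (simp_all add: sum_subtractf shared_defect_def)
  moreover have "(\<Sum>k\<le>m. \<alpha> k - t k) = 0 \<longleftrightarrow> (\<forall>k\<in>{..m}. \<alpha> k - t k = 0)"
    "(\<Sum>k\<le>m. q k - t k) = 0 \<longleftrightarrow> (\<forall>k\<in>{..m}. q k - t k = 0)"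
    by (intro sum_nonneg_eq_0_iff; use t\<alpha> tq in simp)+
  ultimately have "\<alpha> k - t k = 0" "q k - t k = 0"
    using assms(2) by simp_all
  then show "t k = \<alpha> k" "t k = q k" by simp_all
qed

lemma cell_weight_nonneg: "k \<le> m \<Longrightarrow> l \<le> m \<Longrightarrow> 0 \<le> cell_weight m \<alpha> q t k l"
  unfolding cell_weight_def using order_trans[OF t0 t\<alpha>, of k] order_trans[OF t0 tq, of k] t0[of k]
  by (auto intro!: add_nonneg_nonneg mult_nonneg_nonneg divide_nonneg_nonneg shared_defect_nonneg rest_nonneg)

lemma sum_cell_weight_right:
  assumes k: "k \<le> m" and "0 < \<alpha> k"
  shows "(\<Sum>l\<le>m. cell_weight m \<alpha> q t k l * q l) = 1"
proof -
  have "(\<Sum>l\<le>m. cell_weight m \<alpha> q t k l * q l)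
      = (\<Sum>l\<le>m. (if k = l then t k / (\<alpha> k * q k) * q k else 0)
        + (1 - t k / \<alpha> k) / shared_defect m t * ((1 - t l / q l) * q l))"
    by (rule sum.cong) (auto simp: cell_weight_def distrib_right)
  also have "\<dots> = (\<Sum>l\<le>m. if k = l then t k / (\<alpha> k * q k) * q k else 0)
        + (1 - t k / \<alpha> k) / shared_defect m t * (\<Sum>l\<le>m. (1 - t l / q l) * q l)"
    unfolding sum.distrib sum_distrib_left ..
  also have "\<dots> = t k / (\<alpha> k * q k) * q k + (1 - t k / \<alpha> k) * (shared_defect m t / shared_defect m t)"
    using k by (simp add: sum_rest)
  also have "t k / (\<alpha> k * q k) * q k = t k / \<alpha> k"
    using t0[OF k] tq[OF k] by (cases "q k = 0") auto
  \<comment> \<open>If the defect is 0, the quotient \<open>0 / 0\<close> deletes the second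
    summand; but then all mass is shared, \<open>t k = \<alpha> k\<close>, and the first summand
    alone is 1.\<close>
  also have "t k / \<alpha> k + (1 - t k / \<alpha> k) * (shared_defect m t / shared_defect m t) = 1"
    using shared_defect_0[OF _ k] assms by (cases "shared_defect m t = 0") auto
  finally show ?thesis .
qed

lemma sum_cell_weight_left:
  assumes l: "l \<le> m" and "0 < q l"
  shows "(\<Sum>k\<le>m. cell_weight m \<alpha> q t k l * \<alpha> k) = 1"
proof -
  have "(\<Sum>k\<le>m. cell_weight m \<alpha> q t k l * \<alpha> k)
      = (\<Sum>k\<le>m. (if k = l then t l / (\<alpha> l * q l) * \<alpha> l else 0)
        + (1 - t l / q l) / shared_defect m t * ((1 - t k / \<alpha> k) * \<alpha> k))"
    by (rule sum.cong) (auto simp: cell_weight_def distrib_right)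
  also have "\<dots> = (\<Sum>k\<le>m. if k = l then t l / (\<alpha> l * q l) * \<alpha> l else 0)
        + (1 - t l / q l) / shared_defect m t * (\<Sum>k\<le>m. (1 - t k / \<alpha> k) * \<alpha> k)"
    unfolding sum.distrib sum_distrib_left ..
  also have "\<dots> = t l / (\<alpha> l * q l) * \<alpha> l + (1 - t l / q l) * (shared_defect m t / shared_defect m t)"
    using l by (simp add: sum_rest)
  also have "t l / (\<alpha> l * q l) * \<alpha> l = t l / q l"
    using t0[OF l] t\<alpha>[OF l] by (cases "\<alpha> l = 0") auto
  also have "t l / q l + (1 - t l / q l) * (shared_defect m t / shared_defect m t) = 1"
    using shared_defect_0[OF _ l] assms by (cases "shared_defect m t = 0") auto
  finally show ?thesis .
qed

end

text \<open>The conditions of \<open>coupling_of_weights\<close> as a property of the weights alone,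
  free of the atoms, so that one family of weights can be combined with two different
  samples.\<close>

definition coupling_weights :: "nat \<Rightarrow> 'b measure \<Rightarrow> (nat \<Rightarrow> 'b \<Rightarrow> real) \<Rightarrow> bool" where
  "coupling_weights n \<mu> g \<longleftrightarrow>
     (\<forall>j<n. g j \<in> borel_measurable \<mu> \<and> (\<integral>\<^sup>+y. ennreal (g j y) \<partial>\<mu>) = 1) \<and>
     (AE y in \<mu>. (\<Sum>j<n. ennreal (g j y)) = of_nat n)"

text \<open>A statement about one fixed sample \<open>x\<close>. Shared mass moves inside a cell and
  costs at most \<open>\<epsilon>\<close>. The rest is matched independently, at a cost of at most
  twice the squared norms of both ends. In a cell below \<open>m\<close> these are bounded by
  \<open>H\<close>, and the unshared masses of the two sides add up to the absolute difference
  there. The catch-all cell \<open>m\<close> has no such bound; its full second moments appear on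
  the right.\<close>

lemma cell_coupling:
  fixes m n :: nat and x :: "nat \<Rightarrow> real \<Rightarrow> real"
  assumes T: "0 < T" and n: "0 < n" and x: "\<And>j. j < n \<Longrightarrow> x j \<in> space (path_space T)"
    and \<mu>: "prob_space \<mu>" and s[measurable_cong]: "sets \<mu> = sets (path_space T)"
    and \<kappa>[measurable]: "\<kappa> \<in> path_space T \<rightarrow>\<^sub>M count_space UNIV"
    and r: "\<And>y. y \<in> space (path_space T) \<Longrightarrow> \<kappa> y \<le> m"
    and diam: "\<And>y z. y \<in> space (path_space T) \<Longrightarrow> z \<in> space (path_space T) \<Longrightarrow> \<kappa> y = \<kappa> z \<Longrightarrow> \<kappa> y < m
      \<Longrightarrow> sup_sq T (\<lambda>u. y u - z u) \<le> ennreal \<epsilon>"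
    and bnd: "\<And>y. y \<in> space (path_space T) \<Longrightarrow> \<kappa> y < m \<Longrightarrow> sup_sq T y \<le> ennreal H"
  obtains g where "coupling_weights n \<mu> g"
    and "(\<Sum>j<n. \<integral>\<^sup>+y. ennreal (g j y) * sup_sq T (\<lambda>u. x j u - y u) \<partial>\<mu>) * ennreal (1 / n)
      \<le> ennreal \<epsilon> + 2 * ((\<Sum>j<n. if \<kappa> (x j) = m then sup_sq T (x j) else 0) * ennreal (1 / n)
        + (\<integral>\<^sup>+y. (if \<kappa> y = m then sup_sq T y else 0) \<partial>\<mu>)
        + ennreal H * (\<Sum>k<m. ennreal \<bar>(\<Sum>j<n. indicator {y\<in>space (path_space T). \<kappa> y = k} (x j)) / n
            - measure \<mu> {y\<in>space (path_space T). \<kappa> y = k}\<bar>))"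
proof -
  interpret \<mu>: prob_space \<mu> by (rule \<mu>)
  let ?P = "path_space T"
  have sp: "space \<mu> = space ?P" by (rule sets_eq_imp_space_eq[OF s])
  define A where "A k = {y\<in>space ?P. \<kappa> y = k}" for k
  have A[measurable]: "A k \<in> sets ?P" for k unfolding A_def by measurable
  define \<alpha> where "\<alpha> k = (\<Sum>j<n. indicator (A k) (x j)) / real n" for k
  define q where "q k = measure \<mu> (A k)" for k
  \<comment> \<open>No mass is kept in the cell \<open>m\<close>, because that cell has no bound on
    its diameter.\<close>
  define t where "t k = (if k < m then min (\<alpha> k) (q k) else 0)" for k
  have \<alpha>0: "0 \<le> \<alpha> k" for k by (auto simp: \<alpha>_def intro!: divide_nonneg_nonneg sum_nonneg)
  have q0: "0 \<le> q k" for k by (simp add: q_def)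
  have AF: "(\<Sum>j<n. F (\<kappa> (x j))) / n = (\<Sum>k\<le>m. F k * \<alpha> k)" for F :: "nat \<Rightarrow> real"
  proof -
    have "F (\<kappa> (x j)) = (\<Sum>k\<le>m. F k * indicator (A k) (x j))" if j: "j < n" for j
    proof -
      have "(\<Sum>k\<le>m. F k * indicator (A k) (x j)) = (\<Sum>k\<le>m. if k = \<kappa> (x j) then F k else 0)"
        by (rule sum.cong) (use x[OF j] in \<open>auto simp: A_def split: split_indicator\<close>)
      then show ?thesis using r[OF x[OF j]] by simp
    qed
    then have "(\<Sum>j<n. F (\<kappa> (x j))) = (\<Sum>j<n. \<Sum>k\<le>m. F k * indicator (A k) (x j))" by simp
    also have "\<dots> = (\<Sum>k\<le>m. F k * (\<Sum>j<n. indicator (A k) (x j)))"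
      by (subst sum.swap) (simp add: sum_distrib_left)
    finally show ?thesis
      by (simp only: \<alpha>_def times_divide_eq_right sum_divide_distrib[symmetric])
  qed
  have \<kappa>\<mu>: "\<kappa> \<in> \<mu> \<rightarrow>\<^sub>M count_space UNIV" by measurable
  have QF: "(\<integral>\<^sup>+y. ennreal (F (\<kappa> y)) \<partial>\<mu>) = ennreal (\<Sum>l\<le>m. F l * q l)" if "\<And>l. l \<le> m \<Longrightarrow> 0 \<le> F l" for F
  proof -
    have "(\<integral>\<^sup>+y. ennreal (F (\<kappa> y)) \<partial>\<mu>) = (\<Sum>l\<le>m. ennreal (F l) * emeasure \<mu> {y\<in>space \<mu>. \<kappa> y = l})"
      by (rule nn_integral_finite_range[OF \<kappa>\<mu>]) (simp add: sp r)
    also have "\<dots> = (\<Sum>l\<le>m. ennreal (F l * q l))"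
      using that q0 by (intro sum.cong) (simp_all add: q_def A_def sp \<mu>.emeasure_eq_measure ennreal_mult)
    also have "\<dots> = ennreal (\<Sum>l\<le>m. F l * q l)"
      using that q0 by (intro sum_ennreal) auto
    finally show ?thesis .
  qed
  have \<alpha>1: "(\<Sum>k\<le>m. \<alpha> k) = 1" using AF[of "\<lambda>_. 1"] n by simp
  have q1: "(\<Sum>k\<le>m. q k) = 1"
  proof -
    have "ennreal (\<Sum>k\<le>m. q k) = ennreal 1" using QF[of "\<lambda>_. 1"] by (simp add: \<mu>.emeasure_space_1)
    then show ?thesis using q0 by (subst (asm) ennreal_inj) (auto intro: sum_nonneg)
  qed
  have t0: "0 \<le> t k" and t\<alpha>: "t k \<le> \<alpha> k" and tq: "t k \<le> q k" if "k \<le> m" for k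
    using \<alpha>0[of k] q0[of k] by (auto simp: t_def)
  note w = t0 t\<alpha> tq \<alpha>1 q1
  define D where "D = shared_defect m t"
  define \<rho> where "\<rho> k = 1 - t k / \<alpha> k" for k
  define \<sigma> where "\<sigma> k = 1 - t k / q k" for k
  have D0: "0 \<le> D" unfolding D_def by (rule shared_defect_nonneg[OF w])
  have \<rho>0: "0 \<le> \<rho> k" and \<sigma>0: "0 \<le> \<sigma> k" and \<rho>1: "\<rho> k \<le> 1" and \<sigma>1: "\<sigma> k \<le> 1" if "k \<le> m" for k
    unfolding \<rho>_def \<sigma>_def using rest_nonneg[OF w that] by auto
  have \<rho>\<alpha>: "\<rho> k * \<alpha> k = \<alpha> k - t k" and \<sigma>q: "\<sigma> k * q k = q k - t k" if "k \<le> m" for k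
    unfolding \<rho>_def \<sigma>_def using rest_mult[OF w that] by auto
  have \<rho>s: "(\<Sum>k\<le>m. \<rho> k * \<alpha> k) = D" and \<sigma>s: "(\<Sum>k\<le>m. \<sigma> k * q k) = D"
    unfolding \<rho>_def \<sigma>_def D_def using sum_rest[OF w] by auto
  define W where "W = cell_weight m \<alpha> q t"
  have W0: "0 \<le> W k l" if "k \<le> m" "l \<le> m" for k l
    unfolding W_def by (rule cell_weight_nonneg[OF w that])
  define g where "g j y = W (\<kappa> (x j)) (\<kappa> y)" for j y
  have kx: "\<kappa> (x j) \<le> m" if "j < n" for j using r[OF x[OF that]] .
  have \<alpha>x: "0 < \<alpha> (\<kappa> (x j))" if "j < n" for j
  proof -
    have "0 < (\<Sum>i<n. indicator (A (\<kappa> (x j))) (x i) :: real)"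
      by (rule sum_pos2[of _ j]) (use that x in \<open>auto simp: A_def\<close>)
    then show ?thesis using n by (simp add: \<alpha>_def)
  qed
  have gm: "g j \<in> borel_measurable \<mu>" for j
    unfolding g_def[abs_def] by (rule measurable_compose[OF \<kappa>\<mu>]) simp
  have g1: "(\<integral>\<^sup>+y. ennreal (g j y) \<partial>\<mu>) = 1" if j: "j < n" for j
    unfolding g_def using sum_cell_weight_right[OF w kx[OF j] \<alpha>x[OF j]] W0[OF kx[OF j]]
    by (subst QF) (auto simp: W_def)
  \<comment> \<open>The weights over \<open>y\<close> add up to \<open>n\<close> only if the cell of
    \<open>y\<close> has positive mass. The finitely many other cells are null sets.\<close>
  have "AE y in \<mu>. \<forall>l\<in>{..m}. q l = 0 \<longrightarrow> \<kappa> y \<noteq> l"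
  proof (rule AE_finite_allI)
    fix l
    show "AE y in \<mu>. q l = 0 \<longrightarrow> \<kappa> y \<noteq> l"
    proof (cases "q l = 0")
      case True
      then have "A l \<in> null_sets \<mu>"
        using A[of l] s by (auto simp: null_sets_def q_def \<mu>.emeasure_eq_measure)
      then show ?thesis by (rule AE_I') (auto simp: A_def sp)
    qed simp
  qed simp
  then have g2: "AE y in \<mu>. (\<Sum>j<n. ennreal (g j y)) = of_nat n"
    using AE_space[of \<mu>]
  proof eventually_elim
    case (elim y)
    then have ky: "\<kappa> y \<le> m" using r sp by auto
    then have "0 < q (\<kappa> y)" using elim q0[of "\<kappa> y"] by (auto simp: less_le)
    have "(\<Sum>j<n. g j y) = n * ((\<Sum>j<n. W (\<kappa> (x j)) (\<kappa> y)) / n)" using n by (simp add: g_def)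
    also have "\<dots> = n"
      unfolding AF[of "\<lambda>k. W k (\<kappa> y)"]
      unfolding W_def by (subst sum_cell_weight_left[OF w ky \<open>0 < q (\<kappa> y)\<close>]) simp_all
    finally show ?case
      using W0 kx ky by (subst sum_ennreal) (auto simp: g_def ennreal_of_nat_eq_real_of_nat)
  qed
  define h where "h = (\<lambda>y. sup_sq T y)"
  have hm: "h \<in> borel_measurable \<mu>"
    unfolding h_def using borel_measurable_sup_sq_path1[OF T measurable_ident_sets[OF s]] by simp
  define B where "B = (\<integral>\<^sup>+y. ennreal (\<sigma> (\<kappa> y)) * h y \<partial>\<mu>)"
  define bad where "bad = (\<integral>\<^sup>+y. (if \<kappa> y = m then h y else 0) \<partial>\<mu>)"
  \<comment> \<open>The weight is
    \<open>d (\<kappa> y) + \<rho> k * \<sigma> (\<kappa> y) / D\<close>. The first part lives in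
    the cell of \<open>x j\<close>, where the distance is small; the second has product form, so
    after \<open>sup_sq_diff_le\<close> the integral over \<open>y\<close> either has total mass at
    most \<open>\<rho> k\<close> or yields the constant \<open>B\<close>, which does not depend on
    \<open>j\<close>.\<close>
  have cost: "(\<integral>\<^sup>+y. ennreal (g j y) * sup_sq T (\<lambda>u. x j u - y u) \<partial>\<mu>)
      \<le> ennreal \<epsilon> + 2 * h (x j) * ennreal (\<rho> (\<kappa> (x j))) + ennreal (\<rho> (\<kappa> (x j)) / D) * (2 * B)"
    if j: "j < n" for j
  proof -
    define k where "k = \<kappa> (x j)"
    have k: "k \<le> m" using kx[OF j] by (simp add: k_def)
    define d where "d l = (if k = l then t k / (\<alpha> k * q k) else 0)" for l
    have d0: "0 \<le> d l" if "l \<le> m" for l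
      using t0[OF k] \<alpha>0 q0 by (auto simp: d_def)
    have o0: "0 \<le> \<rho> k * \<sigma> l / D" if "l \<le> m" for l
      using \<rho>0[OF k] \<sigma>0[OF that] D0 by simp
    have "(\<integral>\<^sup>+y. ennreal (g j y) * sup_sq T (\<lambda>u. x j u - y u) \<partial>\<mu>)
      \<le> (\<integral>\<^sup>+y. ennreal \<epsilon> * ennreal (d (\<kappa> y)) + (2 * h (x j)) * ennreal (\<rho> k * \<sigma> (\<kappa> y) / D)
          + ennreal (\<rho> k / D) * (2 * (ennreal (\<sigma> (\<kappa> y)) * h y)) \<partial>\<mu>)"
    proof (rule nn_integral_mono)
      fix y assume "y \<in> space \<mu>"
      then have y: "y \<in> space ?P" by (simp add: sp)
      have ky: "\<kappa> y \<le> m" by (rule r[OF y])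
      have "g j y = d (\<kappa> y) + \<rho> k * \<sigma> (\<kappa> y) / D"
        by (simp add: g_def W_def cell_weight_def d_def \<rho>_def \<sigma>_def D_def k_def)
      then have "ennreal (g j y) = ennreal (d (\<kappa> y)) + ennreal (\<rho> k * \<sigma> (\<kappa> y) / D)"
        using d0[OF ky] o0[OF ky] by simp
      then have "ennreal (g j y) * sup_sq T (\<lambda>u. x j u - y u)
        = ennreal (d (\<kappa> y)) * sup_sq T (\<lambda>u. x j u - y u)
          + ennreal (\<rho> k * \<sigma> (\<kappa> y) / D) * sup_sq T (\<lambda>u. x j u - y u)"
        by (simp add: distrib_right)
      also have "ennreal (d (\<kappa> y)) * sup_sq T (\<lambda>u. x j u - y u) \<le> ennreal \<epsilon> * ennreal (d (\<kappa> y))"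
      proof (cases "k = \<kappa> y \<and> k < m")
        case True
        then show ?thesis using diam[OF x[OF j] y] by (subst mult.commute) (auto simp: k_def intro: mult_left_mono)
      next
        case False
        then have "d (\<kappa> y) = 0" using ky by (auto simp: d_def t_def)
        then show ?thesis by simp
      qed
      also have "ennreal (\<rho> k * \<sigma> (\<kappa> y) / D) * sup_sq T (\<lambda>u. x j u - y u)
          \<le> ennreal (\<rho> k * \<sigma> (\<kappa> y) / D) * (2 * h (x j) + 2 * h y)"
        unfolding h_def by (intro mult_left_mono sup_sq_diff_le) simp
      also have "\<dots> = (2 * h (x j)) * ennreal (\<rho> k * \<sigma> (\<kappa> y) / D)
          + ennreal (\<rho> k / D) * (2 * (ennreal (\<sigma> (\<kappa> y)) * h y))"
      proof -
        have "ennreal (\<rho> k * \<sigma> (\<kappa> y) / D) = ennreal (\<rho> k / D) * ennreal (\<sigma> (\<kappa> y))"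
          using \<rho>0[OF k] \<sigma>0[OF ky] D0 by (simp add: ennreal_mult[symmetric])
        then show ?thesis by (simp add: distrib_left mult_ac)
      qed
      finally show "ennreal (g j y) * sup_sq T (\<lambda>u. x j u - y u)
          \<le> ennreal \<epsilon> * ennreal (d (\<kappa> y)) + (2 * h (x j)) * ennreal (\<rho> k * \<sigma> (\<kappa> y) / D)
          + ennreal (\<rho> k / D) * (2 * (ennreal (\<sigma> (\<kappa> y)) * h y))"
        by (simp add: add.assoc)
    qed
    also have "\<dots> = ennreal \<epsilon> * (\<integral>\<^sup>+y. ennreal (d (\<kappa> y)) \<partial>\<mu>)
        + (2 * h (x j)) * (\<integral>\<^sup>+y. ennreal (\<rho> k * \<sigma> (\<kappa> y) / D) \<partial>\<mu>) + ennreal (\<rho> k / D) * (2 * B)"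
    proof -
      have [measurable]: "(\<lambda>y. F (\<kappa> y)) \<in> borel_measurable \<mu>" for F :: "nat \<Rightarrow> ennreal"
        by (rule measurable_compose[OF \<kappa>\<mu>]) simp
      have [measurable]: "h \<in> borel_measurable \<mu>" by (rule hm)
      show ?thesis unfolding B_def
        by (simp add: nn_integral_add nn_integral_cmult)
    qed
    also have "\<dots> \<le> ennreal \<epsilon> * 1 + (2 * h (x j)) * ennreal (\<rho> k) + ennreal (\<rho> k / D) * (2 * B)"
    proof (intro add_mono mult_left_mono order_refl)
      have "(\<integral>\<^sup>+y. ennreal (d (\<kappa> y)) \<partial>\<mu>) = ennreal (\<Sum>l\<le>m. d l * q l)"
        by (rule QF) (rule d0)
      also have "(\<Sum>l\<le>m. d l * q l) = (\<Sum>l\<le>m. if k = l then t k / (\<alpha> k * q k) * q k else 0)"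
        by (rule sum.cong) (auto simp: d_def)
      also have "\<dots> = t k / (\<alpha> k * q k) * q k" using k by simp
      also have "\<dots> \<le> 1"
        using t\<alpha>[OF k] \<alpha>0[of k] by (auto simp: divide_le_eq_1)
      finally show "(\<integral>\<^sup>+y. ennreal (d (\<kappa> y)) \<partial>\<mu>) \<le> 1" by (simp add: ennreal_leI)
      have "(\<integral>\<^sup>+y. ennreal (\<rho> k * \<sigma> (\<kappa> y) / D) \<partial>\<mu>) = ennreal (\<Sum>l\<le>m. \<rho> k * \<sigma> l / D * q l)"
        by (rule QF) (rule o0)
      also have "(\<Sum>l\<le>m. \<rho> k * \<sigma> l / D * q l) = \<rho> k / D * (\<Sum>l\<le>m. \<sigma> l * q l)"
        unfolding sum_distrib_left by (rule sum.cong) auto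
      also have "\<dots> \<le> \<rho> k" unfolding \<sigma>s using \<rho>0[OF k] by (cases "D = 0") auto
      finally show "(\<integral>\<^sup>+y. ennreal (\<rho> k * \<sigma> (\<kappa> y) / D) \<partial>\<mu>) \<le> ennreal (\<rho> k)" by (simp add: ennreal_leI)
    qed auto
    finally show ?thesis by (simp add: k_def)
  qed
  let ?a = "ennreal (1 / n)"
  have an: "of_nat n * ?a = 1"
    using n by (simp add: ennreal_of_nat_eq_real_of_nat ennreal_mult[symmetric])
  have AFe: "(\<Sum>j<n. ennreal (F (\<kappa> (x j)))) * ?a = ennreal (\<Sum>k\<le>m. F k * \<alpha> k)"
    if "\<And>k. k \<le> m \<Longrightarrow> 0 \<le> F k" for F
  proof -
    have F0: "0 \<le> F (\<kappa> (x j))" if "j < n" for j using \<open>\<And>k. k \<le> m \<Longrightarrow> 0 \<le> F k\<close> kx[OF that] .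
    then have "0 \<le> (\<Sum>j<n. F (\<kappa> (x j)))" by (intro sum_nonneg) simp
    moreover have "(\<Sum>j<n. ennreal (F (\<kappa> (x j)))) = ennreal (\<Sum>j<n. F (\<kappa> (x j)))"
      by (rule sum_ennreal) (use F0 in simp)
    ultimately show ?thesis by (simp add: AF[symmetric] ennreal_mult[symmetric])
  qed
  let ?bx = "(\<Sum>j<n. if \<kappa> (x j) = m then h (x j) else 0) * ?a"
  have good_sum: "(\<Sum>k\<le>m. (if k < m then F k else 0) * G k) = (\<Sum>k<m. F k * G k)" for F G :: "nat \<Rightarrow> real"
    by (simp add: lessThan_Suc_atMost[symmetric])
  \<comment> \<open>Below \<open>m\<close> the norm is bounded by \<open>H\<close> and
    \<open>\<rho> k * \<alpha> k\<close> is the unshared mass; in the cell \<open>m\<close> only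
    \<open>\<rho> \<le> 1\<close> is available. The bound \<open>b2\<close> is its counterpart for
    \<open>\<mu>\<close>.\<close>
  have b1: "(\<Sum>j<n. h (x j) * ennreal (\<rho> (\<kappa> (x j)))) * ?a \<le> ?bx + ennreal H * ennreal (\<Sum>k<m. \<alpha> k - t k)"
  proof -
    have "(\<Sum>j<n. h (x j) * ennreal (\<rho> (\<kappa> (x j))))
      \<le> (\<Sum>j<n. (if \<kappa> (x j) = m then h (x j) else 0) + ennreal H * ennreal (if \<kappa> (x j) < m then \<rho> (\<kappa> (x j)) else 0))"
    proof (rule sum_mono)
      fix j assume "j \<in> {..<n}"
      then have j: "j < n" by simp
      show "h (x j) * ennreal (\<rho> (\<kappa> (x j))) \<le> (if \<kappa> (x j) = m then h (x j) else 0)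
          + ennreal H * ennreal (if \<kappa> (x j) < m then \<rho> (\<kappa> (x j)) else 0)"
      proof (cases "\<kappa> (x j) < m")
        case True
        then show ?thesis using bnd[OF x[OF j]] by (auto simp: h_def intro!: mult_right_mono)
      next
        case False
        then have "\<kappa> (x j) = m" using kx[OF j] by simp
        moreover have "h (x j) * ennreal (\<rho> (\<kappa> (x j))) \<le> h (x j) * 1"
          using \<rho>1[OF kx[OF j]] by (intro mult_left_mono) (auto simp: ennreal_leI)
        ultimately show ?thesis by simp
      qed
    qed
    then have "(\<Sum>j<n. h (x j) * ennreal (\<rho> (\<kappa> (x j)))) * ?a
      \<le> (\<Sum>j<n. (if \<kappa> (x j) = m then h (x j) else 0) + ennreal H * ennreal (if \<kappa> (x j) < m then \<rho> (\<kappa> (x j)) else 0)) * ?a"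
      by (rule mult_right_mono) simp
    also have "\<dots> = ?bx + ennreal H * ((\<Sum>j<n. ennreal (if \<kappa> (x j) < m then \<rho> (\<kappa> (x j)) else 0)) * ?a)"
      by (simp only: sum.distrib distrib_right sum_distrib_left[symmetric] mult.assoc)
    also have "(\<Sum>j<n. ennreal (if \<kappa> (x j) < m then \<rho> (\<kappa> (x j)) else 0)) * ?a = ennreal (\<Sum>k<m. \<rho> k * \<alpha> k)"
      by (subst AFe[of "\<lambda>k. if k < m then \<rho> k else 0"]) (use \<rho>0 good_sum in auto)
    finally show ?thesis by (simp add: \<rho>\<alpha>)
  qed
  have b2: "B \<le> bad + ennreal H * ennreal (\<Sum>k<m. q k - t k)"
  proof -
    have [measurable]: "(\<lambda>y. F (\<kappa> y)) \<in> borel_measurable \<mu>" for F :: "nat \<Rightarrow> ennreal"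
      by (rule measurable_compose[OF \<kappa>\<mu>]) simp
    have [measurable]: "h \<in> borel_measurable \<mu>" by (rule hm)
    have "B \<le> (\<integral>\<^sup>+y. (if \<kappa> y = m then h y else 0) + ennreal H * ennreal (if \<kappa> y < m then \<sigma> (\<kappa> y) else 0) \<partial>\<mu>)"
      unfolding B_def
    proof (rule nn_integral_mono)
      fix y assume "y \<in> space \<mu>"
      then have y: "y \<in> space ?P" by (simp add: sp)
      show "ennreal (\<sigma> (\<kappa> y)) * h y \<le> (if \<kappa> y = m then h y else 0) + ennreal H * ennreal (if \<kappa> y < m then \<sigma> (\<kappa> y) else 0)"
      proof (cases "\<kappa> y < m")
        case True
        then show ?thesis using bnd[OF y] by (subst mult.commute) (auto simp: h_def intro!: mult_right_mono)
      next
        case False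
        then have "\<kappa> y = m" using r[OF y] by simp
        moreover have "ennreal (\<sigma> (\<kappa> y)) * h y \<le> 1 * h y"
          using \<sigma>1[OF r[OF y]] by (intro mult_right_mono) (auto simp: ennreal_leI)
        ultimately show ?thesis by simp
      qed
    qed
    also have "\<dots> = bad + ennreal H * (\<integral>\<^sup>+y. ennreal (if \<kappa> y < m then \<sigma> (\<kappa> y) else 0) \<partial>\<mu>)"
      unfolding bad_def
      by (subst nn_integral_add) (auto simp: nn_integral_cmult intro!: measurable_If)
    also have "(\<integral>\<^sup>+y. ennreal (if \<kappa> y < m then \<sigma> (\<kappa> y) else 0) \<partial>\<mu>) = ennreal (\<Sum>k<m. \<sigma> k * q k)"
      by (subst QF[of "\<lambda>k. if k < m then \<sigma> k else 0"]) (use \<sigma>0 good_sum in auto)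
    finally show ?thesis by (simp add: \<sigma>q)
  qed
  have "(\<Sum>j<n. \<integral>\<^sup>+y. ennreal (g j y) * sup_sq T (\<lambda>u. x j u - y u) \<partial>\<mu>) * ?a
    \<le> (\<Sum>j<n. ennreal \<epsilon> + 2 * h (x j) * ennreal (\<rho> (\<kappa> (x j))) + ennreal (\<rho> (\<kappa> (x j)) / D) * (2 * B)) * ?a"
    by (intro mult_right_mono sum_mono cost) auto
  also have "\<dots> = ennreal \<epsilon> * (of_nat n * ?a) + 2 * ((\<Sum>j<n. h (x j) * ennreal (\<rho> (\<kappa> (x j)))) * ?a)
      + (\<Sum>j<n. ennreal (\<rho> (\<kappa> (x j)) / D)) * ?a * (2 * B)"
  proof -
    have "(\<Sum>j<n. ennreal \<epsilon> + 2 * h (x j) * ennreal (\<rho> (\<kappa> (x j))) + ennreal (\<rho> (\<kappa> (x j)) / D) * (2 * B))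
      = of_nat n * ennreal \<epsilon> + 2 * (\<Sum>j<n. h (x j) * ennreal (\<rho> (\<kappa> (x j))))
        + (\<Sum>j<n. ennreal (\<rho> (\<kappa> (x j)) / D)) * (2 * B)"
      by (simp only: sum.distrib sum_distrib_right[symmetric] mult.assoc[of 2] sum_distrib_left[symmetric]
          sum_constant card_lessThan)
    then show ?thesis by (simp only: distrib_right) (simp only: mult_ac)
  qed
  also have "(\<Sum>j<n. ennreal (\<rho> (\<kappa> (x j)) / D)) * ?a = ennreal ((\<Sum>k\<le>m. \<rho> k * \<alpha> k) / D)"
    using \<rho>0 D0 by (subst AFe[of "\<lambda>k. \<rho> k / D"]) (auto simp: sum_divide_distrib)
  \<comment> \<open>The factor 1 on the right bounds \<open>D / D\<close>, which is 0 when no mass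
    is left over.\<close>
  also have "ennreal \<epsilon> * (of_nat n * ?a) + 2 * ((\<Sum>j<n. h (x j) * ennreal (\<rho> (\<kappa> (x j)))) * ?a)
      + ennreal ((\<Sum>k\<le>m. \<rho> k * \<alpha> k) / D) * (2 * B)
    \<le> ennreal \<epsilon> + 2 * (?bx + ennreal H * ennreal (\<Sum>k<m. \<alpha> k - t k))
      + 1 * (2 * (bad + ennreal H * ennreal (\<Sum>k<m. q k - t k)))"
    unfolding an \<rho>s by (intro add_mono mult_mono b1 b2 mult_left_mono) (auto simp: ennreal_leI)
  also have "\<dots> = ennreal \<epsilon> + 2 * (?bx + bad + ennreal H * (ennreal (\<Sum>k<m. \<alpha> k - t k) + ennreal (\<Sum>k<m. q k - t k)))"
    by (simp add: distrib_left add_ac)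
  also have "ennreal (\<Sum>k<m. \<alpha> k - t k) + ennreal (\<Sum>k<m. q k - t k) = (\<Sum>k<m. ennreal \<bar>\<alpha> k - q k\<bar>)"
  proof -
    have "ennreal (\<Sum>k<m. \<alpha> k - t k) + ennreal (\<Sum>k<m. q k - t k)
        = ennreal ((\<Sum>k<m. \<alpha> k - t k) + (\<Sum>k<m. q k - t k))"
      using t\<alpha> tq by (intro ennreal_plus[symmetric] sum_nonneg) (auto simp: less_imp_le)
    also have "(\<Sum>k<m. \<alpha> k - t k) + (\<Sum>k<m. q k - t k) = (\<Sum>k<m. \<bar>\<alpha> k - q k\<bar>)"
      unfolding sum.distrib[symmetric] by (rule sum.cong) (auto simp: t_def min_def)
    finally show ?thesis by (simp add: sum_ennreal)
  qed
  finally have fin: "(\<Sum>j<n. \<integral>\<^sup>+y. ennreal (g j y) * sup_sq T (\<lambda>u. x j u - y u) \<partial>\<mu>) * ?a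
    \<le> ennreal \<epsilon> + 2 * (?bx + bad + ennreal H * (\<Sum>k<m. ennreal \<bar>\<alpha> k - q k\<bar>))" .
  show thesis
  proof (rule that)
    show "coupling_weights n \<mu> g" unfolding coupling_weights_def using gm g1 g2 by auto
    show "(\<Sum>j<n. \<integral>\<^sup>+y. ennreal (g j y) * sup_sq T (\<lambda>u. x j u - y u) \<partial>\<mu>) * ?a
      \<le> ennreal \<epsilon> + 2 * ((\<Sum>j<n. if \<kappa> (x j) = m then sup_sq T (x j) else 0) * ?a
        + (\<integral>\<^sup>+y. (if \<kappa> y = m then sup_sq T y else 0) \<partial>\<mu>)
        + ennreal H * (\<Sum>k<m. ennreal \<bar>(\<Sum>j<n. indicator {y\<in>space ?P. \<kappa> y = k} (x j)) / n
            - measure \<mu> {y\<in>space ?P. \<kappa> y = k}\<bar>))"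
      using fin unfolding \<alpha>_def q_def A_def h_def bad_def .
  qed
qed

section \<open>Countably many cells of small diameter\<close>

lemma sup_sq_le_gridI:
  assumes T: "0 < T" and f: "continuous_on {0..T} f"
    and le: "\<And>k j. \<bar>f (gridpt T k (min j (Suc k)))\<bar> \<le> c"
  shows "sup_sq T f \<le> ennreal (c\<^sup>2)"
proof -
  have "grid_sup_sq T k f \<le> ennreal (c\<^sup>2)" for k
    unfolding grid_sup_sq_def
  proof (rule SUP_least)
    fix j assume "j \<in> {..Suc k}"
    then have "\<bar>f (gridpt T k j)\<bar> \<le> c" using le[of k j] by (simp add: min_absorb1)
    then have "(f (gridpt T k j))\<^sup>2 \<le> c\<^sup>2" by (metis abs_ge_zero power2_abs power_mono)
    then show "ennreal ((f (gridpt T k j))\<^sup>2) \<le> ennreal (c\<^sup>2)" by (rule ennreal_leI)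
  qed
  then have "liminf (\<lambda>k. grid_sup_sq T k f) \<le> liminf (\<lambda>k::nat. ennreal (c\<^sup>2))"
    by (intro Liminf_mono always_eventually allI)
  then show ?thesis by (simp add: sup_sq_eq_liminf_grid[OF T f] Liminf_const)
qed

text \<open>The cells are the uniform neighbourhoods of the countably many step functions on regular grids
  with values in a lattice; all but finitely many of them are merged into one.\<close>

lemma exists_cells:
  assumes T: "0 < T" and s[measurable_cong]: "sets \<mu> = sets (path_space T)"
    and fin: "(\<integral>\<^sup>+y. sup_sq T y \<partial>\<mu>) < \<infinity>" and \<epsilon>: "0 < \<epsilon>"
  obtains \<kappa> :: "(real \<Rightarrow> real) \<Rightarrow> nat" and m H where "\<kappa> \<in> path_space T \<rightarrow>\<^sub>M count_space UNIV"
    and "\<And>y. y \<in> space (path_space T) \<Longrightarrow> \<kappa> y \<le> m"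
    and "\<And>y z. y \<in> space (path_space T) \<Longrightarrow> z \<in> space (path_space T) \<Longrightarrow> \<kappa> y = \<kappa> z \<Longrightarrow> \<kappa> y < m
      \<Longrightarrow> sup_sq T (\<lambda>u. y u - z u) \<le> ennreal \<epsilon>"
    and "\<And>y. y \<in> space (path_space T) \<Longrightarrow> \<kappa> y < m \<Longrightarrow> sup_sq T y \<le> ennreal H"
    and "(\<integral>\<^sup>+y. (if \<kappa> y = m then sup_sq T y else 0) \<partial>\<mu>) \<le> ennreal \<epsilon>"
proof -
  let ?P = "path_space T"
  have sp: "space \<mu> = space ?P" by (rule sets_eq_imp_space_eq[OF s])
  \<comment> \<open>Two paths in one cell are both within \<open>e\<close> of the same step
    function, hence within \<open>2 * e\<close> of each other, and the square of this is to be
    \<open>\<epsilon>\<close>.\<close>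
  define e where "e = sqrt \<epsilon> / 2"
  have e: "0 < e" "(2 * e)\<^sup>2 = \<epsilon>" using \<epsilon> by (auto simp: e_def)
  \<comment> \<open>Cutting the index off at \<open>Suc k\<close> keeps every point inside
    \<open>{0..T}\<close> while \<open>k\<close> and \<open>j\<close> range over all naturals. Thus
    \<open>near\<close> is a countable conjunction of conditions on evaluations, which makes it
    measurable.\<close>
  define pt where "pt k j = gridpt T k (min j (Suc k))" for k j
  have pt: "pt k j \<in> {0..T}" for k j unfolding pt_def by (rule gridpt_mem[OF T]) simp
  \<comment> \<open>The index set of pairs of a mesh and a list of integers is countable. A list
    that is too short makes \<open>!\<close> return an unspecified number, which does no harm: all
    that is used of an arbitrary \<open>d\<close> is that \<open>stp d\<close> is a fixed function
    bounded by \<open>C d\<close>.\<close>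
  define stp :: "nat \<times> int list \<Rightarrow> real \<Rightarrow> real"
    where "stp d u = e / 2 * of_int (snd d ! gridix T (fst d) u)" for d u
  define near where "near d y \<longleftrightarrow> (\<forall>k j. \<bar>y (pt k j) - stp d (pt k j)\<bar> \<le> e)" for d and y :: "real \<Rightarrow> real"
  \<comment> \<open>Taking the first suitable index makes the overlapping neighbourhoods
    disjoint.\<close>
  define cell where "cell y = (LEAST i. near (from_nat i) y)" for y
  have [measurable]: "(\<lambda>y. y (pt k j)) \<in> borel_measurable ?P" for k j by (rule measurable_eval[OF pt])
  have [measurable]: "(\<lambda>y. near d y) \<in> ?P \<rightarrow>\<^sub>M count_space UNIV" for d
    unfolding near_def by measurable
  have cell_meas[measurable]: "cell \<in> ?P \<rightarrow>\<^sub>M count_space UNIV"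
    unfolding cell_def[abs_def] by measurable
  \<comment> \<open>By uniform continuity, freezing the path at the left grid point costs less than
    \<open>e / 2\<close>; rounding the value down to a multiple of \<open>e / 2\<close> costs at
    most another \<open>e / 2\<close>.\<close>
  have cov: "\<exists>i. near (from_nat i) y" if y: "y \<in> space ?P" for y
  proof -
    have c: "continuous_on {0..T} y" using y by (simp add: space_path_space)
    then have "uniformly_continuous_on {0..T} y" by (rule compact_uniformly_continuous) simp
    then obtain d where d: "0 < d" "\<And>u v. u \<in> {0..T} \<Longrightarrow> v \<in> {0..T} \<Longrightarrow> dist u v < d \<Longrightarrow> dist (y u) (y v) < e / 2"
      unfolding uniformly_continuous_on_def using e(1) by (meson half_gt_zero)
    obtain N where N: "inverse (real (Suc N)) < d / T"
      using reals_Archimedean[of "d / T"] d(1) T by auto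
    define qs where "qs = map (\<lambda>i. \<lfloor>y (gridpt T N i) / (e / 2)\<rfloor>) [0..<Suc (Suc N)]"
    have "\<bar>y u - stp (N, qs) u\<bar> \<le> e" if u: "u \<in> {0..T}" for u
    proof -
      define i where "i = gridix T N u"
      have i: "i \<le> Suc N" unfolding i_def by (rule gridix_le[OF T u])
      have "T * inverse (real (Suc N)) < d" using N T by (simp add: field_simps)
      then have "\<bar>gridpt T N i - u\<bar> < d"
        using gridpt_gridix_close[OF T u, of N] unfolding i_def by linarith
      then have "dist (y (gridpt T N i)) (y u) < e / 2"
        by (intro d(2) gridpt_mem[OF T i] u) (simp add: dist_real_def)
      then have 1: "\<bar>y u - y (gridpt T N i)\<bar> < e / 2" by (simp add: dist_real_def abs_minus_commute)
      define v where "v = y (gridpt T N i) / (e / 2)"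
      have yv: "y (gridpt T N i) = e / 2 * v" using e(1) by (simp add: v_def)
      have "stp (N, qs) u = e / 2 * of_int \<lfloor>v\<rfloor>"
        unfolding stp_def fst_conv snd_conv i_def[symmetric] using i
        by (simp add: qs_def v_def del: upt_Suc)
      then have "y (gridpt T N i) - stp (N, qs) u = e / 2 * (v - of_int \<lfloor>v\<rfloor>)"
        unfolding yv by (simp only: right_diff_distrib)
      also have "\<bar>\<dots>\<bar> \<le> e / 2 * 1"
        unfolding abs_mult using e(1) by (intro mult_mono) (linarith | simp)+
      finally show ?thesis using 1 by linarith
    qed
    then have "near (N, qs) y" unfolding near_def using pt by auto
    then show ?thesis by (intro exI[of _ "to_nat (N, qs)"]) simp
  qed
  have near_cell: "near (from_nat (cell y)) y" if "y \<in> space ?P" for y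
    unfolding cell_def using cov[OF that] by (rule LeastI_ex)
  define C where "C d = e / 2 * (\<Sum>i\<le>Suc (fst d). \<bar>of_int (snd d ! i)\<bar>)" for d :: "nat \<times> int list"
  have C: "\<bar>stp d u\<bar> \<le> C d" if "u \<in> {0..T}" for d u
  proof -
    have "\<bar>real_of_int (snd d ! gridix T (fst d) u)\<bar> \<le> (\<Sum>i\<le>Suc (fst d). \<bar>of_int (snd d ! i)\<bar>)"
      by (rule member_le_sum[where f="\<lambda>i. \<bar>real_of_int (snd d ! i)\<bar>"]) (use gridix_le[OF T that, of "fst d"] in auto)
    then show ?thesis unfolding stp_def C_def abs_mult using e(1) by (intro mult_mono) auto
  qed
  have sup_cell: "sup_sq T y \<le> ennreal ((e + C (from_nat (cell y)))\<^sup>2)" if y: "y \<in> space ?P" for y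
  proof (rule sup_sq_le_gridI[OF T])
    show "continuous_on {0..T} y" using y by (simp add: space_path_space)
    fix k j
    show "\<bar>y (gridpt T k (min j (Suc k)))\<bar> \<le> e + C (from_nat (cell y))"
      using near_cell[OF y, unfolded near_def, rule_format, of k j] C[OF pt, of "from_nat (cell y)" k j]
      unfolding pt_def by linarith
  qed
  have diam_cell: "sup_sq T (\<lambda>u. y u - z u) \<le> ennreal \<epsilon>"
    if y: "y \<in> space ?P" and z: "z \<in> space ?P" and eq: "cell y = cell z" for y z
    unfolding e(2)[symmetric]
  proof (rule sup_sq_le_gridI[OF T])
    show "continuous_on {0..T} (\<lambda>u. y u - z u)"
      using y z by (intro continuous_intros) (auto simp: space_path_space)
    fix k j
    show "\<bar>y (gridpt T k (min j (Suc k))) - z (gridpt T k (min j (Suc k)))\<bar> \<le> 2 * e"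
      using near_cell[OF y, unfolded near_def, rule_format, of k j]
        near_cell[OF z, unfolded near_def, rule_format, of k j]
      unfolding pt_def eq by linarith
  qed
  have hm[measurable]: "(\<lambda>y. sup_sq T y) \<in> borel_measurable \<mu>"
    by (rule borel_measurable_sup_sq_path1[OF T measurable_ident_sets[OF s]])
  \<comment> \<open>Every path lies in exactly one cell, so the part of the second moment carried by
    the cells from \<open>m\<close> on tends to 0 by dominated convergence. These cells are then
    merged into the single cell \<open>m\<close>.\<close>
  have "(\<lambda>m. \<integral>\<^sup>+y. (if m \<le> cell y then sup_sq T y else 0) \<partial>\<mu>) \<longlonglongrightarrow> (\<integral>\<^sup>+y. 0 \<partial>\<mu>)"
  proof (rule nn_integral_dominated_convergence[where w="\<lambda>y. sup_sq T y"])
    fix m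
    show "(\<lambda>y. if m \<le> cell y then sup_sq T y else 0) \<in> borel_measurable \<mu>" by measurable
  next
    show "AE y in \<mu>. (\<lambda>m. if m \<le> cell y then sup_sq T y else 0) \<longlonglongrightarrow> 0"
    proof (rule AE_I2, rule tendsto_eventually)
      fix y
      show "\<forall>\<^sub>F m in sequentially. (if m \<le> cell y then sup_sq T y else 0) = 0"
        using eventually_gt_at_top[of "cell y"] by eventually_elim auto
    qed
  qed (use fin in auto)
  then have "\<forall>\<^sub>F m in sequentially. (\<integral>\<^sup>+y. (if m \<le> cell y then sup_sq T y else 0) \<partial>\<mu>) < ennreal \<epsilon>"
    using \<epsilon> by (intro order_tendstoD(2)) auto
  then obtain m where m: "(\<integral>\<^sup>+y. (if m \<le> cell y then sup_sq T y else 0) \<partial>\<mu>) < ennreal \<epsilon>"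
    by (auto simp: eventually_sequentially)
  \<comment> \<open>A sum in place of a maximum over the finitely many cells that are kept; the
    summands are nonnegative.\<close>
  define H where "H = (\<Sum>i<m. (e + C (from_nat i))\<^sup>2)"
  show thesis
  proof (rule that[of "\<lambda>y. min (cell y) m" m H])
    show "(\<lambda>y. min (cell y) m) \<in> ?P \<rightarrow>\<^sub>M count_space UNIV" by measurable
    show "sup_sq T (\<lambda>u. y u - z u) \<le> ennreal \<epsilon>"
      if "y \<in> space ?P" "z \<in> space ?P" "min (cell y) m = min (cell z) m" "min (cell y) m < m" for y z
      by (rule diam_cell) (use that in \<open>auto simp: min_def split: if_splits\<close>)
    show "sup_sq T y \<le> ennreal H" if y: "y \<in> space ?P" "min (cell y) m < m" for y
    proof -
      have "(e + C (from_nat (cell y)))\<^sup>2 \<le> H"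
        unfolding H_def by (rule member_le_sum[where f="\<lambda>i. (e + C (from_nat i))\<^sup>2"]) (use y(2) in auto)
      then show ?thesis using sup_cell[OF y(1)] by (meson ennreal_leI order_trans)
    qed
    have "(\<integral>\<^sup>+y. (if min (cell y) m = m then sup_sq T y else 0) \<partial>\<mu>)
        = (\<integral>\<^sup>+y. (if m \<le> cell y then sup_sq T y else 0) \<partial>\<mu>)"
      by (rule nn_integral_cong) (auto simp: min_def)
    then show "(\<integral>\<^sup>+y. (if min (cell y) m = m then sup_sq T y else 0) \<partial>\<mu>) \<le> ennreal \<epsilon>"
      using m by simp
  qed simp
qed

text \<open>The threshold \<open>n0\<close> depends on \<open>\<mu>\<close> and
  \<open>\<epsilon>\<close> alone and is chosen before the probability space, since the theorem
  allows a different space for each \<open>n\<close>. The majorant \<open>Q\<close> is explicit,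
  hence measurable, whereas the weights are merely asserted to exist for each sample point.\<close>

lemma empirical_coupling_expectation:
  fixes \<mu> :: "(real \<Rightarrow> real) measure"
  assumes T: "0 < T" and \<mu>: "prob_space \<mu>" and s: "sets \<mu> = sets (path_space T)"
    and fin: "(\<integral>\<^sup>+y. sup_sq T y \<partial>\<mu>) < \<infinity>" and \<epsilon>: "0 < \<epsilon>"
  shows "\<exists>n0>0. \<forall>n\<ge>n0. \<forall>(M :: 'a measure) V.
    prob_space M \<longrightarrow> prob_space.indep_vars M (\<lambda>_. path_space T) V {..<n} \<longrightarrow>
    (\<forall>j<n. distr M (path_space T) (V j) = \<mu>) \<longrightarrow>
    (\<exists>Q\<in>borel_measurable M. (\<integral>\<^sup>+\<omega>. Q \<omega> \<partial>M) \<le> ennreal \<epsilon> \<and>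
      (\<forall>\<omega>\<in>space M. \<exists>g. coupling_weights n \<mu> g \<and>
        (\<Sum>j<n. \<integral>\<^sup>+y. ennreal (g j y) * sup_sq T (\<lambda>u. V j \<omega> u - y u) \<partial>\<mu>) * ennreal (1 / n) \<le> Q \<omega>))"
proof -
  let ?P = "path_space T"
  have sp: "space \<mu> = space ?P" by (rule sets_eq_imp_space_eq[OF s])
  \<comment> \<open>The contributions below add up to \<open>\<delta> + 2 * (\<delta> + \<delta> +
    \<delta>) = 7 * \<delta>\<close>, which stays below \<open>\<epsilon>\<close>.\<close>
  define \<delta> where "\<delta> = \<epsilon> / 10"
  have \<delta>: "0 < \<delta>" using \<epsilon> by (simp add: \<delta>_def)
  obtain \<kappa> :: "(real \<Rightarrow> real) \<Rightarrow> nat" and m H where \<kappa>[measurable]: "\<kappa> \<in> ?P \<rightarrow>\<^sub>M count_space UNIV"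
    and r: "\<And>y. y \<in> space ?P \<Longrightarrow> \<kappa> y \<le> m"
    and diam: "\<And>y z. y \<in> space ?P \<Longrightarrow> z \<in> space ?P \<Longrightarrow> \<kappa> y = \<kappa> z \<Longrightarrow> \<kappa> y < m
      \<Longrightarrow> sup_sq T (\<lambda>u. y u - z u) \<le> ennreal \<delta>"
    and bnd: "\<And>y. y \<in> space ?P \<Longrightarrow> \<kappa> y < m \<Longrightarrow> sup_sq T y \<le> ennreal H"
    and bad: "(\<integral>\<^sup>+y. (if \<kappa> y = m then sup_sq T y else 0) \<partial>\<mu>) \<le> ennreal \<delta>"
  proof (rule exists_cells[OF T s fin \<delta>], goal_cases)
    case (1 \<kappa> m H)
    show thesis by (rule 1(1)) (fact 1(2) 1(3) 1(4) 1(5) 1(6))+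
  qed
  \<comment> \<open>\<open>exists_cells\<close> returns \<open>H\<close> without a sign, and
    products of real factors pass through \<open>ennreal\<close> only for nonnegative ones.\<close>
  define H' where "H' = max 0 H"
  have bnd': "sup_sq T y \<le> ennreal H'" if "y \<in> space ?P" "\<kappa> y < m" for y
    using order_trans[OF bnd[OF that] ennreal_leI] by (simp add: H'_def)
  have "(\<lambda>n::nat. 1 / sqrt n) \<longlonglongrightarrow> 0"
    by (rule tendsto_divide_0[OF tendsto_const filterlim_at_top_imp_at_infinity])
      (rule filterlim_compose[OF sqrt_at_top filterlim_real_sequentially])
  then have "(\<lambda>n::nat. H' * m * (1 / sqrt n)) \<longlonglongrightarrow> H' * m * 0"
    by (rule tendsto_mult[OF tendsto_const])
  then have "\<forall>\<^sub>F n::nat in sequentially. H' * m * (1 / sqrt n) < \<delta>"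
    using \<delta> by (intro order_tendstoD(2)) auto
  then obtain n1 :: nat where n1: "\<And>n::nat. n1 \<le> n \<Longrightarrow> H' * m * (1 / sqrt n) < \<delta>"
    by (auto simp: eventually_sequentially)
  show ?thesis
  proof (intro exI[of _ "Suc n1"] conjI allI impI)
    fix n :: nat and M :: "'a measure" and V :: "nat \<Rightarrow> 'a \<Rightarrow> real \<Rightarrow> real"
    assume n: "Suc n1 \<le> n" and M: "prob_space M" and V: "prob_space.indep_vars M (\<lambda>_. ?P) V {..<n}"
      and d: "\<forall>j<n. distr M ?P (V j) = \<mu>"
    interpret prob_space M by (rule M)
    have n0: "0 < n" using n by simp
    have Vm: "V j \<in> M \<rightarrow>\<^sub>M ?P" if "j < n" for j using V that by (auto simp: indep_vars_def)
    let ?h = "\<lambda>y. if \<kappa> y = m then sup_sq T y else 0"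
    let ?a = "ennreal (1 / n)"
    have h[measurable]: "?h \<in> borel_measurable ?P"
      using borel_measurable_sup_sq_path1[OF T measurable_ident[of ?P]] by (intro measurable_If) auto
    have A[measurable]: "{y\<in>space ?P. \<kappa> y = k} \<in> sets ?P" for k by measurable
    define dev where "dev k \<omega> = ennreal \<bar>(\<Sum>j<n. indicator {y\<in>space ?P. \<kappa> y = k} (V j \<omega>)) / n
            - measure \<mu> {y\<in>space ?P. \<kappa> y = k}\<bar>" for k \<omega>
    define Q where "Q \<omega> = ennreal \<delta> + 2 * ((\<Sum>j<n. ?h (V j \<omega>)) * ?a
        + (\<integral>\<^sup>+y. ?h y \<partial>\<mu>) + ennreal H' * (\<Sum>k<m. dev k \<omega>))" for \<omega>
    have hV: "(\<lambda>\<omega>. ?h (V j \<omega>)) \<in> borel_measurable M" if "j < n" for j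
      by (rule measurable_compose[OF Vm[OF that] h])
    have dm[measurable]: "dev k \<in> borel_measurable M" for k
      unfolding dev_def[abs_def]
      by (intro measurable_compose[OF _ measurable_ennreal] borel_measurable_abs borel_measurable_diff
          borel_measurable_divide borel_measurable_sum measurable_const
          measurable_compose[OF Vm borel_measurable_indicator]) (auto simp: A)
    have Qm: "Q \<in> borel_measurable M"
      unfolding Q_def[abs_def]
      by (intro borel_measurable_add borel_measurable_times_ennreal borel_measurable_sum hV dm measurable_const) auto
    \<comment> \<open>Each \<open>V j\<close> has law \<open>\<mu>\<close>, so the sample average of
      the bad-cell contribution has the same mean as that contribution under \<open>\<mu>\<close>,
      which the choice of the cells made at most \<open>\<delta>\<close>.\<close>
    have Eh: "(\<integral>\<^sup>+\<omega>. (\<Sum>j<n. ?h (V j \<omega>)) * ?a \<partial>M) = (\<integral>\<^sup>+y. ?h y \<partial>\<mu>)"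
    proof -
      have "(\<integral>\<^sup>+\<omega>. (\<Sum>j<n. ?h (V j \<omega>)) * ?a \<partial>M) = (\<integral>\<^sup>+\<omega>. (\<Sum>j<n. ?h (V j \<omega>)) \<partial>M) * ?a"
        by (rule nn_integral_multc) (intro borel_measurable_sum hV, simp)
      also have "(\<integral>\<^sup>+\<omega>. (\<Sum>j<n. ?h (V j \<omega>)) \<partial>M) = (\<Sum>j<n. \<integral>\<^sup>+\<omega>. ?h (V j \<omega>) \<partial>M)"
        by (rule nn_integral_sum) (intro hV, simp)
      also have "\<dots> = (\<Sum>j<n. \<integral>\<^sup>+y. ?h y \<partial>\<mu>)"
      proof (intro sum.cong refl)
        fix j assume "j \<in> {..<n}"
        then have j: "j < n" by simp
        show "(\<integral>\<^sup>+\<omega>. ?h (V j \<omega>) \<partial>M) = (\<integral>\<^sup>+y. ?h y \<partial>\<mu>)"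
          using nn_integral_distr[OF Vm[OF j], of ?h] d j h by (simp add: measurable_cong_sets[OF s refl])
      qed
      also have "\<dots> * ?a = (of_nat n * ?a) * (\<integral>\<^sup>+y. ?h y \<partial>\<mu>)"
        by (simp only: sum_constant card_lessThan mult_ac)
      also have "of_nat n * ?a = 1"
        using n0 by (simp add: ennreal_of_nat_eq_real_of_nat ennreal_mult[symmetric])
      finally show ?thesis by simp
    qed
    have Ed: "(\<integral>\<^sup>+\<omega>. dev k \<omega> \<partial>M) \<le> ennreal (1 / sqrt n)" for k
      unfolding dev_def
    proof (rule frequency_deviation_le[OF n0 V A])
      fix j assume j: "j < n"
      have "measure \<mu> {y\<in>space ?P. \<kappa> y = k} = measure (distr M ?P (V j)) {y\<in>space ?P. \<kappa> y = k}"
        using d j by simp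
      also have "\<dots> = prob (V j -` {y\<in>space ?P. \<kappa> y = k} \<inter> space M)"
        by (rule measure_distr[OF Vm[OF j] A])
      finally show "prob (V j -` {y\<in>space ?P. \<kappa> y = k} \<inter> space M) = measure \<mu> {y\<in>space ?P. \<kappa> y = k}" ..
    qed
    have sd: "(\<integral>\<^sup>+\<omega>. (\<Sum>k<m. dev k \<omega>) \<partial>M) \<le> ennreal (m * (1 / sqrt n))"
    proof -
      have "(\<integral>\<^sup>+\<omega>. (\<Sum>k<m. dev k \<omega>) \<partial>M) = (\<Sum>k<m. \<integral>\<^sup>+\<omega>. dev k \<omega> \<partial>M)"
        by (rule nn_integral_sum) simp
      also have "\<dots> \<le> (\<Sum>k<m. ennreal (1 / sqrt n))" by (intro sum_mono Ed)
      finally show ?thesis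
        by (simp add: ennreal_of_nat_eq_real_of_nat ennreal_mult[symmetric])
    qed
    have "(\<integral>\<^sup>+\<omega>. Q \<omega> \<partial>M) = ennreal \<delta> + 2 * ((\<integral>\<^sup>+\<omega>. (\<Sum>j<n. ?h (V j \<omega>)) * ?a \<partial>M)
        + (\<integral>\<^sup>+y. ?h y \<partial>\<mu>) + ennreal H' * (\<integral>\<^sup>+\<omega>. (\<Sum>k<m. dev k \<omega>) \<partial>M))"
    proof -
      have [measurable]: "(\<lambda>\<omega>. (\<Sum>j<n. ?h (V j \<omega>)) * ?a) \<in> borel_measurable M"
        by (intro borel_measurable_times_ennreal borel_measurable_sum hV) auto
      define f where "f = (\<lambda>\<omega>. (\<Sum>j<n. ?h (V j \<omega>)) * ?a)"
      have [measurable]: "f \<in> borel_measurable M" unfolding f_def by measurable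
      show ?thesis
        unfolding Q_def f_def[symmetric] fun_cong[OF f_def, symmetric]
        by (simp add: nn_integral_add nn_integral_cmult emeasure_space_1 del: sum.lessThan_Suc)
    qed
    also have "\<dots> \<le> ennreal \<delta> + 2 * (ennreal \<delta> + ennreal \<delta> + ennreal H' * ennreal (m * (1 / sqrt n)))"
      unfolding Eh by (intro add_mono mult_left_mono order_refl bad sd) auto
    also have "ennreal H' * ennreal (m * (1 / sqrt n)) \<le> ennreal \<delta>"
    proof -
      have "H' * (m * (1 / sqrt n)) \<le> \<delta>" using n1[of n] n by (simp add: mult_ac less_imp_le)
      moreover have "ennreal H' * ennreal (m * (1 / sqrt n)) = ennreal (H' * (m * (1 / sqrt n)))"
        by (rule ennreal_mult[symmetric]) (auto simp: H'_def)
      ultimately show ?thesis by (simp only: ennreal_leI)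
    qed
    also have "ennreal \<delta> + 2 * (ennreal \<delta> + ennreal \<delta> + ennreal \<delta>) = ennreal (7 * \<delta>)"
      using \<delta> by (simp add: ennreal_plus[symmetric] ennreal_mult[symmetric] ennreal_numeral[symmetric]
          del: ennreal_plus ennreal_numeral)
    also have "\<dots> \<le> ennreal \<epsilon>" using \<epsilon> by (intro ennreal_leI) (simp add: \<delta>_def)
    finally have "(\<integral>\<^sup>+\<omega>. Q \<omega> \<partial>M) \<le> ennreal \<epsilon>" by (simp add: add_left_mono mult_left_mono)
    moreover have "\<exists>g. coupling_weights n \<mu> g \<and>
        (\<Sum>j<n. \<integral>\<^sup>+y. ennreal (g j y) * sup_sq T (\<lambda>u. V j \<omega> u - y u) \<partial>\<mu>) * ?a \<le> Q \<omega>"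
      if w: "\<omega> \<in> space M" for \<omega>
    proof -
      have Vs: "V j \<omega> \<in> space ?P" if "j < n" for j using measurable_space[OF Vm[OF that] w] .
      show ?thesis
      proof (rule cell_coupling[OF T n0 Vs \<mu> s \<kappa> r diam bnd'])
        fix g assume "coupling_weights n \<mu> g"
          and "(\<Sum>j<n. \<integral>\<^sup>+y. ennreal (g j y) * sup_sq T (\<lambda>u. V j \<omega> u - y u) \<partial>\<mu>) * ?a
            \<le> ennreal \<delta> + 2 * ((\<Sum>j<n. ?h (V j \<omega>)) * ?a + (\<integral>\<^sup>+y. ?h y \<partial>\<mu>)
              + ennreal H' * (\<Sum>k<m. ennreal \<bar>(\<Sum>j<n. indicator {y\<in>space ?P. \<kappa> y = k} (V j \<omega>)) / n
                - measure \<mu> {y\<in>space ?P. \<kappa> y = k}\<bar>))"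
        then show ?thesis unfolding Q_def dev_def by (intro exI[of _ g] conjI)
      qed
    qed
    ultimately show "\<exists>Q\<in>borel_measurable M. (\<integral>\<^sup>+\<omega>. Q \<omega> \<partial>M) \<le> ennreal \<epsilon> \<and>
      (\<forall>\<omega>\<in>space M. \<exists>g. coupling_weights n \<mu> g \<and>
        (\<Sum>j<n. \<integral>\<^sup>+y. ennreal (g j y) * sup_sq T (\<lambda>u. V j \<omega> u - y u) \<partial>\<mu>) * ?a \<le> Q \<omega>)"
      using Qm by blast
  qed simp
qed

section \<open>Square-integrable martingales\<close>

lemma integrable_mult_square:
  fixes f g :: "'a \<Rightarrow> real"
  assumes [measurable]: "f \<in> borel_measurable M" "g \<in> borel_measurable M"
    and "integrable M (\<lambda>x. (f x)\<^sup>2)" "integrable M (\<lambda>x. (g x)\<^sup>2)"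
  shows "integrable M (\<lambda>x. f x * g x)"
proof (rule Bochner_Integration.integrable_bound[OF Bochner_Integration.integrable_add[OF assms(3,4)]])
  show "AE x in M. norm (f x * g x) \<le> norm ((f x)\<^sup>2 + (g x)\<^sup>2)"
  proof (rule AE_I2)
    fix x
    have "\<bar>f x * g x\<bar> \<le> (f x)\<^sup>2 + (g x)\<^sup>2"
      using sum_squares_bound[of "\<bar>f x\<bar>" "\<bar>g x\<bar>"] mult_nonneg_nonneg[of "\<bar>f x\<bar>" "\<bar>g x\<bar>"]
      unfolding abs_mult power2_abs by linarith
    then show "norm (f x * g x) \<le> norm ((f x)\<^sup>2 + (g x)\<^sup>2)" by simp
  qed
qed simp

lemma integrable_square_add:
  fixes f g :: "'a \<Rightarrow> real"
  assumes [measurable]: "f \<in> borel_measurable M" "g \<in> borel_measurable M"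
    and "integrable M (\<lambda>x. (f x)\<^sup>2)" "integrable M (\<lambda>x. (g x)\<^sup>2)"
  shows "integrable M (\<lambda>x. (f x + g x)\<^sup>2)"
  unfolding power2_sum using integrable_mult_square[OF assms] assms(3,4) by (simp add: mult.assoc)

lemma integrable_square_diff:
  fixes f g :: "'a \<Rightarrow> real"
  assumes [measurable]: "f \<in> borel_measurable M" "g \<in> borel_measurable M"
    and "integrable M (\<lambda>x. (f x)\<^sup>2)" "integrable M (\<lambda>x. (g x)\<^sup>2)"
  shows "integrable M (\<lambda>x. (f x - g x)\<^sup>2)"
  unfolding power2_diff using integrable_mult_square[OF assms] assms(3,4) by (simp add: mult.assoc)

lemma integrable_square_iff:
  fixes f :: "'a \<Rightarrow> real"
  assumes [measurable]: "f \<in> borel_measurable M"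
  shows "integrable M (\<lambda>x. (f x)\<^sup>2) \<longleftrightarrow> (\<integral>\<^sup>+x. ennreal ((f x)\<^sup>2) \<partial>M) < \<infinity>"
  by (subst integrable_iff_bounded) simp

locale sub_filtration = prob_space M for M :: "'a measure" +
  fixes H :: "real \<Rightarrow> 'a measure" and T :: real
  assumes T_pos: "0 < T"
    and space_H: "\<And>t. t \<in> {0..T} \<Longrightarrow> space (H t) = space M"
    and sets_H_mono: "\<And>s t. 0 \<le> s \<Longrightarrow> s \<le> t \<Longrightarrow> t \<le> T \<Longrightarrow> sets (H s) \<subseteq> sets (H t)"
    and sets_H: "\<And>t. t \<in> {0..T} \<Longrightarrow> sets (H t) \<subseteq> sets M"
begin

lemma H_measurable_mono:
  assumes "f \<in> H s \<rightarrow>\<^sub>M N" "0 \<le> s" "s \<le> t" "t \<le> T" shows "f \<in> H t \<rightarrow>\<^sub>M N"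
  using assms sets_H_mono[of s t] space_H[of s] space_H[of t] by (auto simp: measurable_def)

lemma H_measurable:
  assumes "f \<in> H s \<rightarrow>\<^sub>M N" "s \<in> {0..T}" shows "f \<in> M \<rightarrow>\<^sub>M N"
  using assms sets_H[of s] space_H[of s] by (auto simp: measurable_def)

text \<open>The martingale property in dual form, tested against square-integrable variables known
  at time \<open>s\<close> instead of being stated with conditional expectations. In this form it is
  linear, passes to limits in mean square by the Cauchy-Schwarz inequality, and is exactly what the
  energy estimate and Doob's inequality consume.\<close>

definition l2_martingale :: "(real \<Rightarrow> 'a \<Rightarrow> real) \<Rightarrow> bool" where
  "l2_martingale N \<longleftrightarrow>
     (\<forall>t\<in>{0..T}. N t \<in> borel_measurable (H t) \<and> integrable M (\<lambda>\<omega>. (N t \<omega>)\<^sup>2)) \<and>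
     (\<forall>s t. 0 \<le> s \<longrightarrow> s \<le> t \<longrightarrow> t \<le> T \<longrightarrow> (\<forall>Z\<in>borel_measurable (H s). integrable M (\<lambda>\<omega>. (Z \<omega>)\<^sup>2) \<longrightarrow>
        (\<integral>\<omega>. Z \<omega> * (N t \<omega> - N s \<omega>) \<partial>M) = 0))"

lemma l2_martingaleD:
  assumes "l2_martingale N" "t \<in> {0..T}"
  shows "N t \<in> borel_measurable (H t)" "N t \<in> borel_measurable M" "integrable M (\<lambda>\<omega>. (N t \<omega>)\<^sup>2)"
proof -
  show "N t \<in> borel_measurable (H t)" "integrable M (\<lambda>\<omega>. (N t \<omega>)\<^sup>2)"
    using assms by (auto simp: l2_martingale_def)
  then show "N t \<in> borel_measurable M" using H_measurable assms(2) by blast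
qed

lemma l2_martingale_orthogonal:
  assumes "l2_martingale N" "0 \<le> s" "s \<le> t" "t \<le> T" "Z \<in> borel_measurable (H s)" "integrable M (\<lambda>\<omega>. (Z \<omega>)\<^sup>2)"
  shows "(\<integral>\<omega>. Z \<omega> * (N t \<omega> - N s \<omega>) \<partial>M) = 0"
    and "integrable M (\<lambda>\<omega>. Z \<omega> * (N t \<omega> - N s \<omega>))"
proof -
  show "(\<integral>\<omega>. Z \<omega> * (N t \<omega> - N s \<omega>) \<partial>M) = 0"
    using assms by (auto simp: l2_martingale_def)
  have "s \<in> {0..T}" "t \<in> {0..T}" using assms by auto
  then show "integrable M (\<lambda>\<omega>. Z \<omega> * (N t \<omega> - N s \<omega>))"
    using l2_martingaleD[OF assms(1)] H_measurable[OF assms(5)] assms(6)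
    by (intro integrable_mult_square integrable_square_diff borel_measurable_diff) auto
qed

lemma l2_martingale_zero: "l2_martingale (\<lambda>t \<omega>. 0)"
  by (auto simp: l2_martingale_def)

lemma l2_martingale_add:
  assumes N: "l2_martingale N" and K: "l2_martingale K"
  shows "l2_martingale (\<lambda>t \<omega>. N t \<omega> + K t \<omega>)"
  unfolding l2_martingale_def
proof (intro conjI ballI allI impI)
  fix t assume t: "t \<in> {0..T}"
  show "(\<lambda>\<omega>. N t \<omega> + K t \<omega>) \<in> borel_measurable (H t)"
    using l2_martingaleD(1)[OF N t] l2_martingaleD(1)[OF K t] by simp
  show "integrable M (\<lambda>\<omega>. (N t \<omega> + K t \<omega>)\<^sup>2)"
    by (intro integrable_square_add l2_martingaleD[OF N t] l2_martingaleD[OF K t])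
next
  fix s t and Z :: "'a \<Rightarrow> real" assume st: "0 \<le> s" "s \<le> t" "t \<le> T" and Z: "Z \<in> borel_measurable (H s)" "integrable M (\<lambda>\<omega>. (Z \<omega>)\<^sup>2)"
  have "(\<integral>\<omega>. Z \<omega> * (N t \<omega> + K t \<omega> - (N s \<omega> + K s \<omega>)) \<partial>M)
    = (\<integral>\<omega>. Z \<omega> * (N t \<omega> - N s \<omega>) + Z \<omega> * (K t \<omega> - K s \<omega>) \<partial>M)"
    by (rule Bochner_Integration.integral_cong) (auto simp: algebra_simps)
  also have "\<dots> = 0"
    using l2_martingale_orthogonal[OF N st Z] l2_martingale_orthogonal[OF K st Z] by simp
  finally show "(\<integral>\<omega>. Z \<omega> * (N t \<omega> + K t \<omega> - (N s \<omega> + K s \<omega>)) \<partial>M) = 0" .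
qed

lemma l2_martingale_cmult:
  assumes N: "l2_martingale N"
  shows "l2_martingale (\<lambda>t \<omega>. c * N t \<omega>)"
  unfolding l2_martingale_def
proof (intro conjI ballI allI impI)
  fix t assume t: "t \<in> {0..T}"
  show "(\<lambda>\<omega>. c * N t \<omega>) \<in> borel_measurable (H t)"
    using l2_martingaleD(1)[OF N t] by simp
  show "integrable M (\<lambda>\<omega>. (c * N t \<omega>)\<^sup>2)"
    using l2_martingaleD(3)[OF N t] by (simp add: power_mult_distrib)
next
  fix s t and Z :: "'a \<Rightarrow> real" assume st: "0 \<le> s" "s \<le> t" "t \<le> T" and Z: "Z \<in> borel_measurable (H s)" "integrable M (\<lambda>\<omega>. (Z \<omega>)\<^sup>2)"
  have "(\<integral>\<omega>. Z \<omega> * (c * N t \<omega> - c * N s \<omega>) \<partial>M) = (\<integral>\<omega>. c * (Z \<omega> * (N t \<omega> - N s \<omega>)) \<partial>M)"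
    by (rule Bochner_Integration.integral_cong) (auto simp: algebra_simps)
  then show "(\<integral>\<omega>. Z \<omega> * (c * N t \<omega> - c * N s \<omega>) \<partial>M) = 0"
    using l2_martingale_orthogonal[OF N st Z] by simp
qed

lemma l2_martingale_diff:
  assumes "l2_martingale N" "l2_martingale K"
  shows "l2_martingale (\<lambda>t \<omega>. N t \<omega> - K t \<omega>)"
  using l2_martingale_add[OF assms(1) l2_martingale_cmult[OF assms(2), of "-1"]] by simp

lemma l2_martingale_sum:
  assumes "\<And>i. i \<in> I \<Longrightarrow> l2_martingale (N i)"
  shows "l2_martingale (\<lambda>t \<omega>. \<Sum>i\<in>I. N i t \<omega>)"
  using assms
proof (induction I rule: infinite_finite_induct)
  case (insert i I)
  then show ?case using l2_martingale_add[of "N i" "\<lambda>t \<omega>. \<Sum>i\<in>I. N i t \<omega>"] by simp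
qed (simp_all add: l2_martingale_zero)

lemma l2_martingale_minus_initial:
  assumes N: "l2_martingale N"
  shows "l2_martingale (\<lambda>t \<omega>. N t \<omega> - N 0 \<omega>)"
proof -
  have "0 \<in> {0..T}" using T_pos by simp
  note N0 = l2_martingaleD[OF N this]
  have "l2_martingale (\<lambda>t. N 0)"
    unfolding l2_martingale_def using N0 H_measurable_mono[OF N0(1)] by auto
  then show ?thesis by (rule l2_martingale_diff[OF N])
qed

text \<open>Doob's maximal inequality in trajectorial form: with \<open>m j\<close> the running maximum of
  \<open>s j = \<bar>N (t j)\<bar>\<close>, the sum of the \<open>m j * (s (j + 1) - s j)\<close> has nonnegative mean and is at most
  \<open>m n * s n - (m n)\<^sup>2 / 2\<close>.\<close>

lemma doob_discrete:
  fixes t :: "nat \<Rightarrow> real"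
  assumes N: "l2_martingale N" and t: "\<And>j. j \<le> n \<Longrightarrow> t j \<in> {0..T}" and mono: "\<And>j. j < n \<Longrightarrow> t j \<le> t (Suc j)"
  shows "(\<integral>\<^sup>+\<omega>. (SUP j\<in>{..n}. ennreal ((N (t j) \<omega>)\<^sup>2)) \<partial>M) \<le> 4 * (\<integral>\<^sup>+\<omega>. ennreal ((N (t n) \<omega>)\<^sup>2) \<partial>M)"
proof -
  define S where "S j \<omega> = \<bar>N (t j) \<omega>\<bar>" for j \<omega>
  define m where "m j \<omega> = Max ((\<lambda>i. S i \<omega>) ` {..j})" for j \<omega>
  have m0: "m 0 \<omega> = S 0 \<omega>" and mS: "m (Suc j) \<omega> = max (S (Suc j) \<omega>) (m j \<omega>)" for j \<omega>
    by (simp_all add: m_def atMost_Suc)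
  have S0: "0 \<le> S j \<omega>" for j \<omega> by (simp add: S_def)
  have m_ge: "S i \<omega> \<le> m j \<omega>" if "i \<le> j" for i j \<omega> unfolding m_def using that by (intro Max_ge) auto
  have m_nonneg: "0 \<le> m j \<omega>" for j \<omega> using m_ge[of j j \<omega>] S0[of j \<omega>] by simp
  have Sm: "S j \<in> borel_measurable (H (t j))" and SL2: "integrable M (\<lambda>\<omega>. (S j \<omega>)\<^sup>2)" if "j \<le> n" for j
    using l2_martingaleD[OF N t[OF that]] by (auto simp: S_def[abs_def])
  have SM: "S j \<in> borel_measurable M" if "j \<le> n" for j using H_measurable[OF Sm[OF that] t[OF that]] .
  have mm: "m j \<in> borel_measurable (H (t j)) \<and> integrable M (\<lambda>\<omega>. (m j \<omega>)\<^sup>2)" if "j \<le> n" for j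
    using that
  proof (induction j)
    case 0
    have "m 0 = S 0" by (rule ext) (rule m0)
    then show ?case using Sm[of 0] SL2[of 0] by simp
  next
    case (Suc j)
    then have IH: "m j \<in> borel_measurable (H (t j))" "integrable M (\<lambda>\<omega>. (m j \<omega>)\<^sup>2)" by auto
    have ts: "0 \<le> t j" "t j \<le> t (Suc j)" "t (Suc j) \<le> T" using t[of j] t[of "Suc j"] mono[of j] Suc.prems by auto
    have a: "m j \<in> borel_measurable (H (t (Suc j)))" using H_measurable_mono[OF IH(1) ts] .
    have mjM: "m j \<in> borel_measurable M" using H_measurable[OF IH(1)] t[of j] Suc.prems by auto
    have eq: "m (Suc j) = (\<lambda>\<omega>. max (S (Suc j) \<omega>) (m j \<omega>))" by (rule ext) (rule mS)
    have "integrable M (\<lambda>\<omega>. (m (Suc j) \<omega>)\<^sup>2)"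
    proof (rule Bochner_Integration.integrable_bound[OF Bochner_Integration.integrable_add[OF SL2[OF Suc.prems] IH(2)]])
      show "(\<lambda>\<omega>. (m (Suc j) \<omega>)\<^sup>2) \<in> borel_measurable M"
        unfolding eq using SM[OF Suc.prems] mjM by measurable
      show "AE \<omega> in M. norm ((m (Suc j) \<omega>)\<^sup>2) \<le> norm ((S (Suc j) \<omega>)\<^sup>2 + (m j \<omega>)\<^sup>2)"
        by (rule AE_I2) (auto simp: mS max_def)
    qed
    moreover have "m (Suc j) \<in> borel_measurable (H (t (Suc j)))"
      unfolding eq using a Sm[OF Suc.prems] by measurable
    ultimately show ?case by simp
  qed
  have mM: "m j \<in> borel_measurable M" if "j \<le> n" for j
    using H_measurable[OF conjunct1[OF mm[OF that]] t[OF that]] .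
  have inc: "0 \<le> (\<integral>\<omega>. m j \<omega> * (S (Suc j) \<omega> - S j \<omega>) \<partial>M) \<and> integrable M (\<lambda>\<omega>. m j \<omega> * (S (Suc j) \<omega> - S j \<omega>))"
    if j: "j < n" for j
  proof
    have ts: "0 \<le> t j" "t j \<le> t (Suc j)" "t (Suc j) \<le> T" using t[of j] t[of "Suc j"] mono[OF j] j by auto
    \<comment> \<open>The test variable that extracts the submartingale property of the absolute
      value: \<open>sgn a * (b - a) \<le> \<bar>b\<bar> - \<bar>a\<bar>\<close>, multiplied by the
      nonnegative running maximum, which is known at time \<open>t j\<close>.\<close>
    define Z where "Z \<omega> = m j \<omega> * sgn (N (t j) \<omega>)" for \<omega>
    have Zm: "Z \<in> borel_measurable (H (t j))"
      unfolding Z_def[abs_def] using mm[of j] l2_martingaleD(1)[OF N t[of j]] j by auto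
    have Z2: "integrable M (\<lambda>\<omega>. (Z \<omega>)\<^sup>2)"
    proof (rule Bochner_Integration.integrable_bound)
      show "integrable M (\<lambda>\<omega>. (m j \<omega>)\<^sup>2)" using mm[of j] j by simp
      show "(\<lambda>\<omega>. (Z \<omega>)\<^sup>2) \<in> borel_measurable M" using H_measurable[OF Zm t[of j]] j by simp
      show "AE \<omega> in M. norm ((Z \<omega>)\<^sup>2) \<le> norm ((m j \<omega>)\<^sup>2)"
        by (rule AE_I2) (auto simp: Z_def power_mult_distrib sgn_if)
    qed
    show int: "integrable M (\<lambda>\<omega>. m j \<omega> * (S (Suc j) \<omega> - S j \<omega>))"
      using mm[of j] SL2 SM mM j by (intro integrable_mult_square integrable_square_diff) auto
    have "0 = (\<integral>\<omega>. Z \<omega> * (N (t (Suc j)) \<omega> - N (t j) \<omega>) \<partial>M)"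
      using l2_martingale_orthogonal(1)[OF N ts Zm Z2] by simp
    also have "\<dots> \<le> (\<integral>\<omega>. m j \<omega> * (S (Suc j) \<omega> - S j \<omega>) \<partial>M)"
    proof (rule integral_mono[OF l2_martingale_orthogonal(2)[OF N ts Zm Z2] int])
      fix \<omega>
      have "sgn a * (b - a) \<le> \<bar>b\<bar> - \<bar>a\<bar>" for a b :: real by (auto simp: sgn_if abs_if)
      then have "m j \<omega> * (sgn (N (t j) \<omega>) * (N (t (Suc j)) \<omega> - N (t j) \<omega>)) \<le> m j \<omega> * (S (Suc j) \<omega> - S j \<omega>)"
        unfolding S_def by (intro mult_left_mono m_nonneg)
      then show "Z \<omega> * (N (t (Suc j)) \<omega> - N (t j) \<omega>) \<le> m j \<omega> * (S (Suc j) \<omega> - S j \<omega>)"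
        by (simp add: Z_def mult.assoc)
    qed
    finally show "0 \<le> (\<integral>\<omega>. m j \<omega> * (S (Suc j) \<omega> - S j \<omega>) \<partial>M)" .
  qed
  \<comment> \<open>A discrete integration by parts. If the new value is not a record,
    \<open>m\<close> does not change; if it is one, then \<open>m (Suc k) = S (Suc k)\<close> and
    the step reduces to \<open>0 \<le> (a - b)\<^sup>2\<close> for the new maximum \<open>a\<close>
    and the old one \<open>b\<close>.\<close>
  have path: "(\<Sum>j<k. m j \<omega> * (S (Suc j) \<omega> - S j \<omega>)) \<le> m k \<omega> * S k \<omega> - (m k \<omega>)\<^sup>2 / 2" for k \<omega>
  proof (induction k)
    case 0
    then show ?case by (simp add: m0 power2_eq_square)
  next
    case (Suc k)
    have "(\<Sum>j<Suc k. m j \<omega> * (S (Suc j) \<omega> - S j \<omega>)) \<le> m k \<omega> * S (Suc k) \<omega> - (m k \<omega>)\<^sup>2 / 2"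
      using Suc by (simp add: algebra_simps)
    also have "\<dots> \<le> m (Suc k) \<omega> * S (Suc k) \<omega> - (m (Suc k) \<omega>)\<^sup>2 / 2"
    proof (cases "S (Suc k) \<omega> \<le> m k \<omega>")
      case False
      then have "m (Suc k) \<omega> = S (Suc k) \<omega>" by (simp add: mS)
      moreover have "b * a - b\<^sup>2 / 2 \<le> a * a - a\<^sup>2 / 2" for a b :: real
        using zero_le_power2[of "a - b"] by (simp add: power2_eq_square algebra_simps)
      ultimately show ?thesis by simp
    qed (simp add: mS)
    finally show ?case .
  qed
  have int_m: "integrable M (\<lambda>\<omega>. (m n \<omega>)\<^sup>2)" using mm[of n] by simp
  have "0 \<le> (\<Sum>j<n. \<integral>\<omega>. m j \<omega> * (S (Suc j) \<omega> - S j \<omega>) \<partial>M)" using inc by (intro sum_nonneg) auto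
  also have "\<dots> = (\<integral>\<omega>. (\<Sum>j<n. m j \<omega> * (S (Suc j) \<omega> - S j \<omega>)) \<partial>M)"
    using inc by (intro Bochner_Integration.integral_sum[symmetric]) auto
  also have "\<dots> \<le> (\<integral>\<omega>. (S n \<omega>)\<^sup>2 - (m n \<omega>)\<^sup>2 / 4 \<partial>M)"
  proof (rule integral_mono)
    fix \<omega>
    \<comment> \<open>Completing this square trades the product \<open>m n * S n\<close> for
      \<open>(S n)\<^sup>2\<close> and leaves a quarter of \<open>(m n)\<^sup>2\<close>; this is the
      origin of the constant 4.\<close>
    have "0 \<le> (m n \<omega> / 2 - S n \<omega>)\<^sup>2" by simp
    then have "m n \<omega> * S n \<omega> - (m n \<omega>)\<^sup>2 / 2 \<le> (S n \<omega>)\<^sup>2 - (m n \<omega>)\<^sup>2 / 4"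
      by (simp add: power2_diff power_divide)
    then show "(\<Sum>j<n. m j \<omega> * (S (Suc j) \<omega> - S j \<omega>)) \<le> (S n \<omega>)\<^sup>2 - (m n \<omega>)\<^sup>2 / 4"
      using path[of \<omega> n] by linarith
  qed (use inc int_m SL2[of n] in auto)
  also have "\<dots> = (\<integral>\<omega>. (S n \<omega>)\<^sup>2 \<partial>M) - (\<integral>\<omega>. (m n \<omega>)\<^sup>2 \<partial>M) / 4"
    using int_m SL2[of n] by simp
  finally have *: "(\<integral>\<omega>. (m n \<omega>)\<^sup>2 \<partial>M) \<le> 4 * (\<integral>\<omega>. (S n \<omega>)\<^sup>2 \<partial>M)" by simp
  have "(\<integral>\<^sup>+\<omega>. (SUP j\<in>{..n}. ennreal ((N (t j) \<omega>)\<^sup>2)) \<partial>M) \<le> (\<integral>\<^sup>+\<omega>. ennreal ((m n \<omega>)\<^sup>2) \<partial>M)"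
  proof (intro nn_integral_mono SUP_least ennreal_leI)
    fix \<omega> j assume "j \<in> {..n}"
    then have "S j \<omega> \<le> m n \<omega>" by (intro m_ge) simp
    then have "(S j \<omega>)\<^sup>2 \<le> (m n \<omega>)\<^sup>2" using S0 by (intro power_mono)
    then show "(N (t j) \<omega>)\<^sup>2 \<le> (m n \<omega>)\<^sup>2" by (simp add: S_def)
  qed
  also have "\<dots> = ennreal (\<integral>\<omega>. (m n \<omega>)\<^sup>2 \<partial>M)" by (rule nn_integral_eq_integral[OF int_m]) simp
  also have "\<dots> \<le> ennreal (4 * (\<integral>\<omega>. (S n \<omega>)\<^sup>2 \<partial>M))" using * by (rule ennreal_leI)
  also have "\<dots> = 4 * ennreal (\<integral>\<omega>. (S n \<omega>)\<^sup>2 \<partial>M)" by (simp add: ennreal_mult)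
  also have "ennreal (\<integral>\<omega>. (S n \<omega>)\<^sup>2 \<partial>M) = (\<integral>\<^sup>+\<omega>. ennreal ((S n \<omega>)\<^sup>2) \<partial>M)"
    by (rule nn_integral_eq_integral[symmetric]) (use SL2[of n] in auto)
  finally show ?thesis by (simp add: S_def)
qed

text \<open>All grids end at \<open>T\<close>, so the discrete inequality has the same right side
  for each of them, and Fatou's lemma passes to the supremum over the whole interval.\<close>

lemma doob:
  assumes N: "l2_martingale N" and cont: "AE \<omega> in M. continuous_on {0..T} (\<lambda>t. N t \<omega>)"
  shows "(\<integral>\<^sup>+\<omega>. sup_sq T (\<lambda>t. N t \<omega>) \<partial>M) \<le> 4 * (\<integral>\<^sup>+\<omega>. ennreal ((N T \<omega>)\<^sup>2) \<partial>M)"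
proof -
  have gT: "gridpt T k (Suc k) = T" for k by (simp add: gridpt_def)
  have "(\<integral>\<^sup>+\<omega>. sup_sq T (\<lambda>t. N t \<omega>) \<partial>M) = (\<integral>\<^sup>+\<omega>. liminf (\<lambda>k. grid_sup_sq T k (\<lambda>t. N t \<omega>)) \<partial>M)"
    by (rule nn_integral_cong_AE) (use cont in \<open>auto simp: sup_sq_eq_liminf_grid[OF T_pos]\<close>)
  also have "\<dots> \<le> liminf (\<lambda>k. \<integral>\<^sup>+\<omega>. grid_sup_sq T k (\<lambda>t. N t \<omega>) \<partial>M)"
  proof (rule nn_integral_liminf)
    fix k
    show "(\<lambda>\<omega>. grid_sup_sq T k (\<lambda>t. N t \<omega>)) \<in> borel_measurable M"
      unfolding grid_sup_sq_def
      by (intro borel_measurable_SUP measurable_compose[OF _ measurable_ennreal]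
          borel_measurable_power l2_martingaleD(2)[OF N] gridpt_mem[OF T_pos]) auto
  qed
  also have "\<dots> \<le> liminf (\<lambda>k::nat. 4 * (\<integral>\<^sup>+\<omega>. ennreal ((N T \<omega>)\<^sup>2) \<partial>M))"
  proof (intro Liminf_mono always_eventually allI)
    fix k
    show "(\<integral>\<^sup>+\<omega>. grid_sup_sq T k (\<lambda>t. N t \<omega>) \<partial>M) \<le> 4 * (\<integral>\<^sup>+\<omega>. ennreal ((N T \<omega>)\<^sup>2) \<partial>M)"
      unfolding grid_sup_sq_def
      using doob_discrete[OF N, of "Suc k" "gridpt T k"] gridpt_mem[OF T_pos, of _ k] gridpt_mono[OF T_pos, of _ _ k]
      by (simp add: gT)
  qed
  finally show ?thesis by (simp add: Liminf_const)
qed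

end

section \<open>Stochastic integrals as martingales\<close>

context sub_filtration
begin

lemma brownian_increment:
  assumes bm: "brownian_motion M H T W" and st: "0 \<le> s" "s < t" "t \<le> T"
  shows "integrable M (\<lambda>\<omega>. (W t \<omega> - W s \<omega>)\<^sup>2)"
    and "\<And>Z. Z \<in> borel_measurable (H s) \<Longrightarrow> integrable M Z \<Longrightarrow> (\<integral>\<omega>. Z \<omega> * (W t \<omega> - W s \<omega>) \<partial>M) = 0"
proof -
  let ?D = "\<lambda>\<omega>. W t \<omega> - W s \<omega>"
  have dist: "distributed M lborel ?D (normal_density 0 (sqrt (t - s)))"
    and ind: "indep_set (sets (H s)) (sets (vimage_algebra (space M) ?D borel))"
    using bm st unfolding brownian_motion_def by auto
  have \<sigma>: "0 < sqrt (t - s)" using st by simp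
  have s: "s \<in> {0..T}" using st by auto
  have Dm: "?D \<in> borel_measurable M" using dist by (simp add: distributed_def)
  show "integrable M (\<lambda>\<omega>. (?D \<omega>)\<^sup>2)"
    using distributed_integrable[OF dist, of "\<lambda>x. x\<^sup>2"] integrable_normal_moment[OF \<sigma>, of 0 2] by simp
  have iD: "integrable M ?D"
    using distributed_integrable[OF dist, of "\<lambda>x. x"] integrable_normal_moment[OF \<sigma>, of 0 1] by simp
  have ED: "expectation ?D = 0"
    by (rule normal_distributed_expectation[OF \<sigma> dist])
  fix Z :: "'a \<Rightarrow> real" assume Z: "Z \<in> borel_measurable (H s)" "integrable M Z"
  have "indep_var borel Z borel ?D"
    unfolding indep_var_eq
  proof (intro conjI)
    show "Z \<in> borel_measurable M" using Z(2) by simp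
    show "?D \<in> borel_measurable M" by (rule Dm)
    have 1: "sigma_sets (space M) {Z -` A \<inter> space M |A. A \<in> sets borel} \<subseteq> sets (H s)"
      using sets.sigma_sets_subset[of "{Z -` A \<inter> space M |A. A \<in> sets borel}" "H s"]
        measurable_sets[OF Z(1)] by (auto simp: space_H[OF s])
    have 2: "sets (vimage_algebra (space M) ?D borel) = sigma_sets (space M) {?D -` A \<inter> space M |A. A \<in> sets borel}"
      by (rule sets_vimage_algebra)
    show "indep_set (sigma_sets (space M) {Z -` A \<inter> space M |A. A \<in> sets borel})
       (sigma_sets (space M) {?D -` A \<inter> space M |A. A \<in> sets borel})"
    proof (rule indep_setI)
      show "sigma_sets (space M) {Z -` A \<inter> space M |A. A \<in> sets borel} \<subseteq> events"
        using 1 sets_H[OF s] by auto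
      show "sigma_sets (space M) {?D -` A \<inter> space M |A. A \<in> sets borel} \<subseteq> events"
        using Dm by (intro sets.sigma_sets_subset) (auto intro: measurable_sets)
      show "prob (a \<inter> b) = prob a * prob b"
        if "a \<in> sigma_sets (space M) {Z -` A \<inter> space M |A. A \<in> sets borel}"
          "b \<in> sigma_sets (space M) {?D -` A \<inter> space M |A. A \<in> sets borel}" for a b
        by (rule indep_setD[OF ind]) (use that 1 2 in auto)
    qed
  qed
  then show "(\<integral>\<omega>. Z \<omega> * ?D \<omega> \<partial>M) = 0"
    using indep_var_lebesgue_integral[OF _ Z(2) iD] ED by simp
qed

lemma simple_term_l2_martingale:
  assumes bm: "brownian_motion M H T W" and ab: "0 \<le> a" "a \<le> b" "b \<le> T"
    and \<zeta>: "\<zeta> \<in> borel_measurable (H a)" and B: "\<And>\<omega>. \<omega> \<in> space M \<Longrightarrow> \<bar>\<zeta> \<omega>\<bar> \<le> B"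
  shows "l2_martingale (\<lambda>t \<omega>. \<zeta> \<omega> * (W (min t b) \<omega> - W (min t a) \<omega>))"
proof -
  have Wad: "W t \<in> borel_measurable (H t)" if "t \<in> {0..T}" for t
    using bm that by (auto simp: brownian_motion_def adapted_def)
  have a: "a \<in> {0..T}" using ab by auto
  have \<zeta>M: "\<zeta> \<in> borel_measurable M" using H_measurable[OF \<zeta> a] .
  have WM: "W t \<in> borel_measurable M" if "t \<in> {0..T}" for t using H_measurable[OF Wad[OF that] that] .
  have sq: "integrable M (\<lambda>\<omega>. (W v \<omega> - W u \<omega>)\<^sup>2)" if "0 \<le> u" "u \<le> v" "v \<le> T" for u v
    using brownian_increment(1)[OF bm, of u v] that by (cases "u = v") auto
  show ?thesis
    unfolding l2_martingale_def
  proof (intro conjI ballI allI impI)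
    fix t assume t: "t \<in> {0..T}"
    show "(\<lambda>\<omega>. \<zeta> \<omega> * (W (min t b) \<omega> - W (min t a) \<omega>)) \<in> borel_measurable (H t)"
    proof (cases "t \<le> a")
      case True
      then have "(\<lambda>\<omega>. \<zeta> \<omega> * (W (min t b) \<omega> - W (min t a) \<omega>)) = (\<lambda>\<omega>. 0)"
        using ab by (auto simp: min_def)
      then show ?thesis by simp
    next
      case False
      have "\<zeta> \<in> borel_measurable (H t)" by (rule H_measurable_mono[OF \<zeta>]) (use ab t False in auto)
      moreover have "W (min t b) \<in> borel_measurable (H t)"
        by (rule H_measurable_mono[OF Wad[of "min t b"]]) (use ab t in \<open>auto simp: min_def\<close>)
      moreover have "W (min t a) \<in> borel_measurable (H t)"
        by (rule H_measurable_mono[OF Wad[of "min t a"]]) (use ab t in \<open>auto simp: min_def\<close>)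
      ultimately show ?thesis by measurable
    qed
    have m: "0 \<le> min t a" "min t a \<le> min t b" "min t b \<le> T" using t ab by auto
    show "integrable M (\<lambda>\<omega>. (\<zeta> \<omega> * (W (min t b) \<omega> - W (min t a) \<omega>))\<^sup>2)"
    proof (rule Bochner_Integration.integrable_bound[OF Bochner_Integration.integrable_mult_right[OF sq[OF m], of "B\<^sup>2"]])
      show "(\<lambda>\<omega>. (\<zeta> \<omega> * (W (min t b) \<omega> - W (min t a) \<omega>))\<^sup>2) \<in> borel_measurable M"
        using \<zeta>M WM[of "min t b"] WM[of "min t a"] m by auto
      show "AE \<omega> in M. norm ((\<zeta> \<omega> * (W (min t b) \<omega> - W (min t a) \<omega>))\<^sup>2)
          \<le> norm (B\<^sup>2 * (W (min t b) \<omega> - W (min t a) \<omega>)\<^sup>2)"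
      proof (rule AE_I2)
        fix \<omega> assume "\<omega> \<in> space M"
        then have "(\<zeta> \<omega>)\<^sup>2 \<le> B\<^sup>2" using B by (metis abs_ge_zero power2_abs power_mono)
        then show "norm ((\<zeta> \<omega> * (W (min t b) \<omega> - W (min t a) \<omega>))\<^sup>2)
          \<le> norm (B\<^sup>2 * (W (min t b) \<omega> - W (min t a) \<omega>)\<^sup>2)"
          by (simp add: power_mult_distrib mult_right_mono)
      qed
    qed
  next
    fix s t and Z :: "'a \<Rightarrow> real"
    assume st: "0 \<le> s" "s \<le> t" "t \<le> T" and Z: "Z \<in> borel_measurable (H s)" "integrable M (\<lambda>\<omega>. (Z \<omega>)\<^sup>2)"
    have ZM: "Z \<in> borel_measurable M" by (rule H_measurable[OF Z(1)]) (use st in auto)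
    show "(\<integral>\<omega>. Z \<omega> * (\<zeta> \<omega> * (W (min t b) \<omega> - W (min t a) \<omega>) - \<zeta> \<omega> * (W (min s b) \<omega> - W (min s a) \<omega>)) \<partial>M) = 0"
    \<comment> \<open>Between \<open>s\<close> and \<open>t\<close> the term changes only on the
      interval from \<open>max s a\<close> to \<open>min t b\<close>. If it is empty there is no
      increment. Otherwise both \<open>Z\<close> and \<open>\<zeta>\<close> are known at its left
      end, and the increment over it is independent of them and centred.\<close>
    proof (cases "max s a < min t b")
      case False
      then have "W (min t b) \<omega> - W (min t a) \<omega> = W (min s b) \<omega> - W (min s a) \<omega>" for \<omega>
        using ab st by (auto simp: min_def max_def split: if_splits)
      then show ?thesis by simp
    next
      case True
      define u v where "u = max s a" and "v = min t b"
      have uv: "0 \<le> u" "u < v" "v \<le> T" using True st ab by (auto simp: u_def v_def)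
      have eq: "W (min t b) \<omega> - W (min t a) \<omega> - (W (min s b) \<omega> - W (min s a) \<omega>) = W v \<omega> - W u \<omega>" for \<omega>
        using True ab st by (auto simp: u_def v_def min_def max_def split: if_splits)
      have "(\<integral>\<omega>. Z \<omega> * (\<zeta> \<omega> * (W (min t b) \<omega> - W (min t a) \<omega>) - \<zeta> \<omega> * (W (min s b) \<omega> - W (min s a) \<omega>)) \<partial>M)
        = (\<integral>\<omega>. (Z \<omega> * \<zeta> \<omega>) * (W v \<omega> - W u \<omega>) \<partial>M)"
        unfolding eq[symmetric] by (rule Bochner_Integration.integral_cong) (auto simp: algebra_simps)
      also have "\<dots> = 0"
      proof (rule brownian_increment(2)[OF bm uv])
        have "Z \<in> borel_measurable (H u)" "\<zeta> \<in> borel_measurable (H u)"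
          by (rule H_measurable_mono[OF Z(1)] H_measurable_mono[OF \<zeta>]; use uv st ab in \<open>auto simp: u_def\<close>)+
        then show "(\<lambda>\<omega>. Z \<omega> * \<zeta> \<omega>) \<in> borel_measurable (H u)" by measurable
        show "integrable M (\<lambda>\<omega>. Z \<omega> * \<zeta> \<omega>)"
        proof (rule integrable_mult_square[OF ZM \<zeta>M Z(2)])
          show "integrable M (\<lambda>\<omega>. (\<zeta> \<omega>)\<^sup>2)"
            by (rule integrable_const_bound[of _ "B\<^sup>2"])
              (use B \<zeta>M in \<open>auto intro!: AE_I2 simp: abs_le_square_iff[symmetric] intro: order_trans[OF B abs_ge_self]\<close>)
        qed
      qed
      finally show ?thesis .
    qed
  qed
qed

lemma simple_integral_l2_martingale:
  assumes bm: "brownian_motion M H T W" and \<zeta>: "simple_integrand M H T m \<tau> \<zeta>"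
  shows "l2_martingale (simple_integral W m \<tau> \<zeta>)"
  unfolding simple_integral_def[abs_def]
proof (rule l2_martingale_sum)
  fix j assume "j \<in> {..<m}"
  then have "0 \<le> \<tau> j" "\<tau> j \<le> \<tau> (Suc j)" "\<tau> (Suc j) \<le> T" "\<zeta> j \<in> borel_measurable (H (\<tau> j))"
    "\<exists>B. \<forall>\<omega>\<in>space M. \<bar>\<zeta> j \<omega>\<bar> \<le> B"
    using \<zeta> by (auto simp: simple_integrand_def)
  then show "l2_martingale (\<lambda>t \<omega>. \<zeta> j \<omega> * (W (min t (\<tau> (Suc j))) \<omega> - W (min t (\<tau> j)) \<omega>))"
    using simple_term_l2_martingale[OF bm] by blast
qed

text \<open>Subtracting the vanishing pairing of \<open>Z\<close> with the increment of
  \<open>J k\<close> writes the pairing with the increment of \<open>I\<close> as one with the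
  increment of \<open>I - J k\<close>. By the Cauchy-Schwarz inequality this is small in
  \<open>k\<close>, while its value does not depend on \<open>k\<close>.\<close>

lemma l2_martingale_limit:
  assumes J: "\<And>k. l2_martingale (J k)" and I: "\<And>t. t \<in> {0..T} \<Longrightarrow> I t \<in> borel_measurable (H t)"
    and lim: "\<And>t. t \<in> {0..T} \<Longrightarrow> (\<lambda>k. \<integral>\<^sup>+\<omega>. ennreal ((J k t \<omega> - I t \<omega>)\<^sup>2) \<partial>M) \<longlonglongrightarrow> 0"
  shows "l2_martingale I"
proof -
  have IM: "I t \<in> borel_measurable M" if "t \<in> {0..T}" for t using H_measurable[OF I[OF that] that] .
  have ev: "\<forall>\<^sub>F k in sequentially. integrable M (\<lambda>\<omega>. (J k t \<omega> - I t \<omega>)\<^sup>2)" if t: "t \<in> {0..T}" for t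
  proof -
    have "\<forall>\<^sub>F k in sequentially. (\<integral>\<^sup>+\<omega>. ennreal ((J k t \<omega> - I t \<omega>)\<^sup>2) \<partial>M) < 1"
      by (rule order_tendstoD(2)[OF lim[OF t]]) simp
    then show ?thesis
    proof eventually_elim
      case (elim k)
      show ?case
        by (subst integrable_square_iff)
          (use l2_martingaleD(2)[OF J t] IM[OF t] less_trans[OF elim ennreal_one_less_top] in auto)
    qed
  qed
  have I2: "integrable M (\<lambda>\<omega>. (I t \<omega>)\<^sup>2)" if t: "t \<in> {0..T}" for t
  proof -
    obtain k where k: "integrable M (\<lambda>\<omega>. (J k t \<omega> - I t \<omega>)\<^sup>2)"
      using ev[OF t] by (auto simp: eventually_sequentially)
    have "integrable M (\<lambda>\<omega>. (J k t \<omega> - (J k t \<omega> - I t \<omega>))\<^sup>2)"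
      by (rule integrable_square_diff[OF l2_martingaleD(2)[OF J t] _ l2_martingaleD(3)[OF J t] k])
        (rule borel_measurable_diff[OF l2_martingaleD(2)[OF J t] IM[OF t]])
    then show ?thesis by simp
  qed
  show ?thesis
    unfolding l2_martingale_def
  proof (intro conjI ballI allI impI)
    fix t assume t: "t \<in> {0..T}"
    show "I t \<in> borel_measurable (H t)" by (rule I[OF t])
    show "integrable M (\<lambda>\<omega>. (I t \<omega>)\<^sup>2)" by (rule I2[OF t])
  next
    fix s t and Z :: "'a \<Rightarrow> real"
    assume st: "0 \<le> s" "s \<le> t" "t \<le> T" and Z: "Z \<in> borel_measurable (H s)" "integrable M (\<lambda>\<omega>. (Z \<omega>)\<^sup>2)"
    have s: "s \<in> {0..T}" and t: "t \<in> {0..T}" using st by auto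
    have [measurable]: "Z \<in> borel_measurable M" by (rule H_measurable[OF Z(1) s])
    have [measurable]: "I t \<in> borel_measurable M" "I s \<in> borel_measurable M"
      "J k t \<in> borel_measurable M" "J k s \<in> borel_measurable M" for k
      using IM[OF t] IM[OF s] l2_martingaleD(2)[OF J t] l2_martingaleD(2)[OF J s] by auto
    have int: "integrable M (\<lambda>\<omega>. Z \<omega> * (I t \<omega> - I s \<omega>))"
      by (intro integrable_mult_square integrable_square_diff Z I2 s t) measurable
    define c where "c = (\<integral>\<omega>. Z \<omega> * (I t \<omega> - I s \<omega>) \<partial>M)"
    define E where "E u k = (\<integral>\<^sup>+\<omega>. ennreal ((J k u \<omega> - I u \<omega>)\<^sup>2) \<partial>M)" for u k
    have le: "ennreal (c\<^sup>2) \<le> (\<integral>\<^sup>+\<omega>. ennreal ((Z \<omega>)\<^sup>2) \<partial>M) * (2 * E t k + 2 * E s k)" for k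
    proof -
      let ?d = "\<lambda>\<omega>. (I t \<omega> - J k t \<omega>) - (I s \<omega> - J k s \<omega>)"
      have Jo: "(\<integral>\<omega>. Z \<omega> * (J k t \<omega> - J k s \<omega>) \<partial>M) = 0" "integrable M (\<lambda>\<omega>. Z \<omega> * (J k t \<omega> - J k s \<omega>))"
        using l2_martingale_orthogonal[OF J st Z] by auto
      have "(\<integral>\<omega>. Z \<omega> * ?d \<omega> \<partial>M) = (\<integral>\<omega>. Z \<omega> * (I t \<omega> - I s \<omega>) - Z \<omega> * (J k t \<omega> - J k s \<omega>) \<partial>M)"
        by (rule Bochner_Integration.integral_cong) (auto simp: algebra_simps)
      also have "\<dots> = c" using int Jo by (simp add: c_def)
      finally have c: "c = (\<integral>\<omega>. Z \<omega> * ?d \<omega> \<partial>M)" ..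
      have "integrable M (\<lambda>\<omega>. Z \<omega> * (I t \<omega> - I s \<omega>) - Z \<omega> * (J k t \<omega> - J k s \<omega>))" using int Jo by simp
      then have id: "integrable M (\<lambda>\<omega>. Z \<omega> * ?d \<omega>)" by (simp add: algebra_simps)
      have "ennreal (c\<^sup>2) = (ennreal (norm c))\<^sup>2" by (simp add: ennreal_power)
      also have "\<dots> \<le> (\<integral>\<^sup>+\<omega>. ennreal (norm (Z \<omega> * ?d \<omega>)) \<partial>M)\<^sup>2"
        unfolding c using integral_norm_bound_ennreal[OF id] by (intro power_mono) auto
      also have "\<dots> = (\<integral>\<^sup>+\<omega>. ennreal \<bar>Z \<omega>\<bar> * ennreal \<bar>?d \<omega>\<bar> \<partial>M)\<^sup>2"
        by (simp add: abs_mult ennreal_mult)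
      also have "\<dots> \<le> (\<integral>\<^sup>+\<omega>. (ennreal \<bar>Z \<omega>\<bar>)\<^sup>2 \<partial>M) * (\<integral>\<^sup>+\<omega>. (ennreal \<bar>?d \<omega>\<bar>)\<^sup>2 \<partial>M)"
        by (rule Cauchy_Schwarz_nn_integral) auto
      also have "\<dots> = (\<integral>\<^sup>+\<omega>. ennreal ((Z \<omega>)\<^sup>2) \<partial>M) * (\<integral>\<^sup>+\<omega>. ennreal ((?d \<omega>)\<^sup>2) \<partial>M)"
        by (simp add: ennreal_power)
      also have "(\<integral>\<^sup>+\<omega>. ennreal ((?d \<omega>)\<^sup>2) \<partial>M) \<le> (\<integral>\<^sup>+\<omega>. 2 * ennreal ((J k t \<omega> - I t \<omega>)\<^sup>2) + 2 * ennreal ((J k s \<omega> - I s \<omega>)\<^sup>2) \<partial>M)"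
      proof (rule nn_integral_mono)
        fix \<omega>
        have "(a - b)\<^sup>2 \<le> 2 * a\<^sup>2 + 2 * b\<^sup>2" for a b :: real
          using zero_le_power2[of "a + b"] by (simp add: power2_sum power2_diff)
        from this[of "I t \<omega> - J k t \<omega>" "I s \<omega> - J k s \<omega>"]
        have "(?d \<omega>)\<^sup>2 \<le> 2 * (J k t \<omega> - I t \<omega>)\<^sup>2 + 2 * (J k s \<omega> - I s \<omega>)\<^sup>2"
          by (simp add: power2_commute)
        then have "ennreal ((?d \<omega>)\<^sup>2) \<le> ennreal (2 * (J k t \<omega> - I t \<omega>)\<^sup>2 + 2 * (J k s \<omega> - I s \<omega>)\<^sup>2)"
          by (rule ennreal_leI)
        also have "\<dots> = 2 * ennreal ((J k t \<omega> - I t \<omega>)\<^sup>2) + 2 * ennreal ((J k s \<omega> - I s \<omega>)\<^sup>2)"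
          by (simp add: ennreal_mult)
        finally show "ennreal ((?d \<omega>)\<^sup>2) \<le> 2 * ennreal ((J k t \<omega> - I t \<omega>)\<^sup>2) + 2 * ennreal ((J k s \<omega> - I s \<omega>)\<^sup>2)" .
      qed
      also have "\<dots> = 2 * E t k + 2 * E s k"
        unfolding E_def by (simp add: nn_integral_add nn_integral_cmult)
      finally show ?thesis by (simp add: mult_left_mono)
    qed
    have "(\<lambda>k. (\<integral>\<^sup>+\<omega>. ennreal ((Z \<omega>)\<^sup>2) \<partial>M) * (2 * E t k + 2 * E s k))
        \<longlonglongrightarrow> (\<integral>\<^sup>+\<omega>. ennreal ((Z \<omega>)\<^sup>2) \<partial>M) * (2 * 0 + 2 * 0)"
    proof (rule ennreal_tendsto_cmult)
      show "(\<integral>\<^sup>+\<omega>. ennreal ((Z \<omega>)\<^sup>2) \<partial>M) < \<top>"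
        using Z(2) by (simp add: integrable_square_iff)
      show "(\<lambda>k. 2 * E t k + 2 * E s k) \<longlonglongrightarrow> 2 * 0 + 2 * 0"
        unfolding E_def
        by (rule tendsto_add[OF ennreal_tendsto_cmult[OF _ lim[OF t]] ennreal_tendsto_cmult[OF _ lim[OF s]]]) auto
    qed
    then have "ennreal (c\<^sup>2) \<le> (\<integral>\<^sup>+\<omega>. ennreal ((Z \<omega>)\<^sup>2) \<partial>M) * (2 * 0 + 2 * 0)"
      by (rule LIMSEQ_le_const) (use le in auto)
    then show "(\<integral>\<omega>. Z \<omega> * (I t \<omega> - I s \<omega>) \<partial>M) = 0"
      by (simp add: c_def)
  qed
qed

lemma simple_limit_l2_martingale:
  assumes bm: "brownian_motion M H T W" and I: "adapted H T I"
    and simple: "\<And>k. simple_integrand M H T (m k) (\<tau> k) (\<zeta> k)"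
    and lim: "\<And>t. t \<in> {0..T} \<Longrightarrow>
      (\<lambda>k. \<integral>\<^sup>+\<omega>. ennreal (\<bar>simple_integral W (m k) (\<tau> k) (\<zeta> k) t \<omega> - I t \<omega>\<bar>\<^sup>2) \<partial>M) \<longlonglongrightarrow> 0"
  shows "l2_martingale I"
proof (rule l2_martingale_limit)
  show "l2_martingale (simple_integral W (m k) (\<tau> k) (\<zeta> k))" for k
    by (rule simple_integral_l2_martingale[OF bm simple])
  show "I t \<in> borel_measurable (H t)" if "t \<in> {0..T}" for t
    using I that by (auto simp: adapted_def)
  show "(\<lambda>k. \<integral>\<^sup>+\<omega>. ennreal ((simple_integral W (m k) (\<tau> k) (\<zeta> k) t \<omega> - I t \<omega>)\<^sup>2) \<partial>M) \<longlonglongrightarrow> 0"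
    if "t \<in> {0..T}" for t
    using lim[OF that] by simp
qed

end

section \<open>Gronwall's inequality and measurable processes\<close>

text \<open>Gronwall's inequality in integrated form, by absorption: for the weights \<open>exp (\<lambda> t)\<close> or
  \<open>exp (\<lambda> (T - t))\<close> with large \<open>\<lambda>\<close> the Volterra operator has norm at most 1/2.\<close>

lemma volterra_bound:
  fixes g :: "real \<Rightarrow> ennreal" and w :: "real \<Rightarrow> real"
  assumes g[measurable]: "(\<lambda>t. g t * indicator {0..T} t) \<in> borel_measurable borel"
    and w[measurable]: "w \<in> borel_measurable borel" and w1: "\<And>t. t \<in> {0..T} \<Longrightarrow> 1 \<le> w t"
    and wB: "\<And>t. t \<in> {0..T} \<Longrightarrow> w t \<le> B" and T: "0 < T"
    and P[measurable]: "Measurable.pred (borel \<Otimes>\<^sub>M borel) (\<lambda>(t, u). P t u)"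
    and ineq: "\<And>t. t \<in> {0..T} \<Longrightarrow> g t \<le> A + ennreal L * (\<integral>\<^sup>+u. g u * indicator {0..T} u * indicator {u. P t u} u \<partial>lborel)"
    and ker: "\<And>u. u \<in> {0..T} \<Longrightarrow>
      ennreal L * (\<integral>\<^sup>+t. ennreal (w t) * indicator {0..T} t * indicator {u. P t u} u \<partial>lborel) \<le> ennreal (w u / 2)"
    and fin: "(\<integral>\<^sup>+t\<in>{0..T}. g t \<partial>lborel) < \<infinity>"
  shows "(\<integral>\<^sup>+t\<in>{0..T}. g t \<partial>lborel) \<le> ennreal (2 * B * T) * A"
proof (cases "A = \<top>")
  case True
  have "0 < 2 * B * T" using T w1[of 0] wB[of 0] by auto
  then have "ennreal (2 * B * T) \<noteq> 0" by (simp only: ennreal_eq_0_iff not_le)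
  then show ?thesis using True by (simp only: ennreal_mult_top if_False top_greatest)
next
  case False
  define gi where "gi t = g t * indicator {0..T} t" for t
  have gi[measurable]: "gi \<in> borel_measurable borel" using g by (simp add: gi_def[abs_def])
  have B1: "1 \<le> B" using w1[of 0] wB[of 0] T by auto
  have Pm[measurable]: "Measurable.pred (borel \<Otimes>\<^sub>M borel) (\<lambda>z. P (fst z) (snd z))"
    using P by (simp add: case_prod_beta')
  define G where "G = (\<integral>\<^sup>+t. ennreal (w t) * gi t \<partial>lborel)"
  have le: "(\<integral>\<^sup>+t\<in>{0..T}. g t \<partial>lborel) \<le> G"
    unfolding G_def
  proof (rule nn_integral_mono)
    fix t
    show "g t * indicator {0..T} t \<le> ennreal (w t) * gi t"
    proof (cases "t \<in> {0..T}")
      case True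
      then have "1 * gi t \<le> ennreal (w t) * gi t" using w1[OF True] by (intro mult_right_mono) auto
      then show ?thesis by (simp add: gi_def)
    qed simp
  qed
  \<comment> \<open>Half of \<open>G\<close> will be moved to the left side, which is legitimate
    only for finite \<open>G\<close>; bounded weights reduce this to \<open>fin\<close>.\<close>
  have "G \<le> (\<integral>\<^sup>+t. ennreal B * gi t \<partial>lborel)"
    unfolding G_def
  proof (rule nn_integral_mono)
    fix t show "ennreal (w t) * gi t \<le> ennreal B * gi t"
      by (cases "t \<in> {0..T}") (use wB in \<open>auto simp: gi_def intro!: mult_right_mono ennreal_leI\<close>)
  qed
  also have "\<dots> = ennreal B * (\<integral>\<^sup>+t\<in>{0..T}. g t \<partial>lborel)"
    unfolding gi_def[symmetric] by (rule nn_integral_cmult) simp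
  also have "\<dots> < \<top>" using fin by (simp add: ennreal_mult_less_top)
  finally have Gfin: "G < \<top>" .
  have i1: "(\<integral>\<^sup>+t. ennreal (w t) * indicator {0..T} t \<partial>lborel) \<le> ennreal (B * T)"
  proof -
    have "(\<integral>\<^sup>+t. ennreal (w t) * indicator {0..T} t \<partial>lborel) \<le> (\<integral>\<^sup>+t. ennreal B * indicator {0..T} t \<partial>lborel)"
      by (rule nn_integral_mono) (use wB in \<open>auto simp: indicator_def ennreal_leI\<close>)
    also have "\<dots> = ennreal (B * T)"
      using T B1 by (simp add: nn_integral_cmult ennreal_mult)
    finally show ?thesis .
  qed
  have "G \<le> (\<integral>\<^sup>+t. A * (ennreal (w t) * indicator {0..T} t)
      + (\<integral>\<^sup>+u. ennreal L * (ennreal (w t) * indicator {0..T} t * (gi u * indicator {u. P t u} u)) \<partial>lborel) \<partial>lborel)"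
    unfolding G_def
  proof (rule nn_integral_mono)
    fix t
    have "(\<integral>\<^sup>+u. ennreal L * (ennreal (w t) * indicator {0..T} t * (gi u * indicator {u. P t u} u)) \<partial>lborel)
      = ennreal L * (ennreal (w t) * indicator {0..T} t * (\<integral>\<^sup>+u. gi u * indicator {u. P t u} u \<partial>lborel))"
      by (simp add: nn_integral_cmult)
    moreover have "ennreal (w t) * gi t \<le> A * (ennreal (w t) * indicator {0..T} t)
      + ennreal L * (ennreal (w t) * indicator {0..T} t * (\<integral>\<^sup>+u. gi u * indicator {u. P t u} u \<partial>lborel))"
    proof (cases "t \<in> {0..T}")
      case True
      have "ennreal (w t) * gi t \<le> ennreal (w t) * (A + ennreal L * (\<integral>\<^sup>+u. gi u * indicator {u. P t u} u \<partial>lborel))"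
        using ineq[OF True] True unfolding gi_def by (intro mult_left_mono) auto
      also have "\<dots> = A * ennreal (w t) + ennreal L * (ennreal (w t) * (\<integral>\<^sup>+u. gi u * indicator {u. P t u} u \<partial>lborel))"
        by (simp only: distrib_left mult_ac)
      finally show ?thesis using True by simp
    qed (simp add: gi_def)
    ultimately show "ennreal (w t) * gi t \<le> A * (ennreal (w t) * indicator {0..T} t)
      + (\<integral>\<^sup>+u. ennreal L * (ennreal (w t) * indicator {0..T} t * (gi u * indicator {u. P t u} u)) \<partial>lborel)"
      by simp
  qed
  also have "\<dots> = A * (\<integral>\<^sup>+t. ennreal (w t) * indicator {0..T} t \<partial>lborel)
      + (\<integral>\<^sup>+t. \<integral>\<^sup>+u. ennreal L * (ennreal (w t) * indicator {0..T} t * (gi u * indicator {u. P t u} u)) \<partial>lborel \<partial>lborel)"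
    by (subst nn_integral_add) (auto simp: nn_integral_cmult)
  also have "(\<integral>\<^sup>+t. \<integral>\<^sup>+u. ennreal L * (ennreal (w t) * indicator {0..T} t * (gi u * indicator {u. P t u} u)) \<partial>lborel \<partial>lborel)
    = (\<integral>\<^sup>+u. \<integral>\<^sup>+t. ennreal L * (ennreal (w t) * indicator {0..T} t * (gi u * indicator {u. P t u} u)) \<partial>lborel \<partial>lborel)"
    by (rule lborel_pair.Fubini') measurable
  \<comment> \<open>After the exchange of the integrals the inner one runs over the weight alone,
    and \<open>ker\<close> bounds it by half of the weight at \<open>u\<close>.\<close>
  also have "\<dots> \<le> (\<integral>\<^sup>+u. ennreal (1 / 2) * (ennreal (w u) * gi u) \<partial>lborel)"
  proof (rule nn_integral_mono)
    fix u
    show "(\<integral>\<^sup>+t. ennreal L * (ennreal (w t) * indicator {0..T} t * (gi u * indicator {u. P t u} u)) \<partial>lborel)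
      \<le> ennreal (1 / 2) * (ennreal (w u) * gi u)"
    proof (cases "u \<in> {0..T}")
      case True
      have "(\<integral>\<^sup>+t. ennreal L * (ennreal (w t) * indicator {0..T} t * (gi u * indicator {u. P t u} u)) \<partial>lborel)
        = (\<integral>\<^sup>+t. gi u * ennreal L * (ennreal (w t) * indicator {0..T} t * indicator {u. P t u} u) \<partial>lborel)"
        by (rule nn_integral_cong) (simp only: mult_ac)
      also have "\<dots> = gi u * ennreal L * (\<integral>\<^sup>+t. ennreal (w t) * indicator {0..T} t * indicator {u. P t u} u \<partial>lborel)"
        by (rule nn_integral_cmult) measurable
      also have "\<dots> \<le> gi u * ennreal (w u / 2)"
        unfolding mult.assoc[of "gi u"] by (intro mult_left_mono ker True) auto
      also have "ennreal (w u / 2) = ennreal (1 / 2) * ennreal (w u)"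
      proof -
        have "w u / 2 = 1 / 2 * w u" by simp
        moreover have "ennreal (1 / 2 * w u) = ennreal (1 / 2) * ennreal (w u)"
          by (rule ennreal_mult) (use w1[OF True] in simp_all)
        ultimately show ?thesis by (simp only:)
      qed
      finally show ?thesis by (simp only: mult_ac)
    qed (simp add: gi_def)
  qed
  also have "\<dots> = ennreal (1 / 2) * G" unfolding G_def by (rule nn_integral_cmult) measurable
  finally have "G \<le> A * (\<integral>\<^sup>+t. ennreal (w t) * indicator {0..T} t \<partial>lborel) + ennreal (1 / 2) * G"
    by (simp only: add_left_mono)
  also have "\<dots> \<le> A * ennreal (B * T) + ennreal (1 / 2) * G"
    by (intro add_right_mono mult_left_mono i1) simp
  finally have "G \<le> A * ennreal (B * T) + ennreal (1 / 2) * G" .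
  moreover obtain Gr where Gr: "G = ennreal Gr" "0 \<le> Gr" using Gfin by (cases G) auto
  moreover obtain Ar where Ar: "A = ennreal Ar" "0 \<le> Ar" using \<open>A \<noteq> \<top>\<close> by (cases A) auto
  moreover have "ennreal Ar * ennreal (B * T) + ennreal (1 / 2) * ennreal Gr = ennreal (Ar * (B * T) + 1 / 2 * Gr)"
    using Gr(2) Ar(2) B1 T by (simp only: ennreal_mult[symmetric] ennreal_plus[symmetric] mult_nonneg_nonneg
        zero_le_divide_1_iff zero_le_numeral order_less_imp_le order_trans[OF zero_le_one])
  ultimately have "ennreal Gr \<le> ennreal (Ar * (B * T) + 1 / 2 * Gr)" by simp
  then have "Gr \<le> Ar * (B * T) + 1 / 2 * Gr"
    using Gr Ar B1 T by (subst (asm) ennreal_le_iff) auto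
  then have "Gr \<le> 2 * B * T * Ar" by (simp add: mult_ac)
  then have "G \<le> ennreal (2 * B * T) * A"
    using Gr Ar B1 T by (simp add: ennreal_mult[symmetric] ennreal_leI)
  then show ?thesis using le by (rule order_trans[rotated])
qed

lemma nn_integral_exp_interval_le:
  fixes \<kappa> :: real
  assumes "0 < \<kappa>" "a \<le> b"
  shows "(\<integral>\<^sup>+t. ennreal (exp (\<kappa> * t)) * indicator {a..b} t \<partial>lborel) \<le> ennreal (exp (\<kappa> * b) / \<kappa>)"
    and "(\<integral>\<^sup>+t. ennreal (exp (\<kappa> * (T - t))) * indicator {a..b} t \<partial>lborel) \<le> ennreal (exp (\<kappa> * (T - a)) / \<kappa>)"
proof -
  have "(\<integral>\<^sup>+t. ennreal (exp (\<kappa> * t)) * indicator {a..b} t \<partial>lborel) = ennreal (exp (\<kappa> * b) / \<kappa> - exp (\<kappa> * a) / \<kappa>)"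
    using assms by (intro nn_integral_FTC_Icc) (auto intro!: derivative_eq_intros)
  then show "(\<integral>\<^sup>+t. ennreal (exp (\<kappa> * t)) * indicator {a..b} t \<partial>lborel) \<le> ennreal (exp (\<kappa> * b) / \<kappa>)"
    using assms by (simp add: ennreal_leI)
  have "(\<integral>\<^sup>+t. ennreal (exp (\<kappa> * (T - t))) * indicator {a..b} t \<partial>lborel)
      = ennreal (- exp (\<kappa> * (T - b)) / \<kappa> - (- exp (\<kappa> * (T - a)) / \<kappa>))"
    using assms by (intro nn_integral_FTC_Icc) (auto intro!: derivative_eq_intros)
  then show "(\<integral>\<^sup>+t. ennreal (exp (\<kappa> * (T - t))) * indicator {a..b} t \<partial>lborel) \<le> ennreal (exp (\<kappa> * (T - a)) / \<kappa>)"
    using assms by (simp add: ennreal_leI)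
qed

text \<open>The rate \<open>2 * L + 1\<close> stays positive for \<open>L = 0\<close> and makes
  \<open>L / (2 * L + 1)\<close> at most 1/2. The weight decreases in \<open>t\<close> because the
  kernel, read for fixed \<open>u\<close>, integrates over the later times \<open>t\<close>; in the
  backward version it is reversed.\<close>

lemma gronwall_forward:
  fixes g :: "real \<Rightarrow> ennreal"
  assumes g: "(\<lambda>t. g t * indicator {0..T} t) \<in> borel_measurable borel" and T: "0 < T" and L: "0 \<le> L"
    and ineq: "\<And>t. t \<in> {0..T} \<Longrightarrow> g t \<le> A + ennreal L * (\<integral>\<^sup>+u\<in>{0..t}. g u \<partial>lborel)"
    and fin: "(\<integral>\<^sup>+t\<in>{0..T}. g t \<partial>lborel) < \<infinity>"
  shows "(\<integral>\<^sup>+t\<in>{0..T}. g t \<partial>lborel) \<le> ennreal (2 * exp ((2 * L + 1) * T) * T) * A"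
proof (rule volterra_bound[OF g, where w="\<lambda>t. exp ((2 * L + 1) * (T - t))" and P="\<lambda>t u. u \<le> t" and L=L])
  fix t assume t: "t \<in> {0..T}"
  have "(\<integral>\<^sup>+u\<in>{0..t}. g u \<partial>lborel) = (\<integral>\<^sup>+u. g u * indicator {0..T} u * indicator {u. u \<le> t} u \<partial>lborel)"
    by (rule nn_integral_cong) (use t in \<open>auto split: split_indicator\<close>)
  then show "g t \<le> A + ennreal L * (\<integral>\<^sup>+u. g u * indicator {0..T} u * indicator {u. u \<le> t} u \<partial>lborel)"
    using ineq[OF t] by simp
next
  fix u assume u: "u \<in> {0..T}"
  let ?\<kappa> = "2 * L + 1"
  have "(\<integral>\<^sup>+t. ennreal (exp (?\<kappa> * (T - t))) * indicator {0..T} t * indicator {u. u \<le> t} u \<partial>lborel)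
    = (\<integral>\<^sup>+t. ennreal (exp (?\<kappa> * (T - t))) * indicator {u..T} t \<partial>lborel)"
    by (rule nn_integral_cong) (use u in \<open>auto split: split_indicator\<close>)
  also have "\<dots> \<le> ennreal (exp (?\<kappa> * (T - u)) / ?\<kappa>)"
    by (rule nn_integral_exp_interval_le(2)) (use u L in auto)
  finally have "ennreal L * (\<integral>\<^sup>+t. ennreal (exp (?\<kappa> * (T - t))) * indicator {0..T} t * indicator {u. u \<le> t} u \<partial>lborel)
    \<le> ennreal L * ennreal (exp (?\<kappa> * (T - u)) / ?\<kappa>)" by (rule mult_left_mono) simp
  also have "\<dots> = ennreal (L / ?\<kappa> * exp (?\<kappa> * (T - u)))" using L by (simp add: ennreal_mult[symmetric])
  also have "\<dots> \<le> ennreal (1 / 2 * exp (?\<kappa> * (T - u)))"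
    using L by (intro ennreal_leI mult_right_mono) (auto simp: divide_le_eq)
  finally show "ennreal L * (\<integral>\<^sup>+t. ennreal (exp (?\<kappa> * (T - t))) * indicator {0..T} t * indicator {u. u \<le> t} u \<partial>lborel)
    \<le> ennreal (exp (?\<kappa> * (T - u)) / 2)" by simp
next
  show "Measurable.pred (borel \<Otimes>\<^sub>M borel) (\<lambda>(t, u). u \<le> (t::real))" by measurable
qed (use T L fin in \<open>auto intro!: mult_left_mono\<close>)

lemma gronwall_backward:
  fixes g :: "real \<Rightarrow> ennreal"
  assumes g: "(\<lambda>t. g t * indicator {0..T} t) \<in> borel_measurable borel" and T: "0 < T" and L: "0 \<le> L"
    and ineq: "\<And>t. t \<in> {0..T} \<Longrightarrow> g t \<le> A + ennreal L * (\<integral>\<^sup>+u\<in>{t..T}. g u \<partial>lborel)"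
    and fin: "(\<integral>\<^sup>+t\<in>{0..T}. g t \<partial>lborel) < \<infinity>"
  shows "(\<integral>\<^sup>+t\<in>{0..T}. g t \<partial>lborel) \<le> ennreal (2 * exp ((2 * L + 1) * T) * T) * A"
proof (rule volterra_bound[OF g, where w="\<lambda>t. exp ((2 * L + 1) * t)" and P="\<lambda>t u. t \<le> u" and L=L])
  fix t assume t: "t \<in> {0..T}"
  have "(\<integral>\<^sup>+u\<in>{t..T}. g u \<partial>lborel) = (\<integral>\<^sup>+u. g u * indicator {0..T} u * indicator {u. t \<le> u} u \<partial>lborel)"
    by (rule nn_integral_cong) (use t in \<open>auto split: split_indicator\<close>)
  then show "g t \<le> A + ennreal L * (\<integral>\<^sup>+u. g u * indicator {0..T} u * indicator {u. t \<le> u} u \<partial>lborel)"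
    using ineq[OF t] by simp
next
  fix u assume u: "u \<in> {0..T}"
  let ?\<kappa> = "2 * L + 1"
  have "(\<integral>\<^sup>+t. ennreal (exp (?\<kappa> * t)) * indicator {0..T} t * indicator {u. t \<le> u} u \<partial>lborel)
    = (\<integral>\<^sup>+t. ennreal (exp (?\<kappa> * t)) * indicator {0..u} t \<partial>lborel)"
    by (rule nn_integral_cong) (use u in \<open>auto split: split_indicator\<close>)
  also have "\<dots> \<le> ennreal (exp (?\<kappa> * u) / ?\<kappa>)"
    by (rule nn_integral_exp_interval_le(1)) (use u L in auto)
  finally have "ennreal L * (\<integral>\<^sup>+t. ennreal (exp (?\<kappa> * t)) * indicator {0..T} t * indicator {u. t \<le> u} u \<partial>lborel)
    \<le> ennreal L * ennreal (exp (?\<kappa> * u) / ?\<kappa>)" by (rule mult_left_mono) simp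
  also have "\<dots> = ennreal (L / ?\<kappa> * exp (?\<kappa> * u))" using L by (simp add: ennreal_mult[symmetric])
  also have "\<dots> \<le> ennreal (1 / 2 * exp (?\<kappa> * u))"
    using L by (intro ennreal_leI mult_right_mono) (auto simp: divide_le_eq)
  finally show "ennreal L * (\<integral>\<^sup>+t. ennreal (exp (?\<kappa> * t)) * indicator {0..T} t * indicator {u. t \<le> u} u \<partial>lborel)
    \<le> ennreal (exp (?\<kappa> * u) / 2)" by simp
next
  show "Measurable.pred (borel \<Otimes>\<^sub>M borel) (\<lambda>(t, u). t \<le> (u::real))" by measurable
qed (use T L fin in \<open>auto intro!: mult_left_mono\<close>)

text \<open>\<open>measurable_process\<close> speaks of a restricted time axis. Clamping the time
  extends the process to the whole line, where Fubini's theorem for \<open>lborel\<close> applies,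
  without changing it on \<open>{0..T}\<close>.\<close>

lemma measurable_process_clamp:
  assumes H: "measurable_process M T H" and T: "0 \<le> T"
  shows "(\<lambda>z. H (max 0 (min T (fst z))) (snd z)) \<in> borel_measurable (borel \<Otimes>\<^sub>M M)"
proof -
  have "(\<lambda>z. (max 0 (min T (fst z)), snd z)) \<in> borel \<Otimes>\<^sub>M M \<rightarrow>\<^sub>M restrict_space borel {0..T} \<Otimes>\<^sub>M M"
    by (intro measurable_Pair measurable_restrict_space2) (use T in auto)
  from measurable_compose[OF this H[unfolded measurable_process_def]] show ?thesis by simp
qed

lemma measurable_process_indicator:
  assumes H: "measurable_process M T H" and T: "0 \<le> T"
  shows "(\<lambda>z. indicator {0..T} (fst z) * H (fst z) (snd z)) \<in> borel_measurable (lborel \<Otimes>\<^sub>M M)"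
proof -
  have [measurable]: "(\<lambda>z. H (max 0 (min T (fst z))) (snd z)) \<in> borel_measurable (lborel \<Otimes>\<^sub>M M)"
    using measurable_process_clamp[OF H T]
    by (simp add: measurable_cong_sets[OF sets_pair_measure_cong[OF sets_lborel refl] refl])
  have "(\<lambda>z. indicator {0..T} (fst z) * H (max 0 (min T (fst z))) (snd z)) \<in> borel_measurable (lborel \<Otimes>\<^sub>M M)"
    by measurable
  moreover have "(\<lambda>z. indicator {0..T} (fst z) * H (max 0 (min T (fst z))) (snd z))
      = (\<lambda>z. indicator {0..T} (fst z) * H (fst z) (snd z))"
    by (rule ext) (auto split: split_indicator)
  ultimately show ?thesis by simp
qed

lemma measurable_process_path:
  assumes H: "measurable_process M T H" and w: "\<omega> \<in> space M" and T: "0 \<le> T"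
  shows "(\<lambda>t. indicator {0..T} t * H t \<omega>) \<in> borel_measurable lborel"
  using measurable_compose[OF measurable_Pair2'[OF w] measurable_process_indicator[OF H T]] by simp

lemma measurable_process_nn_integral:
  assumes H: "measurable_process M T H" and T: "0 \<le> T" and f: "f \<in> borel_measurable borel" and A: "A \<in> sets borel" "A \<subseteq> {0..T}"
  shows "(\<lambda>\<omega>. \<integral>\<^sup>+t\<in>A. ennreal (f (H t \<omega>)) \<partial>lborel) \<in> borel_measurable M"
proof -
  note [measurable] = measurable_process_clamp[OF H T] f A(1)
  have "(\<lambda>z. H (max 0 (min T (snd z))) (fst z)) \<in> borel_measurable (M \<Otimes>\<^sub>M lborel)"
    using measurable_compose[OF measurable_pair_swap' measurable_process_clamp[OF H T]]
    by (simp add: case_prod_beta' measurable_cong_sets[OF sets_pair_measure_cong[OF refl sets_lborel] refl])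
  note [measurable] = this
  have "(\<lambda>\<omega>. \<integral>\<^sup>+t. ennreal (f (H (max 0 (min T t)) \<omega>)) * indicator A t \<partial>lborel) \<in> borel_measurable M"
    by measurable
  moreover have "(\<integral>\<^sup>+t. ennreal (f (H (max 0 (min T t)) \<omega>)) * indicator A t \<partial>lborel) = (\<integral>\<^sup>+t\<in>A. ennreal (f (H t \<omega>)) \<partial>lborel)" for \<omega>
    by (rule nn_integral_cong) (use A(2) in \<open>auto split: split_indicator simp: max_def min_def subset_eq\<close>)
  ultimately show ?thesis by simp
qed

lemma measurable_process_Fubini:
  assumes M: "sigma_finite_measure M" and H: "measurable_process M T H" and T: "0 \<le> T"
    and f[measurable]: "f \<in> borel_measurable borel" and A: "A \<in> sets borel" "A \<subseteq> {0..T}"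
  shows "(\<integral>\<^sup>+\<omega>. (\<integral>\<^sup>+t\<in>A. ennreal (f (H t \<omega>)) \<partial>lborel) \<partial>M) = (\<integral>\<^sup>+t\<in>A. (\<integral>\<^sup>+\<omega>. ennreal (f (H t \<omega>)) \<partial>M) \<partial>lborel)"
    and "(\<lambda>t. (\<integral>\<^sup>+\<omega>. ennreal (f (H t \<omega>)) \<partial>M) * indicator A t) \<in> borel_measurable borel"
proof -
  interpret M: sigma_finite_measure M by (rule M)
  interpret pair_sigma_finite M lborel by standard
  note [measurable] = A(1)
  have mc: "(\<lambda>z. H (max 0 (min T (snd z))) (fst z)) \<in> borel_measurable (M \<Otimes>\<^sub>M lborel)"
    using measurable_compose[OF measurable_pair_swap' measurable_process_clamp[OF H T]]
    by (simp add: case_prod_beta' measurable_cong_sets[OF sets_pair_measure_cong[OF refl sets_lborel] refl])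
  note [measurable] = mc
  have mc2[measurable]: "(\<lambda>z. H (max 0 (min T (fst z))) (snd z)) \<in> borel_measurable (lborel \<Otimes>\<^sub>M M)"
    using measurable_process_clamp[OF H T]
    by (simp add: measurable_cong_sets[OF sets_pair_measure_cong[OF sets_lborel refl] refl])
  have cl: "ennreal (f (H (max 0 (min T t)) \<omega>)) * indicator A t = ennreal (f (H t \<omega>)) * indicator A t" for t \<omega>
    using A(2) by (auto split: split_indicator simp: max_def min_def subset_eq)
  have "(\<integral>\<^sup>+\<omega>. (\<integral>\<^sup>+t\<in>A. ennreal (f (H t \<omega>)) \<partial>lborel) \<partial>M)
      = (\<integral>\<^sup>+\<omega>. (\<integral>\<^sup>+t. ennreal (f (H (max 0 (min T t)) \<omega>)) * indicator A t \<partial>lborel) \<partial>M)"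
    by (simp add: cl)
  also have "\<dots> = (\<integral>\<^sup>+t. (\<integral>\<^sup>+\<omega>. ennreal (f (H (max 0 (min T t)) \<omega>)) * indicator A t \<partial>M) \<partial>lborel)"
    by (rule Fubini'[symmetric]) measurable
  also have "\<dots> = (\<integral>\<^sup>+t. (\<integral>\<^sup>+\<omega>. ennreal (f (H t \<omega>)) \<partial>M) * indicator A t \<partial>lborel)"
    by (rule nn_integral_cong) (auto simp: cl split: split_indicator)
  finally show "(\<integral>\<^sup>+\<omega>. (\<integral>\<^sup>+t\<in>A. ennreal (f (H t \<omega>)) \<partial>lborel) \<partial>M) = (\<integral>\<^sup>+t\<in>A. (\<integral>\<^sup>+\<omega>. ennreal (f (H t \<omega>)) \<partial>M) \<partial>lborel)" .
  have "(\<lambda>t. (\<integral>\<^sup>+\<omega>. ennreal (f (H (max 0 (min T t)) \<omega>)) \<partial>M) * indicator A t) \<in> borel_measurable lborel"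
    by measurable
  moreover have "(\<integral>\<^sup>+\<omega>. ennreal (f (H (max 0 (min T t)) \<omega>)) \<partial>M) * indicator A t = (\<integral>\<^sup>+\<omega>. ennreal (f (H t \<omega>)) \<partial>M) * indicator A t" for t
    using A(2) by (auto split: split_indicator simp: max_def min_def subset_eq)
  ultimately show "(\<lambda>t. (\<integral>\<^sup>+\<omega>. ennreal (f (H t \<omega>)) \<partial>M) * indicator A t) \<in> borel_measurable borel"
    by simp
qed

lemma measurable_process_path_space:
  assumes "0 < T" "Y \<in> M \<rightarrow>\<^sub>M path_space T"
  shows "measurable_process M T (\<lambda>t \<omega>. Y \<omega> t)"
  using measurable_eval_pair[OF assms] by (simp add: measurable_process_def)

section \<open>The mean field process\<close>

lemma space_aug_sigma [simp]: "space (aug_sigma M S) = space M"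
  by (simp add: aug_sigma_def space_measure_of_conv)

lemma sets_aug_sigma:
  "sets (aug_sigma M S) =
     sigma_sets (space M) ({f -` A \<inter> space M | f A. f \<in> S \<and> A \<in> sets borel} \<union> null_sets M)"
  unfolding aug_sigma_def by (rule sets_measure_of) (auto dest: sets.sets_into_space)

lemma sets_aug_sigma_subset:
  assumes "\<And>f. f \<in> S \<Longrightarrow> f \<in> borel_measurable M"
  shows "sets (aug_sigma M S) \<subseteq> sets M"
  unfolding sets_aug_sigma
  by (rule sets.sigma_sets_subset) (auto intro: measurable_sets[OF assms])

lemma sets_aug_sigma_mono:
  assumes "S \<subseteq> S'" shows "sets (aug_sigma M S) \<subseteq> sets (aug_sigma M S')"
  unfolding sets_aug_sigma by (rule sigma_sets_mono') (use assms in blast)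

lemma measurable_aug_sigma:
  assumes "f \<in> S" shows "f \<in> borel_measurable (aug_sigma M S)"
proof (rule measurableI)
  fix A :: "real set" assume A: "A \<in> sets borel"
  show "f -` A \<inter> space (aug_sigma M S) \<in> sets (aug_sigma M S)"
    unfolding space_aug_sigma sets_aug_sigma using assms A by (intro sigma_sets.Basic) blast
qed simp

lemma ennreal_add_square_le: "(a + b :: ennreal)\<^sup>2 \<le> 2 * a\<^sup>2 + 2 * b\<^sup>2"
proof (cases a)
  case (real x)
  show ?thesis
  proof (cases b)
    case (real y)
    have "(x + y)\<^sup>2 \<le> 2 * x\<^sup>2 + 2 * y\<^sup>2"
      using zero_le_power2[of "x - y"] by (simp add: power2_sum power2_diff)
    then have "ennreal ((x + y)\<^sup>2) \<le> ennreal (2 * x\<^sup>2 + 2 * y\<^sup>2)" by (rule ennreal_leI)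
    also have "\<dots> = 2 * ennreal (x\<^sup>2) + 2 * ennreal (y\<^sup>2)" by (simp add: ennreal_mult)
    also have "ennreal ((x + y)\<^sup>2) = (ennreal x + ennreal y)\<^sup>2"
      using real \<open>0 \<le> x\<close> by (simp add: ennreal_power ennreal_plus[symmetric] del: ennreal_plus)
    finally show ?thesis
      using real \<open>a = ennreal x\<close> \<open>0 \<le> x\<close> by (simp add: ennreal_power)
  qed simp
qed simp

lemma nn_integral_interval_square_le:
  fixes f :: "real \<Rightarrow> ennreal"
  assumes f: "(\<lambda>t. f t * indicator {a..b} t) \<in> borel_measurable lborel" and "a \<le> b"
  shows "(\<integral>\<^sup>+t\<in>{a..b}. f t \<partial>lborel)\<^sup>2 \<le> ennreal (b - a) * (\<integral>\<^sup>+t\<in>{a..b}. (f t)\<^sup>2 \<partial>lborel)"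
proof -
  have "(\<integral>\<^sup>+t\<in>{a..b}. f t \<partial>lborel) = (\<integral>\<^sup>+t. indicator {a..b} t * (f t * indicator {a..b} t) \<partial>lborel)"
    by (rule nn_integral_cong) (auto split: split_indicator)
  also have "\<dots>\<^sup>2 \<le> (\<integral>\<^sup>+t. (indicator {a..b} t)\<^sup>2 \<partial>lborel) * (\<integral>\<^sup>+t. (f t * indicator {a..b} t)\<^sup>2 \<partial>lborel)"
    by (rule Cauchy_Schwarz_nn_integral) (use f in auto)
  also have "(\<integral>\<^sup>+t. (indicator {a..b} t :: ennreal)\<^sup>2 \<partial>lborel) = (\<integral>\<^sup>+t. indicator {a..b} t \<partial>lborel)"
    by (rule nn_integral_cong) (auto split: split_indicator)
  also have "\<dots> = ennreal (b - a)" using \<open>a \<le> b\<close> by simp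
  also have "(\<integral>\<^sup>+t. (f t * indicator {a..b} t)\<^sup>2 \<partial>lborel) = (\<integral>\<^sup>+t\<in>{a..b}. (f t)\<^sup>2 \<partial>lborel)"
    by (rule nn_integral_cong) (auto split: split_indicator)
  finally show ?thesis .
qed

lemma set_integral_abs_le:
  fixes f :: "real \<Rightarrow> real"
  shows "ennreal \<bar>LINT u:A|lborel. f u\<bar> \<le> (\<integral>\<^sup>+u\<in>A. ennreal \<bar>f u\<bar> \<partial>lborel)"
proof (cases "integrable lborel (\<lambda>x. indicator A x *\<^sub>R f x)")
  case True
  have "ennreal (norm (LINT u:A|lborel. f u)) \<le> (\<integral>\<^sup>+u. ennreal (norm (indicator A u *\<^sub>R f u)) \<partial>lborel)"
    unfolding set_lebesgue_integral_def by (rule integral_norm_bound_ennreal[OF True])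
  also have "\<dots> = (\<integral>\<^sup>+u\<in>A. ennreal \<bar>f u\<bar> \<partial>lborel)"
    by (rule nn_integral_cong) (auto split: split_indicator)
  finally show ?thesis by simp
qed (simp add: set_lebesgue_integral_def not_integrable_integral_eq)

context sub_filtration
begin

text \<open>Since the paths of \<open>N\<close> are continuous only almost surely, the uncountable
  supremum need not be measurable. Integrals of sums are going to be split, which requires a
  measurable bound; the lower limit of the grid maxima is one and agrees with the supremum almost
  surely.\<close>

lemma doob_measurable_bound:
  assumes N: "l2_martingale N" and cont: "AE \<omega> in M. continuous_on {0..T} (\<lambda>t. N t \<omega>)"
  obtains h where "h \<in> borel_measurable M" and "AE \<omega> in M. sup_sq T (\<lambda>t. N t \<omega>) \<le> h \<omega>"
    and "(\<integral>\<^sup>+\<omega>. h \<omega> \<partial>M) \<le> 4 * (\<integral>\<^sup>+\<omega>. ennreal ((N T \<omega>)\<^sup>2) \<partial>M)"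
proof
  let ?h = "\<lambda>\<omega>. liminf (\<lambda>k. grid_sup_sq T k (\<lambda>t. N t \<omega>))"
  have eq: "AE \<omega> in M. sup_sq T (\<lambda>t. N t \<omega>) = ?h \<omega>"
    using cont by eventually_elim (rule sup_sq_eq_liminf_grid[OF T_pos])
  show "?h \<in> borel_measurable M"
    unfolding grid_sup_sq_def
    by (intro borel_measurable_liminf borel_measurable_SUP measurable_compose[OF _ measurable_ennreal]
        borel_measurable_power l2_martingaleD(2)[OF N] gridpt_mem[OF T_pos]) auto
  show "AE \<omega> in M. sup_sq T (\<lambda>t. N t \<omega>) \<le> ?h \<omega>" using eq by eventually_elim simp
  have "(\<integral>\<^sup>+\<omega>. ?h \<omega> \<partial>M) = (\<integral>\<^sup>+\<omega>. sup_sq T (\<lambda>t. N t \<omega>) \<partial>M)"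
    by (rule nn_integral_cong_AE) (use eq in auto)
  then show "(\<integral>\<^sup>+\<omega>. ?h \<omega> \<partial>M) \<le> 4 * (\<integral>\<^sup>+\<omega>. ennreal ((N T \<omega>)\<^sup>2) \<partial>M)"
    using doob[OF N cont] by simp
qed

end

section \<open>The equation of the mean field process\<close>

locale mean_field =
  fixes c :: "real \<Rightarrow> ereal" and T Lc :: real and K0 S :: "real set" and p :: "path2 measure"
    and lam :: "real measure" and \<eta> \<theta> :: "real \<Rightarrow> path2 \<Rightarrow> real"
  assumes T_pos: "0 < T" and cstar_lipschitz: "Lc-lipschitz_on UNIV (cstar c)" and K0: "compact K0"
    and adm: "admissible c T K0 S p p lam \<eta> \<theta>"
begin

lemma Lc_nonneg: "0 \<le> Lc"
  using cstar_lipschitz by (rule lipschitz_on_nonneg)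

lemma cstar_measurable [measurable]: "cstar c \<in> borel_measurable borel"
  by (intro borel_measurable_continuous_onI lipschitz_on_continuous_on[OF cstar_lipschitz])

lemma cstar_diff_le: "\<bar>cstar c x - cstar c y\<bar> \<le> Lc * \<bar>x - y\<bar>"
  using lipschitz_onD[OF cstar_lipschitz, of x y] by (simp add: dist_real_def)

sublocale p: prob_space p
  using adm by (simp add: admissible_def)

lemma sets_p [measurable_cong]: "sets p = sets (path_space T)"
  using adm by (simp add: admissible_def)

lemma space_p: "space p = space (path_space T)"
  by (rule sets_eq_imp_space_eq[OF sets_p])

lemma Ybar_measurable: "t \<in> {0..T} \<Longrightarrow> Ybar t \<in> borel_measurable p"
  and Wbar_measurable: "t \<in> {0..T} \<Longrightarrow> Wbar t \<in> borel_measurable p"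
proof -
  assume t: "t \<in> {0..T}"
  have e: "(\<lambda>x::path2. x t) \<in> borel_measurable p"
    using measurable_eval[OF t] by (simp add: measurable_cong_sets[OF sets_p refl])
  have "snd \<in> borel_measurable (borel :: (real \<times> real) measure)" "fst \<in> borel_measurable (borel :: (real \<times> real) measure)"
    by (rule borel_measurable_continuous_onI, rule continuous_on_snd continuous_on_fst, rule continuous_on_id)+
  then show "Ybar t \<in> borel_measurable p" "Wbar t \<in> borel_measurable p"
    unfolding Ybar_def[abs_def] Wbar_def[abs_def] using measurable_compose[OF e] by blast+
qed

definition Ypath :: "path2 \<Rightarrow> real \<Rightarrow> real" where
  "Ypath \<omega> = (\<lambda>t\<in>{0..T}. Ybar t \<omega>)"

lemma Ypath_eq: "t \<in> {0..T} \<Longrightarrow> Ypath \<omega> t = Ybar t \<omega>"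
  by (simp add: Ypath_def)

lemma Ybar_continuous: "\<omega> \<in> space p \<Longrightarrow> continuous_on {0..T} (\<lambda>t. Ybar t \<omega>)"
  unfolding space_p Ybar_def by (simp add: space_path_space continuous_on_snd)

lemma Ypath_space:
  assumes "\<omega> \<in> space p" shows "Ypath \<omega> \<in> space (path_space T)"
proof -
  have "continuous_on {0..T} (Ypath \<omega>) \<longleftrightarrow> continuous_on {0..T} (\<lambda>t. Ybar t \<omega>)"
    by (rule continuous_on_cong) (simp_all add: Ypath_def)
  then have "continuous_on {0..T} (Ypath \<omega>)" using Ybar_continuous[OF assms] by simp
  then show ?thesis by (simp add: space_path_space Ypath_def)
qed

lemma Ypath_measurable [measurable]: "Ypath \<in> p \<rightarrow>\<^sub>M path_space T"
proof (rule measurable_path_spaceI)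
  fix t assume t: "t \<in> {0..T}"
  then show "(\<lambda>\<omega>. Ypath \<omega> t) \<in> borel_measurable p"
    using Ybar_measurable[OF t] by (simp add: Ypath_def)
qed (rule Ypath_space)

lemma Ylaw_eq: "Ylaw T p = distr p (path_space T) Ypath"
  by (simp add: Ylaw_def Ypath_def[abs_def])

lemma cstar_Ybar_integrable: "t \<in> {0..T} \<Longrightarrow> integrable p (\<lambda>\<omega>. cstar c (Ybar t \<omega> - x))"
proof -
  assume t: "t \<in> {0..T}"
  then have "integrable (Ylaw_at p t) (\<lambda>y. cstar c (y - x))"
    using adm by (simp add: admissible_def)
  then show ?thesis
    unfolding Ylaw_at_def by (subst (asm) integrable_distr_eq[OF Ybar_measurable[OF t]]) measurable
qed

definition drift :: "real \<Rightarrow> real \<Rightarrow> real" where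
  "drift u x = (\<integral>y. cstar c (y - x) \<partial>Ylaw_at p u)"

lemma drift_eq: "u \<in> {0..T} \<Longrightarrow> drift u x = (\<integral>\<omega>. cstar c (Ybar u \<omega> - x) \<partial>p)"
  unfolding drift_def Ylaw_at_def by (rule integral_distr[OF Ybar_measurable]) measurable

lemma drift_diff_le:
  assumes u: "u \<in> {0..T}" shows "\<bar>drift u x - drift u y\<bar> \<le> Lc * \<bar>x - y\<bar>"
proof -
  have "drift u x - drift u y = (\<integral>\<omega>. cstar c (Ybar u \<omega> - x) - cstar c (Ybar u \<omega> - y) \<partial>p)"
    unfolding drift_eq[OF u] using cstar_Ybar_integrable[OF u] by simp
  also have "\<bar>\<dots>\<bar> \<le> (\<integral>\<omega>. \<bar>cstar c (Ybar u \<omega> - x) - cstar c (Ybar u \<omega> - y)\<bar> \<partial>p)"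
    by (rule integral_abs_bound)
  also have "\<dots> \<le> (\<integral>\<omega>. Lc * \<bar>x - y\<bar> \<partial>p)"
  proof (rule integral_mono)
    show "integrable p (\<lambda>\<omega>. \<bar>cstar c (Ybar u \<omega> - x) - cstar c (Ybar u \<omega> - y)\<bar>)"
      using cstar_Ybar_integrable[OF u] by simp
    fix \<omega>
    show "\<bar>cstar c (Ybar u \<omega> - x) - cstar c (Ybar u \<omega> - y)\<bar> \<le> Lc * \<bar>x - y\<bar>"
      using cstar_diff_le[of "Ybar u \<omega> - x" "Ybar u \<omega> - y"] by (simp add: abs_minus_commute)
  qed simp
  finally show ?thesis by (simp add: p.prob_space)
qed

text \<open>Clamping keeps the evaluation of the path inside \<open>{0..T}\<close>, where it is
  jointly measurable in time and path. The claim is then measurability in a parameter of an integral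
  over \<open>p\<close>.\<close>

lemma drift_measurable:
  "(\<lambda>z. drift (max 0 (min T (fst z))) (snd z)) \<in> borel_measurable (borel \<Otimes>\<^sub>M borel)"
proof -
  have "(\<lambda>z. Ypath (snd z) (max 0 (min T (fst z)))) \<in> borel_measurable (borel \<Otimes>\<^sub>M p)"
    using measurable_process_clamp[OF measurable_process_path_space[OF T_pos Ypath_measurable]] T_pos by simp
  note [measurable] = measurable_compose[OF _ this]
  have [measurable]: "(\<lambda>z. Ypath (snd z) (max 0 (min T (fst (fst z))))) \<in> borel_measurable ((borel \<Otimes>\<^sub>M borel) \<Otimes>\<^sub>M p)"
    by (rule measurable_compose[OF _ \<open>(\<lambda>z. Ypath (snd z) (max 0 (min T (fst z)))) \<in> borel_measurable (borel \<Otimes>\<^sub>M p)\<close>,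
        where f="\<lambda>z. (fst (fst z), snd z)", simplified]) measurable
  have "(\<lambda>z. \<integral>\<omega>. cstar c (Ypath \<omega> (max 0 (min T (fst z))) - snd z) \<partial>p) \<in> borel_measurable (borel \<Otimes>\<^sub>M borel)"
    by (rule p.borel_measurable_lebesgue_integral) (simp add: case_prod_beta', measurable)
  moreover have "(\<lambda>z. drift (max 0 (min T (fst z))) (snd z))
      = (\<lambda>z. \<integral>\<omega>. cstar c (Ypath \<omega> (max 0 (min T (fst z))) - snd z) \<partial>p)"
    using T_pos by (intro ext) (simp add: drift_eq Ypath_eq)
  ultimately show ?thesis by (simp only:)
qed

lemma \<theta>_measurable_process: "measurable_process p T \<theta>"
  and \<theta>_square_integrable: "square_integrable_process p T \<theta>"
  using adm by (auto simp: admissible_def)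

lemma \<theta>_AE_finite: "AE \<omega> in p. (\<integral>\<^sup>+t\<in>{0..T}. ennreal ((\<theta> t \<omega>)\<^sup>2) \<partial>lborel) < \<infinity>"
proof -
  have "(\<lambda>\<omega>. \<integral>\<^sup>+t\<in>{0..T}. ennreal ((\<theta> t \<omega>)\<^sup>2) \<partial>lborel) \<in> borel_measurable p"
    by (rule measurable_process_nn_integral[OF \<theta>_measurable_process, where f="\<lambda>x. x\<^sup>2"]) (use T_pos in auto)
  then have "AE \<omega> in p. (\<integral>\<^sup>+t\<in>{0..T}. ennreal ((\<theta> t \<omega>)\<^sup>2) \<partial>lborel) \<noteq> \<infinity>"
    by (rule nn_integral_PInf_AE) (use \<theta>_square_integrable in \<open>simp add: square_integrable_process_def\<close>)
  then show ?thesis by eventually_elim (simp add: top.not_eq_extremum)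
qed

lemma dynamics:
  obtains I where "ito_integral p (canonical_filtration p) T Wbar \<eta> I"
    and "AE \<omega> in p. \<forall>t\<in>{0..T}. Ybar t \<omega> = Ybar 0 \<omega> - (LINT u:{0..t}|lborel. drift u (Ybar u \<omega>) + \<theta> u \<omega>) + I t \<omega>"
    and "AE \<omega> in p. set_integrable lborel {0..T} (\<lambda>u. drift u (Ybar u \<omega>) + \<theta> u \<omega>)"
  using adm unfolding admissible_def drift_def by blast

lemma canonical_sub_filtration: "sub_filtration p (canonical_filtration p) T"
proof
  fix s t :: real
  show "space (canonical_filtration p t) = space p" by (simp add: canonical_filtration_def)
  show "sets (canonical_filtration p s) \<subseteq> sets (canonical_filtration p t)" if "s \<le> t"
    unfolding canonical_filtration_def by (rule sets_aug_sigma_mono) (use that in auto)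
  show "sets (canonical_filtration p t) \<subseteq> sets p" if "t \<in> {0..T}"
    unfolding canonical_filtration_def
    by (rule sets_aug_sigma_subset) (use that in \<open>auto intro!: Ybar_measurable Wbar_measurable\<close>)
qed (rule T_pos)

lemma canonical_brownian: "brownian_motion p (canonical_filtration p) T Wbar"
  using adm by (simp add: admissible_def)

lemma Ybar_0_bounded: obtains b where "0 \<le> b" "AE \<omega> in p. \<bar>Ybar 0 \<omega>\<bar> \<le> b"
proof -
  obtain b where b: "\<And>y. y \<in> K0 \<Longrightarrow> \<bar>y\<bar> \<le> b"
    using compact_imp_bounded[OF K0] by (auto simp: bounded_iff)
  have Y0: "Ybar 0 \<in> borel_measurable p" using Ybar_measurable[of 0] T_pos by simp
  have "AE y in distr p borel (Ybar 0). y \<in> K0"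
    using adm by (auto simp: admissible_def)
  then have "AE \<omega> in p. Ybar 0 \<omega> \<in> K0"
    by (subst (asm) AE_distr_iff[OF Y0]) (use compact_imp_closed[OF K0] in \<open>auto simp: Collect_mem_eq\<close>)
  then have "AE \<omega> in p. \<bar>Ybar 0 \<omega>\<bar> \<le> max 0 b"
    by eventually_elim (use b in force)
  then show thesis by (rule that[rotated]) simp
qed

end

lemma (in prob_space) AE_witness:
  assumes "AE \<omega> in M. P \<omega>" obtains \<omega> where "\<omega> \<in> space M" "P \<omega>"
proof -
  have "\<exists>\<omega>\<in>space M. P \<omega>"
  proof (rule ccontr)
    assume no: "\<not> (\<exists>\<omega>\<in>space M. P \<omega>)"
    have "AE \<omega> in M. False"
      by (rule AE_mp[OF assms]) (use no in \<open>auto intro!: AE_I2\<close>)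
    then show False by (simp add: AE_False)
  qed
  then show thesis using that by blast
qed

lemma continuous_indicator_measurable:
  fixes f :: "real \<Rightarrow> real"
  assumes "continuous_on {a..b} f" "g \<in> borel_measurable borel"
  shows "(\<lambda>t. ennreal (g (f t)) * indicator {a..b} t) \<in> borel_measurable borel"
proof -
  have [measurable]: "(\<lambda>t. indicator {a..b} t *\<^sub>R f t) \<in> borel_measurable borel"
    by (rule borel_measurable_continuous_on_indicator) (use assms(1) in auto)
  have [measurable]: "g \<in> borel_measurable borel" by (rule assms(2))
  have "(\<lambda>t. ennreal (g (indicator {a..b} t *\<^sub>R f t)) * indicator {a..b} t) \<in> borel_measurable borel"
    by measurable
  moreover have "(\<lambda>t. ennreal (g (indicator {a..b} t *\<^sub>R f t)) * indicator {a..b} t)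
      = (\<lambda>t. ennreal (g (f t)) * indicator {a..b} t)"
    by (rule ext) (auto split: split_indicator)
  ultimately show ?thesis by (simp only:)
qed

lemma continuous_interval_bounded:
  fixes f :: "real \<Rightarrow> real"
  assumes "continuous_on {a..b} f"
  obtains B where "0 \<le> B" "\<And>t. t \<in> {a..b} \<Longrightarrow> \<bar>f t\<bar> \<le> B"
proof -
  have "bounded (f ` {a..b})"
    by (rule compact_imp_bounded[OF compact_continuous_image[OF assms]]) simp
  then obtain B where "\<forall>x\<in>f ` {a..b}. norm x \<le> B" unfolding bounded_iff by blast
  then show thesis by (intro that[of "max 0 B"]) (simp_all add: le_max_iff_disj)
qed

definition ito_approximation ::
    "'a measure \<Rightarrow> (real \<Rightarrow> 'a measure) \<Rightarrow> real \<Rightarrow> (real \<Rightarrow> 'a \<Rightarrow> real) \<Rightarrow> (real \<Rightarrow> 'a \<Rightarrow> real) \<Rightarrow>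
     (nat \<Rightarrow> nat) \<Rightarrow> (nat \<Rightarrow> nat \<Rightarrow> real) \<Rightarrow> (nat \<Rightarrow> nat \<Rightarrow> 'a \<Rightarrow> real) \<Rightarrow> bool" where
  "ito_approximation M F T W I m \<tau> \<zeta> \<longleftrightarrow>
     (\<forall>k. simple_integrand M F T (m k) (\<tau> k) (\<zeta> k)) \<and>
     (\<forall>t\<in>{0..T}. (\<lambda>k. \<integral>\<^sup>+\<omega>. ennreal (\<bar>simple_integral W (m k) (\<tau> k) (\<zeta> k) t \<omega> - I t \<omega>\<bar>\<^sup>2) \<partial>M) \<longlonglongrightarrow> 0)"

lemma ito_approximation_exists:
  assumes "ito_integral M F T W K I"
  shows "\<exists>m \<tau> \<zeta>. ito_approximation M F T W I m \<tau> \<zeta>"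
  using assms[unfolded ito_integral_def, THEN conjunct2, THEN conjunct2, THEN conjunct2, THEN conjunct2, THEN conjunct2]
  by (elim exE conjE) (unfold ito_approximation_def, intro exI conjI)

text \<open>The integral is taken in \<open>F\<close>, the martingale property is obtained in a
  larger filtration \<open>H\<close> in which \<open>W\<close> is still Brownian: simple integrands
  for \<open>F\<close> are simple integrands for \<open>H\<close>. This is how the integrals of the
  agents' system enter the joint filtration.\<close>

lemma (in sub_filtration) ito_l2_martingale:
  assumes bm: "brownian_motion M H T W" and ito: "ito_integral M F T W K I"
    and F: "\<And>t. t \<in> {0..T} \<Longrightarrow> sets (F t) \<subseteq> sets (H t)" "\<And>t. t \<in> {0..T} \<Longrightarrow> space (F t) = space M"
  shows "l2_martingale I"
proof -
  have FH: "f \<in> borel_measurable (H t)" if "f \<in> borel_measurable (F t)" "t \<in> {0..T}" for f :: "'a \<Rightarrow> real" and t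
    using that F[OF that(2)] space_H[OF that(2)] by (auto simp: measurable_def)
  obtain m \<tau> \<zeta> where approx: "ito_approximation M F T W I m \<tau> \<zeta>"
    using ito_approximation_exists[OF ito] by blast
  note simple = approx[unfolded ito_approximation_def, THEN conjunct1]
    and lim = approx[unfolded ito_approximation_def, THEN conjunct2]
  have I: "adapted F T I"
    by (rule ito[unfolded ito_integral_def, THEN conjunct2, THEN conjunct2, THEN conjunct2, THEN conjunct1])
  show ?thesis
  proof (rule simple_limit_l2_martingale[OF bm])
    show "adapted H T I"
      unfolding adapted_def using FH[OF bspec[OF I[unfolded adapted_def]]] by blast
    show "simple_integrand M H T (m k) (\<tau> k) (\<zeta> k)" for k
      unfolding simple_integrand_def
    proof (intro allI impI)
      fix j assume j: "j < m k"
      have *: "0 \<le> \<tau> k j \<and> \<tau> k j \<le> \<tau> k (Suc j) \<and> \<tau> k (Suc j) \<le> T \<and>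
        \<zeta> k j \<in> borel_measurable (F (\<tau> k j)) \<and> (\<exists>B. \<forall>\<omega>\<in>space M. \<bar>\<zeta> k j \<omega>\<bar> \<le> B)"
        using simple j unfolding simple_integrand_def by blast
      then have "\<tau> k j \<in> {0..T}" by simp
      then have "\<zeta> k j \<in> borel_measurable (H (\<tau> k j))" using FH * by blast
      then show "0 \<le> \<tau> k j \<and> \<tau> k j \<le> \<tau> k (Suc j) \<and> \<tau> k (Suc j) \<le> T \<and>
        \<zeta> k j \<in> borel_measurable (H (\<tau> k j)) \<and> (\<exists>B. \<forall>\<omega>\<in>space M. \<bar>\<zeta> k j \<omega>\<bar> \<le> B)"
        using * by blast
    qed
  qed (rule lim[rule_format])
qed

context mean_field
begin

lemma drift_0_measurable: "(\<lambda>u. ennreal \<bar>drift u 0\<bar> * indicator {0..T} u) \<in> borel_measurable lborel"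
proof -
  have "(\<lambda>u. drift (max 0 (min T u)) 0) \<in> borel_measurable borel"
    using measurable_compose[OF _ drift_measurable, of "\<lambda>u. (u, 0)" borel] by simp
  note [measurable] = this
  have "(\<lambda>u. ennreal \<bar>drift (max 0 (min T u)) 0\<bar> * indicator {0..T} u) \<in> borel_measurable lborel"
    by measurable
  moreover have "(\<lambda>u. ennreal \<bar>drift (max 0 (min T u)) 0\<bar> * indicator {0..T} u) = (\<lambda>u. ennreal \<bar>drift u 0\<bar> * indicator {0..T} u)"
    by (rule ext) (auto split: split_indicator)
  ultimately show ?thesis by (simp only:)
qed

lemma \<theta>_path_measurable:
  assumes w: "\<omega> \<in> space p" and [measurable]: "f \<in> borel_measurable borel"
  shows "(\<lambda>t. ennreal (f (\<theta> t \<omega>)) * indicator {0..T} t) \<in> borel_measurable lborel"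
proof -
  have [measurable]: "(\<lambda>t. indicator {0..T} t * \<theta> t \<omega>) \<in> borel_measurable lborel"
    by (rule measurable_process_path[OF \<theta>_measurable_process w]) (use T_pos in simp)
  have "(\<lambda>t. ennreal (f (indicator {0..T} t * \<theta> t \<omega>)) * indicator {0..T} t) \<in> borel_measurable lborel"
    by measurable
  moreover have "(\<lambda>t. ennreal (f (indicator {0..T} t * \<theta> t \<omega>)) * indicator {0..T} t)
      = (\<lambda>t. ennreal (f (\<theta> t \<omega>)) * indicator {0..T} t)"
    by (rule ext) (auto split: split_indicator)
  ultimately show ?thesis by (simp only:)
qed

text \<open>Integrability of the deterministic function \<open>drift u 0\<close> can be read off from a single path.\<close>

lemma drift_0_integrable: "(\<integral>\<^sup>+u\<in>{0..T}. ennreal \<bar>drift u 0\<bar> \<partial>lborel) < \<infinity>"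
proof -
  obtain I where "AE \<omega> in p. set_integrable lborel {0..T} (\<lambda>u. drift u (Ybar u \<omega>) + \<theta> u \<omega>)"
    by (rule dynamics)
  then have "AE \<omega> in p. set_integrable lborel {0..T} (\<lambda>u. drift u (Ybar u \<omega>) + \<theta> u \<omega>) \<and>
      (\<integral>\<^sup>+t\<in>{0..T}. ennreal ((\<theta> t \<omega>)\<^sup>2) \<partial>lborel) < \<infinity>"
    using \<theta>_AE_finite by eventually_elim simp
  then obtain \<omega> where w: "\<omega> \<in> space p"
    and int: "set_integrable lborel {0..T} (\<lambda>u. drift u (Ybar u \<omega>) + \<theta> u \<omega>)"
    and fin: "(\<integral>\<^sup>+t\<in>{0..T}. ennreal ((\<theta> t \<omega>)\<^sup>2) \<partial>lborel) < \<infinity>"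
    by (rule p.AE_witness) blast
  obtain B where B: "0 \<le> B" "\<And>t. t \<in> {0..T} \<Longrightarrow> \<bar>Ybar t \<omega>\<bar> \<le> B"
    by (rule continuous_interval_bounded[OF Ybar_continuous[OF w]]) blast
  define d where "d u = indicator {0..T} u *\<^sub>R (drift u (Ybar u \<omega>) + \<theta> u \<omega>)" for u
  have d: "integrable lborel d" using int by (simp add: set_integrable_def d_def[abs_def])
  have dm[measurable]: "d \<in> borel_measurable lborel" using d by simp
  note [measurable] = \<theta>_path_measurable[OF w borel_measurable_power[OF measurable_ident], of 2, simplified]
  have "(\<integral>\<^sup>+u\<in>{0..T}. ennreal \<bar>drift u 0\<bar> \<partial>lborel)
    \<le> (\<integral>\<^sup>+u. ennreal (norm (d u)) + ennreal (1 + Lc * B) * indicator {0..T} u + ennreal ((\<theta> u \<omega>)\<^sup>2) * indicator {0..T} u \<partial>lborel)"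
  proof (rule nn_integral_mono)
    fix u
    show "ennreal \<bar>drift u 0\<bar> * indicator {0..T} u
      \<le> ennreal (norm (d u)) + ennreal (1 + Lc * B) * indicator {0..T} u + ennreal ((\<theta> u \<omega>)\<^sup>2) * indicator {0..T} u"
    proof (cases "u \<in> {0..T}")
      case True
      have "\<bar>drift u (Ybar u \<omega>) - drift u 0\<bar> \<le> Lc * \<bar>Ybar u \<omega> - 0\<bar>" by (rule drift_diff_le[OF True])
      also have "\<dots> \<le> Lc * B" using B(2)[OF True] Lc_nonneg by (intro mult_left_mono) auto
      finally have 1: "\<bar>drift u (Ybar u \<omega>) - drift u 0\<bar> \<le> Lc * B" .
      have 2: "\<bar>\<theta> u \<omega>\<bar> \<le> 1 + (\<theta> u \<omega>)\<^sup>2"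
        using zero_le_power2[of "\<bar>\<theta> u \<omega>\<bar> - 1"] abs_ge_zero[of "\<theta> u \<omega>"] by (simp add: power2_diff)
      have "\<bar>drift u 0\<bar> \<le> norm (d u) + (1 + Lc * B) + (\<theta> u \<omega>)\<^sup>2"
        using 1 2 True by (simp add: d_def)
      then have "ennreal \<bar>drift u 0\<bar> \<le> ennreal (norm (d u) + (1 + Lc * B) + (\<theta> u \<omega>)\<^sup>2)" by (rule ennreal_leI)
      also have "\<dots> = ennreal (norm (d u)) + ennreal (1 + Lc * B) + ennreal ((\<theta> u \<omega>)\<^sup>2)"
        using B(1) Lc_nonneg by (simp add: ennreal_plus)
      finally show ?thesis using True by simp
    qed simp
  qed
  also have "\<dots> = (\<integral>\<^sup>+u. ennreal (norm (d u)) \<partial>lborel) + ennreal (1 + Lc * B) * ennreal T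
      + (\<integral>\<^sup>+u\<in>{0..T}. ennreal ((\<theta> u \<omega>)\<^sup>2) \<partial>lborel)"
    using T_pos by (simp add: nn_integral_add nn_integral_cmult)
  also have "\<dots> < \<infinity>"
    using d fin by (auto simp: integrable_iff_bounded ennreal_mult_less_top)
  finally show ?thesis .
qed

text \<open>Gronwall's inequality needs a quantity known to be finite. A moment of the process is
  not, but the time integral of a single continuous path is; so the inequality is applied path by
  path, and expectations are taken only of the resulting bound in terms of the initial value,
  \<open>\<theta>\<close> and the maximum of the stochastic integral.\<close>

lemma Ypath_second_moment: "(\<integral>\<^sup>+\<omega>. sup_sq T (Ypath \<omega>) \<partial>p) < \<infinity>"
proof -
  interpret can: sub_filtration p "canonical_filtration p" T by (rule canonical_sub_filtration)
  obtain I where ito: "ito_integral p (canonical_filtration p) T Wbar \<eta> I"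
    and Y: "AE \<omega> in p. \<forall>t\<in>{0..T}. Ybar t \<omega> = Ybar 0 \<omega> - (LINT u:{0..t}|lborel. drift u (Ybar u \<omega>) + \<theta> u \<omega>) + I t \<omega>"
    by (rule dynamics)
  have mart: "can.l2_martingale I"
    by (rule can.ito_l2_martingale[OF canonical_brownian ito]) (simp_all add: can.space_H)
  have cont: "AE \<omega> in p. continuous_on {0..T} (\<lambda>t. I t \<omega>)"
    using ito unfolding ito_integral_def by auto
  obtain h where h[measurable]: "h \<in> borel_measurable p" and Ih: "AE \<omega> in p. sup_sq T (\<lambda>t. I t \<omega>) \<le> h \<omega>"
    and Eh: "(\<integral>\<^sup>+\<omega>. h \<omega> \<partial>p) \<le> 4 * (\<integral>\<^sup>+\<omega>. ennreal ((I T \<omega>)\<^sup>2) \<partial>p)"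
    by (rule can.doob_measurable_bound[OF mart cont])
  obtain b where b: "0 \<le> b" "AE \<omega> in p. \<bar>Ybar 0 \<omega>\<bar> \<le> b" by (rule Ybar_0_bounded)
  define \<Phi> where "\<Phi> = (\<integral>\<^sup>+u\<in>{0..T}. ennreal \<bar>drift u 0\<bar> \<partial>lborel)"
  define C where "C = 2 * exp ((2 * Lc + 1) * T) * T"
  have C: "0 \<le> C" using T_pos by (simp add: C_def)
  \<comment> \<open>Gronwall's inequality bounds the time integral of the absolute value by
    \<open>C * A\<close>; inserting this into the integral inequality gives
    \<open>A + Lc * (C * A)\<close> at each single time.\<close>
  define K where "K = 1 + Lc * C"
  have K: "1 \<le> K" using C Lc_nonneg by (simp add: K_def)
  define \<Theta>2 where "\<Theta>2 \<omega> = (\<integral>\<^sup>+t\<in>{0..T}. ennreal ((\<theta> t \<omega>)\<^sup>2) \<partial>lborel)" for \<omega>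
  have [measurable]: "\<Theta>2 \<in> borel_measurable p"
    unfolding \<Theta>2_def[abs_def]
    by (rule measurable_process_nn_integral[OF \<theta>_measurable_process, where f="\<lambda>x. x\<^sup>2"]) (use T_pos in auto)
  \<comment> \<open>\<open>K\<^sup>2 * A\<^sup>2\<close> after splitting the square twice with
    \<open>(a + b)\<^sup>2 \<le> 2 * a\<^sup>2 + 2 * b\<^sup>2\<close>, with the square of the
    integral of \<open>\<bar>\<theta>\<bar>\<close> bounded by \<open>T * \<Theta>2\<close>.\<close>
  define rhs where "rhs \<omega> = ennreal (K\<^sup>2) * (2 * (ennreal b + \<Phi>)\<^sup>2 + 4 * (ennreal T * \<Theta>2 \<omega>) + 4 * h \<omega>)" for \<omega>
  have "AE \<omega> in p. sup_sq T (Ypath \<omega>) \<le> rhs \<omega>"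
    using Y Ih b(2) AE_space[of p]
  proof eventually_elim
    case (elim \<omega>)
    note w = elim(4)
    show ?case
    \<comment> \<open>The majorant \<open>h\<close> may be infinite at a sample point, where the
      claim is trivial. Elsewhere its root \<open>s\<close> is a real bound for the stochastic
      integral.\<close>
    proof (cases "h \<omega> = \<top>")
      case True
      have "rhs \<omega> = \<top>" using K by (simp add: rhs_def True ennreal_mult_top ennreal_top_mult)
      then show ?thesis by simp
    next
      case False
      define s where "s = sqrt (enn2real (h \<omega>))"
      have s: "0 \<le> s" "ennreal (s\<^sup>2) = h \<omega>" using False by (auto simp: s_def top.not_eq_extremum)
      have I_le: "\<bar>I t \<omega>\<bar> \<le> s" if "t \<in> {0..T}" for t
      proof -
        have "ennreal ((I t \<omega>)\<^sup>2) \<le> ennreal (s\<^sup>2)"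
          unfolding s(2) using elim(2) by (rule order_trans[OF SUP_upper[OF that]])
        then have "(I t \<omega>)\<^sup>2 \<le> s\<^sup>2" by (simp add: ennreal_le_iff)
        then show ?thesis using s(1) by (simp add: abs_le_square_iff[symmetric])
      qed
      define \<Theta> where "\<Theta> = (\<integral>\<^sup>+t\<in>{0..T}. ennreal \<bar>\<theta> t \<omega>\<bar> \<partial>lborel)"
      define A where "A = ennreal b + \<Phi> + (\<Theta> + ennreal s)"
      have cY: "continuous_on {0..T} (\<lambda>t. Ybar t \<omega>)" by (rule Ybar_continuous[OF w])
      obtain B where B: "0 \<le> B" "\<And>t. t \<in> {0..T} \<Longrightarrow> \<bar>Ybar t \<omega>\<bar> \<le> B"
        by (rule continuous_interval_bounded[OF cY]) blast
      have \<theta>m[measurable]: "(\<lambda>t. ennreal \<bar>\<theta> t \<omega>\<bar> * indicator {0..T} t) \<in> borel_measurable lborel"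
        by (rule \<theta>_path_measurable[OF w]) simp
      have ineq: "ennreal \<bar>Ybar t \<omega>\<bar> \<le> A + ennreal Lc * (\<integral>\<^sup>+u\<in>{0..t}. ennreal \<bar>Ybar u \<omega>\<bar> \<partial>lborel)"
        if t: "t \<in> {0..T}" for t
      proof -
        have Ym[measurable]: "(\<lambda>u. ennreal \<bar>Ybar u \<omega>\<bar> * indicator {0..t} u) \<in> borel_measurable lborel"
          using continuous_indicator_measurable[OF continuous_on_subset[OF cY], of 0 t abs] t by simp
        note [measurable] = drift_0_measurable
        let ?L = "LINT u:{0..t}|lborel. drift u (Ybar u \<omega>) + \<theta> u \<omega>"
        have "ennreal \<bar>?L\<bar> \<le> (\<integral>\<^sup>+u\<in>{0..t}. ennreal \<bar>drift u (Ybar u \<omega>) + \<theta> u \<omega>\<bar> \<partial>lborel)"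
          by (rule set_integral_abs_le)
        also have "\<dots> \<le> (\<integral>\<^sup>+u. ennreal \<bar>drift u 0\<bar> * indicator {0..T} u + ennreal \<bar>\<theta> u \<omega>\<bar> * indicator {0..T} u
            + ennreal Lc * (ennreal \<bar>Ybar u \<omega>\<bar> * indicator {0..t} u) \<partial>lborel)"
        proof (rule nn_integral_mono)
          fix u
          show "ennreal \<bar>drift u (Ybar u \<omega>) + \<theta> u \<omega>\<bar> * indicator {0..t} u
            \<le> ennreal \<bar>drift u 0\<bar> * indicator {0..T} u + ennreal \<bar>\<theta> u \<omega>\<bar> * indicator {0..T} u
              + ennreal Lc * (ennreal \<bar>Ybar u \<omega>\<bar> * indicator {0..t} u)"
          proof (cases "u \<in> {0..t}")
            case True
            then have u: "u \<in> {0..T}" using t by auto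
            have "\<bar>drift u (Ybar u \<omega>) + \<theta> u \<omega>\<bar> \<le> \<bar>drift u 0\<bar> + \<bar>\<theta> u \<omega>\<bar> + Lc * \<bar>Ybar u \<omega>\<bar>"
              using drift_diff_le[OF u, of "Ybar u \<omega>" 0] by (simp add: abs_if split: if_splits)
            then have "ennreal \<bar>drift u (Ybar u \<omega>) + \<theta> u \<omega>\<bar> \<le> ennreal (\<bar>drift u 0\<bar> + \<bar>\<theta> u \<omega>\<bar> + Lc * \<bar>Ybar u \<omega>\<bar>)"
              by (rule ennreal_leI)
            also have "\<dots> = ennreal \<bar>drift u 0\<bar> + ennreal \<bar>\<theta> u \<omega>\<bar> + ennreal Lc * ennreal \<bar>Ybar u \<omega>\<bar>"
              using Lc_nonneg by (simp add: ennreal_plus ennreal_mult)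
            finally show ?thesis using True u by simp
          qed simp
        qed
        also have "\<dots> = \<Phi> + \<Theta> + ennreal Lc * (\<integral>\<^sup>+u\<in>{0..t}. ennreal \<bar>Ybar u \<omega>\<bar> \<partial>lborel)"
          unfolding \<Phi>_def \<Theta>_def by (simp add: nn_integral_add nn_integral_cmult)
        finally have L: "ennreal \<bar>?L\<bar> \<le> \<Phi> + \<Theta> + ennreal Lc * (\<integral>\<^sup>+u\<in>{0..t}. ennreal \<bar>Ybar u \<omega>\<bar> \<partial>lborel)" .
        have "\<bar>Ybar t \<omega>\<bar> \<le> b + \<bar>?L\<bar> + s"
          using elim(1)[rule_format, OF t] elim(3) I_le[OF t] by linarith
        then have "ennreal \<bar>Ybar t \<omega>\<bar> \<le> ennreal (b + \<bar>?L\<bar> + s)" by (rule ennreal_leI)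
        also have "\<dots> = ennreal b + ennreal \<bar>?L\<bar> + ennreal s" using b s by (simp add: ennreal_plus)
        also have "\<dots> \<le> ennreal b + (\<Phi> + \<Theta> + ennreal Lc * (\<integral>\<^sup>+u\<in>{0..t}. ennreal \<bar>Ybar u \<omega>\<bar> \<partial>lborel)) + ennreal s"
          by (intro add_mono L order_refl)
        also have "\<dots> = A + ennreal Lc * (\<integral>\<^sup>+u\<in>{0..t}. ennreal \<bar>Ybar u \<omega>\<bar> \<partial>lborel)"
          by (simp only: A_def add_ac)
        finally show ?thesis .
      qed
      have gr: "(\<integral>\<^sup>+t\<in>{0..T}. ennreal \<bar>Ybar t \<omega>\<bar> \<partial>lborel) \<le> ennreal C * A"
        unfolding C_def
      proof (rule gronwall_forward[OF _ T_pos Lc_nonneg ineq])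
        show "(\<lambda>t. ennreal \<bar>Ybar t \<omega>\<bar> * indicator {0..T} t) \<in> borel_measurable borel"
          by (rule continuous_indicator_measurable[OF cY]) simp
        have "(\<integral>\<^sup>+t\<in>{0..T}. ennreal \<bar>Ybar t \<omega>\<bar> \<partial>lborel) \<le> (\<integral>\<^sup>+t. ennreal B * indicator {0..T} t \<partial>lborel)"
          by (rule nn_integral_mono) (use B in \<open>auto split: split_indicator intro: ennreal_leI\<close>)
        also have "\<dots> < \<infinity>" using T_pos by (simp add: nn_integral_cmult ennreal_mult_less_top)
        finally show "(\<integral>\<^sup>+t\<in>{0..T}. ennreal \<bar>Ybar t \<omega>\<bar> \<partial>lborel) < \<infinity>" .
      qed
      have Y_le: "ennreal \<bar>Ybar t \<omega>\<bar> \<le> ennreal K * A" if t: "t \<in> {0..T}" for t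
      proof -
        have "(\<integral>\<^sup>+u\<in>{0..t}. ennreal \<bar>Ybar u \<omega>\<bar> \<partial>lborel) \<le> (\<integral>\<^sup>+t\<in>{0..T}. ennreal \<bar>Ybar t \<omega>\<bar> \<partial>lborel)"
          by (rule nn_integral_mono) (use t in \<open>auto split: split_indicator\<close>)
        then have "ennreal \<bar>Ybar t \<omega>\<bar> \<le> A + ennreal Lc * (ennreal C * A)"
          using gr by (intro order_trans[OF ineq[OF t]] add_left_mono mult_left_mono) auto
        also have "\<dots> = ennreal K * A"
          using C Lc_nonneg by (simp add: K_def ennreal_plus ennreal_mult distrib_right mult.assoc)
        finally show ?thesis .
      qed
      have \<Theta>: "\<Theta>\<^sup>2 \<le> ennreal T * \<Theta>2 \<omega>"
        using nn_integral_interval_square_le[OF \<theta>m] T_pos by (simp add: \<Theta>_def \<Theta>2_def ennreal_power)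
      have "A\<^sup>2 \<le> 2 * (ennreal b + \<Phi>)\<^sup>2 + 2 * (\<Theta> + ennreal s)\<^sup>2"
        unfolding A_def by (rule ennreal_add_square_le)
      also have "\<dots> \<le> 2 * (ennreal b + \<Phi>)\<^sup>2 + 2 * (2 * (ennreal T * \<Theta>2 \<omega>) + 2 * h \<omega>)"
      proof (intro add_left_mono mult_left_mono)
        have "(\<Theta> + ennreal s)\<^sup>2 \<le> 2 * \<Theta>\<^sup>2 + 2 * (ennreal s)\<^sup>2" by (rule ennreal_add_square_le)
        also have "(ennreal s)\<^sup>2 = h \<omega>" using s by (simp add: ennreal_power)
        also have "2 * \<Theta>\<^sup>2 + 2 * h \<omega> \<le> 2 * (ennreal T * \<Theta>2 \<omega>) + 2 * h \<omega>"
          by (intro add_right_mono mult_left_mono \<Theta>) simp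
        finally show "(\<Theta> + ennreal s)\<^sup>2 \<le> 2 * (ennreal T * \<Theta>2 \<omega>) + 2 * h \<omega>" .
      qed simp
      also have "\<dots> = 2 * (ennreal b + \<Phi>)\<^sup>2 + 4 * (ennreal T * \<Theta>2 \<omega>) + 4 * h \<omega>"
        by (simp only: distrib_left mult.assoc[symmetric] add.assoc) simp
      finally have A2: "ennreal (K\<^sup>2) * A\<^sup>2 \<le> rhs \<omega>"
        unfolding rhs_def by (rule mult_left_mono) simp
      show ?thesis
      proof (rule SUP_least)
        fix t assume t: "t \<in> {0..T}"
        have "ennreal ((Ypath \<omega> t)\<^sup>2) = (ennreal \<bar>Ybar t \<omega>\<bar>)\<^sup>2" by (simp add: Ypath_eq[OF t] ennreal_power)
        also have "\<dots> \<le> (ennreal K * A)\<^sup>2" by (intro power_mono Y_le t) simp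
        also have "\<dots> = ennreal (K\<^sup>2) * A\<^sup>2" using K by (simp add: power_mult_distrib ennreal_power)
        also have "\<dots> \<le> rhs \<omega>" by (rule A2)
        finally show "ennreal ((Ypath \<omega> t)\<^sup>2) \<le> rhs \<omega>" .
      qed
    qed
  qed
  then have "(\<integral>\<^sup>+\<omega>. sup_sq T (Ypath \<omega>) \<partial>p) \<le> (\<integral>\<^sup>+\<omega>. rhs \<omega> \<partial>p)"
    by (rule nn_integral_mono_AE)
  also have "\<dots> = ennreal (K\<^sup>2) * (2 * (ennreal b + \<Phi>)\<^sup>2 + 4 * (ennreal T * (\<integral>\<^sup>+\<omega>. \<Theta>2 \<omega> \<partial>p)) + 4 * (\<integral>\<^sup>+\<omega>. h \<omega> \<partial>p))"
    unfolding rhs_def by (simp add: nn_integral_add nn_integral_cmult p.emeasure_space_1)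
  also have "\<dots> < \<infinity>"
  proof -
    have "(\<integral>\<^sup>+\<omega>. h \<omega> \<partial>p) < \<top>"
    proof (rule order.strict_trans1[OF Eh])
      have "(\<integral>\<^sup>+\<omega>. ennreal ((I T \<omega>)\<^sup>2) \<partial>p) < \<top>"
        using can.l2_martingaleD[OF mart, of T] T_pos by (simp add: integrable_square_iff)
      then show "4 * (\<integral>\<^sup>+\<omega>. ennreal ((I T \<omega>)\<^sup>2) \<partial>p) < \<top>" by (simp add: ennreal_mult_less_top)
    qed
    moreover have "(\<integral>\<^sup>+\<omega>. \<Theta>2 \<omega> \<partial>p) < \<top>"
      using \<theta>_square_integrable by (simp add: square_integrable_process_def \<Theta>2_def)
    moreover have "\<Phi> < \<top>" using drift_0_integrable by (simp add: \<Phi>_def)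
    ultimately show ?thesis by (simp add: ennreal_mult_less_top power_less_top_ennreal)
  qed
  finally show ?thesis .
qed

end

section \<open>Independent copies and their joint filtration\<close>

locale mean_field_copies = mean_field +
  fixes M :: "'a measure" and n :: nat and X :: "nat \<Rightarrow> 'a \<Rightarrow> path2"
  assumes n2: "2 \<le> n" and copies: "independent_copies T p M n X"
begin

sublocale M: prob_space M
  using copies by (simp add: independent_copies_def)

lemma index_nonempty: "{..<n} \<noteq> {}"
  using n2 by (auto simp: lessThan_empty_iff)

lemma X_indep: "M.indep_vars (\<lambda>_. path_space T) X {..<n}"
  using copies by (simp add: independent_copies_def)

lemma X_measurable: "i < n \<Longrightarrow> X i \<in> M \<rightarrow>\<^sub>M p"
  using X_indep by (auto simp: M.indep_vars_def measurable_cong_sets[OF refl sets_p])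

lemma distr_X: "i < n \<Longrightarrow> distr M p (X i) = p"
  using copies distr_cong[OF refl sets_p, of M "X i" "X i"] by (simp add: independent_copies_def)

lemma X_AE: "i < n \<Longrightarrow> AE \<omega> in p. P \<omega> \<Longrightarrow> AE \<omega> in M. P (X i \<omega>)"
  by (rule AE_distrD[OF X_measurable]) (assumption, subst distr_X)

lemma X_nn_integral: "i < n \<Longrightarrow> f \<in> borel_measurable p \<Longrightarrow> (\<integral>\<^sup>+\<omega>. f (X i \<omega>) \<partial>M) = (\<integral>\<^sup>+\<omega>. f \<omega> \<partial>p)"
  using nn_integral_distr[OF X_measurable, of i f] distr_X[of i] by simp

lemma X_prob: "i < n \<Longrightarrow> A \<in> sets p \<Longrightarrow> M.prob (X i -` A \<inter> space M) = p.prob A"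
  using measure_distr[OF X_measurable, of i A] distr_X[of i] by simp

definition rectangle :: "(nat \<Rightarrow> path2 set) \<Rightarrow> 'a set" where
  "rectangle A = (\<Inter>i\<in>{..<n}. X i -` A i \<inter> space M)"

text \<open>The null sets of \<open>M\<close> are included because \<open>copies_filtration\<close>
  contains all of them, while the canonical filtrations contribute only null sets that come from
  single copies. The family remains closed under intersection, and null sets are independent of
  every event, so independence may be checked on rectangles.\<close>

definition rectangles :: "real \<Rightarrow> 'a set set" where
  "rectangles t = rectangle ` {A. \<forall>i<n. A i \<in> sets (canonical_filtration p t)} \<union> null_sets M"

text \<open>The joint filtration of all copies. Unlike the filtration generated by the Brownian motions and
  the initial values, the processes \<open>Ybar t (X i \<omega>)\<close> and the integrands are adapted to it by
  construction, and the Brownian motions remain Brownian motions.\<close>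

definition full_filtration :: "real \<Rightarrow> 'a measure" where
  "full_filtration t = sigma (space M) (rectangles t)"

sublocale can: sub_filtration p "canonical_filtration p" T
  by (rule canonical_sub_filtration)

lemma rectangle_sets: "(\<And>i. i < n \<Longrightarrow> A i \<in> sets p) \<Longrightarrow> rectangle A \<in> sets M"
  unfolding rectangle_def using index_nonempty
  by (intro sets.finite_INT) (auto intro: measurable_sets[OF X_measurable])

lemma rectangles_subset: "t \<in> {0..T} \<Longrightarrow> rectangles t \<subseteq> sets M"
  unfolding rectangles_def using can.sets_H by (auto intro!: rectangle_sets)

lemma rectangles_Pow: "rectangles t \<subseteq> Pow (space M)"
  using index_nonempty by (auto simp: rectangles_def rectangle_def dest: sets.sets_into_space)

lemma space_full_filtration [simp]: "space (full_filtration t) = space M"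
  by (simp add: full_filtration_def space_measure_of_conv)

lemma sets_full_filtration: "sets (full_filtration t) = sigma_sets (space M) (rectangles t)"
  unfolding full_filtration_def by (rule sets_measure_of[OF rectangles_Pow])

sublocale full: sub_filtration M full_filtration T
proof
  show "sets (full_filtration s) \<subseteq> sets (full_filtration t)" if "0 \<le> s" "s \<le> t" "t \<le> T" for s t
    unfolding sets_full_filtration
    by (rule sigma_sets_mono') (use can.sets_H_mono[OF that] in \<open>auto simp: rectangles_def\<close>)
  show "sets (full_filtration t) \<subseteq> sets M" if "t \<in> {0..T}" for t
    unfolding sets_full_filtration by (rule sets.sigma_sets_subset[OF rectangles_subset[OF that]])
qed (simp_all add: T_pos)

lemma vimage_X_full:
  assumes i: "i < n" and A: "A \<in> sets (canonical_filtration p t)" and t: "t \<in> {0..T}"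
  shows "X i -` A \<inter> space M \<in> sets (full_filtration t)"
proof -
  have "space p \<in> sets (canonical_filtration p t)"
    using can.space_H[OF t] sets.top by metis
  then have "rectangle (\<lambda>j. if j = i then A else space p) \<in> rectangles t"
    using A by (auto simp: rectangles_def)
  moreover have "rectangle (\<lambda>j. if j = i then A else space p) = X i -` A \<inter> space M"
    using i measurable_space[OF X_measurable] by (auto simp: rectangle_def split: if_splits)
  ultimately show ?thesis unfolding sets_full_filtration by (auto intro: sigma_sets.Basic)
qed

lemma measurable_X_full:
  fixes f :: "path2 \<Rightarrow> real"
  assumes i: "i < n" and f: "f \<in> borel_measurable (canonical_filtration p t)" and t: "t \<in> {0..T}"
  shows "(\<lambda>\<omega>. f (X i \<omega>)) \<in> borel_measurable (full_filtration t)"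
proof (rule measurableI)
  fix B :: "real set" assume "B \<in> sets borel"
  then have "f -` B \<inter> space p \<in> sets (canonical_filtration p t)"
    using measurable_sets[OF f] can.space_H[OF t] by auto
  from vimage_X_full[OF i this t]
  have "X i -` (f -` B \<inter> space p) \<inter> space M \<in> sets (full_filtration t)" .
  also have "X i -` (f -` B \<inter> space p) \<inter> space M = (\<lambda>\<omega>. f (X i \<omega>)) -` B \<inter> space M"
    using measurable_space[OF X_measurable[OF i]] by auto
  finally show "(\<lambda>\<omega>. f (X i \<omega>)) -` B \<inter> space (full_filtration t) \<in> sets (full_filtration t)" by simp
qed simp

lemma Wbar_canonical: "s \<in> {0..t} \<Longrightarrow> Wbar s \<in> borel_measurable (canonical_filtration p t)"
  and Ybar_canonical: "s \<in> {0..t} \<Longrightarrow> Ybar s \<in> borel_measurable (canonical_filtration p t)"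
  unfolding canonical_filtration_def by (rule measurable_aug_sigma; simp)+

lemma copies_filtration_subset:
  assumes t: "t \<in> {0..T}" shows "sets (copies_filtration M n X t) \<subseteq> sets (full_filtration t)"
proof -
  let ?S = "{\<lambda>\<omega>. Wbar s (X i \<omega>) | i s. i < n \<and> s \<in> {0..t}} \<union> {\<lambda>\<omega>. Ybar 0 (X i \<omega>) | i. i < n}"
  have S: "f \<in> borel_measurable (full_filtration t)" if "f \<in> ?S" for f
    using that t measurable_X_full[OF _ Wbar_canonical t] measurable_X_full[OF _ Ybar_canonical t] by auto
  have N: "null_sets M \<subseteq> sets (full_filtration t)"
    unfolding sets_full_filtration rectangles_def by (auto intro: sigma_sets.Basic)
  have "sigma_sets (space M) ({f -` A \<inter> space M | f A. f \<in> ?S \<and> A \<in> sets borel} \<union> null_sets M) \<subseteq> sets (full_filtration t)"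
  proof (subst space_full_filtration[of t, symmetric], rule sets.sigma_sets_subset, rule Un_least)
    show "{f -` A \<inter> space M | f A. f \<in> ?S \<and> A \<in> sets borel} \<subseteq> sets (full_filtration t)"
    proof
      fix E assume "E \<in> {f -` A \<inter> space M | f A. f \<in> ?S \<and> A \<in> sets borel}"
      then obtain f A where "E = f -` A \<inter> space M" "f \<in> ?S" "A \<in> sets borel" by blast
      then show "E \<in> sets (full_filtration t)" using measurable_sets[OF S[of f]] by simp
    qed
  qed (rule N)
  then show ?thesis unfolding copies_filtration_def sets_aug_sigma .
qed

lemma Int_stable_rectangles: "t \<in> {0..T} \<Longrightarrow> Int_stable (rectangles t)"
proof (rule Int_stableI)
  fix a b assume t: "t \<in> {0..T}" and a: "a \<in> rectangles t" and b: "b \<in> rectangles t"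
  have ab: "a \<in> sets M" "b \<in> sets M" using a b rectangles_subset[OF t] by auto
  show "a \<inter> b \<in> rectangles t"
  proof (cases "a \<in> null_sets M \<or> b \<in> null_sets M")
    case True
    then have "a \<inter> b \<in> null_sets M"
      using ab by (metis null_set_Int1 null_set_Int2)
    then show ?thesis by (simp add: rectangles_def)
  next
    case False
    then obtain A B where A: "a = rectangle A" "\<forall>i<n. A i \<in> sets (canonical_filtration p t)"
      and B: "b = rectangle B" "\<forall>i<n. B i \<in> sets (canonical_filtration p t)"
      using a b by (auto simp: rectangles_def)
    have "a \<inter> b = rectangle (\<lambda>i. A i \<inter> B i)" using A B by (auto simp: rectangle_def)
    then show ?thesis using A B unfolding rectangles_def by blast
  qed
qed

lemma prob_rectangle:
  assumes A: "\<And>i. i < n \<Longrightarrow> A i \<in> sets p"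
  shows "M.prob (rectangle A) = (\<Prod>i<n. p.prob (A i))"
proof -
  have "M.prob (rectangle A) = (\<Prod>i<n. M.prob (X i -` A i \<inter> space M))"
    unfolding rectangle_def
    by (rule M.indep_varsD_finite[OF X_indep]) (use index_nonempty A sets_p in auto)
  also have "\<dots> = (\<Prod>i<n. p.prob (A i))"
    by (intro prod.cong refl X_prob) (use A in auto)
  finally show ?thesis .
qed

text \<open>An increment of the \<open>i\<close>-th Brownian motion meets only the
  \<open>i\<close>-th factor of a rectangle, and there independence holds on the canonical space;
  the other factors are independent of copy \<open>i\<close>. Closedness of the rectangles under
  intersection extends this to the generated sigma-algebra.\<close>

lemma full_brownian:
  assumes i: "i < n"
  shows "brownian_motion M full_filtration T (\<lambda>t \<omega>. Wbar t (X i \<omega>))"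
  unfolding brownian_motion_def
proof (intro conjI allI impI)
  note bm = canonical_brownian[unfolded brownian_motion_def]
  show "prob_space M" by (rule M.prob_space_axioms)
  show "adapted full_filtration T (\<lambda>t \<omega>. Wbar t (X i \<omega>))"
    unfolding adapted_def by (auto intro!: measurable_X_full[OF i] Wbar_canonical)
  show "\<forall>\<omega>\<in>space M. continuous_on {0..T} (\<lambda>t. Wbar t (X i \<omega>))"
    using bm measurable_space[OF X_measurable[OF i]] by blast
  have "AE \<omega> in p. Wbar 0 \<omega> = 0" using bm by blast
  then show "AE \<omega> in M. Wbar 0 (X i \<omega>) = 0" by (rule X_AE[OF i])
  fix s t :: real assume st: "0 \<le> s \<and> s < t \<and> t \<le> T"
  then have s: "s \<in> {0..T}" by auto
  let ?D = "\<lambda>\<omega>. Wbar t \<omega> - Wbar s \<omega>"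
  have dist: "distributed p lborel ?D (normal_density 0 (sqrt (t - s)))"
    and ind: "p.indep_set (sets (canonical_filtration p s)) (sets (vimage_algebra (space p) ?D borel))"
    using bm st by auto
  have Dm: "?D \<in> p \<rightarrow>\<^sub>M lborel" and Dd: "distr p lborel ?D = density lborel (normal_density 0 (sqrt (t - s)))"
    using dist by (auto simp: distributed_def)
  have DX: "(\<lambda>\<omega>. ?D (X i \<omega>)) \<in> M \<rightarrow>\<^sub>M lborel" by (rule measurable_compose[OF X_measurable[OF i] Dm])
  have "distr M lborel (\<lambda>\<omega>. ?D (X i \<omega>)) = distr (distr M p (X i)) lborel ?D"
    using distr_distr[OF Dm X_measurable[OF i]] by (simp add: comp_def)
  then show "distributed M lborel (\<lambda>\<omega>. Wbar t (X i \<omega>) - Wbar s (X i \<omega>)) (normal_density 0 (sqrt (t - s)))"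
    using dist DX Dd distr_X[OF i] by (simp add: distributed_def)
  have Bp: "?D -` B \<inter> space p \<in> sets p" if "B \<in> sets borel" for B
    using measurable_sets[OF Dm] that by simp
  have eqv: "(\<lambda>\<omega>. ?D (X i \<omega>)) -` B \<inter> space M = X i -` (?D -` B \<inter> space p) \<inter> space M" for B
    using measurable_space[OF X_measurable[OF i]] by auto
  let ?V = "{(\<lambda>\<omega>. ?D (X i \<omega>)) -` B \<inter> space M | B. B \<in> sets borel}"
  have "M.indep_set (rectangles s) ?V"
  proof (rule M.indep_setI)
    show "rectangles s \<subseteq> M.events" by (rule rectangles_subset[OF s])
    show "?V \<subseteq> M.events" using measurable_sets[OF DX] by auto
    fix a b assume a: "a \<in> rectangles s" and "b \<in> ?V"
    then obtain B where B: "B \<in> sets borel" and b: "b = X i -` (?D -` B \<inter> space p) \<inter> space M"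
      unfolding eqv by blast
    let ?E = "?D -` B \<inter> space p"
    have bM: "b \<in> sets M" unfolding b by (rule measurable_sets[OF X_measurable[OF i] Bp[OF B]])
    show "M.prob (a \<inter> b) = M.prob a * M.prob b"
    proof (cases "a \<in> null_sets M")
      case True
      then have "a \<inter> b \<in> null_sets M" using bM by (metis null_set_Int2 Int_commute)
      then show ?thesis using True by (simp add: measure_eq_0_null_sets)
    next
      case False
      then obtain A where A: "a = rectangle A" "\<forall>j<n. A j \<in> sets (canonical_filtration p s)"
        using a by (auto simp: rectangles_def)
      have Ap: "A j \<in> sets p" if "j < n" for j using A(2) can.sets_H[OF s] that by auto
      \<comment> \<open>Intersecting with the increment event yields another rectangle, whose
        \<open>i\<close>-th factor has absorbed that event; so the product formula applies to both
        sides.\<close>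
      define A' where "A' j = (if j = i then A j \<inter> ?E else A j)" for j
      have "a \<inter> b = rectangle A'"
        using i by (auto simp: A(1) b A'_def rectangle_def split: if_splits)
      then have "M.prob (a \<inter> b) = (\<Prod>j<n. p.prob (A' j))"
        using Ap Bp[OF B] by (subst prob_rectangle[symmetric]) (auto simp: A'_def)
      also have "\<dots> = p.prob (A' i) * (\<Prod>j\<in>{..<n} - {i}. p.prob (A' j))"
        using i by (intro prod.remove) auto
      also have "p.prob (A' i) = p.prob (A i) * p.prob ?E"
      proof -
        have "?E \<in> sets (vimage_algebra (space p) ?D borel)" using B by (rule in_vimage_algebra)
        then show ?thesis unfolding A'_def using p.indep_setD[OF ind, of "A i" ?E] A(2) i by simp
      qed
      also have "(\<Prod>j\<in>{..<n} - {i}. p.prob (A' j)) = (\<Prod>j\<in>{..<n} - {i}. p.prob (A j))"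
        by (intro prod.cong) (auto simp: A'_def)
      also have "p.prob (A i) * p.prob ?E * \<dots> = (p.prob (A i) * \<dots>) * p.prob ?E" by simp
      also have "p.prob (A i) * (\<Prod>j\<in>{..<n} - {i}. p.prob (A j)) = (\<Prod>j<n. p.prob (A j))"
        using i by (intro prod.remove[symmetric]) auto
      also have "\<dots> = M.prob a" unfolding A(1) by (rule prob_rectangle[symmetric]) (rule Ap)
      also have "p.prob ?E = M.prob b" unfolding b by (rule X_prob[symmetric, OF i Bp[OF B]])
      finally show ?thesis .
    qed
  qed
  then have "M.indep_set (sigma_sets (space M) (rectangles s)) (sigma_sets (space M) ?V)"
  proof (rule M.indep_set_sigma_sets)
    show "Int_stable (rectangles s)" by (rule Int_stable_rectangles[OF s])
    show "Int_stable ?V"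
    proof (rule Int_stableI)
      fix a b assume "a \<in> ?V" "b \<in> ?V"
      then obtain B C where "B \<in> sets borel" "C \<in> sets borel" "a = (\<lambda>\<omega>. ?D (X i \<omega>)) -` B \<inter> space M"
        "b = (\<lambda>\<omega>. ?D (X i \<omega>)) -` C \<inter> space M" by blast
      then have "B \<inter> C \<in> sets borel" "a \<inter> b = (\<lambda>\<omega>. ?D (X i \<omega>)) -` (B \<inter> C) \<inter> space M" by auto
      then show "a \<inter> b \<in> ?V" by blast
    qed
  qed
  then show "M.indep_set (sets (full_filtration s))
     (sets (vimage_algebra (space M) (\<lambda>\<omega>. Wbar t (X i \<omega>) - Wbar s (X i \<omega>)) borel))"
    unfolding sets_full_filtration sets_vimage_algebra .
qed

text \<open>The simple approximations are composed with \<open>X i\<close>. They remain simple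
  integrands, now for the joint filtration, and since \<open>X i\<close> has law \<open>p\<close>
  all mean square distances are the same as on the canonical space.\<close>

lemma ito_X_l2_martingale:
  assumes i: "i < n" and ito: "ito_integral p (canonical_filtration p) T Wbar K I"
  shows "full.l2_martingale (\<lambda>t \<omega>. I t (X i \<omega>))"
proof -
  obtain m \<tau> \<zeta> where approx: "ito_approximation p (canonical_filtration p) T Wbar I m \<tau> \<zeta>"
    using ito_approximation_exists[OF ito] by blast
  note simple = approx[unfolded ito_approximation_def, THEN conjunct1]
    and lim = approx[unfolded ito_approximation_def, THEN conjunct2]
  have I: "adapted (canonical_filtration p) T I"
    by (rule ito[unfolded ito_integral_def, THEN conjunct2, THEN conjunct2, THEN conjunct2, THEN conjunct1])
  show ?thesis
  proof (rule full.simple_limit_l2_martingale[OF full_brownian[OF i]])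
    show "adapted full_filtration T (\<lambda>t \<omega>. I t (X i \<omega>))"
      unfolding adapted_def
      by (intro ballI measurable_X_full[OF i] bspec[OF I[unfolded adapted_def]])
    show "simple_integrand M full_filtration T (m k) (\<tau> k) (\<lambda>j \<omega>. \<zeta> k j (X i \<omega>))" for k
      unfolding simple_integrand_def
    proof (intro allI impI)
      fix j assume j: "j < m k"
      have *: "0 \<le> \<tau> k j" "\<tau> k j \<le> \<tau> k (Suc j)" "\<tau> k (Suc j) \<le> T"
        "\<zeta> k j \<in> borel_measurable (canonical_filtration p (\<tau> k j))" "\<exists>B. \<forall>\<omega>\<in>space p. \<bar>\<zeta> k j \<omega>\<bar> \<le> B"
        using simple j unfolding simple_integrand_def by blast+
      then have \<tau>: "\<tau> k j \<in> {0..T}" by simp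
      have "\<exists>B. \<forall>\<omega>\<in>space M. \<bar>\<zeta> k j (X i \<omega>)\<bar> \<le> B"
        using *(5) measurable_space[OF X_measurable[OF i]] by blast
      then show "0 \<le> \<tau> k j \<and> \<tau> k j \<le> \<tau> k (Suc j) \<and> \<tau> k (Suc j) \<le> T \<and>
        (\<lambda>\<omega>. \<zeta> k j (X i \<omega>)) \<in> borel_measurable (full_filtration (\<tau> k j)) \<and>
        (\<exists>B. \<forall>\<omega>\<in>space M. \<bar>\<zeta> k j (X i \<omega>)\<bar> \<le> B)"
        using *(1-3) measurable_X_full[OF i *(4) \<tau>] by blast
    qed
    fix t assume t: "t \<in> {0..T}"
    have "(\<integral>\<^sup>+\<omega>. ennreal (\<bar>simple_integral (\<lambda>t \<omega>. Wbar t (X i \<omega>)) (m k) (\<tau> k) (\<lambda>j \<omega>. \<zeta> k j (X i \<omega>)) t \<omega> - I t (X i \<omega>)\<bar>\<^sup>2) \<partial>M)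
      = (\<integral>\<^sup>+\<omega>. ennreal (\<bar>simple_integral Wbar (m k) (\<tau> k) (\<zeta> k) t \<omega> - I t \<omega>\<bar>\<^sup>2) \<partial>p)" for k
    proof -
      have "simple_integral Wbar (m k) (\<tau> k) (\<zeta> k) t \<in> borel_measurable p"
        by (rule can.l2_martingaleD(2)[OF can.simple_integral_l2_martingale[OF canonical_brownian simple[rule_format]] t])
      moreover have "I t \<in> borel_measurable p"
        by (rule can.H_measurable[OF bspec[OF I[unfolded adapted_def] t] t])
      ultimately have "(\<lambda>\<omega>. ennreal (\<bar>simple_integral Wbar (m k) (\<tau> k) (\<zeta> k) t \<omega> - I t \<omega>\<bar>\<^sup>2)) \<in> borel_measurable p"
        by measurable
      from X_nn_integral[OF i this] show ?thesis by (simp only: simple_integral_def)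
    qed
    then show "(\<lambda>k. \<integral>\<^sup>+\<omega>. ennreal (\<bar>simple_integral (\<lambda>t \<omega>. Wbar t (X i \<omega>)) (m k) (\<tau> k) (\<lambda>j \<omega>. \<zeta> k j (X i \<omega>)) t \<omega> - I t (X i \<omega>)\<bar>\<^sup>2) \<partial>M)
      \<longlonglongrightarrow> 0"
      using bspec[OF lim t] by (simp only:)
  qed
qed

end

section \<open>Stability of the agents' system\<close>

lemma set_integral_split_interval:
  fixes f :: "real \<Rightarrow> real"
  assumes f: "set_integrable lborel {a..b} f" and t: "t \<in> {a..b}"
  shows "(LINT u:{a..b}|lborel. f u) = (LINT u:{a..t}|lborel. f u) + (LINT u:{t..b}|lborel. f u)"
proof -
  have i1: "integrable lborel (\<lambda>u. indicator {a..t} u *\<^sub>R f u)" and i2: "integrable lborel (\<lambda>u. indicator {t..b} u *\<^sub>R f u)"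
    using set_integrable_subset[OF f, of "{a..t}"] set_integrable_subset[OF f, of "{t..b}"] t
    by (auto simp: set_integrable_def)
  have i0: "integrable lborel (\<lambda>u. indicator {a..b} u *\<^sub>R f u)"
    using f by (simp add: set_integrable_def)
  have "(LINT u|lborel. indicator {a..b} u *\<^sub>R f u)
      = (LINT u|lborel. indicator {a..t} u *\<^sub>R f u + indicator {t..b} u *\<^sub>R f u)"
  proof (rule integral_cong_AE)
    \<comment> \<open>The two closed intervals overlap in the point \<open>t\<close>, so the
      indicators add up only almost everywhere.\<close>
    show "AE u in lborel. indicator {a..b} u *\<^sub>R f u = indicator {a..t} u *\<^sub>R f u + indicator {t..b} u *\<^sub>R f u"
      using AE_lborel_singleton[of t] by eventually_elim (use t in \<open>auto split: split_indicator\<close>)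
  qed (use i0 i1 i2 in auto)
  then show ?thesis using i1 i2 by (simp add: set_lebesgue_integral_def)
qed

text \<open>Pythagoras: \<open>B\<close> is the sum of \<open>D\<close>, which is known at time
  \<open>t\<close>, and the increment of \<open>N\<close> after \<open>t\<close>, which is
  orthogonal to it. So each summand has at most the norm of \<open>B\<close>. This takes the place
  of Ito's formula for the square of the solution.\<close>

lemma (in sub_filtration) energy_estimate:
  assumes N: "l2_martingale N" and D: "D \<in> borel_measurable (H t)" and t: "t \<in> {0..T}"
    and eq: "AE \<omega> in M. D \<omega> = B \<omega> - (N T \<omega> - N t \<omega>)"
  shows "(\<integral>\<^sup>+\<omega>. ennreal ((D \<omega>)\<^sup>2) \<partial>M) \<le> (\<integral>\<^sup>+\<omega>. ennreal ((B \<omega>)\<^sup>2) \<partial>M)"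
    and "(\<integral>\<^sup>+\<omega>. ennreal ((N T \<omega> - N t \<omega>)\<^sup>2) \<partial>M) \<le> (\<integral>\<^sup>+\<omega>. ennreal ((B \<omega>)\<^sup>2) \<partial>M)"
proof -
  have T: "T \<in> {0..T}" using T_pos by simp
  let ?d = "\<lambda>\<omega>. N T \<omega> - N t \<omega>"
  note [measurable] = H_measurable[OF D t] l2_martingaleD(2)[OF N t] l2_martingaleD(2)[OF N T]
  have B: "(\<integral>\<^sup>+\<omega>. ennreal ((B \<omega>)\<^sup>2) \<partial>M) = (\<integral>\<^sup>+\<omega>. ennreal ((D \<omega> + ?d \<omega>)\<^sup>2) \<partial>M)"
    by (rule nn_integral_cong_AE) (use eq in eventually_elim, simp)
  show "(\<integral>\<^sup>+\<omega>. ennreal ((D \<omega>)\<^sup>2) \<partial>M) \<le> (\<integral>\<^sup>+\<omega>. ennreal ((B \<omega>)\<^sup>2) \<partial>M)"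
    and "(\<integral>\<^sup>+\<omega>. ennreal ((?d \<omega>)\<^sup>2) \<partial>M) \<le> (\<integral>\<^sup>+\<omega>. ennreal ((B \<omega>)\<^sup>2) \<partial>M)"
  proof (atomize (full), cases "(\<integral>\<^sup>+\<omega>. ennreal ((D \<omega> + ?d \<omega>)\<^sup>2) \<partial>M) < \<infinity>")
    case False
    then have "(\<integral>\<^sup>+\<omega>. ennreal ((B \<omega>)\<^sup>2) \<partial>M) = \<top>" unfolding B by (simp add: less_top[symmetric])
    then show "(\<integral>\<^sup>+\<omega>. ennreal ((D \<omega>)\<^sup>2) \<partial>M) \<le> (\<integral>\<^sup>+\<omega>. ennreal ((B \<omega>)\<^sup>2) \<partial>M)
      \<and> (\<integral>\<^sup>+\<omega>. ennreal ((?d \<omega>)\<^sup>2) \<partial>M) \<le> (\<integral>\<^sup>+\<omega>. ennreal ((B \<omega>)\<^sup>2) \<partial>M)" by simp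
  next
    case True
    then have iB: "integrable M (\<lambda>\<omega>. (D \<omega> + ?d \<omega>)\<^sup>2)" by (subst integrable_square_iff) simp_all
    have id: "integrable M (\<lambda>\<omega>. (?d \<omega>)\<^sup>2)"
      by (intro integrable_square_diff l2_martingaleD[OF N T] l2_martingaleD[OF N t])
    \<comment> \<open>Orthogonality may be used only once \<open>D\<close> is known to be square
      integrable; here this follows from the finite norms of \<open>B\<close> and of the
      increment.\<close>
    have "integrable M (\<lambda>\<omega>. ((D \<omega> + ?d \<omega>) - ?d \<omega>)\<^sup>2)"
      by (rule integrable_square_diff[OF _ _ iB id]) measurable
    then have iD: "integrable M (\<lambda>\<omega>. (D \<omega>)\<^sup>2)" by simp
    have o: "(\<integral>\<omega>. D \<omega> * ?d \<omega> \<partial>M) = 0" "integrable M (\<lambda>\<omega>. D \<omega> * ?d \<omega>)"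
      using l2_martingale_orthogonal[OF N _ _ _ D iD, of T] t by auto
    have "(\<integral>\<omega>. (D \<omega> + ?d \<omega>)\<^sup>2 \<partial>M) = (\<integral>\<omega>. (D \<omega>)\<^sup>2 + (?d \<omega>)\<^sup>2 + 2 * (D \<omega> * ?d \<omega>) \<partial>M)"
      by (rule Bochner_Integration.integral_cong) (auto simp: power2_sum)
    also have "\<dots> = (\<integral>\<omega>. (D \<omega>)\<^sup>2 \<partial>M) + (\<integral>\<omega>. (?d \<omega>)\<^sup>2 \<partial>M)" using iD id o by simp
    finally have E: "(\<integral>\<omega>. (D \<omega> + ?d \<omega>)\<^sup>2 \<partial>M) = (\<integral>\<omega>. (D \<omega>)\<^sup>2 \<partial>M) + (\<integral>\<omega>. (?d \<omega>)\<^sup>2 \<partial>M)" .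
    have nonneg: "0 \<le> (\<integral>\<omega>. (D \<omega>)\<^sup>2 \<partial>M)" "0 \<le> (\<integral>\<omega>. (?d \<omega>)\<^sup>2 \<partial>M)" by simp_all
    have c: "(\<integral>\<^sup>+\<omega>. ennreal ((D \<omega> + ?d \<omega>)\<^sup>2) \<partial>M) = ennreal (\<integral>\<omega>. (D \<omega> + ?d \<omega>)\<^sup>2 \<partial>M)"
      "(\<integral>\<^sup>+\<omega>. ennreal ((D \<omega>)\<^sup>2) \<partial>M) = ennreal (\<integral>\<omega>. (D \<omega>)\<^sup>2 \<partial>M)"
      "(\<integral>\<^sup>+\<omega>. ennreal ((?d \<omega>)\<^sup>2) \<partial>M) = ennreal (\<integral>\<omega>. (?d \<omega>)\<^sup>2 \<partial>M)"
      using nn_integral_eq_integral[OF iB] nn_integral_eq_integral[OF iD] nn_integral_eq_integral[OF id] by simp_all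
    show "(\<integral>\<^sup>+\<omega>. ennreal ((D \<omega>)\<^sup>2) \<partial>M) \<le> (\<integral>\<^sup>+\<omega>. ennreal ((B \<omega>)\<^sup>2) \<partial>M)
      \<and> (\<integral>\<^sup>+\<omega>. ennreal ((?d \<omega>)\<^sup>2) \<partial>M) \<le> (\<integral>\<^sup>+\<omega>. ennreal ((B \<omega>)\<^sup>2) \<partial>M)"
      unfolding B c E by (intro conjI ennreal_leI) (use nonneg in linarith)+
  qed
qed

section \<open>Error of the interaction term\<close>

lemma mean_square_le:
  fixes a :: "nat \<Rightarrow> real" assumes "0 < n"
  shows "((\<Sum>j<n. a j) / n)\<^sup>2 \<le> (\<Sum>j<n. (a j)\<^sup>2) / n"
proof -
  have "(\<Sum>j<n. a j * 1)\<^sup>2 \<le> (\<Sum>j<n. (a j)\<^sup>2) * (\<Sum>j<n. 1\<^sup>2)"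
    by (rule Cauchy_Schwarz_ineq_sum)
  then have "(\<Sum>j<n. a j)\<^sup>2 / (real n)\<^sup>2 \<le> (\<Sum>j<n. (a j)\<^sup>2) * n / (real n)\<^sup>2"
    by (intro divide_right_mono) auto
  then show ?thesis using assms by (simp add: power_divide power2_eq_square)
qed

text \<open>The third term on the right is the cost of replacing the mean over the other agents by the mean
  over all agents.\<close>

lemma interaction_error_le:
  fixes f :: "real \<Rightarrow> real" and y z :: "nat \<Rightarrow> real" and n i :: nat
  assumes n: "2 \<le> n" and i: "i < n" and f: "\<And>a b. \<bar>f a - f b\<bar> \<le> L * \<bar>a - b\<bar>" and L: "0 \<le> L"
  shows "(1 / (real n - 1) * (\<Sum>j\<in>{..<n} - {i}. f (y j - y i)) - d)\<^sup>2
    \<le> 6 * L\<^sup>2 * (y i - z i)\<^sup>2 + 24 * L\<^sup>2 * ((\<Sum>j<n. (y j - z j)\<^sup>2) / n)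
      + 6 * L\<^sup>2 / (real n - 1)\<^sup>2 * ((\<Sum>j<n. (z j)\<^sup>2) / n + (z i)\<^sup>2)
      + 3 * ((\<Sum>j<n. f (z j - z i)) / n - d)\<^sup>2"
proof -
  have n1: "0 < real n - 1" "0 < real n" using n by auto
  define S where "S = (\<Sum>j<n. f (z j - z i))"
  \<comment> \<open>Three sources of error: \<open>a1\<close> comes from replacing \<open>y\<close>
    by \<open>z\<close>, \<open>a2\<close> from averaging over all agents instead of the others, and
    \<open>r\<close> is the deviation of the full average at \<open>z\<close> from
    \<open>d\<close>.\<close>
  define a1 where "a1 = 1 / (real n - 1) * (\<Sum>j\<in>{..<n} - {i}. f (y j - y i) - f (z j - z i))"
  define a2 where "a2 = 1 / (real n - 1) * (\<Sum>j\<in>{..<n} - {i}. f (z j - z i)) - S / n"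
  define r where "r = S / n - d"
  have split: "(\<Sum>j<n. g j) = g i + (\<Sum>j\<in>{..<n} - {i}. g j)" for g :: "nat \<Rightarrow> real"
    using i by (intro sum.remove) auto
  have dec: "1 / (real n - 1) * (\<Sum>j\<in>{..<n} - {i}. f (y j - y i)) - d = a1 + a2 + r"
    by (simp add: a1_def a2_def r_def sum_subtractf right_diff_distrib diff_divide_distrib)
  define u where "u j = \<bar>y j - z j\<bar>" for j
  define m where "m = (\<Sum>j<n. u j) / n"
  have m0: "0 \<le> m" by (auto simp: m_def u_def intro!: divide_nonneg_nonneg sum_nonneg)
  have "\<bar>a1\<bar> \<le> 1 / (real n - 1) * (\<Sum>j\<in>{..<n} - {i}. L * (u j + u i))"
  proof -
    have "\<bar>\<Sum>j\<in>{..<n} - {i}. f (y j - y i) - f (z j - z i)\<bar> \<le> (\<Sum>j\<in>{..<n} - {i}. L * (u j + u i))"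
    proof (rule order_trans[OF sum_abs sum_mono])
      fix j
      have "\<bar>f (y j - y i) - f (z j - z i)\<bar> \<le> L * \<bar>(y j - y i) - (z j - z i)\<bar>" by (rule f)
      also have "\<dots> \<le> L * (u j + u i)" using L by (intro mult_left_mono) (auto simp: u_def)
      finally show "\<bar>f (y j - y i) - f (z j - z i)\<bar> \<le> L * (u j + u i)" .
    qed
    then show ?thesis using n1 by (simp add: a1_def abs_mult divide_right_mono)
  qed
  also have "\<dots> = L * ((\<Sum>j\<in>{..<n} - {i}. u j) / (real n - 1) + u i)"
  proof -
    have "(\<Sum>j\<in>{..<n} - {i}. L * (u j + u i)) = L * ((\<Sum>j\<in>{..<n} - {i}. u j) + (real n - 1) * u i)"
      using i n by (simp add: sum_distrib_left[symmetric] sum.distrib of_nat_diff)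
    then show ?thesis using n1 by (simp add: add_divide_distrib distrib_left)
  qed
  also have "\<dots> \<le> L * (2 * m + u i)"
  proof (intro mult_left_mono add_right_mono L)
    have "(\<Sum>j\<in>{..<n} - {i}. u j) \<le> (\<Sum>j<n. u j)" unfolding split[of u] by (simp add: u_def)
    then have "(\<Sum>j\<in>{..<n} - {i}. u j) / (real n - 1) \<le> (\<Sum>j<n. u j) / (real n - 1)"
      using n1 by (intro divide_right_mono) auto
    \<comment> \<open>Since \<open>n \<ge> 2\<close>, the number \<open>n - 1\<close> is at least
      \<open>n / 2\<close>.\<close>
    also have "\<dots> \<le> (\<Sum>j<n. u j) / (real n / 2)"
      using n n1 by (intro divide_left_mono) (auto simp: u_def intro: sum_nonneg)
    finally show "(\<Sum>j\<in>{..<n} - {i}. u j) / (real n - 1) \<le> 2 * m" by (simp add: m_def mult.commute)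
  qed
  finally have "\<bar>a1\<bar>\<^sup>2 \<le> (L * (2 * m + u i))\<^sup>2" by (rule power_mono) simp
  also have "\<dots> = L\<^sup>2 * (2 * m + u i)\<^sup>2" by (simp add: power_mult_distrib)
  also have "\<dots> \<le> L\<^sup>2 * (8 * m\<^sup>2 + 2 * (u i)\<^sup>2)"
    using zero_le_power2[of "2 * m - u i"] by (intro mult_left_mono) (auto simp: power2_sum power2_diff)
  also have "\<dots> \<le> L\<^sup>2 * (8 * ((\<Sum>j<n. (y j - z j)\<^sup>2) / n) + 2 * (y i - z i)\<^sup>2)"
    using mean_square_le[of n u] n by (intro mult_left_mono add_mono) (auto simp: m_def u_def)
  finally have A1: "a1\<^sup>2 \<le> L\<^sup>2 * (8 * ((\<Sum>j<n. (y j - z j)\<^sup>2) / n) + 2 * (y i - z i)\<^sup>2)" by simp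
  \<comment> \<open>The summand missing from the first average is \<open>f 0\<close>. Subtracting
    \<open>f 0\<close> from all summands leaves the difference of the two averages unchanged and
    makes that summand 0, so only the normalisations differ, by the factor
    \<open>1 / (n - 1)\<close>.\<close>
  have "a2 = 1 / (real n - 1) * ((\<Sum>j<n. f (z j - z i) - f 0) / n)"
  proof -
    have e1: "(\<Sum>j\<in>{..<n} - {i}. f (z j - z i)) = S - f 0" using split[of "\<lambda>j. f (z j - z i)"] by (simp add: S_def)
    have e2: "(\<Sum>j<n. f (z j - z i) - f 0) = S - n * f 0" by (simp add: sum_subtractf S_def)
    show ?thesis unfolding a2_def e1 e2 using n1 by (simp add: field_simps)
  qed
  then have "\<bar>a2\<bar> = 1 / (real n - 1) * (\<bar>\<Sum>j<n. f (z j - z i) - f 0\<bar> / n)" using n1 by (simp add: abs_mult)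
  also have "\<dots> \<le> 1 / (real n - 1) * ((\<Sum>j<n. L * (\<bar>z j\<bar> + \<bar>z i\<bar>)) / n)"
  proof (intro mult_left_mono divide_right_mono order_trans[OF sum_abs sum_mono])
    fix j
    have "\<bar>f (z j - z i) - f 0\<bar> \<le> L * \<bar>(z j - z i) - 0\<bar>" by (rule f)
    also have "\<dots> \<le> L * (\<bar>z j\<bar> + \<bar>z i\<bar>)" using L by (intro mult_left_mono) auto
    finally show "\<bar>f (z j - z i) - f 0\<bar> \<le> L * (\<bar>z j\<bar> + \<bar>z i\<bar>)" .
  qed (use n1 in auto)
  also have "\<dots> = L / (real n - 1) * ((\<Sum>j<n. \<bar>z j\<bar>) / n + \<bar>z i\<bar>)"
    using n1 by (simp add: sum_distrib_left[symmetric] sum.distrib field_simps)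
  finally have "\<bar>a2\<bar>\<^sup>2 \<le> (L / (real n - 1) * ((\<Sum>j<n. \<bar>z j\<bar>) / n + \<bar>z i\<bar>))\<^sup>2" by (rule power_mono) simp
  also have "\<dots> = L\<^sup>2 / (real n - 1)\<^sup>2 * ((\<Sum>j<n. \<bar>z j\<bar>) / n + \<bar>z i\<bar>)\<^sup>2"
    by (simp add: power_mult_distrib power_divide)
  also have "\<dots> \<le> L\<^sup>2 / (real n - 1)\<^sup>2 * (2 * ((\<Sum>j<n. \<bar>z j\<bar>) / n)\<^sup>2 + 2 * (z i)\<^sup>2)"
  proof (rule mult_left_mono)
    show "((\<Sum>j<n. \<bar>z j\<bar>) / n + \<bar>z i\<bar>)\<^sup>2 \<le> 2 * ((\<Sum>j<n. \<bar>z j\<bar>) / n)\<^sup>2 + 2 * (z i)\<^sup>2"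
      using zero_le_power2[of "(\<Sum>j<n. \<bar>z j\<bar>) / n - \<bar>z i\<bar>"] by (simp add: power2_sum power2_diff)
  qed simp
  also have "\<dots> \<le> L\<^sup>2 / (real n - 1)\<^sup>2 * (2 * ((\<Sum>j<n. (z j)\<^sup>2) / n) + 2 * (z i)\<^sup>2)"
    using mean_square_le[of n "\<lambda>j. \<bar>z j\<bar>"] n by (intro mult_left_mono add_mono) auto
  finally have A2: "a2\<^sup>2 \<le> L\<^sup>2 / (real n - 1)\<^sup>2 * (2 * ((\<Sum>j<n. (z j)\<^sup>2) / n) + 2 * (z i)\<^sup>2)" by simp
  \<comment> \<open>The factor 3 for three summands multiplies the constants 8 and 2 in the bound of
    \<open>a1\<close> and 2 in that of \<open>a2\<close>; hence 24, 6 and 6 in the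
    statement.\<close>
  have "(a1 + a2 + r)\<^sup>2 \<le> 3 * a1\<^sup>2 + 3 * a2\<^sup>2 + 3 * r\<^sup>2"
    using zero_le_power2[of "a1 - a2"] zero_le_power2[of "a1 - r"] zero_le_power2[of "a2 - r"]
    by (simp add: power2_eq_square algebra_simps)
  also have "\<dots> \<le> 3 * (L\<^sup>2 * (8 * ((\<Sum>j<n. (y j - z j)\<^sup>2) / n) + 2 * (y i - z i)\<^sup>2))
      + 3 * (L\<^sup>2 / (real n - 1)\<^sup>2 * (2 * ((\<Sum>j<n. (z j)\<^sup>2) / n) + 2 * (z i)\<^sup>2)) + 3 * r\<^sup>2"
    using A1 A2 by linarith
  also have "\<dots> = 6 * L\<^sup>2 * (y i - z i)\<^sup>2 + 24 * L\<^sup>2 * ((\<Sum>j<n. (y j - z j)\<^sup>2) / n)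
      + 6 * L\<^sup>2 / (real n - 1)\<^sup>2 * ((\<Sum>j<n. (z j)\<^sup>2) / n + (z i)\<^sup>2) + 3 * r\<^sup>2"
    by (simp add: distrib_left mult_ac)
  finally show ?thesis unfolding dec r_def S_def .
qed

text \<open>Summed over \<open>i\<close>, an average over \<open>j\<close> contributes as much as
  the individual terms; thus \<open>30 = 6 + 24\<close> and \<open>12 = 6 + 6\<close>. Only after
  this summation does the right side involve the total gap alone, which lets Gronwall's inequality
  close.\<close>

lemma sum_interaction_error_le:
  fixes f :: "real \<Rightarrow> real" and y z d :: "nat \<Rightarrow> real" and n :: nat
  assumes n: "2 \<le> n" and f: "\<And>a b. \<bar>f a - f b\<bar> \<le> L * \<bar>a - b\<bar>" and L: "0 \<le> L"
  shows "(\<Sum>i<n. (1 / (real n - 1) * (\<Sum>j\<in>{..<n} - {i}. f (y j - y i)) - d i)\<^sup>2)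
    \<le> 30 * L\<^sup>2 * (\<Sum>i<n. (y i - z i)\<^sup>2) + 12 * L\<^sup>2 / (real n - 1)\<^sup>2 * (\<Sum>i<n. (z i)\<^sup>2)
      + 3 * (\<Sum>i<n. ((\<Sum>j<n. f (z j - z i)) / n - d i)\<^sup>2)"
proof -
  define A where "A = (\<Sum>j<n. (y j - z j)\<^sup>2)"
  define B where "B = (\<Sum>j<n. (z j)\<^sup>2)"
  define l where "l = L\<^sup>2 / (real n - 1)\<^sup>2"
  have "(\<Sum>i<n. (1 / (real n - 1) * (\<Sum>j\<in>{..<n} - {i}. f (y j - y i)) - d i)\<^sup>2)
    \<le> (\<Sum>i<n. 6 * L\<^sup>2 * (y i - z i)\<^sup>2 + 24 * L\<^sup>2 * (A / n) + 6 * l * (B / n + (z i)\<^sup>2)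
      + 3 * ((\<Sum>j<n. f (z j - z i)) / n - d i)\<^sup>2)"
    using interaction_error_le[OF n _ f L, of _ y "d _" z] by (intro sum_mono) (simp add: A_def B_def l_def)
  also have "\<dots> = 6 * L\<^sup>2 * A + n * (24 * L\<^sup>2 * (A / n)) + (6 * l * (n * (B / n)) + 6 * l * B)
      + 3 * (\<Sum>i<n. ((\<Sum>j<n. f (z j - z i)) / n - d i)\<^sup>2)"
    unfolding A_def[symmetric] B_def[symmetric]
    by (simp add: sum.distrib sum_distrib_left[symmetric] distrib_left A_def[symmetric] B_def[symmetric] del: times_divide_eq_right)
  also have "\<dots> = 30 * L\<^sup>2 * A + 12 * l * B + 3 * (\<Sum>i<n. ((\<Sum>j<n. f (z j - z i)) / n - d i)\<^sup>2)"
    using n by simp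
  finally show ?thesis by (simp add: A_def B_def l_def)
qed

lemma measurable_process_path_on:
  assumes H: "measurable_process M T H" and w: "\<omega> \<in> space M" and T: "0 \<le> T"
    and f[measurable]: "f \<in> borel_measurable borel" and A[measurable]: "A \<in> sets borel" and AT: "A \<subseteq> {0..T}"
  shows "(\<lambda>t. ennreal (f (H t \<omega>)) * indicator A t) \<in> borel_measurable lborel"
proof -
  have [measurable]: "(\<lambda>t. indicator {0..T} t * H t \<omega>) \<in> borel_measurable lborel"
    by (rule measurable_process_path[OF H w T])
  have "(\<lambda>t. ennreal (f (indicator {0..T} t * H t \<omega>)) * indicator A t) \<in> borel_measurable lborel"
    by measurable
  moreover have "(\<lambda>t. ennreal (f (indicator {0..T} t * H t \<omega>)) * indicator A t) = (\<lambda>t. ennreal (f (H t \<omega>)) * indicator A t)"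
    by (rule ext) (use AT in \<open>auto split: split_indicator\<close>)
  ultimately show ?thesis by (simp only:)
qed

section \<open>Gap between the agents and the independent copies\<close>

locale agent_system = mean_field_copies +
  fixes Y :: "nat \<Rightarrow> 'a \<Rightarrow> real \<Rightarrow> real" and Z :: "nat \<Rightarrow> nat \<Rightarrow> real \<Rightarrow> 'a \<Rightarrow> real"
  assumes bsde: "solves_bsde_system c T M (copies_filtration M n X) n
        (\<lambda>i t \<omega>. Wbar t (X i \<omega>)) (\<lambda>i \<omega>. Ybar T (X i \<omega>)) (\<lambda>i t \<omega>. \<theta> t (X i \<omega>)) Y Z"
begin

definition Ys :: "nat \<Rightarrow> 'a \<Rightarrow> real \<Rightarrow> real" where
  "Ys i \<omega> = Ypath (X i \<omega>)"

definition gap :: "nat \<Rightarrow> real \<Rightarrow> 'a \<Rightarrow> real" where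
  "gap i t \<omega> = Y i \<omega> t - Ys i \<omega> t"

text \<open>The difference of the drivers of the two backward equations; the common control
  \<open>\<theta>\<close> cancels.\<close>

definition err :: "nat \<Rightarrow> real \<Rightarrow> 'a \<Rightarrow> real" where
  "err i t \<omega> = 1 / (real n - 1) * (\<Sum>j\<in>{..<n} - {i}. cstar c (Y j \<omega> t - Y i \<omega> t)) - drift t (Ys i \<omega> t)"

lemmas bsdeD = bsde[unfolded solves_bsde_system_def, rule_format]

lemma Y_measurable: "i < n \<Longrightarrow> Y i \<in> M \<rightarrow>\<^sub>M path_space T"
  using bsdeD by (rule conjunct1)

lemma Ys_measurable: "i < n \<Longrightarrow> Ys i \<in> M \<rightarrow>\<^sub>M path_space T"
  unfolding Ys_def[abs_def] by (rule measurable_compose[OF X_measurable Ypath_measurable])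

lemma Ys_eq: "t \<in> {0..T} \<Longrightarrow> Ys i \<omega> t = Ybar t (X i \<omega>)"
  by (simp add: Ys_def Ypath_eq)

lemma Y_continuous: "i < n \<Longrightarrow> \<omega> \<in> space M \<Longrightarrow> continuous_on {0..T} (Y i \<omega>)"
  using measurable_space[OF Y_measurable] by (simp add: space_path_space)

lemma Y_process: "i < n \<Longrightarrow> measurable_process M T (\<lambda>t \<omega>. Y i \<omega> t)"
  and Ys_process: "i < n \<Longrightarrow> measurable_process M T (\<lambda>t \<omega>. Ys i \<omega> t)"
  using measurable_process_path_space[OF T_pos Y_measurable] measurable_process_path_space[OF T_pos Ys_measurable] by auto

lemma gap_process: "i < n \<Longrightarrow> measurable_process M T (gap i)"
  using Y_process[of i] Ys_process[of i] unfolding measurable_process_def gap_def[abs_def]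
  by (simp add: case_prod_beta')

lemma err_process: assumes i: "i < n" shows "measurable_process M T (err i)"
proof -
  let ?N = "restrict_space borel {0..T} \<Otimes>\<^sub>M M"
  have Ym[measurable]: "(\<lambda>z. Y j (snd z) (fst z)) \<in> borel_measurable ?N" if "j < n" for j
    using Y_process[OF that] by (simp add: measurable_process_def case_prod_beta')
  have Ysm[measurable]: "(\<lambda>z. Ys i (snd z) (fst z)) \<in> borel_measurable ?N"
    using Ys_process[OF i] by (simp add: measurable_process_def case_prod_beta')
  have t[measurable]: "fst \<in> ?N \<rightarrow>\<^sub>M borel"
    by (rule measurable_compose[OF measurable_fst measurable_restrict_space1]) simp
  have "(\<lambda>z. drift (max 0 (min T (fst z))) (Ys i (snd z) (fst z))) \<in> borel_measurable ?N"
    using measurable_compose[OF _ drift_measurable, of "\<lambda>z. (fst z, Ys i (snd z) (fst z))" ?N] by simp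
  moreover have "drift (max 0 (min T (fst z))) (Ys i (snd z) (fst z)) = drift (fst z) (Ys i (snd z) (fst z))"
    if "z \<in> space ?N" for z
    using that by (auto simp: space_pair_measure space_restrict_space min_absorb2 max_absorb2)
  ultimately have d: "(\<lambda>z. drift (fst z) (Ys i (snd z) (fst z))) \<in> borel_measurable ?N"
    by (rule measurable_cong[THEN iffD1, rotated])
  have s: "(\<lambda>z. \<Sum>j\<in>{..<n} - {i}. cstar c (Y j (snd z) (fst z) - Y i (snd z) (fst z))) \<in> borel_measurable ?N"
    by (intro borel_measurable_sum measurable_compose[OF _ cstar_measurable] borel_measurable_diff Ym i) auto
  have "(\<lambda>z. 1 / (real n - 1) * (\<Sum>j\<in>{..<n} - {i}. cstar c (Y j (snd z) (fst z) - Y i (snd z) (fst z)))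
      - drift (fst z) (Ys i (snd z) (fst z))) \<in> borel_measurable ?N"
    by (intro borel_measurable_diff borel_measurable_times borel_measurable_const s d)
  then show ?thesis by (simp add: measurable_process_def err_def[abs_def] case_prod_beta')
qed

lemma gap_adapted:
  assumes i: "i < n" and t: "t \<in> {0..T}" shows "gap i t \<in> borel_measurable (full_filtration t)"
proof -
  have "(\<lambda>\<omega>. Y i \<omega> t) \<in> borel_measurable (copies_filtration M n X t)"
    using bsdeD[OF i, THEN conjunct2, THEN conjunct1] t unfolding adapted_def by (rule bspec)
  then have "(\<lambda>\<omega>. Y i \<omega> t) \<in> borel_measurable (full_filtration t)"
    using copies_filtration_subset[OF t] by (auto simp: measurable_def copies_filtration_def)
  moreover have "(\<lambda>\<omega>. Ys i \<omega> t) \<in> borel_measurable (full_filtration t)"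
    unfolding Ys_eq[OF t] by (rule measurable_X_full[OF i Ybar_canonical t]) (use t in auto)
  ultimately show ?thesis unfolding gap_def[abs_def] by (rule borel_measurable_diff)
qed

text \<open>Both equations have the same terminal value, so the gap vanishes at \<open>T\<close>.
  The martingale part \<open>N\<close> is the sum of the \<open>n\<close> integrals of the agent's
  equation minus the integral of the \<open>i\<close>-th copy, all of them martingales for the joint
  filtration.\<close>

lemma gap_bsde:
  assumes i: "i < n"
  obtains N where "full.l2_martingale N" "AE \<omega> in M. continuous_on {0..T} (\<lambda>t. N t \<omega>)"
    "AE \<omega> in M. \<forall>t\<in>{0..T}. gap i t \<omega> = (LINT u:{t..T}|lborel. err i u \<omega>) - (N T \<omega> - N t \<omega>)"
proof -
  from bsdeD[OF i, THEN conjunct2, THEN conjunct2, THEN conjunct2]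
  obtain I where I: "(\<forall>k<n. ito_integral M (copies_filtration M n X) T (\<lambda>t \<omega>. Wbar t (X k \<omega>)) (Z i k) (I k)) \<and>
      (AE \<omega> in M. \<forall>t\<in>{0..T}. Y i \<omega> t = Ybar T (X i \<omega>)
        + (LINT u:{t..T}|lborel. 1 / (real n - 1) * (\<Sum>j\<in>{..<n} - {i}. cstar c (Y j \<omega> u - Y i \<omega> u)) + \<theta> u (X i \<omega>))
        - (\<Sum>k<n. I k T \<omega> - I k t \<omega>))" ..
  have Im: "full.l2_martingale (I k)" and Ic: "AE \<omega> in M. continuous_on {0..T} (\<lambda>t. I k t \<omega>)" if k: "k < n" for k
  proof -
    have ito: "ito_integral M (copies_filtration M n X) T (\<lambda>t \<omega>. Wbar t (X k \<omega>)) (Z i k) (I k)"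
      using I k by blast
    show "full.l2_martingale (I k)"
      by (rule full.ito_l2_martingale[OF full_brownian[OF k] ito])
        (simp_all add: copies_filtration_subset, simp add: copies_filtration_def)
    show "AE \<omega> in M. continuous_on {0..T} (\<lambda>t. I k t \<omega>)"
      using ito unfolding ito_integral_def by (elim conjE)
  qed
  obtain J where Jito: "ito_integral p (canonical_filtration p) T Wbar \<eta> J"
    and J: "AE \<omega> in p. \<forall>t\<in>{0..T}. Ybar t \<omega> = Ybar 0 \<omega> - (LINT u:{0..t}|lborel. drift u (Ybar u \<omega>) + \<theta> u \<omega>) + J t \<omega>"
    and Jint: "AE \<omega> in p. set_integrable lborel {0..T} (\<lambda>u. drift u (Ybar u \<omega>) + \<theta> u \<omega>)"
    by (rule dynamics)
  have Jc: "AE \<omega> in p. continuous_on {0..T} (\<lambda>t. J t \<omega>)"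
    using Jito unfolding ito_integral_def by (elim conjE)
  define N where "N t \<omega> = (\<Sum>k<n. I k t \<omega>) - J t (X i \<omega>)" for t \<omega>
  show thesis
  proof (rule that[of N])
    show "full.l2_martingale N"
      unfolding N_def[abs_def]
      by (intro full.l2_martingale_diff full.l2_martingale_sum ito_X_l2_martingale[OF i Jito] Im) auto
    have "AE \<omega> in M. \<forall>k\<in>{..<n}. continuous_on {0..T} (\<lambda>t. I k t \<omega>)"
      by (rule AE_finite_allI) (use Ic in auto)
    then show "AE \<omega> in M. continuous_on {0..T} (\<lambda>t. N t \<omega>)"
      using X_AE[OF i Jc] unfolding N_def
      by eventually_elim (intro continuous_on_diff continuous_on_sum; blast)
    show "AE \<omega> in M. \<forall>t\<in>{0..T}. gap i t \<omega> = (LINT u:{t..T}|lborel. err i u \<omega>) - (N T \<omega> - N t \<omega>)"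
      using I[THEN conjunct2] X_AE[OF i J] X_AE[OF i Jint] X_AE[OF i \<theta>_AE_finite] AE_space[of M]
    proof eventually_elim
      case (elim \<omega>)
      note w = elim(5)
      have wp: "X i \<omega> \<in> space p" using measurable_space[OF X_measurable[OF i] w] .
      let ?a = "\<lambda>u. 1 / (real n - 1) * (\<Sum>j\<in>{..<n} - {i}. cstar c (Y j \<omega> u - Y i \<omega> u))"
      let ?b = "\<lambda>u. drift u (Ybar u (X i \<omega>)) + \<theta> u (X i \<omega>)"
      \<comment> \<open>Bochner integrals may be subtracted only if each exists. The interaction
        term is continuous in time, \<open>\<theta>\<close> is square integrable on a bounded
        interval along almost every path, and the mean field drift is covered by
        \<open>admissible\<close>.\<close>
      have a: "set_integrable lborel {0..T} ?a"
      proof (rule borel_integrable_atLeastAtMost')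
        have c: "continuous_on UNIV (cstar c)" by (rule lipschitz_on_continuous_on[OF cstar_lipschitz])
        show "continuous_on {0..T} ?a"
          by (intro continuous_on_mult continuous_on_const continuous_on_sum continuous_on_compose2[OF c]
              continuous_on_diff Y_continuous i w) auto
      qed
      have \<theta>: "set_integrable lborel {0..T} (\<lambda>u. \<theta> u (X i \<omega>))"
        unfolding set_integrable_def
      proof (rule integrableI_bounded)
        have "(\<lambda>u. indicator {0..T} u * \<theta> u (X i \<omega>)) \<in> borel_measurable lborel"
          by (rule measurable_process_path[OF \<theta>_measurable_process wp]) (use T_pos in simp)
        then show "(\<lambda>u. indicator {0..T} u *\<^sub>R \<theta> u (X i \<omega>)) \<in> borel_measurable lborel" by simp
        have m: "(\<lambda>u. ennreal ((\<theta> u (X i \<omega>))\<^sup>2) * indicator {0..T} u) \<in> borel_measurable lborel"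
          by (rule \<theta>_path_measurable[OF wp]) simp
        have "(\<integral>\<^sup>+u. ennreal (norm (indicator {0..T} u *\<^sub>R \<theta> u (X i \<omega>))) \<partial>lborel)
          \<le> (\<integral>\<^sup>+u. indicator {0..T} u + ennreal ((\<theta> u (X i \<omega>))\<^sup>2) * indicator {0..T} u \<partial>lborel)"
        proof (rule nn_integral_mono)
          fix u
          have "\<bar>\<theta> u (X i \<omega>)\<bar> \<le> 1 + (\<theta> u (X i \<omega>))\<^sup>2"
            using zero_le_power2[of "\<bar>\<theta> u (X i \<omega>)\<bar> - 1"] abs_ge_zero[of "\<theta> u (X i \<omega>)"] by (simp add: power2_diff)
          then have "ennreal \<bar>\<theta> u (X i \<omega>)\<bar> \<le> ennreal (1 + (\<theta> u (X i \<omega>))\<^sup>2)" by (rule ennreal_leI)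
          then show "ennreal (norm (indicator {0..T} u *\<^sub>R \<theta> u (X i \<omega>)))
              \<le> indicator {0..T} u + ennreal ((\<theta> u (X i \<omega>))\<^sup>2) * indicator {0..T} u"
            by (auto simp: ennreal_plus split: split_indicator)
        qed
        also have "\<dots> < \<infinity>"
          using elim(4) T_pos m by (subst nn_integral_add) (auto simp: ennreal_mult_less_top)
        finally show "(\<integral>\<^sup>+u. ennreal (norm (indicator {0..T} u *\<^sub>R \<theta> u (X i \<omega>))) \<partial>lborel) < \<infinity>" .
      qed
      show ?case
      proof
        fix t assume t: "t \<in> {0..T}"
        have sub: "set_integrable lborel {t..T} f" if "set_integrable lborel {0..T} f" for f :: "real \<Rightarrow> real"
          by (rule set_integrable_subset[OF that]) (use t in auto)
        have T: "T \<in> {0..T}" using T_pos by simp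
        have ab: "(LINT u:{t..T}|lborel. ?a u + \<theta> u (X i \<omega>)) - (LINT u:{t..T}|lborel. ?b u) = (LINT u:{t..T}|lborel. err i u \<omega>)"
        proof -
          have "(LINT u:{t..T}|lborel. ?a u + \<theta> u (X i \<omega>)) - (LINT u:{t..T}|lborel. ?b u)
            = (LINT u:{t..T}|lborel. (?a u + \<theta> u (X i \<omega>)) - ?b u)"
            by (rule set_integral_diff(2)[symmetric])
              (intro set_integral_add(1) sub a \<theta>, rule sub[OF elim(3)])
          also have "\<dots> = (LINT u:{t..T}|lborel. err i u \<omega>)"
            by (rule set_lebesgue_integral_cong) (use t in \<open>auto simp: err_def Ys_eq\<close>)
          finally show ?thesis .
        qed
        \<comment> \<open>The forward equation at \<open>T\<close> minus that at \<open>t\<close> is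
          the backward form: the initial value and the integral up to \<open>t\<close> drop
          out.\<close>
        have "Ybar t (X i \<omega>) = Ybar T (X i \<omega>) + (LINT u:{t..T}|lborel. ?b u) - (J T (X i \<omega>) - J t (X i \<omega>))"
          using elim(2)[rule_format, OF t] elim(2)[rule_format, OF T] set_integral_split_interval[OF elim(3) t] by linarith
        then have "gap i t \<omega> = (LINT u:{t..T}|lborel. ?a u + \<theta> u (X i \<omega>)) - (LINT u:{t..T}|lborel. ?b u)
            - ((\<Sum>k<n. I k T \<omega> - I k t \<omega>) - (J T (X i \<omega>) - J t (X i \<omega>)))"
          using elim(1)[rule_format, OF t] unfolding gap_def Ys_eq[OF t] by linarith
        then show "gap i t \<omega> = (LINT u:{t..T}|lborel. err i u \<omega>) - (N T \<omega> - N t \<omega>)"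
          unfolding ab by (simp add: N_def sum_subtractf)
      qed
    qed
  qed
qed

definition err_energy :: "nat \<Rightarrow> real set \<Rightarrow> ennreal" where
  "err_energy i A = (\<integral>\<^sup>+\<omega>. (\<integral>\<^sup>+u\<in>A. ennreal ((err i u \<omega>)\<^sup>2) \<partial>lborel) \<partial>M)"

lemma err_integral_square_le:
  assumes i: "i < n" and w: "\<omega> \<in> space M" and t: "t \<in> {0..T}"
  shows "(\<integral>\<^sup>+u\<in>{t..T}. ennreal \<bar>err i u \<omega>\<bar> \<partial>lborel)\<^sup>2 \<le> ennreal T * (\<integral>\<^sup>+u\<in>{t..T}. ennreal ((err i u \<omega>)\<^sup>2) \<partial>lborel)"
proof -
  have "(\<integral>\<^sup>+u\<in>{t..T}. ennreal \<bar>err i u \<omega>\<bar> \<partial>lborel)\<^sup>2 \<le> ennreal (T - t) * (\<integral>\<^sup>+u\<in>{t..T}. (ennreal \<bar>err i u \<omega>\<bar>)\<^sup>2 \<partial>lborel)"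
    by (rule nn_integral_interval_square_le[OF measurable_process_path_on[OF err_process[OF i] w]])
      (use t T_pos in auto)
  also have "\<dots> \<le> ennreal T * (\<integral>\<^sup>+u\<in>{t..T}. (ennreal \<bar>err i u \<omega>\<bar>)\<^sup>2 \<partial>lborel)"
    using t by (intro mult_right_mono ennreal_leI) auto
  finally show ?thesis by (simp add: ennreal_power)
qed

lemma err_set_integral_square_le:
  assumes i: "i < n" and t: "t \<in> {0..T}"
  shows "(\<integral>\<^sup>+\<omega>. ennreal ((LINT u:{t..T}|lborel. err i u \<omega>)\<^sup>2) \<partial>M) \<le> ennreal T * err_energy i {t..T}"
proof -
  have "(\<integral>\<^sup>+\<omega>. ennreal ((LINT u:{t..T}|lborel. err i u \<omega>)\<^sup>2) \<partial>M)
      \<le> (\<integral>\<^sup>+\<omega>. ennreal T * (\<integral>\<^sup>+u\<in>{t..T}. ennreal ((err i u \<omega>)\<^sup>2) \<partial>lborel) \<partial>M)"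
  proof (rule nn_integral_mono)
    fix \<omega> assume w: "\<omega> \<in> space M"
    have "ennreal ((LINT u:{t..T}|lborel. err i u \<omega>)\<^sup>2) = (ennreal \<bar>LINT u:{t..T}|lborel. err i u \<omega>\<bar>)\<^sup>2"
      by (simp add: ennreal_power)
    also have "\<dots> \<le> (\<integral>\<^sup>+u\<in>{t..T}. ennreal \<bar>err i u \<omega>\<bar> \<partial>lborel)\<^sup>2"
      by (intro power_mono set_integral_abs_le) simp
    also have "\<dots> \<le> ennreal T * (\<integral>\<^sup>+u\<in>{t..T}. ennreal ((err i u \<omega>)\<^sup>2) \<partial>lborel)"
      by (rule err_integral_square_le[OF i w t])
    finally show "ennreal ((LINT u:{t..T}|lborel. err i u \<omega>)\<^sup>2)
      \<le> ennreal T * (\<integral>\<^sup>+u\<in>{t..T}. ennreal ((err i u \<omega>)\<^sup>2) \<partial>lborel)" .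
  qed
  also have "\<dots> = ennreal T * err_energy i {t..T}"
    unfolding err_energy_def
    by (rule nn_integral_cmult, rule measurable_process_nn_integral[OF err_process[OF i], where f="\<lambda>x. x\<^sup>2"])
      (use t T_pos in auto)
  finally show ?thesis .
qed

lemma gap_square_le:
  assumes i: "i < n" and t: "t \<in> {0..T}"
  shows "(\<integral>\<^sup>+\<omega>. ennreal ((gap i t \<omega>)\<^sup>2) \<partial>M) \<le> ennreal T * err_energy i {t..T}"
proof -
  obtain N where N: "full.l2_martingale N"
    and eq: "AE \<omega> in M. \<forall>t\<in>{0..T}. gap i t \<omega> = (LINT u:{t..T}|lborel. err i u \<omega>) - (N T \<omega> - N t \<omega>)"
    by (rule gap_bsde[OF i])
  have "AE \<omega> in M. gap i t \<omega> = (LINT u:{t..T}|lborel. err i u \<omega>) - (N T \<omega> - N t \<omega>)"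
    using eq by eventually_elim (use t in blast)
  from full.energy_estimate(1)[OF N gap_adapted[OF i t] t this] show ?thesis
    using err_set_integral_square_le[OF i t] by (rule order_trans)
qed

text \<open>The constant is \<open>34 = 2 + 8 * 4\<close>: 2 from separating the drift part from the
  martingale part, 8 because \<open>N T - N t\<close> is a difference of two values of the
  martingale started at 0, each bounded by the same maximum, and 4 from Doob's inequality. The
  energy estimate at time 0 then bounds the final value of that martingale.\<close>

lemma sup_gap_square_le:
  assumes i: "i < n"
  shows "(\<integral>\<^sup>+\<omega>. sup_sq T (\<lambda>t. gap i t \<omega>) \<partial>M) \<le> ennreal (34 * T) * err_energy i {0..T}"
proof -
  have z: "0 \<in> {0..T}" and T: "T \<in> {0..T}" using T_pos by auto
  obtain N where N: "full.l2_martingale N" and Nc: "AE \<omega> in M. continuous_on {0..T} (\<lambda>t. N t \<omega>)"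
    and eq: "AE \<omega> in M. \<forall>t\<in>{0..T}. gap i t \<omega> = (LINT u:{t..T}|lborel. err i u \<omega>) - (N T \<omega> - N t \<omega>)"
    by (rule gap_bsde[OF i])
  let ?N = "\<lambda>t \<omega>. N t \<omega> - N 0 \<omega>"
  have N': "full.l2_martingale ?N" by (rule full.l2_martingale_minus_initial[OF N])
  have "AE \<omega> in M. continuous_on {0..T} (\<lambda>t. ?N t \<omega>)"
    using Nc by eventually_elim (intro continuous_on_diff continuous_on_const)
  then obtain h where h[measurable]: "h \<in> borel_measurable M" and sup_h: "AE \<omega> in M. sup_sq T (\<lambda>t. ?N t \<omega>) \<le> h \<omega>"
    and Eh: "(\<integral>\<^sup>+\<omega>. h \<omega> \<partial>M) \<le> 4 * (\<integral>\<^sup>+\<omega>. ennreal ((?N T \<omega>)\<^sup>2) \<partial>M)"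
    by (rule full.doob_measurable_bound[OF N'])
  have "AE \<omega> in M. gap i 0 \<omega> = (LINT u:{0..T}|lborel. err i u \<omega>) - (N T \<omega> - N 0 \<omega>)"
    using eq by eventually_elim (use z in blast)
  from full.energy_estimate(2)[OF N gap_adapted[OF i z] z this]
  have NT: "(\<integral>\<^sup>+\<omega>. ennreal ((?N T \<omega>)\<^sup>2) \<partial>M) \<le> ennreal T * err_energy i {0..T}"
    using err_set_integral_square_le[OF i z] by (rule order_trans)
  define E where "E \<omega> = (\<integral>\<^sup>+u\<in>{0..T}. ennreal ((err i u \<omega>)\<^sup>2) \<partial>lborel)" for \<omega>
  have [measurable]: "E \<in> borel_measurable M"
    unfolding E_def[abs_def]
    by (rule measurable_process_nn_integral[OF err_process[OF i], where f="\<lambda>x. x\<^sup>2"]) (use T_pos in auto)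
  have "AE \<omega> in M. sup_sq T (\<lambda>t. gap i t \<omega>) \<le> 2 * (ennreal T * E \<omega>) + 8 * h \<omega>"
    using eq sup_h AE_space[of M]
  proof eventually_elim
    case (elim \<omega>)
    show ?case
    proof (rule SUP_least)
      fix t assume t: "t \<in> {0..T}"
      let ?B = "\<integral>\<^sup>+u\<in>{0..T}. ennreal \<bar>err i u \<omega>\<bar> \<partial>lborel"
      have "ennreal \<bar>LINT u:{t..T}|lborel. err i u \<omega>\<bar> \<le> (\<integral>\<^sup>+u\<in>{t..T}. ennreal \<bar>err i u \<omega>\<bar> \<partial>lborel)"
        by (rule set_integral_abs_le)
      also have "\<dots> \<le> ?B" by (rule nn_integral_mono) (use t in \<open>auto split: split_indicator\<close>)
      finally have B: "ennreal \<bar>LINT u:{t..T}|lborel. err i u \<omega>\<bar> \<le> ?B" .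
      have nT: "ennreal ((?N T \<omega>)\<^sup>2) \<le> h \<omega>" and nt: "ennreal ((?N t \<omega>)\<^sup>2) \<le> h \<omega>"
        using elim(2) SUP_upper[OF T, of "\<lambda>t. ennreal ((?N t \<omega>)\<^sup>2)"] SUP_upper[OF t, of "\<lambda>t. ennreal ((?N t \<omega>)\<^sup>2)"]
        by (auto intro: order_trans)
      have "\<bar>gap i t \<omega>\<bar> \<le> \<bar>LINT u:{t..T}|lborel. err i u \<omega>\<bar> + (\<bar>?N T \<omega>\<bar> + \<bar>?N t \<omega>\<bar>)"
        using elim(1)[rule_format, OF t] by linarith
      then have "ennreal \<bar>gap i t \<omega>\<bar> \<le> ennreal (\<bar>LINT u:{t..T}|lborel. err i u \<omega>\<bar> + (\<bar>?N T \<omega>\<bar> + \<bar>?N t \<omega>\<bar>))"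
        by (rule ennreal_leI)
      also have "\<dots> = ennreal \<bar>LINT u:{t..T}|lborel. err i u \<omega>\<bar> + (ennreal \<bar>?N T \<omega>\<bar> + ennreal \<bar>?N t \<omega>\<bar>)"
        by (simp add: ennreal_plus)
      also have "\<dots> \<le> ?B + (ennreal \<bar>?N T \<omega>\<bar> + ennreal \<bar>?N t \<omega>\<bar>)" by (rule add_right_mono[OF B])
      finally have "(ennreal \<bar>gap i t \<omega>\<bar>)\<^sup>2 \<le> (?B + (ennreal \<bar>?N T \<omega>\<bar> + ennreal \<bar>?N t \<omega>\<bar>))\<^sup>2"
        by (rule power_mono) simp
      also have "\<dots> \<le> 2 * ?B\<^sup>2 + 2 * (ennreal \<bar>?N T \<omega>\<bar> + ennreal \<bar>?N t \<omega>\<bar>)\<^sup>2" by (rule ennreal_add_square_le)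
      also have "\<dots> \<le> 2 * (ennreal T * E \<omega>) + 2 * (2 * h \<omega> + 2 * h \<omega>)"
      proof (intro add_mono mult_left_mono)
        show "?B\<^sup>2 \<le> ennreal T * E \<omega>" unfolding E_def by (rule err_integral_square_le[OF i elim(3) z])
        have "(ennreal \<bar>?N T \<omega>\<bar> + ennreal \<bar>?N t \<omega>\<bar>)\<^sup>2 \<le> 2 * (ennreal \<bar>?N T \<omega>\<bar>)\<^sup>2 + 2 * (ennreal \<bar>?N t \<omega>\<bar>)\<^sup>2"
          by (rule ennreal_add_square_le)
        also have "\<dots> \<le> 2 * h \<omega> + 2 * h \<omega>"
          using nT nt by (intro add_mono mult_left_mono) (auto simp: ennreal_power)
        finally show "(ennreal \<bar>?N T \<omega>\<bar> + ennreal \<bar>?N t \<omega>\<bar>)\<^sup>2 \<le> 2 * h \<omega> + 2 * h \<omega>" .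
      qed auto
      also have "\<dots> = 2 * (ennreal T * E \<omega>) + 8 * h \<omega>"
        by (simp only: distrib_right[symmetric] mult.assoc[symmetric]) simp
      finally show "ennreal ((gap i t \<omega>)\<^sup>2) \<le> 2 * (ennreal T * E \<omega>) + 8 * h \<omega>" by (simp add: ennreal_power)
    qed
  qed
  then have "(\<integral>\<^sup>+\<omega>. sup_sq T (\<lambda>t. gap i t \<omega>) \<partial>M) \<le> (\<integral>\<^sup>+\<omega>. 2 * (ennreal T * E \<omega>) + 8 * h \<omega> \<partial>M)"
    by (rule nn_integral_mono_AE)
  also have "\<dots> = 2 * (ennreal T * err_energy i {0..T}) + 8 * (\<integral>\<^sup>+\<omega>. h \<omega> \<partial>M)"
    unfolding err_energy_def E_def[symmetric] by (simp add: nn_integral_add nn_integral_cmult)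
  also have "\<dots> \<le> 2 * (ennreal T * err_energy i {0..T}) + 8 * (4 * (ennreal T * err_energy i {0..T}))"
    by (intro add_left_mono mult_left_mono order_trans[OF Eh] NT) auto
  also have "\<dots> = 34 * (ennreal T * err_energy i {0..T})"
    by (simp only: mult.assoc[symmetric] distrib_right[symmetric]) simp
  also have "\<dots> = ennreal (34 * T) * err_energy i {0..T}"
    using T_pos by (simp add: ennreal_mult mult.assoc)
  finally show ?thesis .
qed

end

lemma ennreal_divide_of_nat: "0 < n \<Longrightarrow> x / of_nat n = x * ennreal (1 / real n)"
  by (simp add: divide_ennreal_def ennreal_of_nat_eq_real_of_nat inverse_ennreal inverse_eq_divide)

lemma coupling_with_cost:
  assumes T: "0 < T" and n: "0 < n" and x: "\<And>j. j < n \<Longrightarrow> x j \<in> space (path_space T)"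
    and \<mu>: "prob_space \<mu>" and s: "sets \<mu> = sets (path_space T)" and g: "coupling_weights n \<mu> g"
  obtains \<pi> where "\<pi> \<in> couplings (empirical_measure T n x) \<mu>"
    and "(\<integral>\<^sup>+z. sup_sq T (\<lambda>u. fst z u - snd z u) \<partial>\<pi>)
      = (\<Sum>j<n. \<integral>\<^sup>+y. ennreal (g j y) * sup_sq T (\<lambda>u. x j u - y u) \<partial>\<mu>) * ennreal (1 / n)"
proof -
  have g1: "g j \<in> borel_measurable \<mu>" "(\<integral>\<^sup>+y. ennreal (g j y) \<partial>\<mu>) = 1" if "j < n" for j
    using g that unfolding coupling_weights_def by simp_all
  have g2: "AE y in \<mu>. (\<Sum>j<n. ennreal (g j y)) = of_nat n"
    using g unfolding coupling_weights_def by (rule conjunct2)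
  show thesis
  proof (rule coupling_of_weights[OF n x \<mu> s g1 g2])
    fix \<pi> assume \<pi>: "\<pi> \<in> couplings (empirical_measure T n x) \<mu>"
      and F: "\<And>F. F \<in> borel_measurable (path_space T \<Otimes>\<^sub>M path_space T) \<Longrightarrow>
        (\<integral>\<^sup>+z. F z \<partial>\<pi>) = (\<Sum>j<n. \<integral>\<^sup>+y. ennreal (g j y) * F (x j, y) \<partial>\<mu>) / of_nat n"
    show thesis
      by (rule that[OF \<pi>]) (simp only: F[OF sup_sq_measurable_pair[OF T]] fst_conv snd_conv ennreal_divide_of_nat[OF n])
  qed
qed

lemma tendsto_0_ennrealI:
  fixes f :: "nat \<Rightarrow> ennreal"
  assumes "\<And>\<epsilon>::real. 0 < \<epsilon> \<Longrightarrow> \<forall>\<^sub>F n in sequentially. f n \<le> ennreal \<epsilon>"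
  shows "f \<longlonglongrightarrow> 0"
proof (rule order_tendstoI)
  fix a :: ennreal assume "0 < a"
  then obtain b where b: "0 < b" "b < a" using dense by blast
  then obtain r where r: "b = ennreal r" "0 \<le> r" by (cases b) auto
  then have "0 < r" using b(1) by simp
  from assms[OF this] show "\<forall>\<^sub>F n in sequentially. f n < a"
    by eventually_elim (use b(2) r in auto)
qed simp

lemma ennreal_linear_combinations:
  fixes a b x y z C T K v d :: real
  assumes "0 \<le> a" "0 \<le> b" "0 \<le> x" "0 \<le> y"
  shows "0 \<le> z \<Longrightarrow> ennreal (a * x + b * y + 3 * z) = ennreal a * ennreal x + ennreal b * ennreal y + ennreal 3 * ennreal z"
    and "ennreal a * (ennreal x * (ennreal y * (ennreal y * r))) + ennreal y * r = ennreal (a * x * y\<^sup>2 + y) * r"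
    and "0 \<le> K \<Longrightarrow> 2 * (ennreal K * (ennreal a * ennreal x + ennreal b * ennreal y)) + 2 * ennreal y
      = ennreal (2 * (K * (a * x + b * y)) + 2 * y)"
  using assms by (simp_all add: ennreal_mult ennreal_plus distrib_right power2_eq_square mult.assoc)

definition (in mean_field) second_moment :: ennreal where
  "second_moment = (\<integral>\<^sup>+\<omega>. sup_sq T (Ypath \<omega>) \<partial>p)"

text \<open>Independent of \<open>n\<close>. The exponential factor is the constant of
  \<open>gronwall_backward\<close> at rate \<open>30 * Lc\<^sup>2 * T\<close>, and
  \<open>34 * T\<close> is that of \<open>sup_gap_square_le\<close>.\<close>

definition (in mean_field) stability_constant :: real where
  "stability_constant = 34 * T * (30 * Lc\<^sup>2 * (2 * exp ((2 * (30 * Lc\<^sup>2 * T) + 1) * T) * T) * T\<^sup>2 + T)"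

section \<open>Gronwall's inequality for all agents together\<close>

context agent_system
begin

lemma Ys_second_moment: "i < n \<Longrightarrow> (\<integral>\<^sup>+\<omega>. sup_sq T (Ys i \<omega>) \<partial>M) = second_moment"
  unfolding Ys_def second_moment_def
  by (rule X_nn_integral[OF _ borel_measurable_sup_sq_path1[OF T_pos Ypath_measurable]])

lemma Ys_sup_measurable: "i < n \<Longrightarrow> (\<lambda>\<omega>. sup_sq T (Ys i \<omega>)) \<in> borel_measurable M"
  by (rule borel_measurable_sup_sq_path1[OF T_pos Ys_measurable])

text \<open>The assumption \<open>mean\<close> holds for every centre \<open>x\<close> with one and
  the same \<open>q\<close>. It can therefore be used at \<open>x = Ys i \<omega> u\<close>,
  although this point is itself one of the samples in the average.\<close>

lemma sum_err_square_le:
  assumes w: "\<omega> \<in> space M" and u: "u \<in> {0..T}"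
    and mean: "\<And>x. ennreal (((\<Sum>j<n. cstar c (Ys j \<omega> u - x)) / n - drift u x)\<^sup>2) \<le> ennreal (Lc\<^sup>2) * q"
  shows "(\<Sum>i<n. ennreal ((err i u \<omega>)\<^sup>2)) \<le> ennreal (30 * Lc\<^sup>2) * (\<Sum>i<n. ennreal ((gap i u \<omega>)\<^sup>2))
    + (ennreal (12 * Lc\<^sup>2 / (real n - 1)\<^sup>2) * (\<Sum>i<n. sup_sq T (Ys i \<omega>)) + ennreal (3 * n * Lc\<^sup>2) * q)"
proof -
  define r where "r i = (\<Sum>j<n. cstar c (Ys j \<omega> u - Ys i \<omega> u)) / n - drift u (Ys i \<omega> u)" for i
  have "(\<Sum>i<n. ennreal ((err i u \<omega>)\<^sup>2)) = ennreal (\<Sum>i<n. (err i u \<omega>)\<^sup>2)" by (rule sum_ennreal) simp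
  also have "\<dots> \<le> ennreal (30 * Lc\<^sup>2 * (\<Sum>i<n. (gap i u \<omega>)\<^sup>2) + 12 * Lc\<^sup>2 / (real n - 1)\<^sup>2 * (\<Sum>i<n. (Ys i \<omega> u)\<^sup>2)
      + 3 * (\<Sum>i<n. (r i)\<^sup>2))"
    unfolding err_def gap_def r_def
    by (intro ennreal_leI sum_interaction_error_le n2 cstar_diff_le Lc_nonneg)
  also have "\<dots> = ennreal (30 * Lc\<^sup>2) * ennreal (\<Sum>i<n. (gap i u \<omega>)\<^sup>2)
      + ennreal (12 * Lc\<^sup>2 / (real n - 1)\<^sup>2) * ennreal (\<Sum>i<n. (Ys i \<omega> u)\<^sup>2) + ennreal 3 * ennreal (\<Sum>i<n. (r i)\<^sup>2)"
    by (rule ennreal_linear_combinations(1)) (auto intro: sum_nonneg divide_nonneg_nonneg)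
  also have "\<dots> = ennreal (30 * Lc\<^sup>2) * (\<Sum>i<n. ennreal ((gap i u \<omega>)\<^sup>2))
      + ennreal (12 * Lc\<^sup>2 / (real n - 1)\<^sup>2) * (\<Sum>i<n. ennreal ((Ys i \<omega> u)\<^sup>2)) + ennreal 3 * (\<Sum>i<n. ennreal ((r i)\<^sup>2))"
    by (simp only: sum_ennreal zero_le_power2)
  also have "\<dots> \<le> ennreal (30 * Lc\<^sup>2) * (\<Sum>i<n. ennreal ((gap i u \<omega>)\<^sup>2))
      + ennreal (12 * Lc\<^sup>2 / (real n - 1)\<^sup>2) * (\<Sum>i<n. sup_sq T (Ys i \<omega>)) + ennreal 3 * (\<Sum>i<n. ennreal (Lc\<^sup>2) * q)"
    by (intro add_mono mult_left_mono sum_mono SUP_upper u order_refl) (auto simp: r_def mean)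
  also have "ennreal 3 * (\<Sum>i<n. ennreal (Lc\<^sup>2) * q) = ennreal (3 * n * Lc\<^sup>2) * q"
  proof -
    have "ennreal 3 * (\<Sum>i<n. ennreal (Lc\<^sup>2) * q) = (ennreal 3 * (ennreal (real n) * ennreal (Lc\<^sup>2))) * q"
      by (simp only: sum_constant card_lessThan mult.assoc ennreal_of_nat_eq_real_of_nat)
    also have "ennreal 3 * (ennreal (real n) * ennreal (Lc\<^sup>2)) = ennreal (3 * (n * Lc\<^sup>2))"
      by (simp only: ennreal_mult zero_le_numeral of_nat_0_le_iff zero_le_power2 mult_nonneg_nonneg)
    finally show ?thesis by (simp only: mult.assoc of_nat_mult of_nat_numeral)
  qed
  finally show ?thesis by (simp only: add.assoc)
qed

context
  fixes Q :: "'a \<Rightarrow> ennreal"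
  assumes Q: "Q \<in> borel_measurable M"
    and mean: "\<And>\<omega> u x. \<omega> \<in> space M \<Longrightarrow> u \<in> {0..T} \<Longrightarrow>
      ennreal (((\<Sum>j<n. cstar c (Ys j \<omega> u - x)) / n - drift u x)\<^sup>2) \<le> ennreal (Lc\<^sup>2) * Q \<omega>"
begin

lemma sum_err_energy_le:
  assumes t: "t \<in> {0..T}"
  shows "(\<Sum>i<n. err_energy i {t..T})
    \<le> ennreal (30 * Lc\<^sup>2) * (\<integral>\<^sup>+u\<in>{t..T}. (\<Sum>i<n. \<integral>\<^sup>+\<omega>. ennreal ((gap i u \<omega>)\<^sup>2) \<partial>M) \<partial>lborel)
      + ennreal T * (ennreal (12 * Lc\<^sup>2 / (real n - 1)\<^sup>2) * (of_nat n * second_moment)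
        + ennreal (3 * n * Lc\<^sup>2) * (\<integral>\<^sup>+\<omega>. Q \<omega> \<partial>M))"
proof -
  let ?A = "{t..T}"
  let ?c1 = "ennreal (12 * Lc\<^sup>2 / (real n - 1)\<^sup>2)" and ?c2 = "ennreal (3 * n * Lc\<^sup>2)"
  have A: "?A \<in> sets borel" "?A \<subseteq> {0..T}" using t by auto
  have T0: "0 \<le> T" using T_pos by simp
  define w where "w \<omega> = ?c1 * (\<Sum>i<n. sup_sq T (Ys i \<omega>)) + ?c2 * Q \<omega>" for \<omega>
  define g where "g i \<omega> = (\<integral>\<^sup>+u\<in>?A. ennreal ((gap i u \<omega>)\<^sup>2) \<partial>lborel)" for i \<omega>
  have gm: "g i \<in> borel_measurable M" if "i < n" for i
    unfolding g_def[abs_def]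
    by (rule measurable_process_nn_integral[OF gap_process[OF that] T0 _ A, where f="\<lambda>x. x\<^sup>2"]) simp
  have em: "(\<lambda>\<omega>. \<integral>\<^sup>+u\<in>?A. ennreal ((err i u \<omega>)\<^sup>2) \<partial>lborel) \<in> borel_measurable M" if "i < n" for i
    by (rule measurable_process_nn_integral[OF err_process[OF that] T0 _ A, where f="\<lambda>x. x\<^sup>2"]) simp
  have sm: "(\<lambda>\<omega>. \<Sum>i<n. sup_sq T (Ys i \<omega>)) \<in> borel_measurable M"
    by (intro borel_measurable_sum Ys_sup_measurable) simp
  have wm: "w \<in> borel_measurable M"
    unfolding w_def[abs_def] using sm Q by (intro borel_measurable_add borel_measurable_times_ennreal) auto
  have "(\<Sum>i<n. err_energy i ?A) = (\<integral>\<^sup>+\<omega>. (\<Sum>i<n. \<integral>\<^sup>+u\<in>?A. ennreal ((err i u \<omega>)\<^sup>2) \<partial>lborel) \<partial>M)"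
    unfolding err_energy_def by (rule nn_integral_sum[symmetric]) (use em in simp)
  also have "\<dots> \<le> (\<integral>\<^sup>+\<omega>. ennreal (30 * Lc\<^sup>2) * (\<Sum>i<n. g i \<omega>) + ennreal T * w \<omega> \<partial>M)"
  proof (rule nn_integral_mono)
    fix \<omega> assume \<omega>: "\<omega> \<in> space M"
    have gp: "(\<lambda>u. ennreal ((gap i u \<omega>)\<^sup>2) * indicator ?A u) \<in> borel_measurable lborel" if "i < n" for i
      by (rule measurable_process_path_on[OF gap_process[OF that] \<omega> T0 _ A, where f="\<lambda>x. x\<^sup>2"]) simp
    have ep: "(\<lambda>u. ennreal ((err i u \<omega>)\<^sup>2) * indicator ?A u) \<in> borel_measurable lborel" if "i < n" for i
      by (rule measurable_process_path_on[OF err_process[OF that] \<omega> T0 _ A, where f="\<lambda>x. x\<^sup>2"]) simp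
    have "(\<Sum>i<n. \<integral>\<^sup>+u\<in>?A. ennreal ((err i u \<omega>)\<^sup>2) \<partial>lborel)
        = (\<integral>\<^sup>+u. (\<Sum>i<n. ennreal ((err i u \<omega>)\<^sup>2) * indicator ?A u) \<partial>lborel)"
      by (rule nn_integral_sum[symmetric]) (use ep in simp)
    also have "\<dots> \<le> (\<integral>\<^sup>+u. ennreal (30 * Lc\<^sup>2) * (\<Sum>i<n. ennreal ((gap i u \<omega>)\<^sup>2) * indicator ?A u) + w \<omega> * indicator ?A u \<partial>lborel)"
    proof (rule nn_integral_mono)
      fix u
      show "(\<Sum>i<n. ennreal ((err i u \<omega>)\<^sup>2) * indicator ?A u)
        \<le> ennreal (30 * Lc\<^sup>2) * (\<Sum>i<n. ennreal ((gap i u \<omega>)\<^sup>2) * indicator ?A u) + w \<omega> * indicator ?A u"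
      proof (cases "u \<in> ?A")
        case True
        then have "u \<in> {0..T}" using t by auto
        then show ?thesis using sum_err_square_le[OF \<omega> _ mean[OF \<omega>]] True by (simp add: w_def)
      qed simp
    qed
    also have "\<dots> = ennreal (30 * Lc\<^sup>2) * (\<Sum>i<n. g i \<omega>) + w \<omega> * ennreal (T - t)"
    proof -
      have "(\<lambda>u. \<Sum>i<n. ennreal ((gap i u \<omega>)\<^sup>2) * indicator ?A u) \<in> borel_measurable lborel"
        by (intro borel_measurable_sum gp) simp
      moreover have "(\<integral>\<^sup>+u. (\<Sum>i<n. ennreal ((gap i u \<omega>)\<^sup>2) * indicator ?A u) \<partial>lborel) = (\<Sum>i<n. g i \<omega>)"
        unfolding g_def by (rule nn_integral_sum) (use gp in simp)
      ultimately show ?thesis using t by (simp add: nn_integral_add nn_integral_cmult)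
    qed
    also have "\<dots> \<le> ennreal (30 * Lc\<^sup>2) * (\<Sum>i<n. g i \<omega>) + ennreal T * w \<omega>"
      using t by (subst mult.commute[of "w \<omega>"]) (intro add_left_mono mult_right_mono ennreal_leI, auto)
    finally show "(\<Sum>i<n. \<integral>\<^sup>+u\<in>?A. ennreal ((err i u \<omega>)\<^sup>2) \<partial>lborel)
      \<le> ennreal (30 * Lc\<^sup>2) * (\<Sum>i<n. g i \<omega>) + ennreal T * w \<omega>" .
  qed
  also have "\<dots> = ennreal (30 * Lc\<^sup>2) * (\<Sum>i<n. \<integral>\<^sup>+\<omega>. g i \<omega> \<partial>M) + ennreal T * (\<integral>\<^sup>+\<omega>. w \<omega> \<partial>M)"
  proof -
    have "(\<lambda>\<omega>. \<Sum>i<n. g i \<omega>) \<in> borel_measurable M" by (intro borel_measurable_sum gm) simp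
    moreover have "(\<integral>\<^sup>+\<omega>. (\<Sum>i<n. g i \<omega>) \<partial>M) = (\<Sum>i<n. \<integral>\<^sup>+\<omega>. g i \<omega> \<partial>M)"
      by (rule nn_integral_sum) (use gm in simp)
    ultimately show ?thesis using wm by (simp add: nn_integral_add nn_integral_cmult)
  qed
  also have "(\<integral>\<^sup>+\<omega>. w \<omega> \<partial>M) = ?c1 * (of_nat n * second_moment) + ?c2 * (\<integral>\<^sup>+\<omega>. Q \<omega> \<partial>M)"
  proof -
    have "(\<integral>\<^sup>+\<omega>. (\<Sum>i<n. sup_sq T (Ys i \<omega>)) \<partial>M) = (\<Sum>i<n. \<integral>\<^sup>+\<omega>. sup_sq T (Ys i \<omega>) \<partial>M)"
      by (rule nn_integral_sum) (use Ys_sup_measurable in simp)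
    also have "\<dots> = of_nat n * second_moment" by (simp add: Ys_second_moment)
    finally show ?thesis
      unfolding w_def using sm Q by (simp add: nn_integral_add nn_integral_cmult)
  qed
  also have "(\<Sum>i<n. \<integral>\<^sup>+\<omega>. g i \<omega> \<partial>M) = (\<integral>\<^sup>+u\<in>?A. (\<Sum>i<n. \<integral>\<^sup>+\<omega>. ennreal ((gap i u \<omega>)\<^sup>2) \<partial>M) \<partial>lborel)"
  proof -
    have F: "(\<integral>\<^sup>+\<omega>. g i \<omega> \<partial>M) = (\<integral>\<^sup>+u\<in>?A. (\<integral>\<^sup>+\<omega>. ennreal ((gap i u \<omega>)\<^sup>2) \<partial>M) \<partial>lborel)"
      "(\<lambda>u. (\<integral>\<^sup>+\<omega>. ennreal ((gap i u \<omega>)\<^sup>2) \<partial>M) * indicator ?A u) \<in> borel_measurable borel" if "i < n" for i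
      unfolding g_def
      using measurable_process_Fubini[OF M.sigma_finite_measure_axioms gap_process[OF that] T0 _ A, of "\<lambda>x. x\<^sup>2"] by auto
    have "(\<Sum>i<n. \<integral>\<^sup>+\<omega>. g i \<omega> \<partial>M) = (\<Sum>i<n. \<integral>\<^sup>+u\<in>?A. (\<integral>\<^sup>+\<omega>. ennreal ((gap i u \<omega>)\<^sup>2) \<partial>M) \<partial>lborel)"
      using F(1) by simp
    also have "\<dots> = (\<integral>\<^sup>+u. (\<Sum>i<n. (\<integral>\<^sup>+\<omega>. ennreal ((gap i u \<omega>)\<^sup>2) \<partial>M) * indicator ?A u) \<partial>lborel)"
      by (rule nn_integral_sum[symmetric]) (use F(2) in simp)
    also have "\<dots> = (\<integral>\<^sup>+u\<in>?A. (\<Sum>i<n. \<integral>\<^sup>+\<omega>. ennreal ((gap i u \<omega>)\<^sup>2) \<partial>M) \<partial>lborel)"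
      by (simp only: sum_distrib_right)
    finally show ?thesis .
  qed
  finally show ?thesis .
qed

text \<open>The a priori finiteness on which the absorption in Gronwall's inequality rests: the
  agents' solution is square integrable by assumption, the mean field copy by
  \<open>Ypath_second_moment\<close>.\<close>

lemma gap_energy_finite:
  assumes i: "i < n" shows "(\<integral>\<^sup>+u\<in>{0..T}. (\<integral>\<^sup>+\<omega>. ennreal ((gap i u \<omega>)\<^sup>2) \<partial>M) \<partial>lborel) < \<top>"
proof -
  have T0: "0 \<le> T" using T_pos by simp
  have F: "(\<integral>\<^sup>+\<omega>. (\<integral>\<^sup>+t\<in>{0..T}. ennreal ((gap i t \<omega>)\<^sup>2) \<partial>lborel) \<partial>M)
      = (\<integral>\<^sup>+u\<in>{0..T}. (\<integral>\<^sup>+\<omega>. ennreal ((gap i u \<omega>)\<^sup>2) \<partial>M) \<partial>lborel)"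
    by (rule measurable_process_Fubini(1)[OF M.sigma_finite_measure_axioms gap_process[OF i] T0, where f="\<lambda>x. x\<^sup>2"]) auto
  define y where "y \<omega> = (\<integral>\<^sup>+t\<in>{0..T}. ennreal ((Y i \<omega> t)\<^sup>2) \<partial>lborel)" for \<omega>
  have ym: "y \<in> borel_measurable M"
    unfolding y_def[abs_def]
    by (rule measurable_process_nn_integral[OF Y_process[OF i] T0, where f="\<lambda>x. x\<^sup>2"]) auto
  have "(\<integral>\<^sup>+\<omega>. (\<integral>\<^sup>+t\<in>{0..T}. ennreal ((gap i t \<omega>)\<^sup>2) \<partial>lborel) \<partial>M)
      \<le> (\<integral>\<^sup>+\<omega>. 2 * y \<omega> + 2 * (sup_sq T (Ys i \<omega>) * ennreal T) \<partial>M)"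
  proof (rule nn_integral_mono)
    fix \<omega> assume \<omega>: "\<omega> \<in> space M"
    have yp: "(\<lambda>u. ennreal ((Y i \<omega> u)\<^sup>2) * indicator {0..T} u) \<in> borel_measurable lborel"
      by (rule measurable_process_path_on[OF Y_process[OF i] \<omega> T0, where f="\<lambda>x. x\<^sup>2"]) auto
    have "(\<integral>\<^sup>+t\<in>{0..T}. ennreal ((gap i t \<omega>)\<^sup>2) \<partial>lborel)
        \<le> (\<integral>\<^sup>+t. 2 * (ennreal ((Y i \<omega> t)\<^sup>2) * indicator {0..T} t) + 2 * sup_sq T (Ys i \<omega>) * indicator {0..T} t \<partial>lborel)"
    proof (rule nn_integral_mono)
      fix t
      show "ennreal ((gap i t \<omega>)\<^sup>2) * indicator {0..T} t
        \<le> 2 * (ennreal ((Y i \<omega> t)\<^sup>2) * indicator {0..T} t) + 2 * sup_sq T (Ys i \<omega>) * indicator {0..T} t"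
      proof (cases "t \<in> {0..T}")
        case True
        have "(gap i t \<omega>)\<^sup>2 \<le> 2 * (Y i \<omega> t)\<^sup>2 + 2 * (Ys i \<omega> t)\<^sup>2"
          using zero_le_power2[of "Y i \<omega> t + Ys i \<omega> t"] by (simp add: gap_def power2_sum power2_diff)
        then have "ennreal ((gap i t \<omega>)\<^sup>2) \<le> ennreal (2 * (Y i \<omega> t)\<^sup>2 + 2 * (Ys i \<omega> t)\<^sup>2)" by (rule ennreal_leI)
        also have "\<dots> = 2 * ennreal ((Y i \<omega> t)\<^sup>2) + 2 * ennreal ((Ys i \<omega> t)\<^sup>2)" by (simp add: ennreal_mult)
        also have "\<dots> \<le> 2 * ennreal ((Y i \<omega> t)\<^sup>2) + 2 * sup_sq T (Ys i \<omega>)"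
          by (intro add_left_mono mult_left_mono SUP_upper True) simp
        finally show ?thesis using True by simp
      qed simp
    qed
    also have "\<dots> = 2 * y \<omega> + 2 * (sup_sq T (Ys i \<omega>) * ennreal T)"
      using yp T0 by (simp add: y_def nn_integral_add nn_integral_cmult mult.assoc)
    finally show "(\<integral>\<^sup>+t\<in>{0..T}. ennreal ((gap i t \<omega>)\<^sup>2) \<partial>lborel) \<le> 2 * y \<omega> + 2 * (sup_sq T (Ys i \<omega>) * ennreal T)" .
  qed
  also have "\<dots> = 2 * (\<integral>\<^sup>+\<omega>. y \<omega> \<partial>M) + 2 * (second_moment * ennreal T)"
    using ym Ys_sup_measurable[OF i]
    by (simp add: nn_integral_add nn_integral_cmult nn_integral_multc Ys_second_moment[OF i])
  also have "\<dots> < \<top>"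
  proof -
    have "(\<integral>\<^sup>+\<omega>. y \<omega> \<partial>M) < \<top>"
      using bsdeD[OF i, THEN conjunct2, THEN conjunct2, THEN conjunct1]
      by (simp add: square_integrable_process_def y_def)
    moreover have "second_moment < \<top>" using Ypath_second_moment by (simp add: second_moment_def)
    ultimately show ?thesis by (simp add: ennreal_mult_less_top)
  qed
  finally show ?thesis unfolding F .
qed

text \<open>The error of one agent involves the gaps of all agents, so no single gap satisfies a
  closed inequality; the sum \<open>G\<close> over the agents does. The remaining terms are the
  \<open>1 / n\<close> correction and the sampling error \<open>Q\<close>.\<close>

lemma stability:
  "(\<Sum>i<n. \<integral>\<^sup>+\<omega>. sup_sq T (\<lambda>t. gap i t \<omega>) \<partial>M) \<le> ennreal stability_constant *
    (ennreal (12 * Lc\<^sup>2 / (real n - 1)\<^sup>2) * (of_nat n * second_moment) + ennreal (3 * n * Lc\<^sup>2) * (\<integral>\<^sup>+\<omega>. Q \<omega> \<partial>M))"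
proof -
  have T0: "0 \<le> T" using T_pos by simp
  define G where "G t = (\<Sum>i<n. \<integral>\<^sup>+\<omega>. ennreal ((gap i t \<omega>)\<^sup>2) \<partial>M)" for t
  define R where "R = ennreal (12 * Lc\<^sup>2 / (real n - 1)\<^sup>2) * (of_nat n * second_moment) + ennreal (3 * n * Lc\<^sup>2) * (\<integral>\<^sup>+\<omega>. Q \<omega> \<partial>M)"
  define l where "l = 30 * Lc\<^sup>2 * T"
  define C where "C = 2 * exp ((2 * l + 1) * T) * T"
  have l0: "0 \<le> l" and C0: "0 \<le> C" using T0 by (simp_all add: l_def C_def)
  have E: "(\<Sum>i<n. err_energy i {t..T}) \<le> ennreal (30 * Lc\<^sup>2) * (\<integral>\<^sup>+u\<in>{t..T}. G u \<partial>lborel) + ennreal T * R"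
    if "t \<in> {0..T}" for t
    using sum_err_energy_le[OF that] by (simp add: G_def R_def)
  have Fm: "(\<lambda>u. (\<integral>\<^sup>+\<omega>. ennreal ((gap i u \<omega>)\<^sup>2) \<partial>M) * indicator {0..T} u) \<in> borel_measurable borel" if "i < n" for i
    by (rule measurable_process_Fubini(2)[OF M.sigma_finite_measure_axioms gap_process[OF that] T0, where f="\<lambda>x. x\<^sup>2"]) auto
  have "(\<integral>\<^sup>+t\<in>{0..T}. G t \<partial>lborel) \<le> ennreal C * (ennreal T * (ennreal T * R))"
    unfolding C_def
  proof (rule gronwall_backward[OF _ T_pos l0])
    show "(\<lambda>t. G t * indicator {0..T} t) \<in> borel_measurable borel"
      unfolding G_def sum_distrib_right by (intro borel_measurable_sum Fm) simp
    fix t assume t: "t \<in> {0..T}"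
    have "G t \<le> (\<Sum>i<n. ennreal T * err_energy i {t..T})"
      unfolding G_def by (intro sum_mono gap_square_le t) simp
    also have "\<dots> = ennreal T * (\<Sum>i<n. err_energy i {t..T})" by (simp only: sum_distrib_left)
    also have "\<dots> \<le> ennreal T * (ennreal (30 * Lc\<^sup>2) * (\<integral>\<^sup>+u\<in>{t..T}. G u \<partial>lborel) + ennreal T * R)"
      by (intro mult_left_mono E t) simp
    also have "\<dots> = ennreal T * (ennreal T * R) + ennreal T * ennreal (30 * Lc\<^sup>2) * (\<integral>\<^sup>+u\<in>{t..T}. G u \<partial>lborel)"
      by (simp only: distrib_left mult.assoc add.commute)
    also have "ennreal T * ennreal (30 * Lc\<^sup>2) = ennreal l"
      unfolding l_def using T0 by (subst ennreal_mult[symmetric]) (auto simp: mult.commute)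
    finally show "G t \<le> ennreal T * (ennreal T * R) + ennreal l * (\<integral>\<^sup>+u\<in>{t..T}. G u \<partial>lborel)" .
  next
    have "(\<integral>\<^sup>+t\<in>{0..T}. G t \<partial>lborel) = (\<Sum>i<n. \<integral>\<^sup>+u\<in>{0..T}. (\<integral>\<^sup>+\<omega>. ennreal ((gap i u \<omega>)\<^sup>2) \<partial>M) \<partial>lborel)"
      unfolding G_def sum_distrib_right by (rule nn_integral_sum) (use Fm in simp)
    also have "\<dots> < \<infinity>" using gap_energy_finite by (auto simp: sum_Inf less_top[symmetric])
    finally show "(\<integral>\<^sup>+t\<in>{0..T}. G t \<partial>lborel) < \<infinity>" .
  qed
  \<comment> \<open>The bound for the time integral of \<open>G\<close> returns to \<open>E\<close>
    at time 0, so that the total energy, and with it the uniform gap, is controlled by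
    \<open>R\<close> alone.\<close>
  then have "(\<Sum>i<n. err_energy i {0..T}) \<le> ennreal (30 * Lc\<^sup>2) * (ennreal C * (ennreal T * (ennreal T * R))) + ennreal T * R"
    using T0 by (intro order_trans[OF E] add_right_mono mult_left_mono) auto
  also have "\<dots> = ennreal (30 * Lc\<^sup>2 * C * T\<^sup>2 + T) * R"
    by (rule ennreal_linear_combinations(2)) (use T0 C0 in auto)
  finally have S: "(\<Sum>i<n. err_energy i {0..T}) \<le> ennreal (30 * Lc\<^sup>2 * C * T\<^sup>2 + T) * R" .
  have "(\<Sum>i<n. \<integral>\<^sup>+\<omega>. sup_sq T (\<lambda>t. gap i t \<omega>) \<partial>M) \<le> (\<Sum>i<n. ennreal (34 * T) * err_energy i {0..T})"
    by (intro sum_mono sup_gap_square_le) simp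
  also have "\<dots> = ennreal (34 * T) * (\<Sum>i<n. err_energy i {0..T})" by (simp only: sum_distrib_left)
  also have "\<dots> \<le> ennreal (34 * T) * (ennreal (30 * Lc\<^sup>2 * C * T\<^sup>2 + T) * R)" by (intro mult_left_mono S) simp
  also have "\<dots> = ennreal stability_constant * R"
  proof -
    have "stability_constant = 34 * T * (30 * Lc\<^sup>2 * C * T\<^sup>2 + T)"
      by (simp add: stability_constant_def C_def l_def)
    moreover have "ennreal (34 * T * (30 * Lc\<^sup>2 * C * T\<^sup>2 + T)) = ennreal (34 * T) * ennreal (30 * Lc\<^sup>2 * C * T\<^sup>2 + T)"
      using T0 C0 by (intro ennreal_mult) auto
    ultimately show ?thesis by (simp only: mult.assoc)
  qed
  finally show ?thesis unfolding R_def .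
qed

end

text \<open>The weights at a sample point are used twice. With the atoms \<open>Ys\<close> they
  bound the sampling error of the drift by \<open>Q\<close>, which feeds the stability estimate;
  with the atoms \<open>Y\<close> they give a coupling of the empirical measure with the limit law,
  whose cost splits path by path into the gap and the cost for \<open>Ys\<close>.\<close>

lemma dist_sq_expectation_le:
  assumes Q: "Q \<in> borel_measurable M"
    and weights: "\<And>\<omega>. \<omega> \<in> space M \<Longrightarrow> \<exists>g. coupling_weights n (Ylaw T p) g \<and>
      (\<Sum>j<n. \<integral>\<^sup>+y. ennreal (g j y) * sup_sq T (\<lambda>u. Ys j \<omega> u - y u) \<partial>Ylaw T p) * ennreal (1 / n) \<le> Q \<omega>"
  shows "(\<integral>\<^sup>+\<omega>. dist_sq T 0 (empirical_measure T n (\<lambda>j. Y j \<omega>)) (Ylaw T p) \<partial>M)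
    \<le> 2 * (ennreal stability_constant * (ennreal (12 * Lc\<^sup>2 / (real n - 1)\<^sup>2) * second_moment
        + ennreal (3 * Lc\<^sup>2) * (\<integral>\<^sup>+\<omega>. Q \<omega> \<partial>M))) + 2 * (\<integral>\<^sup>+\<omega>. Q \<omega> \<partial>M)"
proof -
  have n0: "0 < n" using n2 by simp
  let ?\<mu> = "Ylaw T p" and ?a = "ennreal (1 / n)"
  have \<mu>: "prob_space ?\<mu>" unfolding Ylaw_eq by (rule p.prob_space_distr) (rule Ypath_measurable)
  have s: "sets ?\<mu> = sets (path_space T)" by (simp add: Ylaw_eq)
  have Yss: "Ys j \<omega> \<in> space (path_space T)" and Yj: "Y j \<omega> \<in> space (path_space T)"
    if "\<omega> \<in> space M" "j < n" for j \<omega>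
    using measurable_space[OF Ys_measurable[OF that(2)] that(1)] measurable_space[OF Y_measurable[OF that(2)] that(1)] by auto
  have mean: "ennreal (((\<Sum>j<n. cstar c (Ys j \<omega> u - x)) / n - drift u x)\<^sup>2) \<le> ennreal (Lc\<^sup>2) * Q \<omega>"
    if \<omega>: "\<omega> \<in> space M" and u: "u \<in> {0..T}" for \<omega> u x
  proof -
    obtain g where g: "coupling_weights n ?\<mu> g"
      and cost: "(\<Sum>j<n. \<integral>\<^sup>+y. ennreal (g j y) * sup_sq T (\<lambda>u. Ys j \<omega> u - y u) \<partial>?\<mu>) * ?a \<le> Q \<omega>"
      using weights[OF \<omega>] by blast
    obtain \<pi> where \<pi>: "\<pi> \<in> couplings (empirical_measure T n (\<lambda>j. Ys j \<omega>)) ?\<mu>"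
      and F: "(\<integral>\<^sup>+z. sup_sq T (\<lambda>u. fst z u - snd z u) \<partial>\<pi>)
        = (\<Sum>j<n. \<integral>\<^sup>+y. ennreal (g j y) * sup_sq T (\<lambda>u. Ys j \<omega> u - y u) \<partial>?\<mu>) * ?a"
      by (rule coupling_with_cost[OF T_pos n0 Yss[OF \<omega>] \<mu> s g])
    have L: "Lc-lipschitz_on UNIV (\<lambda>y. cstar c (y - x))"
    proof (rule lipschitz_onI)
      fix y z
      show "dist (cstar c (y - x)) (cstar c (z - x)) \<le> Lc * dist y z"
        using cstar_diff_le[of "y - x" "z - x"] by (simp add: dist_real_def)
    qed (rule Lc_nonneg)
    have m: "(\<lambda>y. cstar c (y u - x)) \<in> borel_measurable (path_space T)"
      by (intro measurable_compose[OF _ cstar_measurable] borel_measurable_diff borel_measurable_const measurable_eval[OF u])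
    have int: "integrable ?\<mu> (\<lambda>y. cstar c (y u - x))"
      unfolding Ylaw_eq integrable_distr_eq[OF Ypath_measurable m] Ypath_eq[OF u] by (rule cstar_Ybar_integrable[OF u])
    have dr: "(\<integral>y. cstar c (y u - x) \<partial>?\<mu>) = drift u x"
      unfolding Ylaw_eq drift_eq[OF u] integral_distr[OF Ypath_measurable m] Ypath_eq[OF u] ..
    have "ennreal (((\<Sum>j<n. cstar c (Ys j \<omega> u - x)) / n - (\<integral>y. cstar c (y u - x) \<partial>?\<mu>))\<^sup>2)
      \<le> ennreal (Lc\<^sup>2) * (\<integral>\<^sup>+z. sup_sq T (\<lambda>u. fst z u - snd z u) \<partial>\<pi>)"
      by (rule coupling_lipschitz[OF T_pos n0 Yss[OF \<omega>] \<mu> s \<pi> u L int])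
    also have "(\<integral>\<^sup>+z. sup_sq T (\<lambda>u. fst z u - snd z u) \<partial>\<pi>)
      = (\<Sum>j<n. \<integral>\<^sup>+y. ennreal (g j y) * sup_sq T (\<lambda>u. Ys j \<omega> u - y u) \<partial>?\<mu>) * ?a"
      by (rule F)
    also have "ennreal (Lc\<^sup>2) * \<dots> \<le> ennreal (Lc\<^sup>2) * Q \<omega>" by (rule mult_left_mono[OF cost]) simp
    finally show ?thesis unfolding dr .
  qed
  have gm: "(\<lambda>\<omega>. sup_sq T (\<lambda>t. gap i t \<omega>)) \<in> borel_measurable M" if "i < n" for i
    unfolding gap_def by (rule borel_measurable_sup_sq_path[OF T_pos Y_measurable[OF that] Ys_measurable[OF that]])
  have "(\<integral>\<^sup>+\<omega>. dist_sq T 0 (empirical_measure T n (\<lambda>j. Y j \<omega>)) ?\<mu> \<partial>M)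
    \<le> (\<integral>\<^sup>+\<omega>. 2 * ((\<Sum>j<n. sup_sq T (\<lambda>t. gap j t \<omega>)) * ?a) + 2 * Q \<omega> \<partial>M)"
  proof (rule nn_integral_mono)
    fix \<omega> assume \<omega>: "\<omega> \<in> space M"
    obtain g where g: "coupling_weights n ?\<mu> g"
      and cost: "(\<Sum>j<n. \<integral>\<^sup>+y. ennreal (g j y) * sup_sq T (\<lambda>u. Ys j \<omega> u - y u) \<partial>?\<mu>) * ?a \<le> Q \<omega>"
      using weights[OF \<omega>] by blast
    obtain \<pi> where \<pi>: "\<pi> \<in> couplings (empirical_measure T n (\<lambda>j. Y j \<omega>)) ?\<mu>"
      and F: "(\<integral>\<^sup>+z. sup_sq T (\<lambda>u. fst z u - snd z u) \<partial>\<pi>)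
        = (\<Sum>j<n. \<integral>\<^sup>+y. ennreal (g j y) * sup_sq T (\<lambda>u. Y j \<omega> u - y u) \<partial>?\<mu>) * ?a"
      by (rule coupling_with_cost[OF T_pos n0 Yj[OF \<omega>] \<mu> s g])
    have "dist_sq T 0 (empirical_measure T n (\<lambda>j. Y j \<omega>)) ?\<mu> \<le> (\<integral>\<^sup>+z. sup_sq T (\<lambda>u. fst z u - snd z u) \<partial>\<pi>)"
      by (rule dist_sq_le[OF \<pi>])
    also have "\<dots> = (\<Sum>j<n. \<integral>\<^sup>+y. ennreal (g j y) * sup_sq T (\<lambda>u. Y j \<omega> u - y u) \<partial>?\<mu>) * ?a"
      by (rule F)
    also have "\<dots> \<le> (\<Sum>j<n. 2 * sup_sq T (\<lambda>t. gap j t \<omega>)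
        + 2 * (\<integral>\<^sup>+y. ennreal (g j y) * sup_sq T (\<lambda>u. Ys j \<omega> u - y u) \<partial>?\<mu>)) * ?a"
    proof (intro mult_right_mono sum_mono)
      fix j assume "j \<in> {..<n}"
      then have j: "j < n" by simp
      have gj: "g j \<in> borel_measurable ?\<mu>" "(\<integral>\<^sup>+y. ennreal (g j y) \<partial>?\<mu>) = 1"
        using g j by (auto simp: coupling_weights_def)
      have sj: "(\<lambda>y. sup_sq T (\<lambda>u. Ys j \<omega> u - y u)) \<in> borel_measurable ?\<mu>"
        using borel_measurable_sup_sq_path[OF T_pos measurable_const[OF Yss[OF \<omega> j]] measurable_ident_sets[OF s]] by simp
      \<comment> \<open>For each index the weight has total mass 1 in \<open>y\<close>, so the gap
        of agent \<open>j\<close>, which does not depend on \<open>y\<close>, leaves the integral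
        with factor 1.\<close>
      have "(\<integral>\<^sup>+y. ennreal (g j y) * sup_sq T (\<lambda>u. Y j \<omega> u - y u) \<partial>?\<mu>)
        \<le> (\<integral>\<^sup>+y. 2 * sup_sq T (\<lambda>t. gap j t \<omega>) * ennreal (g j y)
            + 2 * (ennreal (g j y) * sup_sq T (\<lambda>u. Ys j \<omega> u - y u)) \<partial>?\<mu>)"
      proof (rule nn_integral_mono)
        fix y
        have "sup_sq T (\<lambda>u. Y j \<omega> u - y u) = sup_sq T (\<lambda>u. gap j u \<omega> - (y u - Ys j \<omega> u))"
          by (simp add: gap_def)
        also have "\<dots> \<le> 2 * sup_sq T (\<lambda>u. gap j u \<omega>) + 2 * sup_sq T (\<lambda>u. y u - Ys j \<omega> u)"
          by (rule sup_sq_diff_le)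
        also have "sup_sq T (\<lambda>u. y u - Ys j \<omega> u) = sup_sq T (\<lambda>u. Ys j \<omega> u - y u)"
          by (simp only: power2_commute)
        finally have "ennreal (g j y) * sup_sq T (\<lambda>u. Y j \<omega> u - y u)
          \<le> ennreal (g j y) * (2 * sup_sq T (\<lambda>u. gap j u \<omega>) + 2 * sup_sq T (\<lambda>u. Ys j \<omega> u - y u))"
          by (rule mult_left_mono) simp
        then show "ennreal (g j y) * sup_sq T (\<lambda>u. Y j \<omega> u - y u)
          \<le> 2 * sup_sq T (\<lambda>t. gap j t \<omega>) * ennreal (g j y) + 2 * (ennreal (g j y) * sup_sq T (\<lambda>u. Ys j \<omega> u - y u))"
          by (simp only: distrib_left mult_ac)
      qed
      also have "\<dots> = 2 * sup_sq T (\<lambda>t. gap j t \<omega>)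
          + 2 * (\<integral>\<^sup>+y. ennreal (g j y) * sup_sq T (\<lambda>u. Ys j \<omega> u - y u) \<partial>?\<mu>)"
        using gj sj by (simp add: nn_integral_add nn_integral_cmult)
      finally show "(\<integral>\<^sup>+y. ennreal (g j y) * sup_sq T (\<lambda>u. Y j \<omega> u - y u) \<partial>?\<mu>)
        \<le> 2 * sup_sq T (\<lambda>t. gap j t \<omega>) + 2 * (\<integral>\<^sup>+y. ennreal (g j y) * sup_sq T (\<lambda>u. Ys j \<omega> u - y u) \<partial>?\<mu>)" .
    qed simp
    also have "\<dots> = 2 * ((\<Sum>j<n. sup_sq T (\<lambda>t. gap j t \<omega>)) * ?a)
        + 2 * ((\<Sum>j<n. \<integral>\<^sup>+y. ennreal (g j y) * sup_sq T (\<lambda>u. Ys j \<omega> u - y u) \<partial>?\<mu>) * ?a)"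
      by (simp only: sum.distrib sum_distrib_left[symmetric] distrib_right mult.assoc)
    also have "\<dots> \<le> 2 * ((\<Sum>j<n. sup_sq T (\<lambda>t. gap j t \<omega>)) * ?a) + 2 * Q \<omega>"
      by (intro add_left_mono mult_left_mono cost) simp
    finally show "dist_sq T 0 (empirical_measure T n (\<lambda>j. Y j \<omega>)) ?\<mu>
      \<le> 2 * ((\<Sum>j<n. sup_sq T (\<lambda>t. gap j t \<omega>)) * ?a) + 2 * Q \<omega>" .
  qed
  also have "\<dots> = 2 * ((\<Sum>j<n. \<integral>\<^sup>+\<omega>. sup_sq T (\<lambda>t. gap j t \<omega>) \<partial>M) * ?a) + 2 * (\<integral>\<^sup>+\<omega>. Q \<omega> \<partial>M)"
  proof -
    have m: "(\<lambda>\<omega>. \<Sum>j<n. sup_sq T (\<lambda>t. gap j t \<omega>)) \<in> borel_measurable M"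
      by (intro borel_measurable_sum gm) simp
    have "(\<integral>\<^sup>+\<omega>. (\<Sum>j<n. sup_sq T (\<lambda>t. gap j t \<omega>)) \<partial>M) = (\<Sum>j<n. \<integral>\<^sup>+\<omega>. sup_sq T (\<lambda>t. gap j t \<omega>) \<partial>M)"
      by (rule nn_integral_sum) (use gm in simp)
    then show ?thesis using m Q by (simp add: nn_integral_add nn_integral_cmult nn_integral_multc)
  qed
  also have "\<dots> \<le> 2 * ((ennreal stability_constant *
      (ennreal (12 * Lc\<^sup>2 / (real n - 1)\<^sup>2) * (of_nat n * second_moment) + ennreal (3 * n * Lc\<^sup>2) * (\<integral>\<^sup>+\<omega>. Q \<omega> \<partial>M))) * ?a)
      + 2 * (\<integral>\<^sup>+\<omega>. Q \<omega> \<partial>M)"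
    by (intro add_right_mono mult_left_mono mult_right_mono stability[OF Q mean]) auto
  also have "(ennreal stability_constant *
      (ennreal (12 * Lc\<^sup>2 / (real n - 1)\<^sup>2) * (of_nat n * second_moment) + ennreal (3 * n * Lc\<^sup>2) * (\<integral>\<^sup>+\<omega>. Q \<omega> \<partial>M))) * ?a
    = ennreal stability_constant * (ennreal (12 * Lc\<^sup>2 / (real n - 1)\<^sup>2) * second_moment + ennreal (3 * Lc\<^sup>2) * (\<integral>\<^sup>+\<omega>. Q \<omega> \<partial>M))"
  proof -
    \<comment> \<open>Both terms of the stability bound carry a factor \<open>n\<close>, which the
      average over the agents cancels.\<close>
    have na: "of_nat n * ?a = 1" using n0 by (simp add: ennreal_of_nat_eq_real_of_nat ennreal_mult[symmetric])
    have "ennreal (3 * n * Lc\<^sup>2) = ennreal (3 * Lc\<^sup>2) * of_nat n"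
      unfolding ennreal_of_nat_eq_real_of_nat by (subst ennreal_mult[symmetric]) (auto simp: mult_ac)
    then have "(ennreal stability_constant *
      (ennreal (12 * Lc\<^sup>2 / (real n - 1)\<^sup>2) * (of_nat n * second_moment) + ennreal (3 * n * Lc\<^sup>2) * (\<integral>\<^sup>+\<omega>. Q \<omega> \<partial>M))) * ?a
      = ennreal stability_constant * (ennreal (12 * Lc\<^sup>2 / (real n - 1)\<^sup>2) * second_moment * (of_nat n * ?a)
        + ennreal (3 * Lc\<^sup>2) * (\<integral>\<^sup>+\<omega>. Q \<omega> \<partial>M) * (of_nat n * ?a))"
      by (simp only: distrib_right distrib_left mult_ac)
    then show ?thesis unfolding na by (simp only: mult_1_right)
  qed
  finally show ?thesis .
qed

end

theorem proposition4p9: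
  fixes c :: "real \<Rightarrow> ereal" and U :: "real \<Rightarrow> real" and q T R :: real
    and K0 S :: "real set"
    and p :: "path2 measure" and lam :: "real measure" and \<eta> \<theta> :: "real \<Rightarrow> path2 \<Rightarrow> real"
    and M :: "nat \<Rightarrow> 'a measure" and X :: "nat \<Rightarrow> nat \<Rightarrow> 'a \<Rightarrow> path2"
    and Y :: "nat \<Rightarrow> nat \<Rightarrow> 'a \<Rightarrow> real \<Rightarrow> real"
    and Z :: "nat \<Rightarrow> nat \<Rightarrow> nat \<Rightarrow> real \<Rightarrow> 'a \<Rightarrow> real"
  assumes "standing_assumptions c U q" and "q \<ge> 2"
    and "T > 0" and "compact K0" and "K0 \<subseteq> {R..}" and "compact S"
    and "mean_field_contract c U q T K0 S p lam \<eta> \<theta>"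
    and "\<And>n. n \<ge> 2 \<Longrightarrow> independent_copies T p (M n) n (X n)"
    and "\<And>n. n \<ge> 2 \<Longrightarrow>
      solves_bsde_system c T (M n) (copies_filtration (M n) n (X n)) n
        (\<lambda>i t \<omega>. Wbar t (X n i \<omega>)) (\<lambda>i \<omega>. Ybar T (X n i \<omega>)) (\<lambda>i t \<omega>. \<theta> t (X n i \<omega>))
        (Y n) (Z n)"
  shows "(\<lambda>n. \<integral>\<^sup>+\<omega>. dist_sq T 0 (empirical_measure T n (\<lambda>j. Y n j \<omega>)) (Ylaw T p) \<partial>M n)
           \<longlonglongrightarrow> 0"
proof -
  obtain Lc where Lc: "Lc-lipschitz_on UNIV (cstar c)"
    using assms(1) unfolding standing_assumptions_def by blast
  have adm: "admissible c T K0 S p p lam \<eta> \<theta>"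
    using assms(7) unfolding mean_field_contract_def mean_field_game_def by blast
  interpret mean_field c T Lc K0 S p lam \<eta> \<theta>
    by unfold_locales (fact assms(3) Lc assms(4) adm)+
  let ?\<mu> = "Ylaw T p"
  have \<mu>: "prob_space ?\<mu>" unfolding Ylaw_eq by (rule p.prob_space_distr) (rule Ypath_measurable)
  have s: "sets ?\<mu> = sets (path_space T)" by (simp add: Ylaw_eq)
  have fin: "(\<integral>\<^sup>+y. sup_sq T y \<partial>?\<mu>) < \<infinity>"
    unfolding Ylaw_eq
    by (subst nn_integral_distr[OF Ypath_measurable])
      (use Ypath_second_moment borel_measurable_sup_sq_path1[OF T_pos measurable_ident[of "path_space T"]] in auto)
  have V: "second_moment < \<top>" using Ypath_second_moment by (simp add: second_moment_def)
  define v where "v = enn2real second_moment"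
  have v: "second_moment = ennreal v" "0 \<le> v" using V by (auto simp: v_def less_top)
  define K where "K = stability_constant"
  have K: "0 \<le> K" using T_pos by (auto simp: K_def stability_constant_def)
  have lim: "(\<lambda>n. K * (12 * Lc\<^sup>2) * v * (1 / (real n - 1)\<^sup>2)) \<longlonglongrightarrow> 0"
  proof -
    have "filterlim (\<lambda>n. real n - 1) at_top sequentially"
      using filterlim_tendsto_add_at_top[OF tendsto_const[of "-1"] filterlim_real_sequentially] by simp
    then have "filterlim (\<lambda>n. (real n - 1)\<^sup>2) at_top sequentially"
      by (rule filterlim_pow_at_top[rotated]) simp
    then have "(\<lambda>n. 1 / (real n - 1)\<^sup>2) \<longlonglongrightarrow> 0"
      by (intro tendsto_divide_0[OF tendsto_const] filterlim_at_top_imp_at_infinity)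
    from tendsto_mult[OF tendsto_const[of "K * (12 * Lc\<^sup>2) * v"] this] show ?thesis by simp
  qed
  show ?thesis
  proof (rule tendsto_0_ennrealI)
    fix \<epsilon> :: real assume \<epsilon>: "0 < \<epsilon>"
    \<comment> \<open>Chosen so that
      \<open>(K * (3 * Lc\<^sup>2) + 1) * \<delta> = \<epsilon> / 4\<close>. This collects both
      occurrences of the mean of \<open>Q\<close>; together with at most
      \<open>\<epsilon> / 4\<close> from the \<open>1 / n\<close> correction and the overall factor
      2 the total is at most \<open>\<epsilon>\<close>.\<close>
    define \<delta> where "\<delta> = \<epsilon> / (4 * (K * (3 * Lc\<^sup>2) + 1))"
    have K3: "0 < K * (3 * Lc\<^sup>2) + 1" using K by (simp add: add_nonneg_pos)
    then have \<delta>: "0 < \<delta>" using \<epsilon> by (simp add: \<delta>_def)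
    obtain n0 where n0: "0 < n0" and Qn: "\<forall>n\<ge>n0. \<forall>(M :: 'a measure) V.
      prob_space M \<longrightarrow> prob_space.indep_vars M (\<lambda>_. path_space T) V {..<n} \<longrightarrow>
      (\<forall>j<n. distr M (path_space T) (V j) = ?\<mu>) \<longrightarrow>
      (\<exists>Q\<in>borel_measurable M. (\<integral>\<^sup>+\<omega>. Q \<omega> \<partial>M) \<le> ennreal \<delta> \<and>
        (\<forall>\<omega>\<in>space M. \<exists>g. coupling_weights n ?\<mu> g \<and>
          (\<Sum>j<n. \<integral>\<^sup>+y. ennreal (g j y) * sup_sq T (\<lambda>u. V j \<omega> u - y u) \<partial>?\<mu>) * ennreal (1 / n) \<le> Q \<omega>))"
      using empirical_coupling_expectation[OF T_pos \<mu> s fin \<delta>, where 'a='a] by blast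
    have "\<forall>\<^sub>F n in sequentially. K * (12 * Lc\<^sup>2) * v * (1 / (real n - 1)\<^sup>2) < \<epsilon> / 4"
      using \<epsilon> by (intro order_tendstoD(2)[OF lim]) simp
    then show "\<forall>\<^sub>F n in sequentially.
        (\<integral>\<^sup>+\<omega>. dist_sq T 0 (empirical_measure T n (\<lambda>j. Y n j \<omega>)) ?\<mu> \<partial>M n) \<le> ennreal \<epsilon>"
      using eventually_ge_at_top[of n0] eventually_ge_at_top[of 2]
    proof eventually_elim
      case (elim n)
      \<comment> \<open>Each \<open>n\<close> has its own probability space and system, so the
        locale is entered separately for every \<open>n\<close>; the constants of
        \<open>mean_field\<close> were fixed before and are common to all.\<close>
      interpret agent_system c T Lc K0 S p lam \<eta> \<theta> "M n" n "X n" "Y n" "Z n"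
        by unfold_locales (fact elim(3) assms(8)[OF elim(3)] assms(9)[OF elim(3)])+
      have iY: "M.indep_vars (\<lambda>_. path_space T) Ys {..<n}"
        unfolding Ys_def[abs_def]
        by (rule M.indep_vars_compose2[OF X_indep, where Y="\<lambda>_. Ypath"])
          (use Ypath_measurable in \<open>simp add: measurable_cong_sets[OF sets_p refl]\<close>)
      have dY: "distr (M n) (path_space T) (Ys j) = ?\<mu>" if j: "j < n" for j
      proof -
        have "distr (M n) (path_space T) (Ys j) = distr (distr (M n) p (X n j)) (path_space T) Ypath"
          unfolding Ys_def[abs_def] by (subst distr_distr[OF Ypath_measurable X_measurable[OF j]]) (simp add: comp_def)
        then show ?thesis by (simp add: distr_X[OF j] Ylaw_eq)
      qed
      obtain Q where Q: "Q \<in> borel_measurable (M n)" and EQ: "(\<integral>\<^sup>+\<omega>. Q \<omega> \<partial>M n) \<le> ennreal \<delta>"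
        and W: "\<forall>\<omega>\<in>space (M n). \<exists>g. coupling_weights n ?\<mu> g \<and>
          (\<Sum>j<n. \<integral>\<^sup>+y. ennreal (g j y) * sup_sq T (\<lambda>u. Ys j \<omega> u - y u) \<partial>?\<mu>) * ennreal (1 / n) \<le> Q \<omega>"
        using Qn[rule_format, OF elim(2) M.prob_space_axioms iY dY] by blast
      have "(\<integral>\<^sup>+\<omega>. dist_sq T 0 (empirical_measure T n (\<lambda>j. Y n j \<omega>)) ?\<mu> \<partial>M n)
        \<le> 2 * (ennreal K * (ennreal (12 * Lc\<^sup>2 / (real n - 1)\<^sup>2) * ennreal v
          + ennreal (3 * Lc\<^sup>2) * (\<integral>\<^sup>+\<omega>. Q \<omega> \<partial>M n))) + 2 * (\<integral>\<^sup>+\<omega>. Q \<omega> \<partial>M n)"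
        unfolding K_def v(1)[symmetric] by (rule dist_sq_expectation_le[OF Q bspec[OF W]])
      also have "\<dots> \<le> 2 * (ennreal K * (ennreal (12 * Lc\<^sup>2 / (real n - 1)\<^sup>2) * ennreal v
          + ennreal (3 * Lc\<^sup>2) * ennreal \<delta>)) + 2 * ennreal \<delta>"
        by (intro add_mono mult_left_mono EQ order_refl) auto
      also have "\<dots> = ennreal (2 * (K * (12 * Lc\<^sup>2 / (real n - 1)\<^sup>2 * v + 3 * Lc\<^sup>2 * \<delta>)) + 2 * \<delta>)"
        by (rule ennreal_linear_combinations(3)) (use K v(2) \<delta> in auto)
      also have "\<dots> \<le> ennreal \<epsilon>"
      proof (rule ennreal_leI)
        have "k * (\<epsilon> / (4 * k)) = \<epsilon> / 4" if "0 < k" for k :: real using that by simp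
        from this[OF K3] have "(K * (3 * Lc\<^sup>2) + 1) * \<delta> = \<epsilon> / 4" unfolding \<delta>_def .
        then have "K * (3 * Lc\<^sup>2 * \<delta>) + \<delta> = \<epsilon> / 4" by (simp add: distrib_right mult.assoc)
        moreover have "K * (12 * Lc\<^sup>2 / (real n - 1)\<^sup>2 * v) < \<epsilon> / 4" using elim(1) by (simp add: mult_ac)
        ultimately show "2 * (K * (12 * Lc\<^sup>2 / (real n - 1)\<^sup>2 * v + 3 * Lc\<^sup>2 * \<delta>)) + 2 * \<delta> \<le> \<epsilon>"
          using \<epsilon> unfolding distrib_left by linarith
      qed
      finally show ?case .
    qed
  qed
qed

end
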